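(* Let Assumption A hold, let $E(\lambda)$ be the spectral family of $H$, and let $\Sigma$ be the operator of multiplication by a function $\sigma\in L^2(\mathbb R_+)$. Then for $\lambda>0$ the operator-valued function $d(\Sigma E(\lambda)\Sigma)/d\lambda$ exists and depends continuously on $\lambda>0$ in the Hilbert–Schmidt norm; its kernel is \[ \frac{dE(x,y;\lambda)}{d\lambda}=\frac{\sqrt{p_0\lambda}\,K(\lambda)^2}{\pi|w(\lambda\pm i0)|^2}\varphi(x,\lambda)\varphi(y,\lambda),\qquad\lambda>0 . \]
   Context: Assumption A: $p>0$ absolutely continuous on $\mathbb R_+$, $p'\in L^1(\mathbb R_+)$, $p(x)\to p_0>0$; $q$ real, $q\in L^1(0,x_0)$, absolutely continuous on $[x_0,\infty)$, $q'\in L^1(x_0,\infty)$, $q(x)\to0$. $H=-\frac{d}{dx}p\frac d{dx}+q$ in $L^2(\mathbb R_+)$ with $f(0)=0$ (form-defined on $H^1_0$). $K(\lambda)=\exp(-\int_0^\infty\sqrt{((q-\lambda)/p)_+}dy)$, $(A)_+=(|A|+A)/2$. Modified Jost solution $\theta(x,z)$: solution of $-(p\theta')'+q\theta=z\theta$ with $\theta=a(1+O(\varepsilon))$, $a=\exp(-\int_0^x\sqrt{(q-z)/p}\,dy)$ ($\Re\sqrt{\cdot}>0$, boundary values $z=\lambda\pm i0$), $\varepsilon(x)=\int_x^\infty(|p'|+|q'|)$. Regular solution $\varphi$: $\varphi(0)=0$, $\varphi'(0)=1$. $w(z)=p(0)\theta(0,z)$. *)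

theory Defs
  imports "HOL-Analysis.Analysis"
begin

definition L2 :: "(real \<Rightarrow> complex) \<Rightarrow> bool" where
  "L2 f \<longleftrightarrow> set_borel_measurable lborel {0<..} f \<and>
     set_integrable lborel {0<..} (\<lambda>x. (cmod (f x))^2)"

definition ip :: "(real \<Rightarrow> complex) \<Rightarrow> (real \<Rightarrow> complex) \<Rightarrow> complex" where
  "ip f g = (LINT x:{0<..}|lborel. f x * cnj (g x))"

definition nrm :: "(real \<Rightarrow> complex) \<Rightarrow> real" where
  "nrm f = sqrt (LINT x:{0<..}|lborel. (cmod (f x))^2)"

definition aeq :: "(real \<Rightarrow> complex) \<Rightarrow> (real \<Rightarrow> complex) \<Rightarrow> bool" where
  "aeq f g \<longleftrightarrow> (AE x in lborel. x > 0 \<longrightarrow> f x = g x)"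

definition assumptionA ::
  "(real \<Rightarrow> real) \<Rightarrow> (real \<Rightarrow> real) \<Rightarrow> real \<Rightarrow> (real \<Rightarrow> real) \<Rightarrow> (real \<Rightarrow> real) \<Rightarrow> real \<Rightarrow> bool" where
  "assumptionA p p' p0 q q' x0 \<longleftrightarrow>
     (\<forall>x\<ge>0. p x > 0) \<and> set_integrable lborel {0..} p' \<and>
     (\<forall>x\<ge>0. p x = p 0 + (LINT t:{0..x}|lborel. p' t)) \<and>
     p0 > 0 \<and> (p \<longlongrightarrow> p0) at_top \<and>
     x0 > 0 \<and> set_integrable lborel {0..x0} q \<and>
     set_integrable lborel {x0..} q' \<and>
     (\<forall>x\<ge>x0. q x = q x0 + (LINT t:{x0..x}|lborel. q' t)) \<and>
     (q \<longlongrightarrow> 0) at_top"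

definition H10 :: "(real \<Rightarrow> complex) \<Rightarrow> (real \<Rightarrow> complex) \<Rightarrow> bool" where
  "H10 f df \<longleftrightarrow> L2 f \<and> L2 df \<and>
     (\<forall>x\<ge>0. set_integrable lborel {0..x} df \<and> f x = (LINT t:{0..x}|lborel. df t))"

definition hform ::
  "(real \<Rightarrow> real) \<Rightarrow> (real \<Rightarrow> real) \<Rightarrow> (real \<Rightarrow> complex) \<Rightarrow> (real \<Rightarrow> complex)
     \<Rightarrow> (real \<Rightarrow> complex) \<Rightarrow> (real \<Rightarrow> complex) \<Rightarrow> complex" where
  "hform p q f df h dh = (LINT x:{0<..}|lborel.
      complex_of_real (p x) * df x * cnj (dh x) + complex_of_real (q x) * f x * cnj (h x))"

text \<open>Graph of H: Hop p q f g means f in D(H) and H f = g (up to null sets).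
  This is the operator associated (Kato's first representation theorem) with the form
  hform on H^1_0.\<close>
definition Hop :: "(real \<Rightarrow> real) \<Rightarrow> (real \<Rightarrow> real) \<Rightarrow> (real \<Rightarrow> complex) \<Rightarrow> (real \<Rightarrow> complex) \<Rightarrow> bool" where
  "Hop p q f g \<longleftrightarrow> L2 f \<and> L2 g \<and>
     (\<exists>f0 df0. aeq f f0 \<and> H10 f0 df0 \<and>
        (\<forall>h dh. H10 h dh \<longrightarrow> hform p q f0 df0 h dh = ip g h))"

text \<open>E is a right-continuous resolution of the identity on L2(R+) and the operator
  \<open>\<integral> \<lambda> dE(\<lambda>)\<close> equals Hr: same domain
  \<open>{f. \<integral> \<lambda>^2 d\<parallel>E(\<lambda>)f\<parallel>^2 < \<infinity>}\<close> and same quadratic form (which by polarization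
  determines the operator).\<close>
definition spectral_family ::
  "((real \<Rightarrow> complex) \<Rightarrow> (real \<Rightarrow> complex) \<Rightarrow> bool) \<Rightarrow> (real \<Rightarrow> (real \<Rightarrow> complex) \<Rightarrow> (real \<Rightarrow> complex)) \<Rightarrow> bool" where
  "spectral_family Hr E \<longleftrightarrow>
     (\<forall>l f. L2 f \<longrightarrow> L2 (E l f)) \<and>
     (\<forall>l f g. L2 f \<longrightarrow> L2 g \<longrightarrow> aeq f g \<longrightarrow> aeq (E l f) (E l g)) \<and>
     (\<forall>l f g c. L2 f \<longrightarrow> L2 g \<longrightarrow>
         aeq (E l (\<lambda>x. f x + c * g x)) (\<lambda>x. E l f x + c * E l g x)) \<and>
     (\<forall>l m f. L2 f \<longrightarrow> aeq (E l (E m f)) (E (min l m) f)) \<and>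
     (\<forall>l f g. L2 f \<longrightarrow> L2 g \<longrightarrow> ip (E l f) g = ip f (E l g)) \<and>
     (\<forall>l f. L2 f \<longrightarrow> ((\<lambda>m. nrm (\<lambda>x. E m f x - E l f x)) \<longlongrightarrow> 0) (at_right l)) \<and>
     (\<forall>f. L2 f \<longrightarrow> ((\<lambda>m. nrm (E m f)) \<longlongrightarrow> 0) at_bot) \<and>
     (\<forall>f. L2 f \<longrightarrow> ((\<lambda>m. nrm (\<lambda>x. E m f x - f x)) \<longlongrightarrow> 0) at_top) \<and>
     (\<forall>f. L2 f \<longrightarrow> ((\<exists>g. Hr f g) \<longleftrightarrow>
         integrable (interval_measure (\<lambda>m. (nrm (E m f))^2)) (\<lambda>m. m^2))) \<and>
     (\<forall>f g. Hr f g \<longrightarrow>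
         ip g f = complex_of_real (LINT m|interval_measure (\<lambda>m. (nrm (E m f))^2). m))"

definition L2k :: "(real \<Rightarrow> real \<Rightarrow> complex) \<Rightarrow> bool" where
  "L2k k \<longleftrightarrow> set_borel_measurable lborel ({0<..} \<times> {0<..}) (\<lambda>z. k (fst z) (snd z)) \<and>
     set_integrable lborel ({0<..} \<times> {0<..}) (\<lambda>z. (cmod (k (fst z) (snd z)))^2)"

definition hsn :: "(real \<Rightarrow> real \<Rightarrow> complex) \<Rightarrow> real" where
  "hsn k = sqrt (LINT z:{0<..} \<times> {0<..}|lborel. (cmod (k (fst z) (snd z)))^2)"

definition kop :: "(real \<Rightarrow> real \<Rightarrow> complex) \<Rightarrow> (real \<Rightarrow> complex) \<Rightarrow> (real \<Rightarrow> complex)" where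
  "kop k f = (\<lambda>x. LINT y:{0<..}|lborel. k x y * f y)"

text \<open>first-order system for (u, v) with v = p u' the quasi-derivative\<close>
definition sol_with ::
  "(real \<Rightarrow> real) \<Rightarrow> (real \<Rightarrow> real) \<Rightarrow> complex \<Rightarrow> (real \<Rightarrow> complex) \<Rightarrow> (real \<Rightarrow> complex) \<Rightarrow> bool" where
  "sol_with p q z u v \<longleftrightarrow> (\<forall>x\<ge>0.
      set_integrable lborel {0..x} (\<lambda>t. v t / complex_of_real (p t)) \<and>
      set_integrable lborel {0..x} (\<lambda>t. (complex_of_real (q t) - z) * u t) \<and>
      u x = u 0 + (LINT t:{0..x}|lborel. v t / complex_of_real (p t)) \<and>
      v x = v 0 + (LINT t:{0..x}|lborel. (complex_of_real (q t) - z) * u t))"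

text \<open>regular solution: phi(0) = 0, phi'(0) = 1, i.e. (p phi')(0) = p(0)\<close>
definition regular_sol :: "(real \<Rightarrow> real) \<Rightarrow> (real \<Rightarrow> real) \<Rightarrow> real \<Rightarrow> (real \<Rightarrow> real) \<Rightarrow> bool" where
  "regular_sol p q l u \<longleftrightarrow> (\<exists>v. sol_with p q (complex_of_real l) (\<lambda>x. complex_of_real (u x)) v \<and>
      u 0 = 0 \<and> v 0 = complex_of_real (p 0))"

text \<open>boundary value z = l + i0 of sqrt((q - z)/p) with positive real part\<close>
definition sqrt_bv :: "(real \<Rightarrow> real) \<Rightarrow> (real \<Rightarrow> real) \<Rightarrow> real \<Rightarrow> real \<Rightarrow> complex" where
  "sqrt_bv p q l y = (if q y \<ge> l then complex_of_real (sqrt ((q y - l) / p y))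
                      else - \<i> * complex_of_real (sqrt ((l - q y) / p y)))"

definition jost_a :: "(real \<Rightarrow> real) \<Rightarrow> (real \<Rightarrow> real) \<Rightarrow> real \<Rightarrow> real \<Rightarrow> complex" where
  "jost_a p q l x = exp (- (LINT y:{0..x}|lborel. sqrt_bv p q l y))"

definition eps :: "(real \<Rightarrow> real) \<Rightarrow> (real \<Rightarrow> real) \<Rightarrow> real \<Rightarrow> real" where
  "eps p' q' x = (LINT y:{x..}|lborel. \<bar>p' y\<bar> + \<bar>q' y\<bar>)"

definition jost_sol ::
  "(real \<Rightarrow> real) \<Rightarrow> (real \<Rightarrow> real) \<Rightarrow> (real \<Rightarrow> real) \<Rightarrow> (real \<Rightarrow> real) \<Rightarrow> real \<Rightarrow> real
     \<Rightarrow> (real \<Rightarrow> complex) \<Rightarrow> bool" where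
  "jost_sol p p' q q' x0 l u \<longleftrightarrow> (\<exists>v. sol_with p q (complex_of_real l) u v) \<and>
     (\<exists>C X. X \<ge> x0 \<and> (\<forall>x\<ge>X. cmod (u x / jost_a p q l x - 1) \<le> C * eps p' q' x))"

definition Kfun :: "(real \<Rightarrow> real) \<Rightarrow> (real \<Rightarrow> real) \<Rightarrow> real \<Rightarrow> real" where
  "Kfun p q l = exp (- (LINT y:{0..}|lborel. sqrt (max 0 ((q y - l) / p y))))"

end

theory Submission
  imports Defs "HOL-Probability.Distribution_Functions"
begin

text \<open>For \<open>\<lambda> > 0\<close> the WKB asymptotics of the Jost solution show that every solution of \<open>-(pu')' + qu = \<lambda>u\<close> is
  bounded, with bounds locally uniform in \<open>\<lambda>\<close>. The Weyl solution \<open>\<psi> = \<theta>/w\<close> is not square integrable, so instead of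
  the exact resolvent an approximate one is used: for compactly supported \<open>f\<close> the outgoing solution of
  \<open>(H - \<lambda>)u = f\<close> is multiplied by a slowly decaying factor whose rate \<open>\<epsilon>\<close> is tuned so that \<open>Hu - (\<lambda> + i\<eta>)u - f\<close>
  is small relative to the Poisson integral of \<open>\<parallel>E(\<cdot>)f\<parallel>\<^sup>2\<close>. As \<open>\<eta> \<rightarrow> 0\<close> this gives the boundary value
  \<open>Im \<langle>u, f\<rangle>\<close>, and Stone's formula identifies it with the spectral density \<open>\<kappa>(\<lambda>)/\<pi> |\<integral>\<phi>(x,\<lambda>)f(x)dx|\<^sup>2\<close>, where \<open>\<kappa>\<close> is the
  flux \<open>Im (cnj \<psi> \<cdot> p\<psi>') = \<surd>(p\<^sub>0\<lambda>) K\<^sup>2/|w|\<^sup>2\<close>. Fubini turns this into an integral kernel for \<open>E(m) - E(l)\<close>, and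
  boundedness and continuity of \<open>\<phi>\<close> give Hilbert--Schmidt convergence by dominated convergence.\<close>

text \<open>Two weak inputs shape the proof. \<open>spectral_family\<close> ties \<open>E\<close> to
  the operator only through domain and quadratic form, and no resolvent is at hand. Spectral
  measures of orthogonal components add, hence so do their forms; from this \<open>E\<close> is seen
  to reduce the operator, and Riemann sums over \<open>E\<close> compare the resolvent form with any
  approximate solution. Secondly, \<open>jost_sol\<close> is given energy by energy, at real
  energies, and prescribes the asymptotics of u but not of its quasi-derivative v. So v - i k p0 u
  -> 0 (k the wave number at infinity) has to be derived, and continuity of the flux cannot be read
  off from the Jost solution: it comes from writing the flux through a locally uniform limit of an
  energy of the regular solution. The damping chi satisfies p chi' = - eps chi. With eta = 2 eps k
  the leading residual of chi u is 2 eps chi (v/p - i k u), whose bracket tends to 0. As the norm of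
  chi is of order eps^(-1/2), the squared residual is o(eps), exactly what is needed: it enters
  multiplied by the Poisson integral and divided by eta.\<close>

section \<open>Square-integrable functions on the half-line\<close>

definition lpos :: "real measure" where
  "lpos = restrict_space lborel {0<..}"

lemma measurable_cnj [measurable (raw)]:
  "f \<in> borel_measurable M \<Longrightarrow> (\<lambda>x. cnj (f x)) \<in> borel_measurable M"
  by (simp add: borel_measurable_complex_iff)

lemma space_lpos [simp]: "space lpos = {0<..}"
  by (simp add: lpos_def space_restrict_space)

lemma L2_iff: "L2 f \<longleftrightarrow> f \<in> borel_measurable lpos \<and> integrable lpos (\<lambda>x. (cmod (f x))^2)"
  unfolding L2_def lpos_def set_borel_measurable_def set_integrable_def
  by (subst borel_measurable_restrict_space_iff, simp, subst integrable_restrict_space, auto)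

lemma ip_eq: "ip f g = (LINT x|lpos. f x * cnj (g x))"
  unfolding ip_def lpos_def set_lebesgue_integral_def by (subst integral_restrict_space) auto

lemma nrm_eq: "nrm f = sqrt (LINT x|lpos. (cmod (f x))^2)"
  unfolding nrm_def lpos_def set_lebesgue_integral_def by (subst integral_restrict_space) auto

lemma aeq_iff: "aeq f g \<longleftrightarrow> (AE x in lpos. f x = g x)"
  unfolding aeq_def lpos_def by (subst AE_restrict_space_iff) auto

lemma nrm_power2: "(nrm f)^2 = (LINT x|lpos. (cmod (f x))^2)"
  unfolding nrm_eq by (intro real_sqrt_pow2 integral_nonneg_AE) auto

lemma nrm_nonneg [simp]: "0 \<le> nrm f"
  unfolding nrm_eq by (intro real_sqrt_ge_zero integral_nonneg_AE) auto

lemma aeq_refl [simp]: "aeq f f"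
  by (simp add: aeq_def)

lemma aeq_sym: "aeq f g \<Longrightarrow> aeq g f"
  unfolding aeq_iff by (auto elim: eventually_mono)

lemma aeq_trans: "aeq f g \<Longrightarrow> aeq g h \<Longrightarrow> aeq f h"
  unfolding aeq_iff by (auto elim: eventually_elim2)

lemma aeq_lin: "aeq f f' \<Longrightarrow> aeq g g' \<Longrightarrow> aeq (\<lambda>x. f x + c * g x) (\<lambda>x. f' x + c * g' x)"
  unfolding aeq_iff by (auto elim: eventually_elim2)

lemma L2_integrable_norm:
  assumes "L2 f" "L2 g"
  shows "integrable lpos (\<lambda>x. cmod (f x) * cmod (g x))"
proof (rule Bochner_Integration.integrable_bound)
  show "integrable lpos (\<lambda>x. (cmod (f x))^2 + (cmod (g x))^2)"
    using assms by (auto simp: L2_iff)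
  show "(\<lambda>x. cmod (f x) * cmod (g x)) \<in> borel_measurable lpos"
    using assms by (auto simp: L2_iff)
  show "AE x in lpos. norm (cmod (f x) * cmod (g x)) \<le> norm ((cmod (f x))\<^sup>2 + (cmod (g x))\<^sup>2)"
  proof (rule AE_I2)
    fix x
    have "cmod (f x) * cmod (g x) * 2 \<le> (cmod (f x))\<^sup>2 + (cmod (g x))\<^sup>2"
      using sum_squares_bound[of "cmod (f x)" "cmod (g x)"] by (simp add: algebra_simps)
    then show "norm (cmod (f x) * cmod (g x)) \<le> norm ((cmod (f x))\<^sup>2 + (cmod (g x))\<^sup>2)"
      by (simp add: abs_mult) (smt (verit) mult_nonneg_nonneg norm_ge_zero)
  qed
qed

lemma L2_integrable:
  assumes "L2 f" "L2 g"
  shows "integrable lpos (\<lambda>x. f x * cnj (g x))"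
  by (rule Bochner_Integration.integrable_bound[OF L2_integrable_norm[OF assms]])
     (use assms in \<open>auto simp: L2_iff norm_mult\<close>)

lemma L2_lin:
  assumes "L2 f" "L2 g"
  shows "L2 (\<lambda>x. f x + c * g x)"
  unfolding L2_iff
proof
  show m: "(\<lambda>x. f x + c * g x) \<in> borel_measurable lpos"
    using assms by (auto simp: L2_iff)
  show "integrable lpos (\<lambda>x. (cmod (f x + c * g x))^2)"
  proof (rule Bochner_Integration.integrable_bound)
    show "integrable lpos (\<lambda>x. 2 * (cmod (f x))^2 + 2 * (cmod c)^2 * (cmod (g x))^2)"
      using assms by (auto simp: L2_iff)
    show "(\<lambda>x. (cmod (f x + c * g x))\<^sup>2) \<in> borel_measurable lpos" using m by measurable
    show "AE x in lpos. norm ((cmod (f x + c * g x))\<^sup>2)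
        \<le> norm (2 * (cmod (f x))\<^sup>2 + 2 * (cmod c)\<^sup>2 * (cmod (g x))\<^sup>2)"
    proof (rule AE_I2)
      fix x
      have "cmod (f x + c * g x) \<le> cmod (f x) + cmod c * cmod (g x)"
        by (metis norm_mult norm_triangle_ineq)
      then have "(cmod (f x + c * g x))\<^sup>2 \<le> (cmod (f x) + cmod c * cmod (g x))^2"
        by (intro power_mono) auto
      also have "\<dots> \<le> 2 * (cmod (f x))\<^sup>2 + 2 * (cmod c * cmod (g x))\<^sup>2"
        using sum_squares_bound[of "cmod (f x)" "cmod c * cmod (g x)"]
        by (simp add: power2_sum)
      finally show "norm ((cmod (f x + c * g x))\<^sup>2)
        \<le> norm (2 * (cmod (f x))\<^sup>2 + 2 * (cmod c)\<^sup>2 * (cmod (g x))\<^sup>2)"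
        by (simp add: power_mult_distrib)
    qed
  qed
qed

lemma L2_zero: "L2 (\<lambda>x. 0)"
  by (simp add: L2_iff)

lemma L2_scale: "L2 g \<Longrightarrow> L2 (\<lambda>x. c * g x)"
  using L2_lin[OF L2_zero, of g c] by simp

lemma L2_add: "L2 f \<Longrightarrow> L2 g \<Longrightarrow> L2 (\<lambda>x. f x + g x)"
  using L2_lin[of f g 1] by simp

lemma L2_diff: "L2 f \<Longrightarrow> L2 g \<Longrightarrow> L2 (\<lambda>x. f x - g x)"
  using L2_lin[of f g "-1"] by simp

lemma ip_lin_left:
  assumes "L2 f" "L2 g" "L2 h"
  shows "ip (\<lambda>x. f x + c * g x) h = ip f h + c * ip g h"
proof -
  have "ip (\<lambda>x. f x + c * g x) h = (LINT x|lpos. f x * cnj (h x) + c * (g x * cnj (h x)))"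
    unfolding ip_eq by (simp add: algebra_simps)
  then show ?thesis
    using L2_integrable[OF assms(1,3)] L2_integrable[OF assms(2,3)] by (simp add: ip_eq)
qed

lemma ip_cnj: "ip g f = cnj (ip f g)"
  unfolding ip_eq by (subst Bochner_Integration.integral_cnj[symmetric]) (simp add: mult.commute)

lemma ip_lin_right:
  assumes "L2 f" "L2 g" "L2 h"
  shows "ip h (\<lambda>x. f x + c * g x) = ip h f + cnj c * ip h g"
  using ip_lin_left[OF assms, of c] by (metis complex_cnj_add complex_cnj_mult ip_cnj)

lemma ip_diff_left: "L2 f \<Longrightarrow> L2 g \<Longrightarrow> L2 h \<Longrightarrow> ip (\<lambda>x. f x - g x) h = ip f h - ip g h"
  using ip_lin_left[of f g h "-1"] by simp

lemma ip_diff_right: "L2 f \<Longrightarrow> L2 g \<Longrightarrow> L2 h \<Longrightarrow> ip h (\<lambda>x. f x - g x) = ip h f - ip h g"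
  using ip_lin_right[of f g h "-1"] by simp

lemma ip_self: "ip f f = complex_of_real ((nrm f)^2)"
  unfolding ip_eq nrm_power2 by (simp add: complex_norm_square[symmetric] del: of_real_power)

lemma ip_cong:
  assumes "L2 f" "L2 f'" "L2 g" "L2 g'" "aeq f f'" "aeq g g'"
  shows "ip f g = ip f' g'"
  unfolding ip_eq
proof (rule integral_cong_AE)
  show "AE x in lpos. f x * cnj (g x) = f' x * cnj (g' x)"
    using assms(5,6) unfolding aeq_iff by eventually_elim auto
qed (use assms in \<open>auto simp: L2_iff\<close>)

lemma nrm_cong:
  assumes "L2 f" "L2 g" "aeq f g"
  shows "nrm f = nrm g"
proof -
  have "(nrm f)^2 = (nrm g)^2"
    using ip_cong[OF assms(1,2,1,2,3,3)] unfolding ip_self by (simp only: of_real_eq_iff)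
  then show ?thesis by simp
qed

lemma Cauchy_Schwarz_norm:
  assumes "L2 f" "L2 g"
  shows "(LINT x|lpos. cmod (f x) * cmod (g x)) \<le> nrm f * nrm g"
proof -
  define I where "I = (LINT x|lpos. cmod (f x) * cmod (g x))"
  define a where "a = (nrm f)^2"
  define b where "b = (nrm g)^2"
  have int: "integrable lpos (\<lambda>x. (cmod (f x))^2)" "integrable lpos (\<lambda>x. (cmod (g x))^2)"
    "integrable lpos (\<lambda>x. cmod (f x) * cmod (g x))"
    using assms L2_integrable_norm[OF assms] by (auto simp: L2_iff)
  have *: "0 \<le> s^2 * a - 2 * s * I + b" for s
  proof -
    have "0 \<le> (LINT x|lpos. (s * cmod (f x) - cmod (g x))^2)"
      by (intro integral_nonneg_AE) auto
    also have "\<dots> = (LINT x|lpos. s^2 * (cmod (f x))^2 - 2 * s * (cmod (f x) * cmod (g x)) + (cmod (g x))^2)"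
      by (simp add: power2_diff algebra_simps)
    also have "\<dots> = s^2 * a - 2 * s * I + b"
      using int by (simp add: a_def b_def I_def nrm_power2)
    finally show ?thesis .
  qed
  have "I^2 \<le> a * b"
  proof (cases "a = 0")
    case True
    have "I = 0"
    proof (rule ccontr)
      assume "I \<noteq> 0"
      \<comment> \<open>At this \<open>s\<close> the expression, linear in \<open>s\<close> because
        \<open>a = 0\<close>, takes the value -1.\<close>
      then show False using *[of "(b + 1) / (2 * I)"] True by simp
    qed
    then show ?thesis using True by simp
  next
    case False
    then have "a > 0" by (simp add: a_def zero_less_power2)
    \<comment> \<open>\<open>I / a\<close> is the minimiser of the quadratic; the minimum is
      \<open>b - I^2 / a\<close>.\<close>
    then have "0 \<le> a * ((I / a)^2 * a - 2 * (I / a) * I + b)"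
      using *[of "I / a"] by simp
    also have "\<dots> = a * b - I^2"
      using \<open>a > 0\<close> by (simp add: field_simps power2_eq_square)
    finally show ?thesis by simp
  qed
  then have "\<bar>I\<bar> \<le> \<bar>nrm f * nrm g\<bar>"
    by (subst abs_le_square_iff) (simp add: a_def b_def power_mult_distrib)
  then show ?thesis by (simp add: I_def abs_mult)
qed

lemma Cauchy_Schwarz_ip:
  assumes "L2 f" "L2 g"
  shows "cmod (ip f g) \<le> nrm f * nrm g"
proof -
  have "cmod (ip f g) \<le> (LINT x|lpos. cmod (f x) * cmod (g x))"
    unfolding ip_eq
    using integral_norm_bound[of lpos "\<lambda>x. f x * cnj (g x)"] by (simp add: norm_mult)
  then show ?thesis using Cauchy_Schwarz_norm[OF assms] by simp
qed

lemma nrm_power2_lin: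
  assumes "L2 f" "L2 g"
  shows "(nrm (\<lambda>x. f x + c * g x))^2 = (nrm f)^2 + (cmod c)^2 * (nrm g)^2 + 2 * Re (c * ip g f)"
proof -
  have cc: "c * (cnj c * z) = z * (complex_of_real (cmod c))^2" for z
    using complex_norm_square[of c] by simp
  have "complex_of_real ((nrm (\<lambda>x. f x + c * g x))^2) =
      ip f f + cnj c * ip f g + c * (ip g f + cnj c * ip g g)"
    unfolding ip_self[symmetric]
    by (simp add: ip_lin_left ip_lin_right assms L2_lin)
  also have "\<dots> = complex_of_real ((nrm f)^2) + complex_of_real ((cmod c)^2 * (nrm g)^2)
     + (c * ip g f + cnj (c * ip g f))"
    by (simp add: ip_self ip_cnj[of f g] cc algebra_simps)
  also have "c * ip g f + cnj (c * ip g f) = complex_of_real (2 * Re (c * ip g f))"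
    by (rule complex_add_cnj)
  finally show ?thesis unfolding of_real_add[symmetric] of_real_eq_iff by simp
qed

section \<open>Indefinite Lebesgue integrals and a two-sided Gronwall inequality\<close>

text \<open>Local absolute continuity from \<open>a\<close> on, in the shape in which
  \<open>sol_with\<close> and \<open>H10\<close> provide it. No derivative is taken: with
  \<open>q\<close> merely integrable near 0, a quasi-derivative need not be differentiable at any
  given point.\<close>

definition prim :: "real \<Rightarrow> (real \<Rightarrow> complex) \<Rightarrow> (real \<Rightarrow> complex) \<Rightarrow> bool" where
  "prim a F f \<longleftrightarrow> (\<forall>x\<ge>a. set_integrable lborel {a..x} f \<and> F x = F a + (LINT t:{a..x}|lborel. f t))"

text \<open>The two closed intervals share a point; the detour through the gauge integral disposes
  of the overlap.\<close>

lemma LINT_Icc_combine: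
  fixes f :: "real \<Rightarrow> 'a::euclidean_space"
  assumes "set_integrable lborel {a..c} f" "a \<le> b" "b \<le> c"
  shows "(LINT t:{a..b}|lborel. f t) + (LINT t:{b..c}|lborel. f t) = (LINT t:{a..c}|lborel. f t)"
proof -
  have ab: "set_integrable lborel {a..b} f" and bc: "set_integrable lborel {b..c} f"
    using assms(2,3) by (auto intro!: set_integrable_subset[OF assms(1)])
  show ?thesis
    unfolding set_borel_integral_eq_integral(2)[OF assms(1)] set_borel_integral_eq_integral(2)[OF ab]
      set_borel_integral_eq_integral(2)[OF bc]
    by (rule Henstock_Kurzweil_Integration.integral_combine[OF assms(2,3) set_borel_integral_eq_integral(1)[OF assms(1)]])
qed

lemma prim_integrable: "prim a F f \<Longrightarrow> a \<le> s \<Longrightarrow> set_integrable lborel {s..t} f"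
proof (cases "s \<le> t")
  case True
  assume "prim a F f" "a \<le> s"
  then have "set_integrable lborel {a..t} f"
    using True unfolding prim_def by simp
  then show ?thesis
    by (rule set_integrable_subset) (use \<open>a \<le> s\<close> in auto)
qed (simp add: set_integrable_def)

lemma primD: "prim a F f \<Longrightarrow> a \<le> x \<Longrightarrow> F x = F a + (LINT t:{a..x}|lborel. f t)"
  unfolding prim_def by blast

lemma primI:
  assumes "\<And>x. a \<le> x \<Longrightarrow> set_integrable lborel {a..x} f"
    and "\<And>x. a \<le> x \<Longrightarrow> F x - F a = (LINT t:{a..x}|lborel. f t)"
  shows "prim a F f"
  unfolding prim_def using assms by (metis add_diff_cancel_left' diff_add_cancel add.commute)

lemma prim_diff:
  assumes "prim a F f" "a \<le> s" "s \<le> t"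
  shows "F t - F s = (LINT x:{s..t}|lborel. f x)"
proof -
  have "F t - F a = (LINT x:{a..t}|lborel. f x)" "F s - F a = (LINT x:{a..s}|lborel. f x)"
    using primD[OF assms(1), of t] primD[OF assms(1), of s] assms(2,3) by simp_all
  then show ?thesis
    using LINT_Icc_combine[OF prim_integrable[OF assms(1) order_refl] assms(2,3)]
    by (simp add: algebra_simps)
qed

lemma prim_shift: "prim a F f \<Longrightarrow> a \<le> b \<Longrightarrow> prim b F f"
  by (rule primI) (auto intro: prim_integrable prim_diff)

lemma continuous_on_Ici:
  fixes F :: "real \<Rightarrow> 'a::topological_space"
  assumes "\<And>b. continuous_on {a..b} F"
  shows "continuous_on {a..} F"
  unfolding continuous_on_eq_continuous_within
proof
  fix x assume "x \<in> {a..}"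
  then have "continuous (at x within {a..x+1}) F"
    using assms[of "x+1"] by (auto simp: continuous_on_eq_continuous_within)
  moreover have "at x within {a..x+1} = at x within {a..}"
    by (rule at_within_nhd[where S="{..<x+1}"]) auto
  ultimately show "continuous (at x within {a..}) F" by simp
qed

lemma prim_cont:
  assumes "prim a F f" shows "continuous_on {a..} F"
proof (rule continuous_on_Ici)
  fix b
  have i: "set_integrable lborel {a..b} f" using prim_integrable[OF assms order_refl] .
  have "continuous_on {a..b} (\<lambda>x. F a + integral {a..x} f)"
    by (intro continuous_intros indefinite_integral_continuous_1 set_borel_integral_eq_integral(1)[OF i])
  moreover have "F a + integral {a..x} f = F x" if "x \<in> {a..b}" for x
    using that primD[OF assms, of x] set_borel_integral_eq_integral(2)[OF prim_integrable[OF assms order_refl], of x]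
    by simp
  ultimately show "continuous_on {a..b} F"
    using continuous_on_cong[of "{a..b}" "{a..b}" "\<lambda>x. F a + integral {a..x} f" F] by blast
qed

lemma prim_cong:
  assumes "prim a F f" "\<And>x. x \<ge> a \<Longrightarrow> F x = G x" "\<And>x. x \<ge> a \<Longrightarrow> f x = g x"
  shows "prim a G g"
proof -
  have "set_integrable lborel {a..x} f = set_integrable lborel {a..x} g" for x
    using assms(3) by (intro set_integrable_cong) auto
  moreover have "(LINT t:{a..x}|lborel. f t) = (LINT t:{a..x}|lborel. g t)" for x
    using assms(3) by (intro set_lebesgue_integral_cong) auto
  ultimately show ?thesis
    using assms(2) prim_integrable[OF assms(1) order_refl] prim_diff[OF assms(1) order_refl]
    by (intro primI) auto
qed

lemma prim_lin:
  assumes "prim a F f" "prim a G g"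
  shows "prim a (\<lambda>x. F x + c * G x) (\<lambda>x. f x + c * g x)"
proof (rule primI)
  fix x assume "a \<le> x"
  have i: "set_integrable lborel {a..x} f" "set_integrable lborel {a..x} (\<lambda>x. c * g x)"
    using prim_integrable[OF assms(1)] prim_integrable[OF assms(2)] by auto
  show "set_integrable lborel {a..x} (\<lambda>x. f x + c * g x)"
    by (rule set_integral_add(1)[OF i])
  show "F x + c * G x - (F a + c * G a) = (LINT t:{a..x}|lborel. f t + c * g t)"
    using prim_diff[OF assms(1) order_refl \<open>a \<le> x\<close>] prim_diff[OF assms(2) order_refl \<open>a \<le> x\<close>]
    unfolding set_integral_add(2)[OF i] by (simp add: algebra_simps)
qed

lemma prim_cnj: "prim a F f \<Longrightarrow> prim a (\<lambda>x. cnj (F x)) (\<lambda>x. cnj (f x))"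
proof -
  assume *: "prim a F f"
  have i: "set_integrable lborel {a..x} (\<lambda>x. cnj (f x))" for x
    using prim_integrable[OF * order_refl, of x] unfolding set_integrable_def complex_cnj_scaleR[symmetric] by (rule integrable_cnj)
  have "(LINT t:{a..x}|lborel. cnj (f t)) = cnj (LINT t:{a..x}|lborel. f t)" for x
    unfolding set_lebesgue_integral_def by (subst Bochner_Integration.integral_cnj[symmetric]) simp
  then show ?thesis using i prim_diff[OF * order_refl] by (intro primI) (auto simp flip: complex_cnj_diff)
qed

lemma prim_const: "prim a (\<lambda>x. c) (\<lambda>x. 0)"
  by (simp add: prim_def set_integrable_def set_lebesgue_integral_def)

lemma set_integrable_mult_continuous:
  fixes f G :: "real \<Rightarrow> complex"
  assumes "set_integrable lborel {a..b} f" "continuous_on {a..b} G"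
  shows "set_integrable lborel {a..b} (\<lambda>x. f x * G x)"
proof -
  have "compact (G ` {a..b})" by (rule compact_continuous_image[OF assms(2)]) simp
  then obtain B where B: "\<And>x. x \<in> {a..b} \<Longrightarrow> norm (G x) \<le> B"
    using compact_imp_bounded bounded_iff by (metis (no_types, opaque_lifting) imageI)
  have m: "(\<lambda>x. indicator {a..b} x *\<^sub>R G x) \<in> borel_measurable lborel"
    using borel_measurable_continuous_on_indicator[OF _ assms(2)] by simp
  have i: "integrable lborel (\<lambda>x. indicator {a..b} x *\<^sub>R f x)"
    using assms(1) by (simp add: set_integrable_def)
  have eq: "(\<lambda>x. indicator {a..b} x *\<^sub>R (f x * G x)) = (\<lambda>x. (indicator {a..b} x *\<^sub>R f x) * (indicator {a..b} x *\<^sub>R G x))"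
    by (auto simp: indicator_def)
  show ?thesis unfolding set_integrable_def
  proof (rule Bochner_Integration.integrable_bound)
    show "integrable lborel (\<lambda>x. B * norm (indicator {a..b} x *\<^sub>R f x))"
      by (intro integrable_mult_right integrable_norm i)
    show "(\<lambda>x. indicator {a..b} x *\<^sub>R (f x * G x)) \<in> borel_measurable lborel"
      unfolding eq using m borel_measurable_integrable[OF i] by measurable
    show "AE x in lborel. norm (indicator {a..b} x *\<^sub>R (f x * G x)) \<le> norm (B * norm (indicator {a..b} x *\<^sub>R f x))"
    proof (rule AE_I2)
      fix x
      show "norm (indicator {a..b} x *\<^sub>R (f x * G x)) \<le> norm (B * norm (indicator {a..b} x *\<^sub>R f x))"
        using B[of x] by (auto simp: indicator_def norm_mult abs_mult mult.commute[of "cmod (f x)"] intro!: mult_right_mono)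
    qed
  qed
qed

text \<open>The product rule for indefinite Lebesgue integrals is Fubini's theorem on the square
  \<open>[a, b]\<^sup>2\<close>, cut along the diagonal.\<close>

lemma integral_by_parts_AC:
  fixes f g F G :: "real \<Rightarrow> complex"
  assumes F: "prim a F f" and G: "prim a G g" and ab: "a \<le> b"
  shows "F b * G b - F a * G a = (LINT x:{a..b}|lborel. f x * G x + F x * g x)"
proof -
  define f' where "f' = (\<lambda>x. indicator {a..b} x *\<^sub>R f x)"
  define g' where "g' = (\<lambda>x. indicator {a..b} x *\<^sub>R g x)"
  have if': "integrable lborel f'" and ig': "integrable lborel g'"
    using prim_integrable[OF F order_refl, of b] prim_integrable[OF G order_refl, of b]
    by (simp_all add: f'_def g'_def set_integrable_def)
  have [measurable]: "f' \<in> borel_measurable borel" "g' \<in> borel_measurable borel"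
    using borel_measurable_integrable[OF if'] borel_measurable_integrable[OF ig'] by simp_all
  have inner: "(LINT t|lborel. h' t * of_bool (t \<le> x)) = H x - H a"
    if "prim a H h" "h' = (\<lambda>x. indicator {a..b} x *\<^sub>R h x)" "x \<in> {a..b}" for H h h' x
  proof -
    have "(LINT t|lborel. h' t * of_bool (t \<le> x)) = (LINT t:{a..x}|lborel. h t)"
      unfolding set_lebesgue_integral_def using that by (intro Bochner_Integration.integral_cong) (auto simp: indicator_def)
    then show ?thesis using prim_diff[OF that(1), of a x] that(3) by simp
  qed
  have prodi: "integrable (lborel \<Otimes>\<^sub>M lborel) (\<lambda>(x,t). f' x * g' t * of_bool (P x t))"
    if [measurable]: "Measurable.pred (borel \<Otimes>\<^sub>M borel) (\<lambda>z. P (fst z) (snd z))" for P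
  proof (rule Bochner_Integration.integrable_bound)
    show "integrable (lborel \<Otimes>\<^sub>M lborel) (\<lambda>(x,t). f' x * g' t)"
    proof (rule lborel_pair.Fubini_integrable)
      show "(\<lambda>(x, t). f' x * g' t) \<in> borel_measurable (lborel \<Otimes>\<^sub>M lborel)" by measurable
      show "integrable lborel (\<lambda>x. LINT y|lborel. norm (case (x, y) of (x, t) \<Rightarrow> f' x * g' t))"
        using if' by (simp add: norm_mult)
      show "AE x in lborel. integrable lborel (\<lambda>y. case (x, y) of (x, t) \<Rightarrow> f' x * g' t)"
        using ig' by simp
    qed
    show "(\<lambda>(x,t). f' x * g' t * of_bool (P x t)) \<in> borel_measurable (lborel \<Otimes>\<^sub>M lborel)"
      by (simp add: case_prod_beta') measurable
  qed (auto simp: norm_mult)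
  have p1: "integrable (lborel \<Otimes>\<^sub>M lborel) (\<lambda>(x,t). f' x * g' t * of_bool (t \<le> x))"
    and p2: "integrable (lborel \<Otimes>\<^sub>M lborel) (\<lambda>(x,t). f' x * g' t * of_bool (x \<le> t))"
    by (rule prodi; measurable)+
  have e1: "(LINT x:{a..b}|lborel. f x * (G x - G a)) = (LINT x|lborel. LINT t|lborel. f' x * g' t * of_bool (t \<le> x))"
    unfolding set_lebesgue_integral_def
  proof (intro Bochner_Integration.integral_cong refl)
    fix x
    show "indicator {a..b} x *\<^sub>R (f x * (G x - G a)) = (LINT t|lborel. f' x * g' t * of_bool (t \<le> x))"
      using inner[OF G g'_def, of x] by (cases "x \<in> {a..b}") (auto simp: f'_def mult.assoc)
  qed
  have "(LINT t:{a..b}|lborel. (F t - F a) * g t) = (LINT t|lborel. LINT x|lborel. f' x * g' t * of_bool (x \<le> t))"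
    unfolding set_lebesgue_integral_def
  proof (intro Bochner_Integration.integral_cong refl)
    fix t
    have "(LINT x|lborel. f' x * g' t * of_bool (x \<le> t)) = g' t * (LINT x|lborel. f' x * of_bool (x \<le> t))"
      by (subst integral_mult_right_zero[symmetric]) (simp add: ac_simps)
    then show "indicator {a..b} t *\<^sub>R ((F t - F a) * g t) = (LINT x|lborel. f' x * g' t * of_bool (x \<le> t))"
      using inner[OF F f'_def, of t] by (cases "t \<in> {a..b}") (auto simp: g'_def)
  qed
  also have "\<dots> = (LINT x|lborel. LINT t|lborel. f' x * g' t * of_bool (x \<le> t))"
    using lborel_pair.Fubini_integral[OF p2] by simp
  finally have e2: "(LINT t:{a..b}|lborel. (F t - F a) * g t) = (LINT x|lborel. LINT t|lborel. f' x * g' t * of_bool (x \<le> t))" .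
  have i12: "integrable lborel (\<lambda>x. LINT t|lborel. f' x * g' t * of_bool (t \<le> x))"
     "integrable lborel (\<lambda>x. LINT t|lborel. f' x * g' t * of_bool (x \<le> t))"
    using lborel_pair.integrable_fst[OF p1] lborel_pair.integrable_fst[OF p2] by auto
  have gi: "integrable lborel (\<lambda>t. f' x * g' t * of_bool (Q t))"
    if [measurable]: "Measurable.pred borel Q" for x Q
    by (rule Bochner_Integration.integrable_bound[OF integrable_mult_right[OF ig', of "f' x"]]) (auto simp: norm_mult)
  have "(LINT x:{a..b}|lborel. f x * (G x - G a)) + (LINT t:{a..b}|lborel. (F t - F a) * g t)
     = (LINT x|lborel. (LINT t|lborel. f' x * g' t * of_bool (t \<le> x)) + (LINT t|lborel. f' x * g' t * of_bool (x \<le> t)))"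
    unfolding e1 e2 using i12 by simp
  also have "\<dots> = (LINT x|lborel. LINT t|lborel. f' x * g' t)"
  proof (intro Bochner_Integration.integral_cong refl)
    fix x
    have "(LINT t|lborel. f' x * g' t * of_bool (t \<le> x)) + (LINT t|lborel. f' x * g' t * of_bool (x \<le> t))
      = (LINT t|lborel. f' x * g' t * of_bool (t \<le> x) + f' x * g' t * of_bool (x \<le> t))"
      by (subst Bochner_Integration.integral_add) (auto intro!: gi)
    also have "\<dots> = (LINT t|lborel. f' x * g' t)"
    proof (rule integral_cong_AE)
      \<comment> \<open>Both triangles contain the diagonal, which for fixed \<open>x\<close> is the
        single point \<open>t = x\<close>.\<close>
      show "AE t in lborel. f' x * g' t * of_bool (t \<le> x) + f' x * g' t * of_bool (x \<le> t) = f' x * g' t"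
        using AE_lborel_singleton[of x] by eventually_elim auto
    qed measurable
    finally show "(LINT t|lborel. f' x * g' t * of_bool (t \<le> x)) + (LINT t|lborel. f' x * g' t * of_bool (x \<le> t))
       = (LINT t|lborel. f' x * g' t)" .
  qed
  also have "\<dots> = (LINT x|lborel. f' x) * (LINT t|lborel. g' t)"
    by simp
  also have "\<dots> = (F b - F a) * (G b - G a)"
    using prim_diff[OF F order_refl ab] prim_diff[OF G order_refl ab]
    by (simp add: f'_def g'_def set_lebesgue_integral_def)
  finally have main: "(LINT x:{a..b}|lborel. f x * (G x - G a)) + (LINT t:{a..b}|lborel. (F t - F a) * g t)
     = (F b - F a) * (G b - G a)" .
  have cF: "continuous_on {a..b} F" and cG: "continuous_on {a..b} G"
    using prim_cont[OF F] prim_cont[OF G] by (auto intro: continuous_on_subset)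
  have sf: "set_integrable lborel {a..b} f" and sg: "set_integrable lborel {a..b} g"
    using prim_integrable[OF F order_refl] prim_integrable[OF G order_refl] .
  have s1: "set_integrable lborel {a..b} (\<lambda>x. f x * (G x - G a))"
    by (intro set_integrable_mult_continuous sf continuous_intros cG)
  have s2: "set_integrable lborel {a..b} (\<lambda>x. (F x - F a) * g x)"
    using set_integrable_mult_continuous[OF sg, of "\<lambda>x. F x - F a"] cF
    by (simp add: mult.commute continuous_on_diff)
  \<comment> \<open>\<open>main\<close> is the product rule for primitives that vanish at
    \<open>a\<close>; the constants \<open>F a\<close> and \<open>G a\<close> are put back
    here.\<close>
  have "(LINT x:{a..b}|lborel. f x * G x + F x * g x)
     = (LINT x:{a..b}|lborel. (f x * (G x - G a) + (F x - F a) * g x) + (G a * f x + F a * g x))"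
    by (simp add: algebra_simps)
  also have "\<dots> = (F b - F a) * (G b - G a) + (G a * (F b - F a) + F a * (G b - G a))"
    using s1 s2 sf sg main prim_diff[OF F order_refl ab] prim_diff[OF G order_refl ab]
    by (simp add: set_integral_add set_integrable_mult_right)
  finally show ?thesis by (simp add: algebra_simps)
qed

lemma prim_mult:
  assumes F: "prim a F f" and G: "prim a G g"
  shows "prim a (\<lambda>x. F x * G x) (\<lambda>x. f x * G x + F x * g x)"
  unfolding prim_def
proof (intro allI impI conjI)
  fix x assume x: "x \<ge> a"
  have cF: "continuous_on {a..x} F" and cG: "continuous_on {a..x} G"
    using prim_cont[OF F] prim_cont[OF G] by (auto intro: continuous_on_subset)
  have sf: "set_integrable lborel {a..x} f" and sg: "set_integrable lborel {a..x} g"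
    using prim_integrable[OF F order_refl] prim_integrable[OF G order_refl] .
  show "set_integrable lborel {a..x} (\<lambda>x. f x * G x + F x * g x)"
    using set_integrable_mult_continuous[OF sf cG] set_integrable_mult_continuous[OF sg cF]
    by (simp add: mult.commute[of "F _"] set_integral_add(1))
  show "F x * G x = F a * G a + (LINT t:{a..x}|lborel. f t * G t + F t * g t)"
    using integral_by_parts_AC[OF F G x] by (simp add: algebra_simps)
qed

lemma set_integrable_mult_continuous_real:
  fixes h N :: "real \<Rightarrow> real"
  assumes "set_integrable lborel {a..b} h" "continuous_on {a..b} N"
  shows "set_integrable lborel {a..b} (\<lambda>x. h x * N x)"
proof -
  have "set_integrable lborel {a..b} (\<lambda>x. complex_of_real (h x))"
    using integrable_of_real[OF assms(1)[unfolded set_integrable_def]]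
    unfolding set_integrable_def by (simp add: scaleR_conv_of_real)
  moreover have "continuous_on {a..b} (\<lambda>x. complex_of_real (N x))"
    by (intro continuous_intros assms(2))
  ultimately have "set_integrable lborel {a..b} (\<lambda>x. complex_of_real (h x) * complex_of_real (N x))"
    by (rule set_integrable_mult_continuous)
  then have "integrable lborel (\<lambda>x. Re (indicator {a..b} x *\<^sub>R (complex_of_real (h x) * complex_of_real (N x))))"
    unfolding set_integrable_def by (rule integrable_Re)
  then show ?thesis unfolding set_integrable_def by simp
qed

text \<open>On an interval on which \<open>h\<close> has integral at most \<open>1/2\<close>, the supremum of \<open>N\<close>
  is bounded by twice any of its values; Bolzano's bisection glues such intervals together.\<close>

lemma Gronwall_short:
  fixes h N :: "real \<Rightarrow> real"
  assumes hi: "set_integrable lborel {c..e} h" and h0: "\<And>x. x \<in> {c..e} \<Longrightarrow> 0 \<le> h x"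
    and half: "(LINT x:{c..e}|lborel. h x) \<le> 1/2"
    and cN: "continuous_on {c..e} N" and N0: "\<And>x. x \<in> {c..e} \<Longrightarrow> 0 \<le> N x"
    and N: "\<And>s t. c \<le> s \<Longrightarrow> s \<le> t \<Longrightarrow> t \<le> e \<Longrightarrow> \<bar>N t - N s\<bar> \<le> B + (LINT x:{s..t}|lborel. h x * N x)"
    and s: "s \<in> {c..e}" and t: "t \<in> {c..e}"
  shows "N t \<le> 2 * (N s + B)"
proof -
  obtain m where m: "m \<in> {c..e}" "\<And>y. y \<in> {c..e} \<Longrightarrow> N y \<le> N m"
    using continuous_attains_sup[OF _ _ cN] s by auto
  \<comment> \<open>The point \<open>s\<close> may lie on either side of the maximiser
    \<open>m\<close>. The hypothesis on \<open>N\<close> is symmetric in its endpoints, so the bound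
    travels in both directions.\<close>
  define l u where "l = min s m" and "u = max s m"
  have lu: "c \<le> l" "l \<le> u" "u \<le> e" using s m(1) by (auto simp: l_def u_def)
  have ih: "set_integrable lborel {l..u} h"
    by (rule set_integrable_subset[OF hi]) (use lu in auto)
  have ihN: "set_integrable lborel {l..u} (\<lambda>x. h x * N x)"
    by (rule set_integrable_mult_continuous_real[OF ih]) (use lu in \<open>auto intro: continuous_on_subset[OF cN]\<close>)
  have "N m - N s \<le> \<bar>N u - N l\<bar>" by (auto simp: l_def u_def)
  also have "\<dots> \<le> B + (LINT x:{l..u}|lborel. h x * N x)"
    using lu by (intro N)
  also have "(LINT x:{l..u}|lborel. h x * N x) \<le> (LINT x:{l..u}|lborel. N m * h x)"
    using ih ihN m h0 lu
    by (intro set_integral_mono) (auto simp: mult.commute[of "h _"] intro!: mult_right_mono)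
  also have "(LINT x:{l..u}|lborel. N m * h x) = N m * (LINT x:{l..u}|lborel. h x)" by simp
  also have "\<dots> \<le> N m * (1/2)"
  proof (rule mult_left_mono)
    have "(LINT x:{l..u}|lborel. h x) \<le> (LINT x:{c..e}|lborel. h x)"
      unfolding set_lebesgue_integral_def
      by (rule integral_mono[OF ih[unfolded set_integrable_def] hi[unfolded set_integrable_def]])
        (use h0 lu in \<open>auto simp: indicator_def\<close>)
    then show "(LINT x:{l..u}|lborel. h x) \<le> 1/2" using half by simp
    show "0 \<le> N m" using N0 m(1) .
  qed
  finally have "N m \<le> 2 * (N s + B)" by simp
  then show "N t \<le> 2 * (N s + B)" using m(2)[OF t] by simp
qed

text \<open>The constant is quantified before \<open>N\<close> and \<open>B\<close>: it depends on
  \<open>h\<close> and the interval only. This is what later makes bounds uniform over all solutions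
  and over all energies of a compact set. Running backwards as well as forwards, it also bounds a
  solution at 0 by its values further out.\<close>

lemma two_sided_Gronwall:
  fixes h :: "real \<Rightarrow> real"
  assumes hi: "set_integrable lborel {a..b} h" and h0: "\<And>x. x \<in> {a..b} \<Longrightarrow> 0 \<le> h x" and ab: "a \<le> b"
  obtains C :: real where "C \<ge> 0"
    and "\<And>N B s t. \<lbrakk>continuous_on {a..b} N; B \<ge> 0; \<And>x. x \<in> {a..b} \<Longrightarrow> 0 \<le> N x;
      \<And>s t. \<lbrakk>a \<le> s; s \<le> t; t \<le> b\<rbrakk> \<Longrightarrow> \<bar>N t - N s\<bar> \<le> B + (LINT x:{s..t}|lborel. h x * N x);
      s \<in> {a..b}; t \<in> {a..b}\<rbrakk> \<Longrightarrow> N t \<le> C * (N s + B)"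
proof -
  \<comment> \<open>\<open>Q\<close> imposes the hypotheses on all of \<open>{a..b}\<close> even
    when a subinterval is treated, so that the constants of adjacent subintervals refer to the same
    class of functions and can be combined.\<close>
  define Q where "Q = (\<lambda>N B. continuous_on {a..b} N \<and> (B::real) \<ge> 0 \<and> (\<forall>t\<in>{a..b}. 0 \<le> N t) \<and>
     (\<forall>s t. a \<le> s \<longrightarrow> s \<le> t \<longrightarrow> t \<le> b \<longrightarrow> \<bar>N t - N s\<bar> \<le> B + (LINT x:{s..t}|lborel. h x * (N x::real))))"
  define P where "P = (\<lambda>c d. a \<le> c \<longrightarrow> d \<le> b \<longrightarrow> (\<exists>C\<ge>0. \<forall>N B. Q N B \<longrightarrow>
     (\<forall>s\<in>{c..d}. \<forall>t\<in>{c..d}. N t \<le> C * (N s + (B::real)))))"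
  have "P a b"
    using ab
  proof (induction rule: Bolzano)
    case (trans c d e)
    show ?case unfolding P_def
    proof (intro impI)
      assume ce: "a \<le> c" "e \<le> b"
      obtain C1 where C1: "C1 \<ge> 0" "\<And>N B s t. Q N B \<Longrightarrow> s \<in> {c..d} \<Longrightarrow> t \<in> {c..d} \<Longrightarrow> N t \<le> C1 * (N s + B)"
        using trans(1)[unfolded P_def, rule_format, OF ce(1) order_trans[OF trans(4) ce(2)]] by blast
      obtain C2 where C2: "C2 \<ge> 0" "\<And>N B s t. Q N B \<Longrightarrow> s \<in> {d..e} \<Longrightarrow> t \<in> {d..e} \<Longrightarrow> N t \<le> C2 * (N s + B)"
        using trans(2)[unfolded P_def, rule_format, OF order_trans[OF ce(1) trans(3)] ce(2)] by blast
      \<comment> \<open>\<open>C + C1 + C2\<close> leaves room for the direct bounds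
        \<open>C1\<close> and \<open>C2\<close> and for both composite ones,
        \<open>C2 * C1 + C2\<close> and \<open>C1 * C2 + C1\<close>, which arise on passing through
        \<open>d\<close>.\<close>
      define C where "C = C1 + C2 + C1 * C2 * 2"
      show "\<exists>C\<ge>0. \<forall>N B. Q N B \<longrightarrow> (\<forall>s\<in>{c..e}. \<forall>t\<in>{c..e}. N t \<le> C * (N s + B))"
      proof (intro exI[of _ "C + C1 + C2"] conjI allI impI ballI)
        show "0 \<le> C + C1 + C2" using C1(1) C2(1) by (simp add: C_def)
        fix N B s t assume Q: "Q N B" and s: "s \<in> {c..e}" and t: "t \<in> {c..e}"
        have nn: "B \<ge> 0" "N s \<ge> 0" "N d \<ge> 0"
          using Q s trans ce unfolding Q_def by auto
        have big: "D * (N s + B) \<le> (C + C1 + C2) * (N s + B)" if "D \<le> C + C1 + C2" for D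
          using nn that by (intro mult_right_mono) auto
        have chain: "X \<le> (C + C1 + C2) * (N s + B)"
          if "X \<le> D1 * (N d + B)" "N d \<le> D2 * (N s + B)" "D1 \<ge> 0" "D1 * D2 + D1 \<le> C + C1 + C2" for X D1 D2
        proof -
          have "X \<le> D1 * (D2 * (N s + B) + B)"
            using that(1,2,3) by (meson add_right_mono mult_left_mono order_trans)
          also have "\<dots> \<le> D1 * (D2 * (N s + B) + (N s + B))"
            using nn that(3) by (intro mult_left_mono) auto
          also have "\<dots> = (D1 * D2 + D1) * (N s + B)" by (simp add: algebra_simps)
          also have "\<dots> \<le> (C + C1 + C2) * (N s + B)" using that(4) by (rule big)
          finally show ?thesis .
        qed
        have CC: "C1 * C2 \<ge> 0" using C1(1) C2(1) by simp
        have d1: "d \<in> {c..d}" "d \<in> {d..e}" using trans by auto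
        consider "s \<le> d" "t \<le> d" | "s \<le> d" "d \<le> t" | "d \<le> s" "t \<le> d" | "d \<le> s" "d \<le> t" by linarith
        then show "N t \<le> (C + C1 + C2) * (N s + B)"
        proof cases
          case 1
          then show ?thesis using C1(2)[OF Q, of s t] s t big[of C1] C1(1) C2(1) CC by (auto simp: C_def)
        next
          case 2
          then have "N t \<le> C2 * (N d + B)" using C2(2)[OF Q, of d t] t d1 by auto
          moreover have "N d \<le> C1 * (N s + B)" using C1(2)[OF Q, of s d] 2 s d1 by auto
          ultimately show ?thesis using C2(1) C1(1) CC by (elim chain) (auto simp: C_def mult.commute)
        next
          case 3
          then have "N t \<le> C1 * (N d + B)" using C1(2)[OF Q, of d t] t d1 by auto
          moreover have "N d \<le> C2 * (N s + B)" using C2(2)[OF Q, of s d] 3 s d1 by auto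
          ultimately show ?thesis using C2(1) C1(1) CC by (elim chain) (auto simp: C_def mult.commute)
        next
          case 4
          then show ?thesis using C2(2)[OF Q, of s t] s t big[of C2] C1(1) C2(1) CC by (auto simp: C_def)
        qed
      qed
    qed
  next
    case (local x)
    \<comment> \<open>Uniform continuity of this primitive yields one length \<open>d\<close> below
      which every subinterval carries an integral under 1/2, as \<open>Gronwall_short\<close>
      demands.\<close>
    define H where "H = (\<lambda>y. integral {a..y} h)"
    have Hd: "(LINT z:{s..t}|lborel. h z) = H t - H s" if "a \<le> s" "s \<le> t" "t \<le> b" for s t
    proof -
      have "set_integrable lborel {a..t} h" "set_integrable lborel {a..s} h"
        by (rule set_integrable_subset[OF hi]; use that in auto)+
      then show ?thesis
        using LINT_Icc_combine[of a t h s] that by (simp add: H_def set_borel_integral_eq_integral(2) algebra_simps)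
    qed
    have "continuous_on {a..b} H"
      unfolding H_def by (intro indefinite_integral_continuous_1 set_borel_integral_eq_integral(1)[OF hi])
    then have "uniformly_continuous_on {a..b} H"
      by (intro compact_uniformly_continuous) auto
    then obtain d where d: "d > 0" "\<And>s t. s \<in> {a..b} \<Longrightarrow> t \<in> {a..b} \<Longrightarrow> dist s t < d \<Longrightarrow> dist (H s) (H t) < 1/2"
      unfolding uniformly_continuous_on_def by (metis zero_less_divide_1_iff zero_less_numeral)
    show ?case
    proof (intro exI[of _ d] conjI d(1) allI impI)
      fix c e assume ce: "c \<le> x \<and> x \<le> e \<and> e - c < d"
      show "P c e" unfolding P_def
      proof (intro impI exI[of _ 2] conjI allI ballI)
        assume ac: "a \<le> c" and eb: "e \<le> b"
        fix N B s t assume Q: "Q N B" and s: "s \<in> {c..e}" and t: "t \<in> {c..e}"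
        show "N t \<le> 2 * (N s + B)"
        proof (rule Gronwall_short[where h=h and c=c and e=e and N=N and s=s and t=t and B=B])
          show "set_integrable lborel {c..e} h" by (rule set_integrable_subset[OF hi]) (use ac eb in auto)
          have "dist (H e) (H c) < 1/2"
            by (rule d(2)) (use ac eb ce in \<open>auto simp: dist_real_def\<close>)
          moreover have "(LINT x:{c..e}|lborel. h x) = H e - H c" using Hd[of c e] ac eb ce by simp
          ultimately show "(LINT x:{c..e}|lborel. h x) \<le> 1/2" unfolding dist_real_def by linarith
          show "continuous_on {c..e} N" using Q ac eb unfolding Q_def by (auto intro: continuous_on_subset)
        qed (use Q s t ac eb h0 in \<open>auto simp: Q_def\<close>)
      qed simp
    qed
  qed
  then obtain C where C: "C \<ge> 0" "\<forall>N B. Q N B \<longrightarrow> (\<forall>s\<in>{a..b}. \<forall>t\<in>{a..b}. N t \<le> C * (N s + B))"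
    unfolding P_def by auto
  show ?thesis
  proof (rule that[OF C(1)])
    fix N B s t
    assume "continuous_on {a..b} N" "B \<ge> 0" "\<And>x. x \<in> {a..b} \<Longrightarrow> 0 \<le> N x"
      and "\<And>s t. \<lbrakk>a \<le> s; s \<le> t; t \<le> b\<rbrakk> \<Longrightarrow> \<bar>N t - N s\<bar> \<le> B + (LINT x:{s..t}|lborel. h x * N x)"
      and st: "s \<in> {a..b}" "t \<in> {a..b}"
    then have "Q N B" unfolding Q_def by blast
    then show "N t \<le> C * (N s + B)" using C(2) st by blast
  qed
qed

lemma Hop_L2: "Hop p q f g \<Longrightarrow> L2 f \<and> L2 g"
  by (simp add: Hop_def)

lemma Hop_cong: "Hop p q f g \<Longrightarrow> L2 f' \<Longrightarrow> aeq f f' \<Longrightarrow> Hop p q f' g"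
  unfolding Hop_def by (meson aeq_sym aeq_trans)

section \<open>Measures of distribution functions and their additivity\<close>

text \<open>In the application \<open>F\<close> sends a real number to the squared norm of the
  corresponding spectral projection of a vector, and \<open>m\<close> is the squared norm of that
  vector.\<close>

locale cdf_measure =
  fixes F :: "real \<Rightarrow> real" and m :: real
  assumes mono: "\<And>x y. x \<le> y \<Longrightarrow> F x \<le> F y"
    and right_cont: "\<And>a. continuous (at_right a) F"
    and bot: "(F \<longlongrightarrow> 0) at_bot"
    and top: "(F \<longlongrightarrow> m) at_top"
begin

lemma m_nonneg: "0 \<le> m"
proof (rule tendsto_le[OF _ top bot[THEN filterlim_compose, OF filterlim_uminus_at_bot_at_top]])
  show "\<forall>\<^sub>F x in at_top. F (- x) \<le> F x"
    using eventually_ge_at_top[of 0] by eventually_elim (auto intro: mono)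
qed simp

lemma emeasure_UNIV: "emeasure (interval_measure F) UNIV = m"
  by (rule interval_measure_UNIV[OF mono right_cont bot top m_nonneg])

lemma finite: "finite_measure (interval_measure F)"
  by (rule finite_measureI) (simp add: emeasure_UNIV)

lemma measure_UNIV: "measure (interval_measure F) UNIV = m"
  using m_nonneg by (simp add: measure_def emeasure_UNIV)

lemma measure_Ioc: "a \<le> b \<Longrightarrow> measure (interval_measure F) {a<..b} = F b - F a"
  by (rule measure_interval_measure_Ioc[OF _ mono right_cont])

lemma integrable_bounded:
  fixes f :: "real \<Rightarrow> 'a::{banach, second_countable_topology}"
  assumes "f \<in> borel_measurable borel" "\<And>x. norm (f x) \<le> B"
  shows "integrable (interval_measure F) f"
proof -
  interpret finite_measure "interval_measure F" by (rule finite)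
  show ?thesis using assms by (intro integrable_const_bound[of _ B]) auto
qed

lemma integrable_id:
  assumes "integrable (interval_measure F) (\<lambda>x. x^2)"
  shows "integrable (interval_measure F) (\<lambda>x. x)"
proof (rule Bochner_Integration.integrable_bound)
  show "integrable (interval_measure F) (\<lambda>x. 1 + x^2)"
    using assms integrable_bounded[of "\<lambda>x. 1::real" 1] by auto
  show "AE x in interval_measure F. norm x \<le> norm (1 + x\<^sup>2)"
  proof (rule AE_I2)
    fix x :: real
    have "0 \<le> (\<bar>x\<bar> - 1)^2" by simp
    then have "2 * \<bar>x\<bar> \<le> 1 + x^2" by (simp add: power2_diff)
    then show "norm x \<le> norm (1 + x^2)" by simp
  qed
qed auto

end

lemma Ioc_eq_sigma_sets: "sets (borel :: real measure) = sigma_sets UNIV (range (\<lambda>(a, b). {a<..b::real}))"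
  by (subst borel_sigma_sets_Ioc) (simp add: sets_measure_of)

text \<open>Dynkin's argument starting from half-open intervals. That the sum is again a
  distribution function is a hypothesis, because in the application the sum is known to be the
  distribution function of a vector.\<close>

lemma emeasure_interval_measure_add:
  assumes F: "cdf_measure F m" and G: "cdf_measure G n" and H: "cdf_measure (\<lambda>x. F x + G x) k"
    and A: "A \<in> sets borel"
  shows "emeasure (interval_measure (\<lambda>x. F x + G x)) A = emeasure (interval_measure F) A + emeasure (interval_measure G) A"
proof -
  interpret F: cdf_measure F m by fact
  interpret G: cdf_measure G n by fact
  interpret H: cdf_measure "\<lambda>x. F x + G x" k by fact
  interpret FF: finite_measure "interval_measure F" by (rule F.finite)
  interpret GG: finite_measure "interval_measure G" by (rule G.finite)
  interpret HH: finite_measure "interval_measure (\<lambda>x. F x + G x)" by (rule H.finite)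
  have "((\<lambda>x. F x + G x) \<longlongrightarrow> m + n) at_top" by (intro tendsto_add F.top G.top)
  \<comment> \<open>Total masses add, by uniqueness of the limit at infinity; the complement step of
    the induction consumes this.\<close>
  then have k: "k = m + n" using H.top by (intro tendsto_unique[of at_top]) auto
  let ?g = "range (\<lambda>(a, b). {a<..b::real})"
  have "measure (interval_measure (\<lambda>x. F x + G x)) A = measure (interval_measure F) A + measure (interval_measure G) A"
  proof (rule sigma_sets_induct_disjoint[where G="?g" and \<Omega>=UNIV])
    show "Int_stable ?g"
      by (auto simp: Int_stable_def image_iff)
    show "?g \<subseteq> Pow UNIV" by auto
    show "A \<in> sigma_sets UNIV ?g" using A by (simp add: Ioc_eq_sigma_sets)
    {
      fix A assume "A \<in> ?g"
      then obtain a b where A: "A = {a<..b}" by auto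
      show "measure (interval_measure (\<lambda>x. F x + G x)) A = measure (interval_measure F) A + measure (interval_measure G) A"
        unfolding A by (cases "a \<le> b") (auto simp: F.measure_Ioc G.measure_Ioc H.measure_Ioc)
    next
      show "measure (interval_measure (\<lambda>x. F x + G x)) {} = measure (interval_measure F) {} + measure (interval_measure G) {}"
        by simp
    next
      fix A assume A: "A \<in> sigma_sets UNIV ?g"
        and IH: "measure (interval_measure (\<lambda>x. F x + G x)) A = measure (interval_measure F) A + measure (interval_measure G) A"
      have [measurable]: "A \<in> sets borel" using A by (simp add: Ioc_eq_sigma_sets)
      have "measure (interval_measure F) (UNIV - A) = m - measure (interval_measure F) A"
        using FF.finite_measure_compl[of A] F.measure_UNIV by simp
      moreover have "measure (interval_measure G) (UNIV - A) = n - measure (interval_measure G) A"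
        using GG.finite_measure_compl[of A] G.measure_UNIV by simp
      moreover have "measure (interval_measure (\<lambda>x. F x + G x)) (UNIV - A) = k - measure (interval_measure (\<lambda>x. F x + G x)) A"
        using HH.finite_measure_compl[of A] H.measure_UNIV by simp
      ultimately show "measure (interval_measure (\<lambda>x. F x + G x)) (UNIV - A)
          = measure (interval_measure F) (UNIV - A) + measure (interval_measure G) (UNIV - A)"
        using IH k by simp
    next
      fix A :: "nat \<Rightarrow> real set" assume A: "disjoint_family A" "range A \<subseteq> sigma_sets UNIV ?g"
        and IH: "\<And>i. measure (interval_measure (\<lambda>x. F x + G x)) (A i) = measure (interval_measure F) (A i) + measure (interval_measure G) (A i)"
      have r: "range A \<subseteq> sets borel" using A(2) by (simp add: Ioc_eq_sigma_sets)
      have "(\<lambda>i. measure (interval_measure F) (A i) + measure (interval_measure G) (A i)) sums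
         (measure (interval_measure F) (\<Union>i. A i) + measure (interval_measure G) (\<Union>i. A i))"
        using FF.finite_measure_UNION[of A] GG.finite_measure_UNION[of A] r A(1) by (intro sums_add) auto
      moreover have "(\<lambda>i. measure (interval_measure (\<lambda>x. F x + G x)) (A i)) sums measure (interval_measure (\<lambda>x. F x + G x)) (\<Union>i. A i)"
        using HH.finite_measure_UNION[of A] r A(1) by auto
      ultimately show "measure (interval_measure (\<lambda>x. F x + G x)) (\<Union>i. A i)
          = measure (interval_measure F) (\<Union>i. A i) + measure (interval_measure G) (\<Union>i. A i)"
        using IH by (simp add: sums_iff)
    }
  qed
  then show ?thesis
    unfolding FF.emeasure_eq_measure GG.emeasure_eq_measure HH.emeasure_eq_measure
    by (simp add: ennreal_plus)
qed

lemma nn_integral_interval_measure_add: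
  assumes F: "cdf_measure F m" and G: "cdf_measure G n" and H: "cdf_measure (\<lambda>x. F x + G x) k"
    and f: "f \<in> borel_measurable borel"
  shows "(\<integral>\<^sup>+x. f x \<partial>interval_measure (\<lambda>x. F x + G x)) = (\<integral>\<^sup>+x. f x \<partial>interval_measure F) + (\<integral>\<^sup>+x. f x \<partial>interval_measure G)"
  using f
proof (induction rule: borel_measurable_induct)
  case (cong f g)
  then have "f = g" by (auto simp: fun_eq_iff)
  then show ?case using cong by simp
next
  case (set A)
  then show ?case using emeasure_interval_measure_add[OF F G H, of A] by simp
next
  case (mult u c)
  then show ?case by (simp add: nn_integral_cmult distrib_left)
next
  case (add u v)
  then show ?case by (simp add: nn_integral_add ac_simps)
next
  case (seq U)
  have eq: "(\<integral>\<^sup>+x. (SUP i. U i) x \<partial>interval_measure K) = (SUP i. \<integral>\<^sup>+x. U i x \<partial>interval_measure K)" for K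
    using seq by (simp add: image_comp nn_integral_monotone_convergence_SUP)
  have inc: "incseq (\<lambda>i. \<integral>\<^sup>+x. U i x \<partial>interval_measure K)" for K
    using \<open>incseq U\<close> by (auto simp: incseq_def le_fun_def intro!: nn_integral_mono)
  have "(SUP i. \<integral>\<^sup>+x. U i x \<partial>interval_measure (\<lambda>x. F x + G x))
      = (SUP i. (\<integral>\<^sup>+x. U i x \<partial>interval_measure F) + (\<integral>\<^sup>+x. U i x \<partial>interval_measure G))"
    using seq by (intro SUP_cong refl) blast
  then show ?case unfolding eq using ennreal_SUP_add[OF inc inc, of F G] by simp
qed

text \<open>The integrand of interest is the identity, which has both signs; its positive and
  negative parts are finite under both measures and are treated separately.\<close>

lemma integral_interval_measure_add:
  fixes f :: "real \<Rightarrow> real"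
  assumes F: "cdf_measure F m" and G: "cdf_measure G n" and H: "cdf_measure (\<lambda>x. F x + G x) k"
    and iF: "integrable (interval_measure F) f" and iG: "integrable (interval_measure G) f"
  shows "(LINT x|interval_measure (\<lambda>x. F x + G x). f x) = (LINT x|interval_measure F. f x) + (LINT x|interval_measure G. f x)"
proof -
  have [measurable]: "f \<in> borel_measurable borel" using borel_measurable_integrable[OF iF] by simp
  note add = nn_integral_interval_measure_add[OF F G H]
  have fin: "(\<integral>\<^sup>+x. ennreal (f x) \<partial>interval_measure K) < \<infinity>" "(\<integral>\<^sup>+x. ennreal (- f x) \<partial>interval_measure K) < \<infinity>"
    if "integrable (interval_measure K) f" for K
    using that by (auto simp: real_integrable_def top.not_eq_extremum)
  have "integrable (interval_measure (\<lambda>x. F x + G x)) f"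
    unfolding real_integrable_def using fin[OF iF] fin[OF iG] by (simp add: add less_top[symmetric])
  then show ?thesis
    using iF iG fin[OF iF] fin[OF iG]
    by (simp add: real_lebesgue_integral_def add enn2real_plus)
qed

section \<open>Spectral projections reduce the operator\<close>

text \<open>\<open>Hr\<close> stays abstract: the spectral half of the argument uses only that its
  graph is linear, lies in L2 and tolerates changes of the first argument on null sets.\<close>

locale resolution =
  fixes Hr :: "(real \<Rightarrow> complex) \<Rightarrow> (real \<Rightarrow> complex) \<Rightarrow> bool"
    and E :: "real \<Rightarrow> (real \<Rightarrow> complex) \<Rightarrow> (real \<Rightarrow> complex)"
  assumes sf: "spectral_family Hr E"
    and Hr_L2: "\<And>f g. Hr f g \<Longrightarrow> L2 f \<and> L2 g"
    and Hr_lin: "\<And>f g f' g' c. Hr f g \<Longrightarrow> Hr f' g' \<Longrightarrow> Hr (\<lambda>x. f x + c * f' x) (\<lambda>x. g x + c * g' x)"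
    and Hr_cong: "\<And>f g f'. Hr f g \<Longrightarrow> L2 f' \<Longrightarrow> aeq f f' \<Longrightarrow> Hr f' g"
begin

lemma E_L2 [simp, intro]: "L2 f \<Longrightarrow> L2 (E l f)"
  and E_cong: "L2 f \<Longrightarrow> L2 g \<Longrightarrow> aeq f g \<Longrightarrow> aeq (E l f) (E l g)"
  and E_lin: "L2 f \<Longrightarrow> L2 g \<Longrightarrow> aeq (E l (\<lambda>x. f x + c * g x)) (\<lambda>x. E l f x + c * E l g x)"
  and E_comp: "L2 f \<Longrightarrow> aeq (E l (E m f)) (E (min l m) f)"
  and E_sym: "L2 f \<Longrightarrow> L2 g \<Longrightarrow> ip (E l f) g = ip f (E l g)"
  and E_right: "L2 f \<Longrightarrow> ((\<lambda>m. nrm (\<lambda>x. E m f x - E l f x)) \<longlongrightarrow> 0) (at_right l)"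
  and E_bot: "L2 f \<Longrightarrow> ((\<lambda>m. nrm (E m f)) \<longlongrightarrow> 0) at_bot"
  and E_top: "L2 f \<Longrightarrow> ((\<lambda>m. nrm (\<lambda>x. E m f x - f x)) \<longlongrightarrow> 0) at_top"
  and E_dom: "L2 f \<Longrightarrow> (\<exists>g. Hr f g) \<longleftrightarrow> integrable (interval_measure (\<lambda>m. (nrm (E m f))^2)) (\<lambda>m. m^2)"
  and E_form: "Hr f g \<Longrightarrow> ip g f = complex_of_real (LINT m|interval_measure (\<lambda>m. (nrm (E m f))^2). m)"
proof -
  note s = sf[unfolded spectral_family_def]
  show "L2 f \<Longrightarrow> L2 (E l f)" by (rule s[THEN conjunct1, rule_format])
  show "L2 f \<Longrightarrow> L2 g \<Longrightarrow> aeq f g \<Longrightarrow> aeq (E l f) (E l g)" by (rule s[THEN conjunct2, THEN conjunct1, rule_format])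
  show "L2 f \<Longrightarrow> L2 g \<Longrightarrow> aeq (E l (\<lambda>x. f x + c * g x)) (\<lambda>x. E l f x + c * E l g x)" by (rule s[THEN conjunct2, THEN conjunct2, THEN conjunct1, rule_format])
  show "L2 f \<Longrightarrow> aeq (E l (E m f)) (E (min l m) f)" by (rule s[THEN conjunct2, THEN conjunct2, THEN conjunct2, THEN conjunct1, rule_format])
  show "L2 f \<Longrightarrow> L2 g \<Longrightarrow> ip (E l f) g = ip f (E l g)" by (rule s[THEN conjunct2, THEN conjunct2, THEN conjunct2, THEN conjunct2, THEN conjunct1, rule_format])
  show "L2 f \<Longrightarrow> ((\<lambda>m. nrm (\<lambda>x. E m f x - E l f x)) \<longlongrightarrow> 0) (at_right l)" by (rule s[THEN conjunct2, THEN conjunct2, THEN conjunct2, THEN conjunct2, THEN conjunct2, THEN conjunct1, rule_format])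
  show "L2 f \<Longrightarrow> ((\<lambda>m. nrm (E m f)) \<longlongrightarrow> 0) at_bot" by (rule s[THEN conjunct2, THEN conjunct2, THEN conjunct2, THEN conjunct2, THEN conjunct2, THEN conjunct2, THEN conjunct1, rule_format])
  show "L2 f \<Longrightarrow> ((\<lambda>m. nrm (\<lambda>x. E m f x - f x)) \<longlongrightarrow> 0) at_top" by (rule s[THEN conjunct2, THEN conjunct2, THEN conjunct2, THEN conjunct2, THEN conjunct2, THEN conjunct2, THEN conjunct2, THEN conjunct1, rule_format])
  show "L2 f \<Longrightarrow> (\<exists>g. Hr f g) \<longleftrightarrow> integrable (interval_measure (\<lambda>m. (nrm (E m f))^2)) (\<lambda>m. m^2)" by (rule s[THEN conjunct2, THEN conjunct2, THEN conjunct2, THEN conjunct2, THEN conjunct2, THEN conjunct2, THEN conjunct2, THEN conjunct2, THEN conjunct1, rule_format])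
  show "Hr f g \<Longrightarrow> ip g f = complex_of_real (LINT m|interval_measure (\<lambda>m. (nrm (E m f))^2). m)" by (rule s[THEN conjunct2, THEN conjunct2, THEN conjunct2, THEN conjunct2, THEN conjunct2, THEN conjunct2, THEN conjunct2, THEN conjunct2, THEN conjunct2, rule_format])
qed

definition Ecdf where "Ecdf f m = (nrm (E m f))^2"

text \<open>The spectral projection of the interval (a, b]; half-open because \<open>E\<close> is
  continuous from the right.\<close>

definition PE where "PE a b f = (\<lambda>x. E b f x - E a f x)"

lemma PE_L2 [simp, intro]: "L2 f \<Longrightarrow> L2 (PE a b f)"
  unfolding PE_def by (intro L2_diff) auto

lemma ip_E_self: "L2 f \<Longrightarrow> ip (E m f) f = complex_of_real (Ecdf f m)"
  unfolding Ecdf_def ip_self[symmetric]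
  using E_sym[of "E m f" f m] ip_cong[of "E m (E m f)" "E m f" f f] E_comp[of f m m] by simp

lemma aeq_diff: "aeq f f' \<Longrightarrow> aeq g g' \<Longrightarrow> aeq (\<lambda>x. f x - g x) (\<lambda>x. f' x - g' x)"
  using aeq_lin[of f f' g g' "-1"] by simp

lemma E_diff: "L2 f \<Longrightarrow> L2 g \<Longrightarrow> aeq (E l (\<lambda>x. f x - g x)) (\<lambda>x. E l f x - E l g x)"
  using E_lin[of f g l "-1"] by simp

lemma ip_PE: "L2 f \<Longrightarrow> L2 g \<Longrightarrow> ip (PE a b f) g = ip f (PE a b g)"
  unfolding PE_def by (simp add: ip_diff_left ip_diff_right E_sym)

lemma E_PE: "L2 f \<Longrightarrow> aeq (E m (PE a b f)) (PE (min m a) (min m b) f)"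
  unfolding PE_def by (rule aeq_trans[OF E_diff aeq_diff[OF E_comp E_comp]]) auto

lemma PE_E: "L2 f \<Longrightarrow> aeq (PE a b (E m f)) (PE (min m a) (min m b) f)"
  using aeq_diff[OF E_comp[of f b m] E_comp[of f a m]] by (simp add: PE_def min.commute)

lemma PE_PE: "L2 f \<Longrightarrow> a \<le> b \<Longrightarrow> aeq (PE a b (PE a b f)) (PE a b f)"
  using aeq_diff[OF E_PE[of f b a b] E_PE[of f a a b]] by (simp add: PE_def min_absorb1 min_absorb2)

lemma PE_lin: "L2 f \<Longrightarrow> L2 g \<Longrightarrow> aeq (PE a b (\<lambda>x. f x + c * g x)) (\<lambda>x. PE a b f x + c * PE a b g x)"
  using aeq_diff[OF E_lin[of f g b c] E_lin[of f g a c]] by (simp add: PE_def algebra_simps)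

lemma ip_PE_PE: "L2 f \<Longrightarrow> L2 g \<Longrightarrow> a \<le> b \<Longrightarrow> ip (PE a b f) (PE a b g) = ip f (PE a b g)"
  using ip_PE[of f "PE a b g" a b] ip_cong[of f f "PE a b (PE a b g)" "PE a b g"] PE_PE by simp

lemma nrm_PE: "L2 f \<Longrightarrow> a \<le> b \<Longrightarrow> (nrm (PE a b f))^2 = Ecdf f b - Ecdf f a"
proof -
  assume f: "L2 f" and ab: "a \<le> b"
  have "complex_of_real ((nrm (PE a b f))^2) = ip (PE a b f) f"
    unfolding ip_self[symmetric] using ip_PE_PE[OF f f ab] ip_PE[OF f f] by simp
  also have "\<dots> = complex_of_real (Ecdf f b - Ecdf f a)"
    unfolding PE_def by (simp add: ip_diff_left f ip_E_self)
  finally show ?thesis by (simp only: of_real_eq_iff)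
qed

lemma cdf_mono: "L2 f \<Longrightarrow> a \<le> b \<Longrightarrow> Ecdf f a \<le> Ecdf f b"
  using nrm_PE[of f a b] by (metis diff_ge_0_iff_ge zero_le_power2)

lemma nrm_compl:
  assumes f: "L2 f" shows "(nrm (\<lambda>x. E m f x - f x))^2 = (nrm f)^2 - Ecdf f m"
proof -
  have "ip f (E m f) = complex_of_real (Ecdf f m)" using E_sym[OF f f] ip_E_self[OF f] by simp
  then show ?thesis using nrm_power2_lin[of "E m f" f "-1"] f by (simp add: Ecdf_def)
qed

lemma cdf_le: "L2 f \<Longrightarrow> Ecdf f m \<le> (nrm f)^2"
  using nrm_compl[of f m] by (metis diff_ge_0_iff_ge zero_le_power2)

text \<open>By Pythagoras (\<open>nrm_PE\<close>, \<open>nrm_compl\<close>) increments of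
  \<open>Ecdf f\<close> are squared norms, so strong convergence of \<open>E\<close> turns into
  right-continuity and into the limit at the top.\<close>

lemma cdf_measure_cdf:
  assumes f: "L2 f" shows "cdf_measure (Ecdf f) ((nrm f)^2)"
proof
  show "Ecdf f x \<le> Ecdf f y" if "x \<le> y" for x y using cdf_mono[OF f that] .
  show "continuous (at_right a) (Ecdf f)" for a
    unfolding continuous_within
  proof (rule Lim_transform_eventually)
    show "((\<lambda>m. (nrm (\<lambda>x. E m f x - E a f x))^2 + Ecdf f a) \<longlongrightarrow> Ecdf f a) (at_right a)"
      using tendsto_add[OF tendsto_power[OF E_right[OF f, of a], of 2] tendsto_const[of "Ecdf f a"]] by simp
    show "\<forall>\<^sub>F m in at_right a. (nrm (\<lambda>x. E m f x - E a f x))^2 + Ecdf f a = Ecdf f m"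
      using eventually_at_right_less[of a]
      by eventually_elim (use nrm_PE[OF f] in \<open>simp add: PE_def\<close>)
  qed
  show "(Ecdf f \<longlongrightarrow> 0) at_bot"
    unfolding Ecdf_def[abs_def] using tendsto_power[OF E_bot[OF f], of 2] by simp
  have "((\<lambda>m. (nrm f)^2 - (nrm (\<lambda>x. E m f x - f x))^2) \<longlongrightarrow> (nrm f)^2 - 0^2) at_top"
    by (intro tendsto_intros E_top f)
  then show "(Ecdf f \<longlongrightarrow> (nrm f)^2) at_top" using nrm_compl[OF f] by simp
qed

definition nu where "nu f = interval_measure (Ecdf f)"

lemma E_dom': "L2 f \<Longrightarrow> (\<exists>g. Hr f g) \<longleftrightarrow> integrable (nu f) (\<lambda>m. m^2)"
  and E_form': "Hr f g \<Longrightarrow> ip g f = complex_of_real (LINT m|nu f. m)"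
  using E_dom E_form unfolding nu_def Ecdf_def[abs_def] by auto

text \<open>The spectral measure of \<open>PE a b f\<close> is carried by (a, b]. Hence its second
  moment is finite, which is membership in the domain, and the identity differs from
  \<open>t0\<close> by at most \<open>b - a\<close> almost everywhere.\<close>

lemma PE_range:
  assumes f: "L2 f" and ab: "a \<le> b"
  shows "\<exists>g. Hr (PE a b f) g"
    and "Hr (PE a b f) g \<Longrightarrow> t0 \<in> {a..b} \<Longrightarrow>
      cmod (ip g (PE a b f) - complex_of_real t0 * complex_of_real ((nrm (PE a b f))^2)) \<le> (b - a) * (nrm (PE a b f))^2"
proof -
  define h where "h = PE a b f"
  have h: "L2 h" using f by (auto simp: h_def)
  interpret C: cdf_measure "Ecdf h" "(nrm h)^2" by (rule cdf_measure_cdf[OF h])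
  interpret N: finite_measure "nu h" unfolding nu_def by (rule C.finite)
  have [simp]: "space (nu h) = UNIV" "sets (nu h) = sets borel" by (auto simp: nu_def)
  have [measurable_cong]: "sets (nu h) = sets borel" by simp
  \<comment> \<open>Projecting to (a, b] makes the distribution function vanish at \<open>a\<close>
    and reach its total mass at \<open>b\<close>.\<close>
  have c: "Ecdf h m = (nrm (PE (min m a) (min m b) f))^2" for m
    unfolding Ecdf_def h_def by (intro arg_cong[where f="\<lambda>x. x^2"] nrm_cong E_PE) (use f in auto)
  have ca: "Ecdf h a = 0" using ab nrm_PE[OF f, of a a] by (simp add: c min_absorb1)
  have cb: "Ecdf h b = (nrm h)^2" using ab unfolding c by (simp add: h_def min_absorb2)
  have "measure (nu h) (UNIV - {a<..b}) = 0"
    using N.finite_measure_compl[of "{a<..b}"] C.measure_UNIV C.measure_Ioc[OF ab] ca cb by (simp add: nu_def)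
  then have "emeasure (nu h) (UNIV - {a<..b}) = 0" by (simp add: N.emeasure_eq_measure)
  then have AE: "AE m in nu h. a < m \<and> m \<le> b"
    by (intro AE_I[of _ _ "UNIV - {a<..b}"]) auto
  have "integrable (nu h) (\<lambda>m. m^2)"
  proof (rule N.integrable_const_bound[of _ "(\<bar>a\<bar> + \<bar>b\<bar>)^2"])
    show "AE m in nu h. norm (m\<^sup>2) \<le> (\<bar>a\<bar> + \<bar>b\<bar>)\<^sup>2"
      using AE by eventually_elim (auto intro!: power2_le_iff_abs_le[THEN iffD2] simp: abs_le_square_iff[symmetric])
  qed simp
  then show "\<exists>g. Hr (PE a b f) g" using E_dom'[OF h] by (simp add: h_def)
  have im: "integrable (nu h) (\<lambda>m. m)"
    using C.integrable_id \<open>integrable (nu h) (\<lambda>m. m^2)\<close> by (simp add: nu_def)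
  assume g: "Hr (PE a b f) g" and t0: "t0 \<in> {a..b}"
  have "ip g h - complex_of_real t0 * complex_of_real ((nrm h)^2) = complex_of_real (LINT m|nu h. m - t0)"
    using E_form'[OF g] C.measure_UNIV im by (simp add: h_def[symmetric] nu_def[symmetric] mult.commute)
  moreover have "\<bar>LINT m|nu h. m - t0\<bar> \<le> (LINT m|nu h. b - a)"
  proof (rule order_trans[OF integral_abs_bound integral_mono_AE])
    show "AE m in nu h. \<bar>m - t0\<bar> \<le> b - a" using AE by eventually_elim (use t0 in auto)
  qed (use im in auto)
  moreover have "(LINT m|nu h. b - a) = (b - a) * (nrm h)^2"
    using C.measure_UNIV by (simp add: nu_def[symmetric] mult.commute)
  ultimately show "cmod (ip g (PE a b f) - complex_of_real t0 * complex_of_real ((nrm (PE a b f))^2)) \<le> (b - a) * (nrm (PE a b f))^2"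
    unfolding h_def[symmetric] by (simp only: norm_of_real)
qed

text \<open>The optimal choice is \<open>s = A / B\<close>. If \<open>A\<close> or \<open>B\<close>
  vanishes the infimum need not be attained, and \<open>s\<close> is sent to 0 or to infinity along
  an arbitrary \<open>e\<close> instead.\<close>

lemma real_AMGM_opt:
  fixes A B X :: real
  assumes "A \<ge> 0" "B \<ge> 0" "\<And>s. s > 0 \<Longrightarrow> X \<le> A^2 / s + s * B^2"
  shows "X \<le> 2 * A * B"
proof -
  consider "A > 0" "B > 0" | "A = 0" | "B = 0" using assms(1,2) by force
  then show ?thesis
  proof cases
    case 1
    then have "X \<le> A^2 / (A / B) + (A / B) * B^2" by (intro assms(3)) simp
    then show ?thesis using 1 by (simp add: power2_eq_square)
  next
    case 2
    have "X \<le> 0 + e" if "e > 0" for e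
    proof -
      have "X \<le> e / (B^2 + 1) * B^2"
        using assms(3)[of "e / (B^2 + 1)"] that 2 by (simp add: add_nonneg_pos)
      also have "\<dots> \<le> e" using that by (simp add: divide_simps add_nonneg_pos)
      finally show ?thesis by simp
    qed
    then show ?thesis using 2 field_le_epsilon[of X 0] by simp
  next
    case 3
    have "X \<le> 0 + e" if "e > 0" for e
    proof -
      have "X \<le> A^2 / ((A^2 + 1) / e)"
        using assms(3)[of "(A^2 + 1) / e"] that 3 by (simp add: add_nonneg_pos)
      also have "\<dots> \<le> e" using that by (simp add: divide_simps add_nonneg_pos)
      finally show ?thesis by simp
    qed
    then show ?thesis using 3 field_le_epsilon[of X 0] by simp
  qed
qed

text \<open>Polarisation of \<open>PE_range\<close>, applied to h1 + c h2 with c = s, -s, i s, -i s.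
  The free scale \<open>s\<close> is optimised at the end; this replaces a sum of squared norms by
  the product of the norms, which is what can be summed over many cells later.\<close>

lemma PE_range_polar:
  assumes f1: "L2 f1" and f2: "L2 f2" and ab: "a \<le> b" and t0: "t0 \<in> {a..b}"
    and g1: "Hr (PE a b f1) g1"
  shows "cmod (ip g1 (PE a b f2) - complex_of_real t0 * ip (PE a b f1) (PE a b f2))
     \<le> 2 * (b - a) * nrm (PE a b f1) * nrm (PE a b f2)"
proof -
  define h1 where "h1 = PE a b f1"
  define h2 where "h2 = PE a b f2"
  obtain g2 where g2: "Hr h2 g2" using PE_range(1)[OF f2 ab] unfolding h2_def by blast
  have g1: "Hr h1 g1" using g1 by (simp add: h1_def)
  have L: "L2 h1" "L2 h2" "L2 g1" "L2 g2" using Hr_L2[OF g1] Hr_L2[OF g2] by auto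

  \<comment> \<open>The quadratic form of the operator minus \<open>t0\<close> along h1 + c h2;
    \<open>PE_range\<close> controls exactly this diagonal expression.\<close>
  define Q where "Q c = ip (\<lambda>x. g1 x + c * g2 x) (\<lambda>x. h1 x + c * h2 x)
     - complex_of_real t0 * complex_of_real ((nrm (\<lambda>x. h1 x + c * h2 x))^2)" for c
  have Qle: "cmod (Q c) \<le> (b - a) * (nrm (\<lambda>x. h1 x + c * h2 x))^2" for c
  proof -
    let ?p = "PE a b (\<lambda>x. f1 x + c * f2 x)"
    have e: "aeq ?p (\<lambda>x. h1 x + c * h2 x)" unfolding h1_def h2_def by (rule PE_lin[OF f1 f2])
    have Lp: "L2 ?p" by (intro PE_L2 L2_lin f1 f2)
    have "Hr ?p (\<lambda>x. g1 x + c * g2 x)"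
      by (rule Hr_cong[OF Hr_lin[OF g1 g2] Lp aeq_sym[OF e]])
    from PE_range(2)[OF L2_lin[OF f1 f2] ab this t0]
    have "cmod (ip (\<lambda>x. g1 x + c * g2 x) ?p - complex_of_real t0 * complex_of_real ((nrm ?p)\<^sup>2)) \<le> (b - a) * (nrm ?p)\<^sup>2" .
    moreover have "ip (\<lambda>x. g1 x + c * g2 x) ?p = ip (\<lambda>x. g1 x + c * g2 x) (\<lambda>x. h1 x + c * h2 x)"
      by (rule ip_cong) (use L Lp e in \<open>auto intro!: L2_lin\<close>)
    moreover have "nrm ?p = nrm (\<lambda>x. h1 x + c * h2 x)"
      by (rule nrm_cong) (use L Lp e in \<open>auto intro!: L2_lin\<close>)
    ultimately show ?thesis by (simp add: Q_def)
  qed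
  define B12 where "B12 = ip g1 h2 - complex_of_real t0 * ip h1 h2"
  define B21 where "B21 = ip g2 h1 - complex_of_real t0 * ip h2 h1"
  define B11 where "B11 = ip g1 h1 - complex_of_real t0 * ip h1 h1"
  define B22 where "B22 = ip g2 h2 - complex_of_real t0 * ip h2 h2"
  have Qe: "Q c = B11 + c * B21 + cnj c * B12 + c * cnj c * B22" for c
    unfolding Q_def ip_self[symmetric]
    by (simp add: ip_lin_left ip_lin_right L L2_lin B11_def B12_def B21_def B22_def algebra_simps)
  \<comment> \<open>Parallelogram law: the four polarisation values are paired as c and -c, so the
    cross terms of the norms drop out.\<close>
  have nrm4: "(nrm (\<lambda>x. h1 x + c * h2 x))^2 + (nrm (\<lambda>x. h1 x + (- c) * h2 x))^2
     = 2 * (nrm h1)^2 + 2 * (cmod c)^2 * (nrm h2)^2" for c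
    unfolding nrm_power2_lin[OF L(1,2)] by simp
  have "cmod B12 \<le> (b - a) * ((nrm h1)^2 / s + s * (nrm h2)^2)" if s: "s > 0" for s :: real
  proof -
    let ?s = "complex_of_real s"
    have "4 * ?s * B12 = Q ?s - Q (- ?s) + \<i> * Q (\<i> * ?s) - \<i> * Q (- (\<i> * ?s))"
      unfolding Qe by (simp add: algebra_simps)
    moreover have "cmod (x - y + \<i> * z - \<i> * w) \<le> cmod x + cmod y + cmod z + cmod w" for x y z w
      using norm_triangle_ineq4[of "x - y + \<i> * z" "\<i> * w"] norm_triangle_ineq[of "x - y" "\<i> * z"]
        norm_triangle_ineq4[of x y] by (simp add: norm_mult)
    ultimately have "cmod (4 * ?s * B12) \<le> cmod (Q ?s) + cmod (Q (- ?s)) + cmod (Q (\<i> * ?s)) + cmod (Q (- (\<i> * ?s)))"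
      by presburger
    also have "\<dots> \<le> (b - a) * (nrm (\<lambda>x. h1 x + ?s * h2 x))^2 + (b - a) * (nrm (\<lambda>x. h1 x + (- ?s) * h2 x))^2
       + (b - a) * (nrm (\<lambda>x. h1 x + (\<i> * ?s) * h2 x))^2 + (b - a) * (nrm (\<lambda>x. h1 x + (- (\<i> * ?s)) * h2 x))^2"
      by (intro add_mono Qle)
    also have "\<dots> = (b - a) * (((nrm (\<lambda>x. h1 x + ?s * h2 x))^2 + (nrm (\<lambda>x. h1 x + (- ?s) * h2 x))^2)
       + ((nrm (\<lambda>x. h1 x + (\<i> * ?s) * h2 x))^2 + (nrm (\<lambda>x. h1 x + (- (\<i> * ?s)) * h2 x))^2))"
      by (simp only: distrib_left add.assoc)
    also have "\<dots> = (b - a) * (4 * (nrm h1)^2 + 4 * s^2 * (nrm h2)^2)"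
      unfolding nrm4 by (simp add: norm_mult)
    finally have "4 * s * cmod B12 \<le> (b - a) * (4 * (nrm h1)^2 + 4 * s^2 * (nrm h2)^2)"
      using s by (simp add: norm_mult)
    also have "\<dots> = 4 * s * ((b - a) * ((nrm h1)^2 / s + s * (nrm h2)^2))"
      using s by (simp add: field_simps power2_eq_square)
    finally show ?thesis using s by simp
  qed
  then have "cmod B12 \<le> (sqrt (b - a) * nrm h1)^2 / s + s * (sqrt (b - a) * nrm h2)^2" if "s > 0" for s
    using that ab by (simp add: power_mult_distrib distrib_left mult.left_commute)
  then have "cmod B12 \<le> 2 * (sqrt (b - a) * nrm h1) * (sqrt (b - a) * nrm h2)"
    by (intro real_AMGM_opt) (use ab in auto)
  also have "\<dots> = 2 * (sqrt (b - a) * sqrt (b - a)) * nrm h1 * nrm h2" by (simp only: mult_ac)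
  also have "sqrt (b - a) * sqrt (b - a) = b - a" using ab by simp
  finally show ?thesis by (simp only: B12_def h1_def h2_def)
qed

text \<open>\<open>H\<close> does not couple the range of a spectral projection to its orthogonal complement:
  the measures \<open>nu\<close> of orthogonal spectral components add up, hence so do the quadratic forms.\<close>

lemma PE_commute:
  assumes u: "Hr u g" and f: "L2 f" and ab: "a \<le> b" and t0: "t0 \<in> {a..b}"
  shows "cmod (ip g (PE a b f) - complex_of_real t0 * ip u (PE a b f)) \<le> 2 * (b - a) * nrm (PE a b u) * nrm (PE a b f)"
proof -
  have Lu: "L2 u" and Lg: "L2 g" using Hr_L2[OF u] by auto
  define u1 where "u1 = PE a b u"
  define h where "h = PE a b f"
  obtain g1 where g1: "Hr u1 g1" using PE_range(1)[OF Lu ab] by (auto simp: u1_def)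
  obtain gh where gh: "Hr h gh" using PE_range(1)[OF f ab] by (auto simp: h_def)
  \<comment> \<open>The component of \<open>u\<close> orthogonal to the range of the projection. The
    claim reduces to the vanishing of \<open>ip g2 h\<close>, after which
    \<open>PE_range_polar\<close> applies to the component \<open>u1\<close>.\<close>
  define u2 where "u2 = (\<lambda>x. u x - u1 x)"
  define g2 where "g2 = (\<lambda>x. g x - g1 x)"
  have g2: "Hr u2 g2" using Hr_lin[OF u g1, of "-1"] by (simp add: u2_def g2_def)
  have L: "L2 u1" "L2 h" "L2 u2" "L2 g1" "L2 gh" "L2 g2"
    using Hr_L2[OF g1] Hr_L2[OF gh] Hr_L2[OF g2] by auto
  have z: "ip (PE a b w) u2 = 0" if "L2 w" for w
  proof -
    have "ip (PE a b w) u2 = ip (PE a b w) u - ip (PE a b w) u1"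
      unfolding u2_def using that Lu L by (simp add: ip_diff_right PE_L2)
    also have "ip (PE a b w) u1 = ip w u1"
      unfolding u1_def using ip_PE_PE[OF that Lu ab] by simp
    also have "ip w u1 = ip (PE a b w) u" unfolding u1_def using ip_PE[OF that Lu] by simp
    finally show ?thesis by simp
  qed
  have z2: "ip u2 h = 0" using z[OF f] ip_cnj[of h u2] by (simp add: h_def)
  \<comment> \<open>Orthogonality survives every \<open>E m\<close>, because \<open>E m\<close>
    commutes with the projection. Therefore the distribution functions of \<open>u2\<close> and of c
    h add up when |c| = 1.\<close>
  have z3: "ip (E m h) (E m u2) = 0" for m
  proof -
    have "ip (E m h) (E m u2) = ip (E m (E m h)) u2" using E_sym[of "E m h" u2 m] L by auto
    also have "\<dots> = ip (PE a b (E m f)) u2"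
    proof (rule ip_cong)
      have "aeq (E m (E m h)) (E m h)" using E_comp[of h m m] L by simp
      moreover have "aeq (E m h) (PE a b (E m f))"
        unfolding h_def by (rule aeq_trans[OF E_PE[OF f] aeq_sym[OF PE_E[OF f]]])
      ultimately show "aeq (E m (E m h)) (PE a b (E m f))" by (rule aeq_trans)
    qed (use L f in auto)
    also have "\<dots> = 0" by (rule z) (use f in auto)
    finally show ?thesis .
  qed
  \<comment> \<open>Additive measures give additive forms, for each unimodular \<open>c\<close> at
    once; hence the cross terms must cancel for all these \<open>c\<close>.\<close>
  have add: "ip (\<lambda>x. g2 x + c * gh x) (\<lambda>x. u2 x + c * h x) = ip g2 u2 + ip gh h" if "cmod c = 1" for c
  proof -
    have "Ecdf (\<lambda>x. u2 x + c * h x) m = Ecdf u2 m + Ecdf h m" for m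
    proof -
      have "nrm (E m (\<lambda>x. u2 x + c * h x)) = nrm (\<lambda>x. E m u2 x + c * E m h x)"
        by (rule nrm_cong) (use L in \<open>auto intro!: L2_lin E_lin\<close>)
      then show ?thesis unfolding Ecdf_def using nrm_power2_lin[of "E m u2" "E m h" c] L z3[of m] that by simp
    qed
    then have ce: "Ecdf (\<lambda>x. u2 x + c * h x) = (\<lambda>m. Ecdf u2 m + Ecdf h m)" by auto
    have 1: "cdf_measure (\<lambda>m. Ecdf u2 m + Ecdf h m) ((nrm (\<lambda>x. u2 x + c * h x))^2)"
      unfolding ce[symmetric] by (intro cdf_measure_cdf L2_lin L)
    have int: "integrable (interval_measure (Ecdf w)) (\<lambda>m. m)" if "Hr w gw" for w gw
    proof -
      have Lw: "L2 w" using Hr_L2[OF that] by auto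
      then have "integrable (nu w) (\<lambda>m. m^2)" using E_dom'[of w] that by auto
      then show ?thesis using cdf_measure.integrable_id[OF cdf_measure_cdf[OF Lw]] by (simp add: nu_def)
    qed
    have "(LINT m|nu (\<lambda>x. u2 x + c * h x). m) = (LINT m|nu u2. m) + (LINT m|nu h. m)"
      unfolding nu_def ce
      by (rule integral_interval_measure_add[OF cdf_measure_cdf[OF L(3)] cdf_measure_cdf[OF L(2)] 1 int[OF g2] int[OF gh]])
    then show ?thesis
      using E_form'[OF Hr_lin[OF g2 gh, of c]] E_form'[OF g2] E_form'[OF gh] by simp
  qed
  have "c * ip gh u2 + cnj c * ip g2 h = 0" if "cmod c = 1" for c
  proof -
    have cc: "c * cnj c = 1" using that by (simp add: complex_norm_square[symmetric])
    have "ip (\<lambda>x. g2 x + c * gh x) (\<lambda>x. u2 x + c * h x)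
      = ip g2 u2 + cnj c * ip g2 h + c * ip gh u2 + (c * cnj c) * ip gh h"
      by (simp add: ip_lin_left ip_lin_right L L2_lin algebra_simps)
    then show ?thesis using add[OF that] cc by (simp add: add.commute)
  qed
  \<comment> \<open>For the cross terms X and Y, c = 1 gives X + Y = 0 and c = i gives i (X - Y) =
    0.\<close>
  from this[of 1] this[of \<i>] have "ip g2 h = 0" by (simp add: complex_eq_iff)
  then have "ip g h = ip g1 h" unfolding g2_def using ip_diff_left[OF Lg L(4) L(2)] by simp
  moreover have "ip u h = ip u1 h" using z2 unfolding u2_def using ip_diff_left[OF Lu L(1) L(2)] by simp
  ultimately show ?thesis
    using PE_range_polar[OF Lu f ab t0 g1[unfolded u1_def]] by (simp add: h_def u1_def)
qed

end

section \<open>The resolvent form compared with approximate solutions\<close>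

context resolution
begin

lemma nu_finite: "L2 f \<Longrightarrow> finite_measure (nu f)"
  unfolding nu_def by (rule cdf_measure.finite[OF cdf_measure_cdf])

lemma sets_nu [simp, measurable_cong]: "sets (nu f) = sets borel"
  and space_nu [simp]: "space (nu f) = UNIV"
  by (simp_all add: nu_def)

text \<open>Mesh 1/n on the interval from -n to n, hence 2 n^2 cells: range and fineness grow
  together.\<close>

definition grid :: "nat \<Rightarrow> nat \<Rightarrow> real" where
  "grid n k = (real k - real (n^2)) / real n"

lemma grid_Suc: "n > 0 \<Longrightarrow> grid n (Suc k) = grid n k + 1 / real n"
  by (simp add: grid_def field_simps)

lemma grid_le: "grid n k \<le> grid n (Suc k)"
  by (simp add: grid_def divide_right_mono)

lemma grid_ends: "grid n 0 = - real n" "grid n (2 * n^2) = real n"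
  by (cases "n = 0"; simp add: grid_def power2_eq_square)+

text \<open>The sum is the integral of a step function that samples \<open>s\<close> at the right
  end of each cell, that is at the ceiling of t n divided by n. Since \<open>nu f\<close> is finite,
  the constant \<open>B\<close> dominates.\<close>

lemma Riemann_Stieltjes_limit:
  fixes s :: "real \<Rightarrow> 'a::{banach, second_countable_topology}"
  assumes f: "L2 f" and s: "continuous_on UNIV s" and B: "\<And>x. norm (s x) \<le> B"
  shows "(\<lambda>n. \<Sum>k<2*n^2. (Ecdf f (grid n (Suc k)) - Ecdf f (grid n k)) *\<^sub>R s (grid n (Suc k)))
    \<longlonglongrightarrow> (LINT t|nu f. s t)"
proof -
  interpret C: cdf_measure "Ecdf f" "(nrm f)^2" by (rule cdf_measure_cdf[OF f])
  interpret N: finite_measure "nu f" by (rule nu_finite[OF f])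
  have [measurable]: "s \<in> borel_measurable borel" by (rule borel_measurable_continuous_onI[OF s])
  define S where "S n t = (\<Sum>k<2*n^2. indicator {grid n k<..grid n (Suc k)} t *\<^sub>R s (grid n (Suc k)))" for n t
  have [measurable]: "S n \<in> borel_measurable borel" for n unfolding S_def by measurable
  have Seq: "S n t = (if - real n < t \<and> t \<le> real n then s (of_int \<lceil>t * real n\<rceil> / real n) else 0)" if n: "n > 0" for n t
  proof -
    have mem: "t \<in> {grid n k<..grid n (Suc k)} \<longleftrightarrow> int (Suc k) = \<lceil>t * real n\<rceil> + int (n^2)" for k
    proof -
      have "t \<in> {grid n k<..grid n (Suc k)} \<longleftrightarrow> real k < t * real n + real (n^2) \<and> t * real n + real (n^2) \<le> real k + 1"
        using n by (auto simp: grid_def field_simps)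
      also have "\<dots> \<longleftrightarrow> \<lceil>t * real n\<rceil> = int (Suc k) - int (n^2)"
        unfolding ceiling_eq_iff by auto
      finally show ?thesis by auto
    qed
    have ser: "s (grid n (Suc k)) = s (of_int \<lceil>t * real n\<rceil> / real n)" if "int (Suc k) = \<lceil>t * real n\<rceil> + int (n^2)" for k
    proof -
      have "real (Suc k) = of_int \<lceil>t * real n\<rceil> + real (n^2)"
        using that by (metis of_int_add of_int_of_nat_eq)
      then show ?thesis by (simp add: grid_def)
    qed
    show ?thesis
    proof (cases "- real n < t \<and> t \<le> real n")
      case True
      have nn: "real (n^2) = real n * real n" by (simp add: power2_eq_square)
      have "- real (n^2) < t * real n" "t * real n \<le> real (n^2)"
        unfolding nn using True n mult_strict_right_mono[of "- real n" t "real n"] by (auto intro: mult_right_mono)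
      then have "- int (n^2) < \<lceil>t * real n\<rceil>" "\<lceil>t * real n\<rceil> \<le> int (n^2)"
        by (auto simp: less_ceiling_iff ceiling_le_iff)
      \<comment> \<open>Cells are numbered by their left end while the sample sits at the right end;
        hence the -1.\<close>
      define j where "j = nat (\<lceil>t * real n\<rceil> + int (n^2) - 1)"
      have j: "int (Suc j) = \<lceil>t * real n\<rceil> + int (n^2)" "j < 2 * n^2"
        using \<open>- int (n^2) < _\<close> \<open>_ \<le> int (n^2)\<close> unfolding j_def by (simp_all add: nat_less_iff)
      have "S n t = (\<Sum>k<2*n^2. if k = j then s (of_int \<lceil>t * real n\<rceil> / real n) else 0)"
        unfolding S_def
      proof (intro sum.cong refl)
        fix k
        have "t \<in> {grid n k<..grid n (Suc k)} \<longleftrightarrow> k = j" unfolding mem j(1)[symmetric] by simp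
        then show "indicator {grid n k<..grid n (Suc k)} t *\<^sub>R s (grid n (Suc k)) = (if k = j then s (of_int \<lceil>t * real n\<rceil> / real n) else 0)"
          using ser[OF j(1)] by (auto simp: indicator_def)
      qed
      then show ?thesis using True j(2) by simp
    next
      case False
      have "S n t = (\<Sum>k<2*n^2. 0)"
        unfolding S_def
      proof (intro sum.cong refl)
        fix k assume k: "k \<in> {..<2*n^2}"
        have "t \<notin> {grid n k<..grid n (Suc k)}"
        proof
          assume "t \<in> {grid n k<..grid n (Suc k)}"
          moreover have "- real n \<le> grid n k" using n by (simp add: grid_def power2_eq_square field_simps)
          moreover have "grid n (Suc k) \<le> real n"
          proof -
            have "real (Suc k) \<le> real (2 * n^2)" using k by (intro of_nat_mono) auto
            then show ?thesis using n by (simp add: grid_def power2_eq_square field_simps)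
          qed
          ultimately show False using False by auto
        qed
        then show "indicator {grid n k<..grid n (Suc k)} t *\<^sub>R s (grid n (Suc k)) = 0" by simp
      qed
      then show ?thesis unfolding if_not_P[OF False] by simp
    qed
  qed
  have "(\<lambda>n. LINT t|nu f. S n t) \<longlonglongrightarrow> (LINT t|nu f. s t)"
  proof (rule integral_dominated_convergence[where w="\<lambda>_. B"])
    \<comment> \<open>Passing to \<open>Suc n\<close> avoids the degenerate grid at n = 0.\<close>
    have "(\<lambda>n. S (Suc n) t) \<longlonglongrightarrow> s t" for t
    proof (rule Lim_transform_eventually)
      have lim: "(\<lambda>n. of_int \<lceil>t * real (Suc n)\<rceil> / real (Suc n)) \<longlonglongrightarrow> t"
      proof (rule tendsto_sandwich)
        show "\<forall>\<^sub>F n in sequentially. t \<le> of_int \<lceil>t * real (Suc n)\<rceil> / real (Suc n)"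
          by (rule always_eventually) (auto simp: pos_le_divide_eq)
        show "\<forall>\<^sub>F n in sequentially. of_int \<lceil>t * real (Suc n)\<rceil> / real (Suc n) \<le> t + 1 / real (Suc n)"
        proof (rule always_eventually, rule allI)
          fix n
          have "of_int \<lceil>t * real (Suc n)\<rceil> \<le> t * real (Suc n) + 1" by linarith
          then have "of_int \<lceil>t * real (Suc n)\<rceil> / real (Suc n) \<le> (t * real (Suc n) + 1) / real (Suc n)"
            by (rule divide_right_mono) simp
          then show "of_int \<lceil>t * real (Suc n)\<rceil> / real (Suc n) \<le> t + 1 / real (Suc n)"
            by (simp add: add_divide_distrib del: of_nat_Suc)
        qed
        show "(\<lambda>n. t + 1 / real (Suc n)) \<longlonglongrightarrow> t"
          using tendsto_add[OF tendsto_const LIMSEQ_inverse_real_of_nat, of t] by (simp add: inverse_eq_divide)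
      qed simp
      have "isCont s t" using s by (simp add: continuous_on_eq_continuous_at)
      then show "(\<lambda>n. s (of_int \<lceil>t * real (Suc n)\<rceil> / real (Suc n))) \<longlonglongrightarrow> s t"
        by (rule isCont_tendsto_compose) (rule lim)
      obtain n0 :: nat where n0: "real n0 > \<bar>t\<bar>" using reals_Archimedean2 by blast
      show "\<forall>\<^sub>F n in sequentially. s (of_int \<lceil>t * real (Suc n)\<rceil> / real (Suc n)) = S (Suc n) t"
        using eventually_ge_at_top[of n0]
      proof eventually_elim
        case (elim n)
        then have "real n0 \<le> real (Suc n)" by simp
        then have "- real (Suc n) < t \<and> t \<le> real (Suc n)" using n0 by linarith
        then show ?case using Seq[of "Suc n" t] by simp
      qed
    qed
    then show "AE t in nu f. (\<lambda>n. S n t) \<longlonglongrightarrow> s t"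
      by (intro AE_I2) (simp add: filterlim_sequentially_Suc[of "\<lambda>n. S n _"])
    show "AE t in nu f. norm (S n t) \<le> B" for n
    proof (rule AE_I2)
      fix t
      have "B \<ge> 0" using B[of 0] norm_ge_zero[of "s 0"] by linarith
      show "norm (S n t) \<le> B"
      proof (cases "n = 0")
        case True
        then show ?thesis using \<open>B \<ge> 0\<close> by (simp add: S_def)
      next
        case False
        then show ?thesis using Seq[of n t] B \<open>B \<ge> 0\<close> by auto
      qed
    qed
  qed (auto simp: measurable_cong_sets[OF sets_nu refl])
  moreover have "(LINT t|nu f. S n t) = (\<Sum>k<2*n^2. (Ecdf f (grid n (Suc k)) - Ecdf f (grid n k)) *\<^sub>R s (grid n (Suc k)))" for n
    unfolding S_def using C.measure_Ioc[OF grid_le]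
    by (subst Bochner_Integration.integral_sum) (auto simp: nu_def[symmetric] N.emeasure_finite less_top[symmetric])
  ultimately show ?thesis by simp
qed

text \<open>The left-hand side is \<open>((H - z)\<^sup>-\<^sup>1 f, f) - (u, f)\<close>; it is obtained without constructing the
  resolvent, from the Riemann sums of \<open>\<integral> dE(t) / (t - z)\<close>.\<close>

lemma resolvent_estimate:
  fixes \<mu> \<eta> :: real
  assumes u: "Hr u g" and f: "L2 f" and eta: "\<eta> > 0"
  defines "z \<equiv> Complex \<mu> \<eta>"
  defines "r \<equiv> \<lambda>x. g x - z * u x - f x"
  shows "cmod ((LINT t|nu f. 1 / (complex_of_real t - z)) - ip u f)
    \<le> nrm r * sqrt (LINT t|nu f. (cmod (1 / (complex_of_real t - z)))^2)"
proof -
  have Lu: "L2 u" and Lg: "L2 g" using Hr_L2[OF u] by auto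
  have Lr: "L2 r" unfolding r_def by (intro L2_diff L2_scale Lu Lg f)
  define s where "s t = 1 / (complex_of_real t - z)" for t
  have tz: "complex_of_real t - z \<noteq> 0" for t
    using eta by (simp add: z_def complex_eq_iff)
  have sz: "s t * (complex_of_real t - z) = 1" for t using tz by (simp add: s_def)
  have sb: "cmod (s t) \<le> 1 / \<eta>" for t
  proof -
    have "\<eta> \<le> cmod (complex_of_real t - z)"
      using abs_Im_le_cmod[of "complex_of_real t - z"] eta by (simp add: z_def)
    then show ?thesis using eta by (simp add: s_def norm_divide divide_left_mono frac_le)
  qed
  have sc: "continuous_on UNIV s" unfolding s_def by (intro continuous_intros) (use tz in auto)
  define P where "P n k = PE (grid n k) (grid n (Suc k))" for n k
  define S1 where "S1 n = (\<Sum>k<2*n^2. (Ecdf f (grid n (Suc k)) - Ecdf f (grid n k)) *\<^sub>R s (grid n (Suc k)))" for n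
  define S2 where "S2 n = (\<Sum>k<2*n^2. (Ecdf f (grid n (Suc k)) - Ecdf f (grid n k)) *\<^sub>R (cmod (s (grid n (Suc k))))^2)" for n
  \<comment> \<open>The pairing of \<open>u\<close> with the part of \<open>f\<close> whose spectrum
    lies in (-n, n]; the cell contributions telescope to it.\<close>
  define U where "U n = ip u (E (real n) f) - ip u (E (- real n) f)" for n
  have lim1: "S1 \<longlonglongrightarrow> (LINT t|nu f. s t)"
    unfolding S1_def by (rule Riemann_Stieltjes_limit[OF f sc sb])
  have lim2: "S2 \<longlonglongrightarrow> (LINT t|nu f. (cmod (s t))^2)"
    unfolding S2_def
  proof (rule Riemann_Stieltjes_limit[OF f])
    show "continuous_on UNIV (\<lambda>t. (cmod (s t))\<^sup>2)" by (intro continuous_intros sc)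
    show "norm ((cmod (s x))\<^sup>2) \<le> (1 / \<eta>)^2" for x using sb[of x] by (auto intro: power_mono)
  qed
  have limU: "U \<longlonglongrightarrow> ip u f"
  proof -
    have "(\<lambda>n. ip u (E (real n) f) - ip u f) \<longlonglongrightarrow> 0"
    proof (rule Lim_null_comparison)
      show "\<forall>\<^sub>F n in sequentially. norm (ip u (E (real n) f) - ip u f) \<le> nrm u * nrm (\<lambda>x. E (real n) f x - f x)"
        by (rule always_eventually) (use Cauchy_Schwarz_ip[OF Lu L2_diff[OF E_L2[OF f] f]] Lu f in \<open>auto simp: ip_diff_right\<close>)
      show "(\<lambda>n. nrm u * nrm (\<lambda>x. E (real n) f x - f x)) \<longlonglongrightarrow> 0"
        by (intro tendsto_mult_right_zero filterlim_compose[OF E_top[OF f] filterlim_real_sequentially])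
    qed
    moreover have "(\<lambda>n. ip u (E (- real n) f)) \<longlonglongrightarrow> 0"
    proof (rule Lim_null_comparison)
      show "\<forall>\<^sub>F n in sequentially. norm (ip u (E (- real n) f)) \<le> nrm u * nrm (E (- real n) f)"
        by (rule always_eventually) (use Cauchy_Schwarz_ip[OF Lu E_L2[OF f]] in auto)
      show "(\<lambda>n. nrm u * nrm (E (- real n) f)) \<longlonglongrightarrow> 0"
        by (intro tendsto_mult_right_zero filterlim_compose[OF E_bot[OF f]]
            filterlim_compose[OF filterlim_uminus_at_bot_at_top filterlim_real_sequentially])
    qed
    ultimately have "(\<lambda>n. (ip u (E (real n) f) - ip u f) - ip u (E (- real n) f) + ip u f) \<longlonglongrightarrow> 0 - 0 + ip u f"
      by (intro tendsto_intros)
    then show ?thesis by (simp add: U_def[abs_def] algebra_simps)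
  qed
  have bound: "cmod (S1 n - U n) \<le> 2 / (real n * \<eta>) * (nrm u * nrm f) + nrm r * sqrt (S2 n)" if n: "n > 0" for n
  proof -
    let ?K = "{..<2*n^2}"
    define A where "A w k = nrm (P n k w)" for w k
    have A2: "(A w k)^2 = Ecdf w (grid n (Suc k)) - Ecdf w (grid n k)" if "L2 w" for w k
      unfolding A_def P_def by (rule nrm_PE[OF that grid_le])
    have Asum: "L2_set (A w) ?K \<le> nrm w" if "L2 w" for w
    proof -
      have "(\<Sum>k\<in>?K. (A w k)^2) = Ecdf w (real n) - Ecdf w (- real n)"
        unfolding A2[OF that] sum_lessThan_telescope[of "\<lambda>k. Ecdf w (grid n k)"] grid_ends ..
      also have "\<dots> \<le> (nrm w)^2"
      proof -
        have "0 \<le> Ecdf w (- real n)" by (simp add: Ecdf_def)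
        then show ?thesis using cdf_le[OF that, of "real n"] by linarith
      qed
      finally show ?thesis unfolding L2_set_def by (simp add: real_sqrt_le_iff real_le_lsqrt sum_nonneg)
    qed
    define t where "t k = grid n (Suc k)" for k
    define err where "err k = ip g (P n k f) - complex_of_real (t k) * ip u (P n k f)" for k
    have err: "cmod (err k) \<le> 2 / real n * (A u k * A f k)" for k
      using PE_commute[OF u f grid_le[of n k], of "t k"] grid_le[of n k] grid_Suc[OF n, of k]
      by (simp add: err_def P_def A_def t_def mult.assoc)
    have rk: "cmod (ip r (P n k f)) \<le> A r k * A f k" for k
      unfolding P_def A_def ip_PE_PE[OF Lr f grid_le, symmetric]
      by (rule Cauchy_Schwarz_ip) (use Lr f in auto)
    have ff: "ip f (P n k f) = complex_of_real ((A f k)^2)" for k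
      unfolding P_def A_def ip_self[symmetric] ip_PE_PE[OF f f grid_le] ..
    \<comment> \<open>Testing r = g - z u - f against the cell projection of \<open>f\<close> and
      multiplying by s = 1 / (t - z) solves for the spectral mass of \<open>f\<close> in the cell.
      The term \<open>err k\<close> records that on the cell the operator is only approximately
      multiplication by \<open>t k\<close>.\<close>
    have key: "((A f k)^2) *\<^sub>R s (t k) = s (t k) * err k + ip u (P n k f) - s (t k) * ip r (P n k f)" for k
    proof -
      have "ip r (P n k f) = ip g (P n k f) - z * ip u (P n k f) - ip f (P n k f)"
        unfolding r_def P_def
        using ip_lin_left[OF Lg Lu PE_L2[OF f], of "- z" "grid n k" "grid n (Suc k)"]
          ip_diff_left[OF L2_diff[OF Lg L2_scale[OF Lu, of z]] f PE_L2[OF f]] by simp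
      then have gr: "ip g (P n k f) = ip r (P n k f) + z * ip u (P n k f) + ip f (P n k f)" by simp
      have "s (t k) * err k + ip u (P n k f) - s (t k) * ip r (P n k f)
         = ip u (P n k f) * (1 - s (t k) * (complex_of_real (t k) - z)) + s (t k) * ip f (P n k f)"
        by (simp add: err_def gr algebra_simps)
      also have "\<dots> = s (t k) * ip f (P n k f)" using sz by simp
      also have "\<dots> = ((A f k)^2) *\<^sub>R s (t k)" unfolding ff by (simp add: scaleR_conv_of_real)
      finally show ?thesis by simp
    qed
    have "(\<Sum>k\<in>?K. ip u (P n k f)) = (\<Sum>k\<in>?K. ip u (E (grid n (Suc k)) f) - ip u (E (grid n k) f))"
      unfolding P_def PE_def using Lu f by (simp add: ip_diff_right)
    also have "\<dots> = U n"
      unfolding sum_lessThan_telescope[of "\<lambda>k. ip u (E (grid n k) f)"] grid_ends U_def ..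
    finally have Usum: "(\<Sum>k\<in>?K. ip u (P n k f)) = U n" .
    have "S1 n = (\<Sum>k\<in>?K. ((A f k)^2) *\<^sub>R s (t k))"
      unfolding S1_def t_def A2[OF f] ..
    also have "\<dots> = (\<Sum>k\<in>?K. s (t k) * err k) + U n - (\<Sum>k\<in>?K. s (t k) * ip r (P n k f))"
      unfolding key sum.distrib sum_subtractf Usum ..
    finally have "cmod (S1 n - U n) = cmod ((\<Sum>k\<in>?K. s (t k) * err k) - (\<Sum>k\<in>?K. s (t k) * ip r (P n k f)))" by simp
    also have "\<dots> \<le> cmod (\<Sum>k\<in>?K. s (t k) * err k) + cmod (\<Sum>k\<in>?K. s (t k) * ip r (P n k f))"
      by (rule norm_triangle_ineq4)
    also have "\<dots> \<le> 2 / (real n * \<eta>) * (nrm u * nrm f) + nrm r * sqrt (S2 n)"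
    proof (rule add_mono)
      \<comment> \<open>Each error carries a factor 1/n and the product of the cell projections of
        \<open>u\<close> and \<open>f\<close>. Cauchy-Schwarz over the cells therefore sums all 2
        n^2 of them to O(1/n).\<close>
      have "cmod (\<Sum>k\<in>?K. s (t k) * err k) \<le> (\<Sum>k\<in>?K. 1 / \<eta> * (2 / real n * (A u k * A f k)))"
      proof (rule sum_norm_le)
        fix k
        show "cmod (s (t k) * err k) \<le> 1 / \<eta> * (2 / real n * (A u k * A f k))"
          unfolding norm_mult using eta by (intro mult_mono sb err) auto
      qed
      also have "\<dots> = 2 / (real n * \<eta>) * (\<Sum>k\<in>?K. \<bar>A u k\<bar> * \<bar>A f k\<bar>)"
        unfolding sum_distrib_left by (simp add: A_def field_simps)
      also have "\<dots> \<le> 2 / (real n * \<eta>) * (L2_set (A u) ?K * L2_set (A f) ?K)"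
        using eta by (intro mult_left_mono L2_set_mult_ineq) auto
      also have "\<dots> \<le> 2 / (real n * \<eta>) * (nrm u * nrm f)"
        using eta by (intro mult_left_mono mult_mono Asum Lu f) auto
      finally show "cmod (\<Sum>k\<in>?K. s (t k) * err k) \<le> 2 / (real n * \<eta>) * (nrm u * nrm f)" .
      \<comment> \<open>The weight |s| is kept with the projections of \<open>f\<close>, so that the
        sum of squares becomes the Riemann sum \<open>S2\<close> for the integral of |s|^2.\<close>
      have "cmod (\<Sum>k\<in>?K. s (t k) * ip r (P n k f)) \<le> (\<Sum>k\<in>?K. \<bar>A r k\<bar> * \<bar>cmod (s (t k)) * A f k\<bar>)"
      proof (rule sum_norm_le)
        fix k
        have "cmod (s (t k) * ip r (P n k f)) \<le> cmod (s (t k)) * (A r k * A f k)"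
          unfolding norm_mult by (intro mult_left_mono rk) auto
        also have "\<dots> = \<bar>A r k\<bar> * \<bar>cmod (s (t k)) * A f k\<bar>" by (simp add: A_def abs_mult)
        finally show "cmod (s (t k) * ip r (P n k f)) \<le> \<bar>A r k\<bar> * \<bar>cmod (s (t k)) * A f k\<bar>" .
      qed
      also have "\<dots> \<le> L2_set (A r) ?K * L2_set (\<lambda>k. cmod (s (t k)) * A f k) ?K" by (rule L2_set_mult_ineq)
      also have "L2_set (\<lambda>k. cmod (s (t k)) * A f k) ?K = sqrt (S2 n)"
        unfolding L2_set_def S2_def A2[OF f, symmetric] t_def by (simp add: power_mult_distrib mult.commute)
      also have "L2_set (A r) ?K * sqrt (S2 n) \<le> nrm r * sqrt (S2 n)"
        unfolding S2_def A2[OF f, symmetric] by (intro mult_right_mono Asum Lr) (auto intro: sum_nonneg)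
      finally show "cmod (\<Sum>k\<in>?K. s (t k) * ip r (P n k f)) \<le> nrm r * sqrt (S2 n)" .
    qed
    finally show ?thesis .
  qed
  have "cmod ((LINT t|nu f. s t) - ip u f) \<le> 0 * (nrm u * nrm f) + nrm r * sqrt (LINT t|nu f. (cmod (s t))^2)"
  proof (rule LIMSEQ_le)
    show "(\<lambda>n. cmod (S1 n - U n)) \<longlonglongrightarrow> cmod ((LINT t|nu f. s t) - ip u f)"
      by (intro tendsto_intros lim1 limU)
    have "(\<lambda>n. 2 / (real n * \<eta>)) \<longlonglongrightarrow> 0"
      using tendsto_mult[OF tendsto_const[of "2 / \<eta>"] lim_1_over_n[where 'a=real]] by (simp add: field_simps)
    then show "(\<lambda>n. 2 / (real n * \<eta>) * (nrm u * nrm f) + nrm r * sqrt (S2 n)) \<longlonglongrightarrow>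
       0 * (nrm u * nrm f) + nrm r * sqrt (LINT t|nu f. (cmod (s t))^2)"
      by (intro tendsto_intros lim2)
    show "\<exists>N. \<forall>n\<ge>N. cmod (S1 n - U n) \<le> 2 / (real n * \<eta>) * (nrm u * nrm f) + nrm r * sqrt (S2 n)"
      using bound by (intro exI[of _ 1]) auto
  qed
  then show ?thesis by (simp add: s_def)
qed

text \<open>The imaginary part of the resolvent form at \<mu> + i \<eta>. It carries no factor
  1/\<pi>, which is why \<open>pi\<close> shows up on the other side of
  \<open>Stone_formula\<close>.\<close>

definition poisson :: "(real \<Rightarrow> complex) \<Rightarrow> real \<Rightarrow> real \<Rightarrow> real" where
  "poisson f \<eta> \<mu> = (LINT t|nu f. \<eta> / ((t - \<mu>)^2 + \<eta>^2))"

text \<open>For real t, |1 / (t - z)|^2 equals Im (1 / (t - z)) / \<eta>. So the square root in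
  \<open>resolvent_estimate\<close> is again a Poisson integral, and the inequality closes on a
  single unknown.\<close>

lemma poisson_estimate:
  fixes \<mu> \<eta> :: real
  assumes u: "Hr u g" and f: "L2 f" and eta: "\<eta> > 0"
  defines "z \<equiv> Complex \<mu> \<eta>"
  shows "\<bar>poisson f \<eta> \<mu> - Im (ip u f)\<bar> \<le> nrm (\<lambda>x. g x - z * u x - f x) * sqrt (poisson f \<eta> \<mu> / \<eta>)"
proof -
  interpret N: finite_measure "nu f" by (rule nu_finite[OF f])
  define s where "s t = 1 / (complex_of_real t - z)" for t
  have sq: "(cmod (complex_of_real t - z))^2 = (t - \<mu>)^2 + \<eta>^2" for t
    by (simp add: z_def cmod_power2)
  have pos: "(t - \<mu>)^2 + \<eta>^2 > 0" for t using eta by (simp add: add_nonneg_pos)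
  have n2: "(cmod (s t))^2 = \<eta> / ((t - \<mu>)^2 + \<eta>^2) / \<eta>" for t
    using eta by (simp add: s_def norm_divide power_divide sq)
  have im: "Im (s t) = \<eta> / ((t - \<mu>)^2 + \<eta>^2)" for t
    using sq[of t] by (simp add: s_def Im_divide z_def cmod_power2)
  have tz: "complex_of_real t - z \<noteq> 0" for t
    using eta by (simp add: z_def complex_eq_iff)
  have sb: "cmod (s t) \<le> 1 / \<eta>" for t
  proof -
    have "\<eta> \<le> cmod (complex_of_real t - z)"
      using abs_Im_le_cmod[of "complex_of_real t - z"] eta by (simp add: z_def)
    then show ?thesis using eta by (simp add: s_def norm_divide divide_left_mono frac_le)
  qed
  have sm: "s \<in> borel_measurable borel"
    unfolding s_def by (intro borel_measurable_continuous_onI continuous_intros) (use tz in auto)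
  have si: "integrable (nu f) s"
    by (intro N.integrable_const_bound[of _ "1 / \<eta>"]) (use sb sm in \<open>auto simp: measurable_cong_sets[OF sets_nu refl]\<close>)
  have "poisson f \<eta> \<mu> - Im (ip u f) = Im ((LINT t|nu f. s t) - ip u f)"
    using integral_Im[OF si] by (simp add: poisson_def im[symmetric])
  also have "\<bar>\<dots>\<bar> \<le> cmod ((LINT t|nu f. s t) - ip u f)" by (rule abs_Im_le_cmod)
  also have "\<dots> \<le> nrm (\<lambda>x. g x - z * u x - f x) * sqrt (LINT t|nu f. (cmod (s t))^2)"
    using resolvent_estimate[OF u f eta, of \<mu>] unfolding s_def z_def by simp
  also have "(LINT t|nu f. (cmod (s t))^2) = poisson f \<eta> \<mu> / \<eta>"
    unfolding n2 poisson_def by (rule integral_divide_zero)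
  finally show ?thesis .
qed

end

section \<open>Stone's formula\<close>

context resolution
begin

text \<open>Integrating the Poisson kernel over \<open>[l, m]\<close> gives a difference of
  arctangents, which converges to \<open>\<pi>\<close> times the indicator of \<open>(l, m)\<close>.\<close>

lemma Stone_formula:
  assumes f: "L2 f" and lm: "l < m"
    and lim: "\<And>\<mu>. \<mu> \<in> {l..m} \<Longrightarrow> (\<lambda>n. poisson f (inverse (real (Suc n))) \<mu>) \<longlonglongrightarrow> g \<mu>"
    and bound: "\<And>\<mu> n. \<mu> \<in> {l..m} \<Longrightarrow> poisson f (inverse (real (Suc n))) \<mu> \<le> C"
  shows "pi * (Ecdf f m - Ecdf f l) = (LINT \<mu>:{l..m}|lborel. g \<mu>)"
proof -
  interpret N: finite_measure "nu f" by (rule nu_finite[OF f])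
  interpret C: cdf_measure "Ecdf f" "(nrm f)^2" by (rule cdf_measure_cdf[OF f])
  interpret P: pair_sigma_finite "nu f" "lborel :: real measure"
    by (intro pair_sigma_finite.intro N.sigma_finite_measure_axioms lborel.sigma_finite_measure_axioms)
  define \<eta> where "\<eta> n = inverse (real (Suc n))" for n
  have eta: "\<eta> n > 0" for n by (simp add: \<eta>_def)
  have eta_lim: "\<eta> \<longlonglongrightarrow> 0" unfolding \<eta>_def[abs_def] by (rule LIMSEQ_inverse_real_of_nat)
  define k where "k n t \<mu> = \<eta> n / ((t - \<mu>)^2 + (\<eta> n)^2)" for n t \<mu>
  have den: "(t - \<mu>)^2 + (\<eta> n)^2 > 0" for n t \<mu> using eta[of n] by (simp add: add_nonneg_pos)
  have k0: "0 \<le> k n t \<mu>" for n t \<mu> using eta[of n] den[of t \<mu> n] by (simp add: k_def)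
  have kb: "k n t \<mu> \<le> 1 / \<eta> n" for n t \<mu>
  proof -
    have "\<eta> n / ((t - \<mu>)^2 + (\<eta> n)^2) \<le> \<eta> n / (\<eta> n)^2"
      using eta[of n] by (intro divide_left_mono) (auto simp: add_nonneg_pos)
    then show ?thesis using eta[of n] by (simp add: k_def power2_eq_square)
  qed
  have km [measurable]: "(\<lambda>z. k n (fst z) (snd z)) \<in> borel_measurable (borel \<Otimes>\<^sub>M borel)" for n
    unfolding k_def by measurable
  have kt [measurable]: "(\<lambda>t. k n t \<mu>) \<in> borel_measurable borel" for n \<mu> unfolding k_def by measurable
  have kmu [measurable]: "(\<lambda>\<mu>. k n t \<mu>) \<in> borel_measurable borel" for n t unfolding k_def by measurable
  have ki: "integrable (nu f) (\<lambda>t. k n t \<mu>)" for n \<mu>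
    by (rule N.integrable_const_bound[of _ "1 / \<eta> n"]) (use k0 kb in \<open>auto simp: measurable_cong_sets[OF sets_nu refl]\<close>)
  have pk: "poisson f (\<eta> n) \<mu> = (LINT t|nu f. k n t \<mu>)" for n \<mu> by (simp add: poisson_def k_def)
  \<comment> \<open>At t = \<mu> the kernel is 1/\<eta>, so a bounded Poisson integral leaves no
    room for an atom. This matters at the endpoints, where the arctangents would otherwise count
    half of the mass.\<close>
  have atom: "measure (nu f) {\<mu>} = 0" if mu: "\<mu> \<in> {l..m}" for \<mu>
  proof -
    have "measure (nu f) {\<mu>} \<le> C * \<eta> n" for n
    proof -
      have "measure (nu f) {\<mu>} / \<eta> n = (LINT t|nu f. indicator {\<mu>} t / \<eta> n)" by simp
      also have "\<dots> \<le> (LINT t|nu f. k n t \<mu>)"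
      proof (rule integral_mono)
        show "integrable (nu f) (\<lambda>t. indicat_real {\<mu>} t / \<eta> n)"
          by (simp add: N.emeasure_finite less_top[symmetric])
        show "indicator {\<mu>} t / \<eta> n \<le> k n t \<mu>" for t
          using k0[of n t \<mu>] eta[of n] by (auto simp: indicator_def k_def power2_eq_square)
      qed (rule ki)
      also have "\<dots> \<le> C" using bound[OF mu, of n] pk[of n \<mu>] by (simp add: \<eta>_def)
      finally show ?thesis using eta[of n] by (simp add: pos_divide_le_eq)
    qed
    moreover have "(\<lambda>n. C * \<eta> n) \<longlonglongrightarrow> C * 0" by (intro tendsto_intros eta_lim)
    ultimately have "measure (nu f) {\<mu>} \<le> 0" by (intro LIMSEQ_le_const[of "\<lambda>n. C * \<eta> n"]) auto
    then show ?thesis using measure_nonneg[of "nu f" "{\<mu>}"] by linarith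
  qed
  define h where "h n t = arctan ((m - t) / \<eta> n) - arctan ((l - t) / \<eta> n)" for n t
  have hk: "(LINT \<mu>:{l..m}|lborel. k n t \<mu>) = h n t" for n t
  proof -
    have "(LINT \<mu>|lborel. k n t \<mu> * indicator {l..m} \<mu>) = arctan ((m - t) / \<eta> n) - arctan ((l - t) / \<eta> n)"
    proof (rule integral_FTC_Icc_real)
      fix x assume "l \<le> x" "x \<le> m"
      have "((\<lambda>x. arctan ((x - t) / \<eta> n)) has_real_derivative (1 / \<eta> n) * inverse (1 + ((x - t) / \<eta> n)^2)) (at x)"
        using eta[of n] by (auto intro!: derivative_eq_intros)
      also have "(1 / \<eta> n) * inverse (1 + ((x - t) / \<eta> n)^2) = k n t x"
      proof -
        have e: "\<eta> n \<noteq> 0" using eta[of n] by simp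
        have "1 + ((x - t) / \<eta> n)^2 = ((t - x)^2 + (\<eta> n)^2) / (\<eta> n)^2"
          using e by (simp add: power_divide power2_commute add_divide_distrib)
        then show ?thesis using e by (simp add: k_def power2_eq_square)
      qed
      finally show "((\<lambda>x. arctan ((x - t) / \<eta> n)) has_real_derivative k n t x) (at x)" .
      show "isCont (\<lambda>\<mu>. k n t \<mu>) x" unfolding k_def
        by (intro continuous_intros) (use den[of t x n] in auto)
    qed (use lm in simp)
    then show ?thesis by (simp add: set_lebesgue_integral_def h_def mult.commute)
  qed
  have Fub: "(LINT \<mu>:{l..m}|lborel. poisson f (\<eta> n) \<mu>) = (LINT t|nu f. h n t)" for n
  proof -
    have int: "integrable (nu f \<Otimes>\<^sub>M lborel) (\<lambda>(t, \<mu>). indicator {l..m} \<mu> * k n t \<mu>)"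
    proof (rule P.Fubini_integrable)
      show meas: "(\<lambda>(t, \<mu>). indicator {l..m} \<mu> * k n t \<mu>) \<in> borel_measurable (nu f \<Otimes>\<^sub>M lborel)"
        by (simp add: case_prod_beta' measurable_cong_sets[OF sets_pair_measure_cong[OF sets_nu sets_lborel] refl])
      have i: "integrable lborel (\<lambda>\<mu>. indicator {l..m} \<mu> * k n t \<mu>)" for t
      proof (rule Bochner_Integration.integrable_bound)
        show "integrable lborel (\<lambda>\<mu>. indicator {l..m} \<mu> * (1 / \<eta> n))"
          by (intro integrable_mult_left integrable_real_indicator) (auto simp: emeasure_lborel_Icc_eq)
      qed (use k0 kb in \<open>auto simp: indicator_def abs_mult abs_of_pos[OF eta]\<close>)
      then show "AE t in nu f. integrable lborel (\<lambda>\<mu>. case (t, \<mu>) of (t, \<mu>) \<Rightarrow> indicator {l..m} \<mu> * k n t \<mu>)" by simp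
      have "(LINT \<mu>|lborel. norm (indicator {l..m} \<mu> * k n t \<mu>)) = h n t" for t
        using hk[of n t] k0 by (simp add: set_lebesgue_integral_def abs_mult)
      moreover have "integrable (nu f) (h n)"
      proof (rule N.integrable_const_bound[of _ "pi"])
        show "AE t in nu f. norm (h n t) \<le> pi"
        proof (rule AE_I2)
          fix t show "norm (h n t) \<le> pi"
            unfolding h_def using arctan_bounded[of "(m - t) / \<eta> n"] arctan_bounded[of "(l - t) / \<eta> n"] by auto
        qed
        show "h n \<in> borel_measurable (nu f)"
          unfolding h_def measurable_cong_sets[OF sets_nu refl] by measurable
      qed
      ultimately show "integrable (nu f) (\<lambda>t. LINT \<mu>|lborel. norm (case (t, \<mu>) of (t, \<mu>) \<Rightarrow> indicator {l..m} \<mu> * k n t \<mu>))"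
        by simp
    qed
    have "(LINT \<mu>:{l..m}|lborel. poisson f (\<eta> n) \<mu>) = (LINT \<mu>|lborel. LINT t|nu f. indicator {l..m} \<mu> * k n t \<mu>)"
      unfolding set_lebesgue_integral_def pk by simp
    also have "\<dots> = (LINT t|nu f. LINT \<mu>|lborel. indicator {l..m} \<mu> * k n t \<mu>)"
      by (rule P.Fubini_integral[OF int])
    also have "\<dots> = (LINT t|nu f. h n t)" using hk by (simp add: set_lebesgue_integral_def)
    finally show ?thesis .
  qed
  have lim1: "(\<lambda>n. LINT t|nu f. h n t) \<longlonglongrightarrow> (LINT t|nu f. pi * indicator {l<..<m} t)"
  proof (rule integral_dominated_convergence[where w="\<lambda>_. pi"])
    have "AE t in nu f. t \<noteq> l \<and> t \<noteq> m"
    proof (rule AE_conjI)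
      show "AE t in nu f. t \<noteq> l"
        by (rule AE_I[of _ _ "{l}"]) (use atom[of l] lm in \<open>auto simp: N.emeasure_eq_measure\<close>)
      show "AE t in nu f. t \<noteq> m"
        by (rule AE_I[of _ _ "{m}"]) (use atom[of m] lm in \<open>auto simp: N.emeasure_eq_measure\<close>)
    qed
    then show "AE t in nu f. (\<lambda>n. h n t) \<longlonglongrightarrow> pi * indicator {l<..<m} t"
    proof eventually_elim
      case (elim t)

      have pos: "(\<lambda>n. arctan (c / \<eta> n)) \<longlonglongrightarrow> pi / 2" if "c > 0" for c
      proof (rule filterlim_compose[OF tendsto_arctan_at_top])
        show "filterlim (\<lambda>n. c / \<eta> n) at_top sequentially"
          unfolding \<eta>_def using that
          by (simp add: divide_inverse del: of_nat_Suc)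
            (intro filterlim_tendsto_pos_mult_at_top[OF tendsto_const] filterlim_compose[OF filterlim_real_sequentially filterlim_Suc])
      qed
      have neg: "(\<lambda>n. arctan (c / \<eta> n)) \<longlonglongrightarrow> - (pi / 2)" if "c < 0" for c
        using tendsto_minus[OF pos[of "- c"]] that by (simp add: arctan_minus)
      consider "t < l" | "l < t" "t < m" | "m < t" using elim by linarith
      then show ?case
      proof cases
        case 1
        then show ?thesis unfolding h_def using tendsto_diff[OF pos[of "m - t"] pos[of "l - t"]] lm by simp
      next
        case 2
        then show ?thesis unfolding h_def using tendsto_diff[OF pos[of "m - t"] neg[of "l - t"]] by simp
      next
        case 3
        then show ?thesis unfolding h_def using tendsto_diff[OF neg[of "m - t"] neg[of "l - t"]] lm by simp
      qed
    qed
    show "AE t in nu f. norm (h n t) \<le> pi" for n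
    proof (rule AE_I2)
      fix t show "norm (h n t) \<le> pi"
        unfolding h_def using arctan_bounded[of "(m - t) / \<eta> n"] arctan_bounded[of "(l - t) / \<eta> n"] by auto
    qed
    show "h n \<in> borel_measurable (nu f)" for n
      unfolding h_def measurable_cong_sets[OF sets_nu refl] by measurable
  qed (auto simp: measurable_cong_sets[OF sets_nu refl])
  have pmeas: "poisson f (\<eta> n) \<in> borel_measurable borel" for n
    unfolding pk[abs_def] by (rule N.borel_measurable_lebesgue_integral) 
      (simp add: case_prod_beta' k_def measurable_cong_sets[OF sets_pair_measure_cong[OF refl sets_nu] refl], measurable)
  have "(\<lambda>n. LINT \<mu>:{l..m}|lborel. poisson f (\<eta> n) \<mu>) \<longlonglongrightarrow> (LINT \<mu>:{l..m}|lborel. g \<mu>)"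
    unfolding set_lebesgue_integral_def
  proof (rule integral_dominated_convergence[where w="\<lambda>\<mu>. indicator {l..m} \<mu> * C"])
    have l: "(\<lambda>n. indicator {l..m} \<mu> *\<^sub>R poisson f (\<eta> n) \<mu>) \<longlonglongrightarrow> indicator {l..m} \<mu> *\<^sub>R g \<mu>" for \<mu>
      using lim[of \<mu>] unfolding \<eta>_def by (auto simp: indicator_def)
    then show "AE \<mu> in lborel. (\<lambda>n. indicator {l..m} \<mu> *\<^sub>R poisson f (\<eta> n) \<mu>) \<longlonglongrightarrow> indicator {l..m} \<mu> *\<^sub>R g \<mu>" by simp
    show m: "(\<lambda>\<mu>. indicator {l..m} \<mu> *\<^sub>R poisson f (\<eta> n) \<mu>) \<in> borel_measurable lborel" for n
      using pmeas[of n] by measurable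
    \<comment> \<open>\<open>g\<close> is only given as a pointwise limit, and this is where its
      measurability comes from.\<close>
    show "(\<lambda>\<mu>. indicator {l..m} \<mu> *\<^sub>R g \<mu>) \<in> borel_measurable lborel"
      by (rule borel_measurable_LIMSEQ_real[OF l m])
    have "0 \<le> poisson f (\<eta> n) \<mu>" for n \<mu> unfolding pk using k0 by (intro integral_nonneg_AE) auto
    then show "AE \<mu> in lborel. norm (indicator {l..m} \<mu> *\<^sub>R poisson f (\<eta> n) \<mu>) \<le> indicator {l..m} \<mu> * C" for n
      using bound[of _ n] by (auto simp: indicator_def \<eta>_def)
    show "integrable lborel (\<lambda>\<mu>. indicator {l..m} \<mu> * C)"
      by (intro integrable_mult_left integrable_real_indicator) (auto simp: emeasure_lborel_Icc_eq)
  qed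
  then have "(LINT \<mu>:{l..m}|lborel. g \<mu>) = (LINT t|nu f. pi * indicator {l<..<m} t)"
    unfolding Fub using lim1 LIMSEQ_unique by blast
  also have "\<dots> = pi * measure (nu f) {l<..<m}" by simp
  also have "measure (nu f) {l<..<m} = measure (nu f) {l<..m}"
  proof -
    have "{l<..m} = {l<..<m} \<union> {m}" using lm by auto
    then show ?thesis using N.finite_measure_Union[of "{l<..<m}" "{m}"] atom[of m] lm by simp
  qed
  also have "\<dots> = Ecdf f m - Ecdf f l" using C.measure_Ioc[of l m] lm by (simp add: nu_def)
  finally show ?thesis by simp
qed

end

section \<open>Consequences of the assumption on the coefficients\<close>

lemma set_integrable_of_real:
  "set_integrable M S f \<Longrightarrow> set_integrable M S (\<lambda>x. complex_of_real (f x))"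
  unfolding set_integrable_def
  using integrable_of_real[of M "\<lambda>x. indicator S x *\<^sub>R f x"] by (simp add: scaleR_conv_of_real)

lemma set_integral_of_real:
  "(LINT x:S|M. complex_of_real (f x)) = complex_of_real (LINT x:S|M. f x)"
  unfolding set_lebesgue_integral_def
  by (simp add: scaleR_conv_of_real flip: of_real_mult integral_complex_of_real)

lemma prim_of_real:
  assumes "\<And>x. a \<le> x \<Longrightarrow> set_integrable lborel {a..x} f"
    and "\<And>x. a \<le> x \<Longrightarrow> F x - F a = (LINT t:{a..x}|lborel. f t)"
  shows "prim a (\<lambda>x. complex_of_real (F x)) (\<lambda>x. complex_of_real (f x))"
proof (rule primI)
  fix x assume x: "a \<le> x"
  show "set_integrable lborel {a..x} (\<lambda>x. complex_of_real (f x))"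
    by (rule set_integrable_of_real[OF assms(1)[OF x]])
  show "complex_of_real (F x) - complex_of_real (F a) = (LINT t:{a..x}|lborel. complex_of_real (f t))"
    unfolding set_integral_of_real assms(2)[OF x, symmetric] by simp
qed

lemma set_integrable_const [simp]:
  "set_integrable lborel {a..b::real} (\<lambda>x. c :: 'a::{banach, second_countable_topology})"
  unfolding set_integrable_def
  by (intro integrable_scaleR_left integrable_real_indicator) (auto simp: emeasure_lborel_Icc_eq)

lemma set_integrable_cont:
  fixes f :: "real \<Rightarrow> complex"
  assumes "continuous_on {a..b} f"
  shows "set_integrable lborel {a..b} f"
proof -
  from set_integrable_mult_continuous[OF set_integrable_const assms, of 1] show ?thesis by simp
qed

lemma prim_C1:
  assumes c: "continuous_on {a..} f"
    and d: "\<And>x. a \<le> x \<Longrightarrow> (F has_vector_derivative f x) (at x within {a..})"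
  shows "prim a F f"
proof (rule primI)
  fix x assume x: "a \<le> x"
  have cx: "continuous_on {a..x} f" using c by (rule continuous_on_subset) auto
  show "set_integrable lborel {a..x} f" by (rule set_integrable_cont[OF cx])
  have "(LBINT t. indicator {a..x} t *\<^sub>R f t) = F x - F a"
    by (rule integral_FTC_Icc[OF x _ cx]) (auto intro!: has_vector_derivative_within_subset[OF d])
  then show "F x - F a = (LINT t:{a..x}|lborel. f t)" by (simp add: set_lebesgue_integral_def)
qed

lemma norm_set_integral_le:
  fixes f :: "real \<Rightarrow> complex"
  assumes "set_integrable lborel {a..b} f" "set_integrable lborel {a..b} g"
    "\<And>x. a \<le> x \<Longrightarrow> x \<le> b \<Longrightarrow> cmod (f x) \<le> g x"
  shows "cmod (LINT x:{a..b}|lborel. f x) \<le> (LINT x:{a..b}|lborel. g x)"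
  unfolding set_lebesgue_integral_def
proof (rule order_trans[OF integral_norm_bound integral_mono])
  show "integrable lborel (\<lambda>x. norm (indicator {a..b} x *\<^sub>R f x))"
    using assms(1) unfolding set_integrable_def by (rule integrable_norm)
  show "integrable lborel (\<lambda>x. indicator {a..b} x *\<^sub>R g x)" using assms(2) unfolding set_integrable_def .
qed (use assms(3) in \<open>auto simp: indicator_def\<close>)

lemma tail_tendsto_zero:
  fixes f :: "real \<Rightarrow> real"
  assumes "set_integrable lborel {a..} f"
  shows "((\<lambda>x. LINT t:{x..}|lborel. f t) \<longlongrightarrow> 0) at_top"
proof -
  have i: "integrable lborel (\<lambda>t. indicator {a..} t *\<^sub>R f t)" using assms unfolding set_integrable_def .
  have "((\<lambda>x. LINT t|lborel. indicator {x..} t *\<^sub>R (indicator {a..} t *\<^sub>R f t)) \<longlongrightarrow> (LINT t::real|lborel. 0::real)) at_top"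
  proof (rule integral_dominated_convergence_at_top[where M=lborel and f="\<lambda>_. 0::real"
      and s="\<lambda>x t. indicator {x..} t *\<^sub>R (indicator {a..} t *\<^sub>R f t)"
      and w="\<lambda>t. norm (indicator {a..} t *\<^sub>R f t)"])
    show "\<forall>\<^sub>F x in at_top. AE t in lborel. norm (indicator {x..} t *\<^sub>R (indicator {a..} t *\<^sub>R f t)) \<le> norm (indicator {a..} t *\<^sub>R f t)"
      by (auto intro!: always_eventually simp: indicator_def)
    show "AE t in lborel. ((\<lambda>x. indicator {x..} t *\<^sub>R (indicator {a..} t *\<^sub>R f t)) \<longlongrightarrow> 0) at_top"
    proof (rule AE_I2)
      fix t
      show "((\<lambda>x. indicator {x..} t *\<^sub>R (indicator {a..} t *\<^sub>R f t)) \<longlongrightarrow> 0) at_top"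
        by (rule tendsto_eventually, rule eventually_mono[OF eventually_gt_at_top[of t]]) (auto simp: indicator_def)
    qed
  qed (use borel_measurable_integrable[OF i] i in auto)
  moreover have "\<forall>\<^sub>F x in at_top. (LINT t|lborel. indicator {x..} t *\<^sub>R (indicator {a..} t *\<^sub>R f t)) = (LINT t:{x..}|lborel. f t)"
    using eventually_ge_at_top[of a]
    by eventually_elim (auto simp: set_lebesgue_integral_def indicator_def intro!: Bochner_Integration.integral_cong)
  ultimately show ?thesis by (simp add: tendsto_cong)
qed

text \<open>The size of the state vector of the first-order system, with v = p u' as its second
  entry.\<close>

definition nsol :: "(real \<Rightarrow> complex) \<Rightarrow> (real \<Rightarrow> complex) \<Rightarrow> real \<Rightarrow> real" where
  "nsol u v x = cmod (u x) + cmod (v x)"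

locale coefficients =
  fixes p p' :: "real \<Rightarrow> real" and p0 :: real and q q' :: "real \<Rightarrow> real" and x0 :: real
  assumes A: "assumptionA p p' p0 q q' x0"
begin

lemma p_pos: "x \<ge> 0 \<Longrightarrow> p x > 0"
  and p'_int: "set_integrable lborel {0..} p'"
  and p_eq: "x \<ge> 0 \<Longrightarrow> p x = p 0 + (LINT t:{0..x}|lborel. p' t)"
  and p0_pos: "p0 > 0" and p_lim: "(p \<longlongrightarrow> p0) at_top"
  and x0_pos: "x0 > 0" and q_int0: "set_integrable lborel {0..x0} q"
  and q'_int: "set_integrable lborel {x0..} q'"
  and q_eq: "x \<ge> x0 \<Longrightarrow> q x = q x0 + (LINT t:{x0..x}|lborel. q' t)"
  and q_lim: "(q \<longlongrightarrow> 0) at_top"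
proof -
  note a = A[unfolded assumptionA_def]
  show "x \<ge> 0 \<Longrightarrow> p x > 0" by (rule a[THEN conjunct1, rule_format])
  show "set_integrable lborel {0..} p'" by (rule a[THEN conjunct2, THEN conjunct1, rule_format])
  show "x \<ge> 0 \<Longrightarrow> p x = p 0 + (LINT t:{0..x}|lborel. p' t)" by (rule a[THEN conjunct2, THEN conjunct2, THEN conjunct1, rule_format])
  show "p0 > 0" by (rule a[THEN conjunct2, THEN conjunct2, THEN conjunct2, THEN conjunct1, rule_format])
  show "(p \<longlongrightarrow> p0) at_top" by (rule a[THEN conjunct2, THEN conjunct2, THEN conjunct2, THEN conjunct2, THEN conjunct1, rule_format])
  show "x0 > 0" by (rule a[THEN conjunct2, THEN conjunct2, THEN conjunct2, THEN conjunct2, THEN conjunct2, THEN conjunct1, rule_format])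
  show "set_integrable lborel {0..x0} q" by (rule a[THEN conjunct2, THEN conjunct2, THEN conjunct2, THEN conjunct2, THEN conjunct2, THEN conjunct2, THEN conjunct1, rule_format])
  show "set_integrable lborel {x0..} q'" by (rule a[THEN conjunct2, THEN conjunct2, THEN conjunct2, THEN conjunct2, THEN conjunct2, THEN conjunct2, THEN conjunct2, THEN conjunct1, rule_format])
  show "x \<ge> x0 \<Longrightarrow> q x = q x0 + (LINT t:{x0..x}|lborel. q' t)" by (rule a[THEN conjunct2, THEN conjunct2, THEN conjunct2, THEN conjunct2, THEN conjunct2, THEN conjunct2, THEN conjunct2, THEN conjunct2, THEN conjunct1, rule_format])
  show "(q \<longlongrightarrow> 0) at_top" by (rule a[THEN conjunct2, THEN conjunct2, THEN conjunct2, THEN conjunct2, THEN conjunct2, THEN conjunct2, THEN conjunct2, THEN conjunct2, THEN conjunct2, rule_format])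
qed

abbreviation cp where "cp x \<equiv> complex_of_real (p x)"
abbreviation cq where "cq x \<equiv> complex_of_real (q x)"

lemma prim_p: "prim 0 cp (\<lambda>x. complex_of_real (p' x))"
proof (rule prim_of_real)
  fix x :: real assume "0 \<le> x"
  show "set_integrable lborel {0..x} p'" by (rule set_integrable_subset[OF p'_int]) auto
  show "p x - p 0 = (LINT t:{0..x}|lborel. p' t)" using p_eq[OF \<open>0 \<le> x\<close>] by simp
qed

lemma prim_q: "prim x0 cq (\<lambda>x. complex_of_real (q' x))"
proof (rule prim_of_real)
  fix x :: real assume "x0 \<le> x"
  show "set_integrable lborel {x0..x} q'" by (rule set_integrable_subset[OF q'_int]) auto
  show "q x - q x0 = (LINT t:{x0..x}|lborel. q' t)" using q_eq[OF \<open>x0 \<le> x\<close>] by simp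
qed

lemma p_cont: "continuous_on {0..} p"
  using continuous_on_Re[OF prim_cont[OF prim_p]] by simp

lemma q_cont: "continuous_on {x0..} q"
  using continuous_on_Re[OF prim_cont[OF prim_q]] by simp

lemma continuous_bounded_at_top:
  fixes f :: "real \<Rightarrow> real"
  assumes "continuous_on {a..} f" "(f \<longlongrightarrow> l) at_top"
  shows "\<exists>B. \<forall>x\<ge>a. \<bar>f x\<bar> \<le> B"
proof -
  have "\<forall>\<^sub>F x in at_top. dist (f x) l < 1" using assms(2) by (rule tendstoD) simp
  then obtain X where X: "\<And>x. x \<ge> X \<Longrightarrow> dist (f x) l < 1" by (auto simp: eventually_at_top_linorder)
  have "compact (f ` {a..max a X})"
    by (rule compact_continuous_image[OF continuous_on_subset[OF assms(1)]]) auto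
  then obtain B where B: "\<And>x. x \<in> {a..max a X} \<Longrightarrow> norm (f x) \<le> B"
    using compact_imp_bounded bounded_iff by (metis (no_types, opaque_lifting) imageI)
  show ?thesis
  proof (intro exI[of _ "max B (\<bar>l\<bar> + 1)"] allI impI)
    fix x assume "a \<le> x"
    show "\<bar>f x\<bar> \<le> max B (\<bar>l\<bar> + 1)"
    proof (cases "x \<le> max a X")
      case True
      then show ?thesis using B[of x] \<open>a \<le> x\<close> by (auto simp: le_max_iff_disj)
    next
      case False
      then show ?thesis using X[of x] unfolding dist_real_def by linarith
    qed
  qed
qed

lemma p_bounds: "\<exists>pl ph. pl > 0 \<and> (\<forall>x\<ge>0. pl \<le> p x \<and> p x \<le> ph)"
proof -
  obtain ph where ph: "\<And>x. x \<ge> 0 \<Longrightarrow> \<bar>p x\<bar> \<le> ph"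
    using continuous_bounded_at_top[OF p_cont p_lim] by auto
  have c: "continuous_on {0..} (\<lambda>x. inverse (p x))"
    by (intro continuous_intros p_cont) (use p_pos in force)
  obtain B where B: "\<And>x. x \<ge> 0 \<Longrightarrow> \<bar>inverse (p x)\<bar> \<le> B"
    using continuous_bounded_at_top[OF c tendsto_inverse[OF p_lim]] p0_pos by auto
  have Bpos: "B > 0"
  proof -
    have "0 < inverse (p 0)" using p_pos[of 0] by simp
    then show ?thesis using B[of 0] by linarith
  qed
  show ?thesis
  proof (rule exI[of _ "inverse B"], rule exI[of _ ph], intro conjI allI impI)
    fix x :: real assume "0 \<le> x"
    have "0 < inverse (p x)" "inverse (p x) \<le> B" using B[OF \<open>0 \<le> x\<close>] p_pos[OF \<open>0 \<le> x\<close>] by simp_all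
    then show "inverse B \<le> p x" using le_imp_inverse_le[of "inverse (p x)" B] by simp
    show "p x \<le> ph" using ph[OF \<open>0 \<le> x\<close>] by simp
  qed (use Bpos in simp)
qed

definition pl where "pl = (SOME a. a > 0 \<and> (\<exists>ph. \<forall>x\<ge>0. a \<le> p x \<and> p x \<le> ph))"
definition ph where "ph = (SOME b. \<forall>x\<ge>0. p x \<le> b)"

lemma pl_pos: "pl > 0" and pl_le: "x \<ge> 0 \<Longrightarrow> pl \<le> p x"
proof -
  have "pl > 0 \<and> (\<exists>ph. \<forall>x\<ge>0. pl \<le> p x \<and> p x \<le> ph)"
    unfolding pl_def by (rule someI_ex) (use p_bounds in blast)
  then show "pl > 0" "x \<ge> 0 \<Longrightarrow> pl \<le> p x" by auto
qed

lemma le_ph: "x \<ge> 0 \<Longrightarrow> p x \<le> ph"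
proof -
  have "\<forall>x\<ge>0. p x \<le> ph" unfolding ph_def by (rule someI_ex) (use p_bounds in blast)
  then show "x \<ge> 0 \<Longrightarrow> p x \<le> ph" by auto
qed

lemma ph_pos: "ph > 0" using le_ph[of 0] p_pos[of 0] by linarith

lemma inv_p_cont: "continuous_on {0..} (\<lambda>x. 1 / p x)"
  by (intro continuous_intros p_cont) (use p_pos in force)

lemma inv_cp_cont: "continuous_on {0..} (\<lambda>x. 1 / cp x)"
  by (intro continuous_intros p_cont) (use p_pos in force)

lemma q_int: "set_integrable lborel {0..x} q"
proof -
  have "set_integrable lborel {x0..max x x0} (\<lambda>x. 1 * q x)"
    by (rule set_integrable_mult_continuous_real)
      (auto intro: continuous_on_subset[OF q_cont])
  then have "set_integrable lborel ({0..x0} \<union> {x0..max x x0}) q"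
    using q_int0 by (intro set_integrable_Un) auto
  then show ?thesis by (rule set_integrable_subset) auto
qed

lemma sol_prim:
  assumes "sol_with p q z u v"
  shows "prim 0 u (\<lambda>x. v x / cp x)" "prim 0 v (\<lambda>x. (cq x - z) * u x)"
  using assms unfolding sol_with_def prim_def by blast+

lemma prim_sol:
  assumes "prim 0 u (\<lambda>x. v x / cp x)" "prim 0 v (\<lambda>x. (cq x - z) * u x)"
  shows "sol_with p q z u v"
  using assms unfolding sol_with_def prim_def by blast

lemma nsol_cont:
  assumes "prim 0 u u'" "prim 0 v v'"
  shows "continuous_on {0..} (nsol u v)"
  unfolding nsol_def by (intro continuous_intros prim_cont[OF assms(1)] prim_cont[OF assms(2)])

text \<open>One constant for all energies of modulus at most \<beta> and all solutions. The source
  \<open>g\<close> is there so that the difference of solutions at two energies can be treated as a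
  solution of an inhomogeneous equation.\<close>

lemma nsol_Gronwall:
  assumes X: "X \<ge> 0" and be: "\<beta> \<ge> 0"
  obtains C where "C \<ge> 0" and "\<And>\<mu> u v g B s t. \<lbrakk>\<bar>\<mu>\<bar> \<le> \<beta>; prim 0 u (\<lambda>x. v x / cp x);
     prim 0 v (\<lambda>x. (cq x - complex_of_real \<mu>) * u x + g x); 0 \<le> B;
     (LINT x:{0..X}|lborel. cmod (g x)) \<le> B; s \<in> {0..X}; t \<in> {0..X}\<rbrakk> \<Longrightarrow> nsol u v t \<le> C * (nsol u v s + B)"
proof -
  \<comment> \<open>A common majorant for both coefficients of the system, valid for every
    admissible energy.\<close>
  define h where "h x = 1 / p x + (\<bar>q x\<bar> + \<beta>)" for x
  have hi: "set_integrable lborel {0..X} h"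
  proof -
    have "set_integrable lborel {0..X} (\<lambda>x. 1 * (1 / p x))"
      by (rule set_integrable_mult_continuous_real)
        (auto intro: continuous_on_subset[OF inv_p_cont])
    then have "set_integrable lborel {0..X} (\<lambda>x. 1 / p x)" by simp
    then show ?thesis unfolding h_def
      by (intro set_integral_add(1) set_integrable_abs[OF q_int] set_integrable_const)
  qed
  have h0: "0 \<le> h x" if "x \<in> {0..X}" for x using p_pos[of x] that be by (auto simp: h_def intro!: add_nonneg_nonneg)
  show ?thesis
  proof (rule two_sided_Gronwall[OF hi h0 X])
  fix C :: real
  assume C: "C \<ge> 0" "\<And>N B s t. \<lbrakk>continuous_on {0..X} N; B \<ge> 0; \<And>x. x \<in> {0..X} \<Longrightarrow> 0 \<le> N x;
      \<And>s t. \<lbrakk>0 \<le> s; s \<le> t; t \<le> X\<rbrakk> \<Longrightarrow> \<bar>N t - N s\<bar> \<le> B + (LINT x:{s..t}|lborel. h x * N x);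
      s \<in> {0..X}; t \<in> {0..X}\<rbrakk> \<Longrightarrow> N t \<le> C * (N s + B)"
  show thesis
  proof (rule that[OF C(1)])
    fix \<mu> u v g B s t
    assume mu: "\<bar>\<mu>\<bar> \<le> \<beta>" and u: "prim 0 u (\<lambda>x. v x / cp x)"
      and v: "prim 0 v (\<lambda>x. (cq x - complex_of_real \<mu>) * u x + g x)"
      and B: "0 \<le> B" "(LINT x:{0..X}|lborel. cmod (g x)) \<le> B"
      and st: "s \<in> {0..X}" "t \<in> {0..X}"
    let ?N = "nsol u v"
    have cN: "continuous_on {0..X} ?N" by (rule continuous_on_subset[OF nsol_cont[OF u v]]) auto
    have cu: "continuous_on {0..X} u" by (rule continuous_on_subset[OF prim_cont[OF u]]) auto
    have qu: "set_integrable lborel {0..X} (\<lambda>x. (cq x - complex_of_real \<mu>) * u x)"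
    proof (rule set_integrable_mult_continuous[OF _ cu])
      show "set_integrable lborel {0..X} (\<lambda>x. cq x - complex_of_real \<mu>)"
        by (intro set_integral_diff(1) set_integrable_of_real[OF q_int] set_integrable_const)
    qed
    have i1': "set_integrable lborel {0..X} (\<lambda>x. 1 / p x * cmod (v x))"
    proof -
      have "set_integrable lborel {0..X} (\<lambda>x. 1 * (1 / p x * cmod (v x)))"
        by (intro set_integrable_mult_continuous_real set_integrable_const continuous_on_mult continuous_on_norm
            continuous_on_subset[OF inv_p_cont] continuous_on_subset[OF prim_cont[OF v]]) auto
      then show ?thesis by simp
    qed
    have i2': "set_integrable lborel {0..X} (\<lambda>x. (\<bar>q x\<bar> + \<beta>) * cmod (u x))"
      by (intro set_integrable_mult_continuous_real set_integral_add(1) set_integrable_abs[OF q_int]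
          set_integrable_const continuous_on_norm cu)
    have gi: "set_integrable lborel {0..X} g"
      using set_integral_diff(1)[OF prim_integrable[OF v order_refl] qu] by simp
    show "?N t \<le> C * (?N s + B)"
    proof (rule C(2)[OF cN B(1) _ _ st])
      show "0 \<le> ?N x" for x by (simp add: nsol_def)
      show "\<bar>?N t - ?N s\<bar> \<le> B + (LINT x:{s..t}|lborel. h x * ?N x)" if st: "0 \<le> s" "s \<le> t" "t \<le> X" for s t
      proof -
        have sub: "set_integrable lborel {s..t} f" if "set_integrable lborel {0..X} f"
          for f :: "real \<Rightarrow> 'z::{banach,second_countable_topology}"
          by (rule set_integrable_subset[OF that]) (use st in auto)
        have hN: "set_integrable lborel {s..t} (\<lambda>x. h x * ?N x)"
          by (rule sub[OF set_integrable_mult_continuous_real[OF hi cN]])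
        have gn: "set_integrable lborel {s..t} (\<lambda>x. cmod (g x))"
          by (rule sub[OF set_integrable_norm[OF gi]])
        have "\<bar>?N t - ?N s\<bar> \<le> cmod (u t - u s) + cmod (v t - v s)"
          using norm_triangle_ineq3[of "u t" "u s"] norm_triangle_ineq3[of "v t" "v s"] unfolding nsol_def by linarith
        also have "cmod (u t - u s) \<le> (LINT x:{s..t}|lborel. 1 / p x * cmod (v x))"
          unfolding prim_diff[OF u st(1,2)]
        proof (rule norm_set_integral_le)
          show "set_integrable lborel {s..t} (\<lambda>x. v x / cp x)" using prim_integrable[OF u st(1)] .
          show "set_integrable lborel {s..t} (\<lambda>x. 1 / p x * cmod (v x))" by (rule sub[OF i1'])
          show "cmod (v x / cp x) \<le> 1 / p x * cmod (v x)" if "s \<le> x" "x \<le> t" for x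
            using p_pos[of x] that st by (simp add: norm_divide)
        qed
        also have "cmod (v t - v s) \<le> (LINT x:{s..t}|lborel. (\<bar>q x\<bar> + \<beta>) * cmod (u x) + cmod (g x))"
          unfolding prim_diff[OF v st(1,2)]
        proof (rule norm_set_integral_le)
          show "set_integrable lborel {s..t} (\<lambda>x. (cq x - complex_of_real \<mu>) * u x + g x)"
            using prim_integrable[OF v st(1)] .
          show "set_integrable lborel {s..t} (\<lambda>x. (\<bar>q x\<bar> + \<beta>) * cmod (u x) + cmod (g x))"
            by (intro set_integral_add(1) gn sub[OF i2'])
          show "cmod ((cq x - complex_of_real \<mu>) * u x + g x) \<le> (\<bar>q x\<bar> + \<beta>) * cmod (u x) + cmod (g x)" for x
          proof -
            have "cmod (cq x - complex_of_real \<mu>) \<le> \<bar>q x\<bar> + \<beta>"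
              using mu norm_triangle_ineq4[of "cq x" "complex_of_real \<mu>"] by simp
            then have "cmod (cq x - complex_of_real \<mu>) * cmod (u x) \<le> (\<bar>q x\<bar> + \<beta>) * cmod (u x)"
              by (rule mult_right_mono) simp
            then show ?thesis
              using norm_triangle_ineq[of "(cq x - complex_of_real \<mu>) * u x" "g x"] by (simp add: norm_mult)
          qed
        qed
        finally have 1: "\<bar>?N t - ?N s\<bar> \<le> (LINT x:{s..t}|lborel. 1 / p x * cmod (v x))
           + (LINT x:{s..t}|lborel. (\<bar>q x\<bar> + \<beta>) * cmod (u x) + cmod (g x))" by simp
        note i1 = sub[OF i1'] and i2 = sub[OF i2']
        have "(LINT x:{s..t}|lborel. 1 / p x * cmod (v x)) + (LINT x:{s..t}|lborel. (\<bar>q x\<bar> + \<beta>) * cmod (u x) + cmod (g x))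
          = (LINT x:{s..t}|lborel. 1 / p x * cmod (v x) + (\<bar>q x\<bar> + \<beta>) * cmod (u x)) + (LINT x:{s..t}|lborel. cmod (g x))"
          using i1 i2 gn by (simp add: set_integral_add)
        also have "\<dots> \<le> (LINT x:{s..t}|lborel. h x * ?N x) + B"
        proof (rule add_mono)
          show "(LINT x:{s..t}|lborel. 1 / p x * cmod (v x) + (\<bar>q x\<bar> + \<beta>) * cmod (u x)) \<le> (LINT x:{s..t}|lborel. h x * ?N x)"
          proof (rule set_integral_mono[OF set_integral_add(1)[OF i1 i2] hN])
            fix x assume "x \<in> {s..t}"
            then have "1 / p x \<ge> 0" using p_pos[of x] st by simp
            then show "1 / p x * cmod (v x) + (\<bar>q x\<bar> + \<beta>) * cmod (u x) \<le> h x * ?N x"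
              using be by (simp add: h_def nsol_def algebra_simps)
          qed
          have "(LINT x:{s..t}|lborel. cmod (g x)) \<le> (LINT x:{0..X}|lborel. cmod (g x))"
            unfolding set_lebesgue_integral_def
            by (rule integral_mono[OF gn[unfolded set_integrable_def] set_integrable_norm[OF gi, unfolded set_integrable_def]])
              (use st in \<open>auto simp: indicator_def\<close>)
          then show "(LINT x:{s..t}|lborel. cmod (g x)) \<le> B" using B(2) by simp
        qed
        finally show "\<bar>?N t - ?N s\<bar> \<le> B + (LINT x:{s..t}|lborel. h x * ?N x)" using 1 by simp
      qed
    qed
  qed
  qed
qed

lemma nsol_Gronwall_hom:
  assumes X: "X \<ge> 0" and be: "\<beta> \<ge> 0"
  obtains C where "C \<ge> 0" and "\<And>\<mu> u v s t. \<lbrakk>\<bar>\<mu>\<bar> \<le> \<beta>; sol_with p q (complex_of_real \<mu>) u v;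
     s \<in> {0..X}; t \<in> {0..X}\<rbrakk> \<Longrightarrow> nsol u v t \<le> C * nsol u v s"
proof -
  obtain C where C: "C \<ge> 0" "\<And>\<mu> u v g B s t. \<lbrakk>\<bar>\<mu>\<bar> \<le> \<beta>; prim 0 u (\<lambda>x. v x / cp x);
     prim 0 v (\<lambda>x. (cq x - complex_of_real \<mu>) * u x + g x); 0 \<le> B;
     (LINT x:{0..X}|lborel. cmod (g x)) \<le> B; s \<in> {0..X}; t \<in> {0..X}\<rbrakk> \<Longrightarrow> nsol u v t \<le> C * (nsol u v s + B)"
    by (rule nsol_Gronwall[OF X be]) (assumption | rule that)+
  show ?thesis
  proof (rule that[OF C(1)])
    fix \<mu> u v s t assume "\<bar>\<mu>\<bar> \<le> \<beta>" "sol_with p q (complex_of_real \<mu>) u v" "s\<in>{0..X}" "t\<in>{0..X}"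
    then show "nsol u v t \<le> C * nsol u v s"
      using C(2)[of \<mu> u v "\<lambda>_. 0" 0 s t] sol_prim[of "complex_of_real \<mu>" u v] by simp
  qed
qed

end

section \<open>Positive energies: bounds for all solutions up to infinity\<close>

lemma window_integral:
  fixes f :: "real \<Rightarrow> complex"
  assumes h: "h > 0" and fi: "\<And>x. x \<ge> a \<Longrightarrow> set_integrable lborel {x..x+h} f" and lim: "(f \<longlongrightarrow> L) at_top"
  shows "((\<lambda>x. LINT t:{x..x+h}|lborel. f t) \<longlongrightarrow> of_real h * L) at_top"
proof (rule tendstoI)
  fix e :: real assume e: "e > 0"
  have "\<forall>\<^sub>F x in at_top. dist (f x) L < e / (2 * h)" using lim e h by (intro tendstoD) auto
  then obtain X where X: "\<And>x. x \<ge> X \<Longrightarrow> dist (f x) L < e / (2 * h)" by (auto simp: eventually_at_top_linorder)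
  show "\<forall>\<^sub>F x in at_top. dist (LINT t:{x..x+h}|lborel. f t) (of_real h * L) < e"
    using eventually_ge_at_top[of "max a X"]
  proof eventually_elim
    case (elim x)
    have c: "(LINT t:{x..x+h}|lborel. (c::'b::euclidean_space)) = h *\<^sub>R c" for c
      using h by (simp add: set_integral_const)
    have i: "set_integrable lborel {x..x+h} f" using fi elim by simp
    have "(LINT t:{x..x+h}|lborel. f t) - of_real h * L = (LINT t:{x..x+h}|lborel. f t - L)"
      using set_integral_diff(2)[OF i set_integrable_const, of L] c[of L] by (simp add: scaleR_conv_of_real)
    also have "cmod \<dots> \<le> (LINT t:{x..x+h}|lborel. e / (2 * h))"
    proof (rule norm_set_integral_le)
      show "set_integrable lborel {x..x+h} (\<lambda>t. f t - L)" by (intro set_integral_diff(1) i set_integrable_const)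
      show "cmod (f t - L) \<le> e / (2 * h)" if "x \<le> t" for t
        using X[of t] that elim by (simp add: dist_norm)
    qed simp
    also have "\<dots> = e / 2" unfolding c using h by simp
    finally show ?case using e by (simp add: dist_norm)
  qed
qed

lemma prim_exp_linear: "prim 0 (\<lambda>x. exp (c * complex_of_real x)) (\<lambda>x. c * exp (c * complex_of_real x))"
proof (rule prim_C1)
  show "continuous_on {0..} (\<lambda>x. c * exp (c * complex_of_real x))" by (intro continuous_intros)
  fix x :: real
  have "((\<lambda>z. exp (c * z)) has_field_derivative c * exp (c * complex_of_real x)) (at (complex_of_real x))"
    by (auto intro!: derivative_eq_intros)
  then show "((\<lambda>x. exp (c * complex_of_real x)) has_vector_derivative c * exp (c * complex_of_real x)) (at x within {0..})"
    by (rule has_vector_derivative_real_field)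
qed

context coefficients
begin

abbreviation sol where "sol \<mu> u v \<equiv> sol_with p q (complex_of_real \<mu>) u v"

lemma prim_at_top_diff:
  assumes F: "prim 0 F f" and f: "(f \<longlongrightarrow> 0) at_top" and h: "h > 0"
  shows "((\<lambda>x. F (x + h) - F x) \<longlongrightarrow> 0) at_top"
proof (rule Lim_transform_eventually)
  show "((\<lambda>x. LINT t:{x..x+h}|lborel. f t) \<longlongrightarrow> 0) at_top"
    using window_integral[OF h _ f, of 0] prim_integrable[OF F] by simp
  show "\<forall>\<^sub>F x in at_top. (LINT t:{x..x+h}|lborel. f t) = F (x + h) - F x"
    using eventually_ge_at_top[of 0] by eventually_elim (use prim_diff[OF F] h in auto)
qed

lemma Wronskian_const:
  assumes 1: "sol_with p q z u1 v1" and 2: "sol_with p q z u2 v2" and x: "x \<ge> 0"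
  shows "v1 x * u2 x - u1 x * v2 x = v1 0 * u2 0 - u1 0 * v2 0"
proof -
  note p1 = sol_prim[OF 1] and p2 = sol_prim[OF 2]
  have "prim 0 (\<lambda>x. v1 x * u2 x + (-1) * (u1 x * v2 x)) (\<lambda>x. ((cq x - z) * u1 x * u2 x + v1 x * (v2 x / cp x))
     + (-1) * (v1 x / cp x * v2 x + u1 x * ((cq x - z) * u2 x)))"
    by (intro prim_lin prim_mult p1 p2)
  from prim_diff[OF this order_refl x] show ?thesis by (simp add: algebra_simps)
qed

lemma sol_cnj: "sol \<mu> u v \<Longrightarrow> sol \<mu> (\<lambda>x. cnj (u x)) (\<lambda>x. cnj (v x))"
proof (rule prim_sol)
  assume s: "sol \<mu> u v"
  show "prim 0 (\<lambda>x. cnj (u x)) (\<lambda>x. cnj (v x) / cp x)" using prim_cnj[OF sol_prim(1)[OF s]] by simp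
  show "prim 0 (\<lambda>x. cnj (v x)) (\<lambda>x. (cq x - complex_of_real \<mu>) * cnj (u x))"
    using prim_cnj[OF sol_prim(2)[OF s]] by simp
qed

lemma sol_lin: "sol_with p q z u v \<Longrightarrow> sol_with p q z u' v' \<Longrightarrow> sol_with p q z (\<lambda>x. u x + c * u' x) (\<lambda>x. v x + c * v' x)"
proof (rule prim_sol)
  assume s: "sol_with p q z u v" "sol_with p q z u' v'"
  show "prim 0 (\<lambda>x. u x + c * u' x) (\<lambda>x. (v x + c * v' x) / cp x)"
    using prim_lin[OF sol_prim(1)[OF s(1)] sol_prim(1)[OF s(2)], of c] by (simp add: add_divide_distrib)
  show "prim 0 (\<lambda>x. v x + c * v' x) (\<lambda>x. (cq x - z) * (u x + c * u' x))"
    using prim_lin[OF sol_prim(2)[OF s(1)] sol_prim(2)[OF s(2)], of c] by (simp add: algebra_simps)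
qed

lemma sol_zero: "sol_with p q z (\<lambda>x. 0) (\<lambda>x. 0)"
  by (rule prim_sol) (use prim_const[of 0 0] in simp_all)

lemma sol_scale: "sol_with p q z u v \<Longrightarrow> sol_with p q z (\<lambda>x. c * u x) (\<lambda>x. c * v x)"
  using sol_lin[OF sol_zero, of z u v c] by simp

text \<open>The weight on |u|^2 is chosen so that the terms mixing u and v cancel in the derivative.
  What is left is |u|^2 times a combination of p' and q' (\<open>prim_en\<close>), which is
  integrable up to infinity.\<close>

definition en :: "real \<Rightarrow> (real \<Rightarrow> complex) \<Rightarrow> (real \<Rightarrow> complex) \<Rightarrow> real \<Rightarrow> real" where
  "en \<mu> u v x = (\<mu> - q x) * p x * (cmod (u x))^2 + (cmod (v x))^2"

definition var :: "real \<Rightarrow> real" where "var t = \<bar>p' t\<bar> + \<bar>q' t\<bar>"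

lemma var_nonneg: "0 \<le> var t" by (simp add: var_def)

lemma var_int: "set_integrable lborel {x0..} var"
  unfolding var_def
proof (intro set_integral_add(1) set_integrable_abs q'_int)
  show "set_integrable lborel {x0..} p'" by (rule set_integrable_subset[OF p'_int]) (use x0_pos in auto)
qed

lemma var_int_Icc: "x0 \<le> s \<Longrightarrow> set_integrable lborel {s..t} var"
  by (rule set_integrable_subset[OF var_int]) auto

lemma prim_en:
  assumes "sol \<mu> u v"
  shows "prim x0 (\<lambda>x. complex_of_real (en \<mu> u v x))
    (\<lambda>x. complex_of_real ((\<mu> - q x) * p' x - q' x * p x) * (u x * cnj (u x)))"
proof -
  note s = prim_shift[OF sol_prim(1)[OF assms]] prim_shift[OF sol_prim(2)[OF assms]]
  have x0: "0 \<le> x0" using x0_pos by simp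
  note u = s(1)[OF x0] and v = s(2)[OF x0] and pp = prim_shift[OF prim_p x0]
  have qq: "prim x0 (\<lambda>x. complex_of_real \<mu> + (-1) * cq x) (\<lambda>x. 0 + (-1) * complex_of_real (q' x))"
    by (intro prim_lin prim_const prim_q)
  show ?thesis
  proof (rule prim_cong[OF prim_lin[OF prim_mult[OF prim_mult[OF qq pp] prim_mult[OF u prim_cnj[OF u]]] prim_mult[OF v prim_cnj[OF v]], of 1]])
    fix x assume "x0 \<le> x"
    then have px: "cp x \<noteq> 0" using p_pos[of x] x0 by simp
    show "(complex_of_real \<mu> + - 1 * cq x) * cp x * (u x * cnj (u x)) + 1 * (v x * cnj (v x)) = complex_of_real (en \<mu> u v x)"
      by (simp add: en_def complex_norm_square[symmetric])
    show "((0 + - 1 * complex_of_real (q' x)) * cp x + (complex_of_real \<mu> + - 1 * cq x) * complex_of_real (p' x)) * (u x * cnj (u x)) +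
         (complex_of_real \<mu> + - 1 * cq x) * cp x * (v x / cp x * cnj (u x) + u x * cnj (v x / cp x)) +
         1 * ((cq x - complex_of_real \<mu>) * u x * cnj (v x) + v x * cnj ((cq x - complex_of_real \<mu>) * u x)) =
         complex_of_real ((\<mu> - q x) * p' x - q' x * p x) * (u x * cnj (u x))"
      using px by (simp add: field_simps)
  qed
qed

lemma en_cont: "sol \<mu> u v \<Longrightarrow> continuous_on {x0..} (en \<mu> u v)"
  using continuous_on_Re[OF prim_cont[OF prim_en]] by simp

lemma q_bound: "\<exists>B. \<forall>x\<ge>x0. \<bar>q x\<bar> \<le> B"
  by (rule continuous_bounded_at_top[OF q_cont q_lim])

text \<open>Beyond \<open>X\<close> the potential is below half the smallest energy, so
  \<open>en\<close> is comparable to the square of \<open>nsol\<close>, and its derivative is at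
  most \<open>C * var\<close> times \<open>en\<close> itself. Moving \<open>X\<close> out makes the
  integral of \<open>C * var\<close> at most 1/2, the threshold of
  \<open>Gronwall_short\<close>.\<close>

lemma energy_constants:
  assumes ab: "0 < \<alpha>" "\<alpha> \<le> \<beta>"
  obtains X m M C where "X \<ge> x0" "m > 0" "M > 0" "C > 0"
    and "\<And>\<mu> u v x. \<mu> \<in> {\<alpha>..\<beta>} \<Longrightarrow> x \<ge> X \<Longrightarrow> m * (nsol u v x)^2 \<le> en \<mu> u v x"
    and "\<And>\<mu> u v x. \<mu> \<in> {\<alpha>..\<beta>} \<Longrightarrow> x \<ge> X \<Longrightarrow> en \<mu> u v x \<le> M * (nsol u v x)^2"
    and "\<And>\<mu> u v s t. \<mu> \<in> {\<alpha>..\<beta>} \<Longrightarrow> sol \<mu> u v \<Longrightarrow> X \<le> s \<Longrightarrow> s \<le> t \<Longrightarrow>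
       \<bar>en \<mu> u v t - en \<mu> u v s\<bar> \<le> (LINT x:{s..t}|lborel. C * var x * en \<mu> u v x)"
    and "(LINT x:{X..}|lborel. C * var x) \<le> 1/2"
proof -
  obtain qb where qb: "\<And>x. x \<ge> x0 \<Longrightarrow> \<bar>q x\<bar> \<le> qb" using q_bound by blast
  have qb0: "qb \<ge> 0" using qb[of x0] by simp
  \<comment> \<open>Lower bound for (\<mu> - q) p beyond \<open>X\<close>, from \<mu> - q \<ge>
    \<alpha>/2 and p \<ge> \<open>pl\<close>.\<close>
  define c1 where "c1 = \<alpha> / 2 * pl"
  have c1: "c1 > 0" using ab pl_pos by (simp add: c1_def)
  \<comment> \<open>The division by 2 absorbs (a + b)^2 \<le> 2 a^2 + 2 b^2.\<close>
  define m where "m = min c1 1 / 2"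
  define M where "M = (\<beta> + qb) * ph + 1"
  \<comment> \<open>The numerator bounds the coefficients of p' and q' in the derivative of
    \<open>en\<close>; dividing by \<open>c1\<close> turns |u|^2 into \<open>en\<close>.\<close>
  define C where "C = (\<beta> + qb + ph) / c1"
  have "\<forall>\<^sub>F x in at_top. dist (q x) 0 < \<alpha> / 2" by (rule tendstoD[OF q_lim]) (use ab in simp)
  moreover have "((\<lambda>x. LINT t:{x..}|lborel. C * var t) \<longlongrightarrow> 0) at_top"
    using tendsto_mult_right_zero[OF tail_tendsto_zero[OF var_int], of C] by simp
  then have "\<forall>\<^sub>F x in at_top. dist (LINT t:{x..}|lborel. C * var t) 0 < 1/2" by (rule tendstoD) simp
  ultimately have "\<forall>\<^sub>F x in at_top. dist (q x) 0 < \<alpha> / 2 \<and> dist (LINT t:{x..}|lborel. C * var t) 0 < 1/2"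
    by (rule eventually_conj)
  then obtain X0 where X0: "\<And>x. x \<ge> X0 \<Longrightarrow> \<bar>q x\<bar> < \<alpha> / 2 \<and> \<bar>LINT t:{x..}|lborel. C * var t\<bar> < 1/2"
    unfolding eventually_at_top_linorder dist_real_def by auto
  define X where "X = max X0 x0"
  have Xx: "X \<ge> x0" by (simp add: X_def)
  have low: "c1 \<le> (\<mu> - q x) * p x" and up: "(\<mu> - q x) * p x \<le> (\<beta> + qb) * ph"
    and muq: "\<bar>\<mu> - q x\<bar> \<le> \<beta> + qb" if "\<mu> \<in> {\<alpha>..\<beta>}" "x \<ge> X" for \<mu> x
  proof -
    have x: "x \<ge> 0" "x \<ge> x0" "x \<ge> X0" using that x0_pos by (auto simp: X_def)
    have 1: "\<alpha> / 2 \<le> \<mu> - q x" using X0[OF x(3)] that by auto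
    show 2: "\<bar>\<mu> - q x\<bar> \<le> \<beta> + qb" using qb[OF x(2)] that ab by auto
    show "c1 \<le> (\<mu> - q x) * p x" unfolding c1_def using 1 ab pl_pos pl_le[OF x(1)] by (intro mult_mono) auto
    show "(\<mu> - q x) * p x \<le> (\<beta> + qb) * ph"
      using 1 2 ab qb0 p_pos[OF x(1)] le_ph[OF x(1)] by (intro mult_mono) auto
  qed
  show ?thesis
  proof (rule that[of X m M C, OF Xx])
    show "m > 0" "C > 0" using c1 ab qb0 ph_pos by (simp_all add: m_def C_def)
    have Mb: "(\<beta> + qb) * ph > 0" using ab qb0 ph_pos by simp
    then show "M > 0" by (simp add: M_def)
    fix \<mu> u v x assume mu: "\<mu> \<in> {\<alpha>..\<beta>}" and x: "x \<ge> X"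
    have "(nsol u v x)^2 \<le> 2 * (cmod (u x))^2 + 2 * (cmod (v x))^2"
      using sum_squares_bound[of "cmod (u x)" "cmod (v x)"] by (simp add: nsol_def power2_sum)
    then have "m * (nsol u v x)^2 \<le> m * (2 * (cmod (u x))^2 + 2 * (cmod (v x))^2)"
      using \<open>m > 0\<close> by (intro mult_left_mono) auto
    also have "\<dots> = min c1 1 * (cmod (u x))^2 + min c1 1 * (cmod (v x))^2" by (simp add: m_def algebra_simps)
    also have "\<dots> \<le> (\<mu> - q x) * p x * (cmod (u x))^2 + 1 * (cmod (v x))^2"
      using low[OF mu x] by (intro add_mono mult_right_mono) auto
    finally show "m * (nsol u v x)^2 \<le> en \<mu> u v x" by (simp add: en_def)
    have "en \<mu> u v x \<le> M * (cmod (u x))^2 + M * (cmod (v x))^2"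
    proof -
      have "(\<mu> - q x) * p x * (cmod (u x))^2 \<le> M * (cmod (u x))^2"
        using up[OF mu x] by (intro mult_right_mono) (auto simp: M_def)
      moreover have "1 * (cmod (v x))^2 \<le> M * (cmod (v x))^2"
        using Mb by (intro mult_right_mono) (auto simp: M_def)
      ultimately show ?thesis by (simp add: en_def)
    qed
    also have "\<dots> \<le> M * (nsol u v x)^2"
    proof -
      have "(cmod (u x))^2 + (cmod (v x))^2 \<le> (nsol u v x)^2" by (simp add: nsol_def power2_sum)
      then show ?thesis using \<open>M > 0\<close> by (simp add: distrib_left[symmetric])
    qed
    finally show "en \<mu> u v x \<le> M * (nsol u v x)^2" .
  next
    have "\<bar>LINT x:{X..}|lborel. C * var x\<bar> < 1/2" using X0[of X] unfolding X_def by (meson max.cobounded1)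
    then show "(LINT x:{X..}|lborel. C * var x) \<le> 1/2" by linarith
  next
    fix \<mu> u v s t assume mu: "\<mu> \<in> {\<alpha>..\<beta>}" and sl: "sol \<mu> u v" and st: "X \<le> s" "s \<le> t"
    have "complex_of_real (en \<mu> u v t - en \<mu> u v s)
      = (LINT x:{s..t}|lborel. complex_of_real ((\<mu> - q x) * p' x - q' x * p x) * (u x * cnj (u x)))"
      using prim_diff[OF prim_en[OF sl], of s t] st Xx by simp
    then have "\<bar>en \<mu> u v t - en \<mu> u v s\<bar> = cmod (LINT x:{s..t}|lborel. complex_of_real ((\<mu> - q x) * p' x - q' x * p x) * (u x * cnj (u x)))"
      by (metis norm_of_real)
    also have "\<dots> \<le> (LINT x:{s..t}|lborel. C * var x * en \<mu> u v x)"
    proof (rule norm_set_integral_le)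
      show "set_integrable lborel {s..t} (\<lambda>x. complex_of_real ((\<mu> - q x) * p' x - q' x * p x) * (u x * cnj (u x)))"
        by (rule prim_integrable[OF prim_en[OF sl]]) (use st Xx in simp)
      have "set_integrable lborel {s..t} (\<lambda>x. C * var x)"
        using var_int_Icc[of s t] st Xx by (intro set_integrable_mult_right) auto
      then show "set_integrable lborel {s..t} (\<lambda>x. C * var x * en \<mu> u v x)"
        by (rule set_integrable_mult_continuous_real) (rule continuous_on_subset[OF en_cont[OF sl]], use st Xx in auto)
      fix x assume x: "s \<le> x" "x \<le> t"
      then have xX: "x \<ge> X" and x00: "x \<ge> 0" using st Xx x0_pos by auto
      have "\<bar>(\<mu> - q x) * p' x - q' x * p x\<bar> \<le> \<bar>\<mu> - q x\<bar> * \<bar>p' x\<bar> + \<bar>q' x\<bar> * p x"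
        using abs_triangle_ineq4[of "(\<mu> - q x) * p' x" "q' x * p x"] p_pos[OF x00] by (simp add: abs_mult)
      also have "\<dots> \<le> (\<beta> + qb + ph) * \<bar>p' x\<bar> + (\<beta> + qb + ph) * \<bar>q' x\<bar>"
        using muq[OF mu xX] le_ph[OF x00] ab qb0 ph_pos
        by (simp only: mult.commute[of "\<bar>q' x\<bar>"]) (intro add_mono mult_right_mono; simp)
      also have "\<dots> = (\<beta> + qb + ph) * var x" by (simp add: var_def algebra_simps)
      finally have 1: "\<bar>(\<mu> - q x) * p' x - q' x * p x\<bar> \<le> (\<beta> + qb + ph) * var x" .
      have 2: "(cmod (u x))^2 \<le> en \<mu> u v x / c1"
      proof -
        have "c1 * (cmod (u x))^2 \<le> (\<mu> - q x) * p x * (cmod (u x))^2" by (rule mult_right_mono[OF low[OF mu xX]]) simp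
        also have "\<dots> \<le> en \<mu> u v x" by (simp add: en_def)
        finally show ?thesis using c1 by (simp add: pos_le_divide_eq mult.commute)
      qed
      have "cmod (complex_of_real ((\<mu> - q x) * p' x - q' x * p x) * (u x * cnj (u x)))
         = \<bar>(\<mu> - q x) * p' x - q' x * p x\<bar> * (cmod (u x))^2"
        unfolding norm_mult complex_mod_cnj norm_of_real by (simp add: power2_eq_square)
      also have "\<dots> \<le> ((\<beta> + qb + ph) * var x) * (en \<mu> u v x / c1)"
        using 1 2 var_nonneg[of x] ab qb0 ph_pos by (intro mult_mono) auto
      also have "\<dots> = C * var x * en \<mu> u v x" by (simp add: C_def)
      finally show "cmod (complex_of_real ((\<mu> - q x) * p' x - q' x * p x) * (u x * cnj (u x))) \<le> C * var x * en \<mu> u v x" .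
    qed
    finally show "\<bar>en \<mu> u v t - en \<mu> u v s\<bar> \<le> (LINT x:{s..t}|lborel. C * var x * en \<mu> u v x)" .
  qed
qed

text \<open>\<open>Gronwall_short\<close> yields the factor 2, in both directions. Inserted back, it
  bounds the oscillation of \<open>en\<close> after \<open>s\<close> by a tail of
  \<open>var\<close>, uniformly in the energy; this rate is what later makes the limit of
  \<open>en\<close> continuous in \<mu>.\<close>

lemma energy_estimates:
  assumes ab: "0 < \<alpha>" "\<alpha> \<le> \<beta>"
  obtains X m M C where "X \<ge> x0" "m > 0" "M > 0" "C > 0"
    and "\<And>\<mu> u v x. \<mu> \<in> {\<alpha>..\<beta>} \<Longrightarrow> x \<ge> X \<Longrightarrow> m * (nsol u v x)^2 \<le> en \<mu> u v x"
    and "\<And>\<mu> u v x. \<mu> \<in> {\<alpha>..\<beta>} \<Longrightarrow> x \<ge> X \<Longrightarrow> en \<mu> u v x \<le> M * (nsol u v x)^2"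
    and "\<And>\<mu> u v s t. \<mu> \<in> {\<alpha>..\<beta>} \<Longrightarrow> sol \<mu> u v \<Longrightarrow> X \<le> s \<Longrightarrow> X \<le> t \<Longrightarrow> en \<mu> u v t \<le> 2 * en \<mu> u v s"
    and "\<And>\<mu> u v s t. \<mu> \<in> {\<alpha>..\<beta>} \<Longrightarrow> sol \<mu> u v \<Longrightarrow> X \<le> s \<Longrightarrow> s \<le> t \<Longrightarrow>
       \<bar>en \<mu> u v t - en \<mu> u v s\<bar> \<le> C * en \<mu> u v X * (LINT x:{s..}|lborel. var x)"
proof -
  obtain X m M C where E: "X \<ge> x0" "m > 0" "M > 0" "C > 0"
    "\<And>\<mu> u v x. \<mu> \<in> {\<alpha>..\<beta>} \<Longrightarrow> x \<ge> X \<Longrightarrow> m * (nsol u v x)^2 \<le> en \<mu> u v x"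
    "\<And>\<mu> u v x. \<mu> \<in> {\<alpha>..\<beta>} \<Longrightarrow> x \<ge> X \<Longrightarrow> en \<mu> u v x \<le> M * (nsol u v x)^2"
    "\<And>\<mu> u v s t. \<mu> \<in> {\<alpha>..\<beta>} \<Longrightarrow> sol \<mu> u v \<Longrightarrow> X \<le> s \<Longrightarrow> s \<le> t \<Longrightarrow>
       \<bar>en \<mu> u v t - en \<mu> u v s\<bar> \<le> (LINT x:{s..t}|lborel. C * var x * en \<mu> u v x)"
    "(LINT x:{X..}|lborel. C * var x) \<le> 1/2"
    by (rule energy_constants[OF ab]) (assumption | rule that)+
  have Ci: "set_integrable lborel {s..} (\<lambda>x. C * var x)" if "X \<le> s" for s
    by (intro set_integrable_mult_right set_integrable_subset[OF var_int]) (use E(1) that in auto)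
  have sub: "(LINT x:{s..t}|lborel. C * var x) \<le> (LINT x:{s..}|lborel. C * var x)" if "X \<le> s" for s t
  proof -
    have "set_integrable lborel {s..t} (\<lambda>x. C * var x)" by (rule set_integrable_subset[OF Ci[OF that]]) auto
    then show ?thesis
      unfolding set_lebesgue_integral_def using Ci[OF that] var_nonneg E(4)
      by (intro integral_mono) (auto simp: set_integrable_def indicator_def)
  qed
  have en0: "0 \<le> en \<mu> u v x" if "\<mu> \<in> {\<alpha>..\<beta>}" "x \<ge> X" for \<mu> u v x
    by (rule order_trans[OF _ E(5)[OF that]]) (use E(2) in simp)
  have double: "en \<mu> u v t \<le> 2 * en \<mu> u v s" if mu: "\<mu> \<in> {\<alpha>..\<beta>}" and sl: "sol \<mu> u v" and st: "X \<le> s" "X \<le> t" for \<mu> u v s t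
  proof -
    define e where "e = max s t"
    have "en \<mu> u v t \<le> 2 * (en \<mu> u v s + 0)"
    proof (rule Gronwall_short[where c=X and e=e and h="\<lambda>x. C * var x" and N="en \<mu> u v" and B=0])
      show "set_integrable lborel {X..e} (\<lambda>x. C * var x)"
        by (rule set_integrable_subset[OF Ci[OF order_refl]]) auto
      show "(LINT x:{X..e}|lborel. C * var x) \<le> 1/2" using sub[OF order_refl, of e] E(8) by simp
      show "continuous_on {X..e} (en \<mu> u v)" by (rule continuous_on_subset[OF en_cont[OF sl]]) (use E(1) in auto)
      show "\<bar>en \<mu> u v t - en \<mu> u v s\<bar> \<le> 0 + (LINT x:{s..t}|lborel. C * var x * en \<mu> u v x)" if "X \<le> s" "s \<le> t" for s t
        using E(7)[OF mu sl that] by simp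
    qed (use en0[OF mu] E(4) var_nonneg st in \<open>auto simp: e_def\<close>)
    then show ?thesis by simp
  qed
  show ?thesis
  proof (rule that[OF E(1-3) _ E(5,6) double])
    \<comment> \<open>Doubled because under the integral the energy is replaced by twice its value
      at \<open>X\<close>.\<close>
    show "2 * C > 0" using E(4) by simp
    fix \<mu> u v s t assume mu: "\<mu> \<in> {\<alpha>..\<beta>}" and sl: "sol \<mu> u v" and st: "X \<le> s" "s \<le> t"
    have i: "set_integrable lborel {s..t} (\<lambda>x. C * var x)"
      by (rule set_integrable_subset[OF Ci[OF st(1)]]) auto
    have "\<bar>en \<mu> u v t - en \<mu> u v s\<bar> \<le> (LINT x:{s..t}|lborel. C * var x * en \<mu> u v x)" by (rule E(7)[OF mu sl st])
    also have "\<dots> \<le> (LINT x:{s..t}|lborel. 2 * en \<mu> u v X * (C * var x))"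
    proof (rule set_integral_mono)
      show "set_integrable lborel {s..t} (\<lambda>x. C * var x * en \<mu> u v x)"
        by (rule set_integrable_mult_continuous_real[OF i], rule continuous_on_subset[OF en_cont[OF sl]]) (use st E(1) in auto)
      show "set_integrable lborel {s..t} (\<lambda>x. 2 * en \<mu> u v X * (C * var x))"
        by (rule set_integrable_mult_right) (rule i)
      fix x assume "x \<in> {s..t}"
      then have "en \<mu> u v x \<le> 2 * en \<mu> u v X" using double[OF mu sl order_refl, of x] st by simp
      then have "C * var x * en \<mu> u v x \<le> C * var x * (2 * en \<mu> u v X)"
        using E(4) var_nonneg[of x] by (intro mult_left_mono) auto
      then show "C * var x * en \<mu> u v x \<le> 2 * en \<mu> u v X * (C * var x)" by (simp add: mult_ac)
    qed
    also have "\<dots> = 2 * en \<mu> u v X * (LINT x:{s..t}|lborel. C * var x)" by simp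
    also have "\<dots> \<le> 2 * en \<mu> u v X * (LINT x:{s..}|lborel. C * var x)"
      using en0[OF mu order_refl] by (intro mult_left_mono sub st) auto
    finally show "\<bar>en \<mu> u v t - en \<mu> u v s\<bar> \<le> 2 * C * en \<mu> u v X * (LINT x:{s..}|lborel. var x)"
      by (simp add: mult_ac)
  qed
qed

lemma nsol_nonneg: "0 \<le> nsol u v x" by (simp add: nsol_def)

text \<open>Gronwall handles [0, X] and the energy handles the rest. Since both work in both
  directions, data near infinity control the solution at 0 as well, which \<open>psi_bounded\<close>
  exploits.\<close>

lemma nsol_global:
  assumes ab: "0 < \<alpha>" "\<alpha> \<le> \<beta>"
  obtains C where "C > 0"
    and "\<And>\<mu> u v s t. \<mu> \<in> {\<alpha>..\<beta>} \<Longrightarrow> sol \<mu> u v \<Longrightarrow> 0 \<le> s \<Longrightarrow> 0 \<le> t \<Longrightarrow> nsol u v t \<le> C * nsol u v s"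
proof -
  obtain X m M C where E: "X \<ge> x0" "m > 0" "M > 0" "C > 0"
    "\<And>\<mu> u v x. \<mu> \<in> {\<alpha>..\<beta>} \<Longrightarrow> x \<ge> X \<Longrightarrow> m * (nsol u v x)^2 \<le> en \<mu> u v x"
    "\<And>\<mu> u v x. \<mu> \<in> {\<alpha>..\<beta>} \<Longrightarrow> x \<ge> X \<Longrightarrow> en \<mu> u v x \<le> M * (nsol u v x)^2"
    "\<And>\<mu> u v s t. \<mu> \<in> {\<alpha>..\<beta>} \<Longrightarrow> sol \<mu> u v \<Longrightarrow> X \<le> s \<Longrightarrow> X \<le> t \<Longrightarrow> en \<mu> u v t \<le> 2 * en \<mu> u v s"
    "\<And>\<mu> u v s t. \<mu> \<in> {\<alpha>..\<beta>} \<Longrightarrow> sol \<mu> u v \<Longrightarrow> X \<le> s \<Longrightarrow> s \<le> t \<Longrightarrow>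
       \<bar>en \<mu> u v t - en \<mu> u v s\<bar> \<le> C * en \<mu> u v X * (LINT x:{s..}|lborel. var x)"
    by (rule energy_estimates[OF ab]) (assumption | rule that)+
  have X: "X \<ge> 0" using E(1) x0_pos by simp
  obtain D where D: "D \<ge> 0" "\<And>\<mu> u v s t. \<lbrakk>\<bar>\<mu>\<bar> \<le> \<beta>; sol \<mu> u v; s \<in> {0..X}; t \<in> {0..X}\<rbrakk> \<Longrightarrow> nsol u v t \<le> D * nsol u v s"
    by (rule nsol_Gronwall_hom[OF X, of \<beta>]) (use ab in simp, (assumption | rule that)+)
  define F where "F = sqrt (2 * M / m)"
  have F0: "F \<ge> 0" using E by (simp add: F_def)
  have far: "nsol u v t \<le> F * nsol u v s" if "\<mu> \<in> {\<alpha>..\<beta>}" "sol \<mu> u v" "X \<le> s" "X \<le> t" for \<mu> u v s t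
  proof -
    have "m * (nsol u v t)^2 \<le> 2 * (M * (nsol u v s)^2)"
      using E(5)[OF that(1,4), of u v] E(7)[OF that] E(6)[OF that(1,3), of u v] by linarith
    then have "(nsol u v t)^2 \<le> 2 * M / m * (nsol u v s)^2" using E(2) by (simp add: field_simps)
    then have "sqrt ((nsol u v t)^2) \<le> sqrt (2 * M / m * (nsol u v s)^2)" by (rule real_sqrt_le_mono)
    then show ?thesis unfolding real_sqrt_mult[of "2 * M / m"] F_def[symmetric] by (simp add: nsol_nonneg)
  qed
  show ?thesis
  \<comment> \<open>The four positions of \<open>s\<close> and \<open>t\<close> relative to
    \<open>X\<close> require \<open>D\<close>, \<open>F\<close> and \<open>D * F\<close>; the 1
    makes the constant positive.\<close>
  proof (rule that[of "D + F + D * F + 1"])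
    show "D + F + D * F + 1 > 0" using D(1) F0 by (simp add: add_nonneg_pos)
    fix \<mu> u v and s t :: real assume a: "\<mu> \<in> {\<alpha>..\<beta>}" "sol \<mu> u v" "0 \<le> s" "0 \<le> t"
    have mu: "\<bar>\<mu>\<bar> \<le> \<beta>" using a ab by auto
    have DF: "D * F \<ge> 0" using D(1) F0 by simp
    have big: "c * nsol u v s \<le> (D + F + D * F + 1) * nsol u v s" if "c \<le> D + F + D * F" for c
      using that by (intro mult_right_mono nsol_nonneg) auto
    consider "s \<le> X" "t \<le> X" | "s \<le> X" "X \<le> t" | "X \<le> s" "t \<le> X" | "X \<le> s" "X \<le> t" by linarith
    then show "nsol u v t \<le> (D + F + D * F + 1) * nsol u v s"
    proof cases
      case 1
      then show ?thesis using D(2)[OF mu a(2), of s t] a(3,4) big[of D] F0 DF by auto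
    next
      case 2
      have "nsol u v t \<le> F * nsol u v X" by (rule far[OF a(1,2) order_refl 2(2)])
      also have "\<dots> \<le> F * (D * nsol u v s)" using D(2)[OF mu a(2), of s X] a(3) 2 X F0 by (intro mult_left_mono) auto
      finally show ?thesis using big[of "D * F"] D(1) F0 by (simp add: mult_ac)
    next
      case 3
      have "nsol u v t \<le> D * nsol u v X" using D(2)[OF mu a(2), of X t] a(4) 3 X by auto
      also have "\<dots> \<le> D * (F * nsol u v s)" using far[OF a(1,2) 3(1) order_refl] D(1) by (intro mult_left_mono) auto
      finally show ?thesis using big[of "D * F"] D(1) F0 by (simp add: mult_ac)
    next
      case 4
      then show ?thesis using far[OF a(1,2), of s t] big[of F] D(1) DF by auto
    qed
  qed
qed

lemma sol_bounded:
  assumes "\<mu> > 0" "sol \<mu> u v"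
  obtains B where "\<And>x. x \<ge> 0 \<Longrightarrow> cmod (u x) \<le> B" "\<And>x. x \<ge> 0 \<Longrightarrow> cmod (v x) \<le> B"
proof -
  obtain C where C: "C > 0"
    "\<And>\<mu>' u v s t. \<mu>' \<in> {\<mu>..\<mu>} \<Longrightarrow> sol \<mu>' u v \<Longrightarrow> 0 \<le> s \<Longrightarrow> 0 \<le> t \<Longrightarrow> nsol u v t \<le> C * nsol u v s"
    by (rule nsol_global[OF assms(1) order_refl]) (assumption | rule that)+
  have *: "cmod (u x) + cmod (v x) \<le> C * nsol u v 0" if "x \<ge> 0" for x
    using C(2)[of \<mu> u v 0 x] assms that by (simp add: nsol_def)
  show ?thesis
  proof (rule that[of "C * nsol u v 0"])
    show "cmod (u x) \<le> C * nsol u v 0" if "x \<ge> 0" for x using *[OF that] norm_ge_zero[of "v x"] by linarith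
    show "cmod (v x) \<le> C * nsol u v 0" if "x \<ge> 0" for x using *[OF that] norm_ge_zero[of "u x"] by linarith
  qed
qed

lemma sol_unique:
  assumes "sol \<mu> u v" "u 0 = 0" "v 0 = 0" "x \<ge> 0"
  shows "u x = 0" "v x = 0"
proof -
  obtain D where D: "D \<ge> 0" "\<And>\<mu>' u v s t. \<lbrakk>\<bar>\<mu>'\<bar> \<le> \<bar>\<mu>\<bar>; sol \<mu>' u v; s \<in> {0..x}; t \<in> {0..x}\<rbrakk> \<Longrightarrow> nsol u v t \<le> D * nsol u v s"
    by (rule nsol_Gronwall_hom[OF assms(4), of "\<bar>\<mu>\<bar>"]) (simp, (assumption | rule that)+)
  have "nsol u v x \<le> D * nsol u v 0" by (rule D(2)[OF order_refl assms(1)]) (use assms(4) in auto)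
  then have "cmod (u x) + cmod (v x) \<le> 0" using assms(2,3) by (simp add: nsol_def)
  then have "cmod (u x) \<le> 0" "cmod (v x) \<le> 0"
    using norm_ge_zero[of "u x"] norm_ge_zero[of "v x"] by linarith+
  then show "u x = 0" "v x = 0" by simp_all
qed

end

section \<open>Jost asymptotics, conserved flux and the Weyl solution\<close>

context coefficients
begin

text \<open>The limit of the local momentum sqrt (p (\<mu> - q)) at infinity: a solution is outgoing
  when v is asymptotic to i times \<open>mom \<mu>\<close> times u. The wave number is
  \<open>mom \<mu> / p0\<close>.\<close>

definition mom :: "real \<Rightarrow> real" where "mom \<mu> = sqrt (p0 * \<mu>)"

lemma mom_pos: "\<mu> > 0 \<Longrightarrow> mom \<mu> > 0" using p0_pos by (simp add: mom_def)

lemma mom_sq: "\<mu> > 0 \<Longrightarrow> mom \<mu> * mom \<mu> = p0 * \<mu>" using p0_pos by (simp add: mom_def)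

lemma eventually_q_less: "\<mu> > 0 \<Longrightarrow> \<exists>X\<ge>0. \<forall>x\<ge>X. q x < \<mu>"
proof -
  assume "\<mu> > 0"
  then have "\<forall>\<^sub>F x in at_top. q x < \<mu>" using order_tendstoD(2)[OF q_lim] by blast
  then obtain X where "\<forall>x\<ge>X. q x < \<mu>" by (auto simp: eventually_at_top_linorder)
  then show ?thesis by (intro exI[of _ "max X 0"]) auto
qed

lemma sqrt_bv_int: "set_integrable lborel {0..x} (sqrt_bv p q \<mu>)"
proof -
  have [measurable]: "(\<lambda>y. indicator {0..x} y *\<^sub>R q y) \<in> borel_measurable borel"
    using borel_measurable_integrable[OF q_int[of x, unfolded set_integrable_def]] by simp
  have [measurable]: "(\<lambda>y. indicator {0..x} y *\<^sub>R p y) \<in> borel_measurable borel"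
    by (rule borel_measurable_continuous_on_indicator) (auto intro: continuous_on_subset[OF p_cont])
  \<comment> \<open>The boundary value of the root as one Borel function of two numbers, fed with
    \<open>q\<close> and \<open>p\<close> cut off to [0, x], where their measurability is
    known.\<close>
  define F where "F a b = (if a \<ge> \<mu> then complex_of_real (sqrt ((a - \<mu>) / b)) else - \<i> * complex_of_real (sqrt ((\<mu> - a) / b)))" for a b :: real
  have m: "(\<lambda>y. indicator {0..x} y *\<^sub>R sqrt_bv p q \<mu> y) \<in> borel_measurable borel"
  proof -
    have "(\<lambda>y. indicator {0..x} y *\<^sub>R sqrt_bv p q \<mu> y)
       = (\<lambda>y. indicator {0..x} y *\<^sub>R F (indicator {0..x} y *\<^sub>R q y) (indicator {0..x} y *\<^sub>R p y))"
      by (auto simp: fun_eq_iff indicator_def F_def sqrt_bv_def)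
    also have "\<dots> \<in> borel_measurable borel" unfolding F_def by measurable
    finally show ?thesis .
  qed
  have i: "set_integrable lborel {0..x} (\<lambda>y. 1 + (\<bar>q y\<bar> + \<bar>\<mu>\<bar>) * (1 / pl))"
    by (intro set_integral_add(1) set_integrable_mult_left set_integrable_const set_integrable_abs q_int)
  show ?thesis
    unfolding set_integrable_def
  proof (rule Bochner_Integration.integrable_bound[OF i[unfolded set_integrable_def]])
    show "(\<lambda>y. indicator {0..x} y *\<^sub>R sqrt_bv p q \<mu> y) \<in> borel_measurable lborel" using m by simp
    show "AE y in lborel. norm (indicator {0..x} y *\<^sub>R sqrt_bv p q \<mu> y)
        \<le> norm (indicator {0..x} y *\<^sub>R (1 + (\<bar>q y\<bar> + \<bar>\<mu>\<bar>) * (1 / pl)))"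
    proof (rule AE_I2)
      fix y
      have le: "cmod (sqrt_bv p q \<mu> y) \<le> 1 + (\<bar>q y\<bar> + \<bar>\<mu>\<bar>) * (1 / pl)" if y: "y \<ge> 0"
      proof -
        \<comment> \<open>\<open>q\<close> is only known to be integrable; the estimate trades the
          root for an integrable function on a bounded interval.\<close>
        have s: "sqrt a \<le> 1 + a" if "a \<ge> 0" for a :: real
          using that by (intro real_le_lsqrt) (auto simp: power2_eq_square algebra_simps)
        have "cmod (sqrt_bv p q \<mu> y) = sqrt (\<bar>q y - \<mu>\<bar> / p y)"
          using p_pos[OF y] by (auto simp: sqrt_bv_def norm_mult)
        also have "\<dots> \<le> 1 + \<bar>q y - \<mu>\<bar> / p y" using p_pos[OF y] by (intro s) simp
        also have "\<bar>q y - \<mu>\<bar> / p y \<le> (\<bar>q y\<bar> + \<bar>\<mu>\<bar>) / pl"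
          using pl_pos pl_le[OF y] by (intro frac_le) auto
        finally show ?thesis by simp
      qed
      have nn: "0 \<le> 1 + (\<bar>q y\<bar> + \<bar>\<mu>\<bar>) * (1 / pl)" using pl_pos by simp
      show "norm (indicator {0..x} y *\<^sub>R sqrt_bv p q \<mu> y) \<le> norm (indicator {0..x} y *\<^sub>R (1 + (\<bar>q y\<bar> + \<bar>\<mu>\<bar>) * (1 / pl)))"
        using le nn by (auto simp: indicator_def simp del: abs_of_nonneg) 
    qed
  qed
qed

lemma Re_sqrt_bv: "y \<ge> 0 \<Longrightarrow> Re (sqrt_bv p q \<mu> y) = sqrt (max 0 ((q y - \<mu>) / p y))"
  using p_pos[of y] by (auto simp: sqrt_bv_def max_def divide_le_0_iff zero_le_divide_iff)

text \<open>Past \<open>X\<close>, where q < \<mu>, the exponent of \<open>jost_a\<close> changes by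
  imaginary amounts only; and the real part of \<open>sqrt_bv\<close> is the integrand of
  \<open>Kfun\<close>.\<close>

lemma norm_jost_a:
  assumes "X \<ge> 0" "\<And>y. y \<ge> X \<Longrightarrow> q y < \<mu>" "x \<ge> X"
  shows "cmod (jost_a p q \<mu> x) = Kfun p q \<mu>"
proof -
  have "Re (LINT y:{0..x}|lborel. sqrt_bv p q \<mu> y) = (LINT y|lborel. Re (indicator {0..x} y *\<^sub>R sqrt_bv p q \<mu> y))"
    unfolding set_lebesgue_integral_def using sqrt_bv_int[unfolded set_integrable_def]
    by (rule integral_Re[symmetric])
  also have "\<dots> = (LINT y:{0..}|lborel. sqrt (max 0 ((q y - \<mu>) / p y)))"
    unfolding set_lebesgue_integral_def
  proof (intro Bochner_Integration.integral_cong refl)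
    fix y
    show "Re (indicator {0..x} y *\<^sub>R sqrt_bv p q \<mu> y) = indicator {0..} y *\<^sub>R sqrt (max 0 ((q y - \<mu>) / p y))"
    proof (cases "0 \<le> y \<and> x < y")
      case True
      then have "(q y - \<mu>) / p y \<le> 0" using assms(2)[of y] assms(3) p_pos[of y] by (simp add: divide_le_0_iff)
      then show ?thesis using True by (simp add: max_absorb1)
    next
      case False
      then show ?thesis using Re_sqrt_bv[of y \<mu>] by (auto simp: indicator_def)
    qed
  qed
  finally show ?thesis by (simp add: jost_a_def Kfun_def)
qed

lemma sqrt_bv_lim: assumes "\<mu> > 0"
  shows "(sqrt_bv p q \<mu> \<longlongrightarrow> - \<i> * complex_of_real (mom \<mu> / p0)) at_top"
proof (rule Lim_transform_eventually)
  obtain X where X: "X \<ge> 0" "\<And>x. x \<ge> X \<Longrightarrow> q x < \<mu>" using eventually_q_less[OF assms] by blast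
  have "((\<lambda>y. sqrt ((\<mu> - q y) / p y)) \<longlongrightarrow> sqrt ((\<mu> - 0) / p0)) at_top"
    by (intro tendsto_intros q_lim p_lim) (use p0_pos in simp)
  moreover have "sqrt ((\<mu> - 0) / p0) = mom \<mu> / p0"
    using p0_pos assms by (simp add: mom_def real_sqrt_mult real_sqrt_divide real_div_sqrt field_simps)
  ultimately show "((\<lambda>y. - \<i> * complex_of_real (sqrt ((\<mu> - q y) / p y))) \<longlongrightarrow> - \<i> * complex_of_real (mom \<mu> / p0)) at_top"
    by (intro tendsto_intros) simp
  show "\<forall>\<^sub>F y in at_top. - \<i> * complex_of_real (sqrt ((\<mu> - q y) / p y)) = sqrt_bv p q \<mu> y"
    using eventually_ge_at_top[of X]
  proof eventually_elim
    case (elim y)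
    then show ?case using X(2)[OF elim] by (simp add: sqrt_bv_def)
  qed
qed

lemma at_top_shift: "filterlim f F at_top \<Longrightarrow> filterlim (\<lambda>x::real. f (x + h)) F at_top"
proof -
  assume f: "filterlim f F at_top"
  have "filterlim (\<lambda>x. x + h) at_top at_top"
    using filterlim_tendsto_add_at_top[OF tendsto_const[of h] filterlim_ident[of at_top]] by (simp add: add.commute)
  then show ?thesis by (rule filterlim_compose[OF f])
qed

text \<open>With \<open>y\<^sub>\<plusminus> = v \<plusminus> i k p\<^sub>0 u\<close> and \<open>k h = \<pi>/2\<close>, the equation gives \<open>y\<^sub>\<plusminus>(x + h) \<approx> \<plusminus> i y\<^sub>\<plusminus>(x)\<close> as
  \<open>x \<rightarrow> \<infinity>\<close>, while \<open>u(x + h) \<approx> i u(x)\<close> for the Jost solution. Hence \<open>y\<^sub>-\<close> tends to zero.\<close>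

lemma jost_asymptotics:
  assumes mu: "\<mu> > 0" and J: "jost_sol p p' q q' x0 \<mu> u"
  obtains v where "sol \<mu> u v"
    and "((\<lambda>x. v x - \<i> * complex_of_real (mom \<mu>) * u x) \<longlongrightarrow> 0) at_top"
    and "((\<lambda>x. cmod (u x)) \<longlongrightarrow> Kfun p q \<mu>) at_top"
proof -
  note J = J[unfolded jost_sol_def]
  obtain v where s: "sol \<mu> u v" using conjunct1[OF J] by (rule exE)
  obtain C where C: "\<exists>X\<ge>x0. \<forall>x\<ge>X. cmod (u x / jost_a p q \<mu> x - 1) \<le> C * eps p' q' x"
    using conjunct2[OF J] by (rule exE)
  obtain X1 where X: "X1 \<ge> x0 \<and> (\<forall>x\<ge>X1. cmod (u x / jost_a p q \<mu> x - 1) \<le> C * eps p' q' x)"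
    using C by (rule exE)
  have X1: "cmod (u x / jost_a p q \<mu> x - 1) \<le> C * eps p' q' x" if "x \<ge> X1" for x
    using X that by simp
  obtain X2 where X2: "X2 \<ge> 0" "\<And>x. x \<ge> X2 \<Longrightarrow> q x < \<mu>" using eventually_q_less[OF mu] by blast
  let ?a = "jost_a p q \<mu>" and ?K = "Kfun p q \<mu>"
  define P where "P = mom \<mu>"
  define k where "k = P / p0"
  have P: "P > 0" unfolding P_def by (rule mom_pos[OF mu])
  have k: "k > 0" using P p0_pos by (simp add: k_def)
  have na: "cmod (?a x) = ?K" if "x \<ge> X2" for x using norm_jost_a[OF X2 that] .
  have eps0: "(eps p' q' \<longlongrightarrow> 0) at_top"
    unfolding eps_def[abs_def] using tail_tendsto_zero[OF var_int] unfolding var_def .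
  have ua: "((\<lambda>x. u x - ?a x) \<longlongrightarrow> 0) at_top"
  proof (rule Lim_null_comparison)
    show "\<forall>\<^sub>F x in at_top. norm (u x - ?a x) \<le> ?K * (C * eps p' q' x)"
      using eventually_ge_at_top[of "max X1 X2"]
    proof eventually_elim
      case (elim x)
      have "u x - ?a x = ?a x * (u x / ?a x - 1)" by (simp add: jost_a_def right_diff_distrib)
      then have "norm (u x - ?a x) = ?K * cmod (u x / ?a x - 1)" using na[of x] elim by (simp add: norm_mult)
      also have "\<dots> \<le> ?K * (C * eps p' q' x)"
        using X1[of x] elim by (intro mult_left_mono) (auto simp: Kfun_def)
      finally show ?case .
    qed
    show "((\<lambda>x. ?K * (C * eps p' q' x)) \<longlongrightarrow> 0) at_top"
      by (intro tendsto_mult_right_zero eps0)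
  qed
  have uK: "((\<lambda>x. cmod (u x)) \<longlongrightarrow> ?K) at_top"
  proof -
    have "((\<lambda>x. cmod (u x) - cmod (?a x)) \<longlongrightarrow> 0) at_top"
      by (rule Lim_null_comparison[OF _ tendsto_norm_zero[OF ua]]) (auto intro!: always_eventually norm_triangle_ineq3)
    moreover have "\<forall>\<^sub>F x in at_top. cmod (u x) - cmod (?a x) = cmod (u x) - ?K"
      using eventually_ge_at_top[of X2] by eventually_elim (simp add: na)
    ultimately have "((\<lambda>x. cmod (u x) - ?K) \<longlongrightarrow> 0) at_top" by (simp add: tendsto_cong)
    then show ?thesis by (simp add: LIM_zero_iff)
  qed
  define h where "h = pi / (2 * k)"
  have h: "h > 0" using k by (simp add: h_def)
  have kh: "k * h = pi / 2" using k by (simp add: h_def)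
  \<comment> \<open>Over a window of length \<open>h\<close> the exponent changes by an amount
    tending to i k h = i \<pi>/2, so the amplitude is multiplied by i in the limit.\<close>
  have ash: "((\<lambda>x. ?a (x + h) - \<i> * ?a x) \<longlongrightarrow> 0) at_top"
  proof (rule Lim_null_comparison)
    let ?I = "\<lambda>x. LINT t:{x..x+h}|lborel. sqrt_bv p q \<mu> t"
    have "(?I \<longlongrightarrow> of_real h * (- \<i> * complex_of_real k)) at_top"
    proof (rule window_integral[OF h _ sqrt_bv_lim[OF mu, folded P_def k_def]])
      show "set_integrable lborel {x..x+h} (sqrt_bv p q \<mu>)" if "0 \<le> x" for x
        by (rule set_integrable_subset[OF sqrt_bv_int[of "x+h"]]) (use that in auto)
    qed
    then have "((\<lambda>x. exp (- ?I x) - \<i>) \<longlongrightarrow> exp (- (of_real h * (- \<i> * complex_of_real k))) - \<i>) at_top"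
      by (intro tendsto_intros)
    moreover have "exp (- (of_real h * (- \<i> * complex_of_real k))) = \<i>"
    proof -
      have "exp (- (of_real h * (- \<i> * complex_of_real k))) = exp (\<i> * complex_of_real (k * h))"
        by (simp add: mult_ac)
      also have "\<dots> = \<i>" unfolding kh by (simp add: complex_eq_iff Re_exp Im_exp)
      finally show ?thesis .
    qed
    ultimately have "((\<lambda>x. exp (- ?I x) - \<i>) \<longlongrightarrow> 0) at_top" by simp
    then show "((\<lambda>x. ?K * norm (exp (- ?I x) - \<i>)) \<longlongrightarrow> 0) at_top"
      by (intro tendsto_mult_right_zero tendsto_norm_zero)
    show "\<forall>\<^sub>F x in at_top. norm (?a (x + h) - \<i> * ?a x) \<le> ?K * norm (exp (- ?I x) - \<i>)"
      using eventually_ge_at_top[of X2]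
    proof eventually_elim
      case (elim x)
      have "?a (x + h) = ?a x * exp (- ?I x)"
        using LINT_Icc_combine[OF sqrt_bv_int[of "x + h" \<mu>], of x] elim X2(1) h
        by (simp add: jost_a_def flip: exp_add) (metis minus_add_distrib uminus_add_conv_diff add.commute)
      then have "?a (x + h) - \<i> * ?a x = ?a x * (exp (- ?I x) - \<i>)" by (simp add: algebra_simps)
      then show ?case using na[OF elim] by (simp add: norm_mult)
    qed
  qed
  have ush: "((\<lambda>x. u (x + h) - \<i> * u x) \<longlongrightarrow> 0) at_top"
  proof -
    have "((\<lambda>x. (u (x + h) - ?a (x + h)) - \<i> * (u x - ?a x) + (?a (x + h) - \<i> * ?a x)) \<longlongrightarrow> 0 - \<i> * 0 + 0) at_top"
      by (intro tendsto_intros ua at_top_shift[OF ua] ash)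
    then show ?thesis by (simp add: algebra_simps)
  qed
  obtain B where B: "\<And>x. x \<ge> 0 \<Longrightarrow> cmod (u x) \<le> B" "\<And>x. x \<ge> 0 \<Longrightarrow> cmod (v x) \<le> B"
    by (rule sol_bounded[OF mu s]) (assumption | rule that)+
  note pu = sol_prim(1)[OF s] and pv = sol_prim(2)[OF s]
  have ysh: "((\<lambda>x. (v (x + h) + c * of_real P * u (x + h)) - c * (v x + c * of_real P * u x)) \<longlongrightarrow> 0) at_top"
    if c: "c = \<i> \<or> c = - \<i>" for c
  proof -
    have cc: "c * c = - 1" "cmod c = 1" using c by auto
    \<comment> \<open>The factor exp (- c k x) removes the leading rotation. Since k P = \<mu> and P
      / p = k p0 / p, the derivative of \<open>Y\<close> contains only q u and a multiple of v (p0 /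
      p - 1), and both tend to 0.\<close>
    define e where "e x = exp ((- c * of_real k) * complex_of_real x)" for x
    have ne: "cmod (e x) = 1" for x using c by (auto simp: e_def)
    define Y where "Y x = e x * (v x + (c * of_real P) * u x)" for x
    define g where "g x = e x * (cq x * u x + c * of_real k * v x * complex_of_real (p0 / p x - 1))" for x
    have "prim 0 Y g"
    proof (rule prim_cong[OF prim_mult[OF prim_exp_linear[of "- c * of_real k"] prim_lin[OF pv pu, of "c * of_real P"]]])
      fix x :: real assume x: "0 \<le> x"
      show "exp ((- c * of_real k) * complex_of_real x) * (v x + c * of_real P * u x) = Y x" by (simp add: Y_def e_def)
      have kP: "of_real k * of_real P = complex_of_real \<mu>"
      proof -
        have "k * P = \<mu>" using mom_sq[OF mu] p0_pos by (simp add: k_def P_def)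
        then show ?thesis by (metis of_real_mult)
      qed
      have pk: "of_real P / cp x = of_real k * complex_of_real (p0 / p x)"
        using p0_pos p_pos[OF x] by (simp add: k_def)
      have "- c * of_real k * e x * (v x + c * of_real P * u x) + e x * ((cq x - complex_of_real \<mu>) * u x + c * of_real P * (v x / cp x))
         = e x * (- c * of_real k * v x - (c * c) * (of_real k * of_real P) * u x + (cq x - complex_of_real \<mu>) * u x + c * (of_real P / cp x) * v x)"
        by (simp add: algebra_simps)
      also have "\<dots> = g x" unfolding cc kP pk g_def by (simp add: algebra_simps)
      finally show "- c * of_real k * exp ((- c * of_real k) * complex_of_real x) * (v x + c * of_real P * u x) +
          exp ((- c * of_real k) * complex_of_real x) * ((cq x - complex_of_real \<mu>) * u x + c * of_real P * (v x / cp x)) = g x"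
        by (simp add: e_def)
    qed
    moreover have "(g \<longlongrightarrow> 0) at_top"
    proof (rule Lim_null_comparison)
      show "\<forall>\<^sub>F x in at_top. norm (g x) \<le> \<bar>q x\<bar> * B + k * B * \<bar>p0 / p x - 1\<bar>"
        using eventually_ge_at_top[of 0]
      proof eventually_elim
        case (elim x)
        have "norm (g x) \<le> \<bar>q x\<bar> * cmod (u x) + k * cmod (v x) * \<bar>p0 / p x - 1\<bar>"
          unfolding g_def norm_mult ne
          using norm_triangle_ineq[of "cq x * u x" "c * of_real k * v x * complex_of_real (p0 / p x - 1)"] k cc
          by (simp only: norm_mult norm_of_real mult_1 abs_of_pos)
        also have "\<dots> \<le> \<bar>q x\<bar> * B + k * B * \<bar>p0 / p x - 1\<bar>"
          using B[OF elim] k by (intro add_mono mult_mono mult_left_mono mult_right_mono) auto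
        finally show ?case .
      qed
      have "((\<lambda>x. \<bar>q x\<bar> * B + k * B * \<bar>p0 / p x - 1\<bar>) \<longlongrightarrow> \<bar>0\<bar> * B + k * B * \<bar>p0 / p0 - 1\<bar>) at_top"
        by (intro tendsto_intros q_lim p_lim) (use p0_pos in simp)
      then show "((\<lambda>x. \<bar>q x\<bar> * B + k * B * \<bar>p0 / p x - 1\<bar>) \<longlongrightarrow> 0) at_top" using p0_pos by simp
    qed
    ultimately have L: "((\<lambda>x. Y (x + h) - Y x) \<longlongrightarrow> 0) at_top" using h by (rule prim_at_top_diff)
    have eq: "norm ((v (x + h) + c * of_real P * u (x + h)) - c * (v x + c * of_real P * u x)) = norm (Y (x + h) - Y x)" for x
    proof -
      have eh: "e (x + h) = e x * (- c)"
      proof -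
        have "e (x + h) = exp ((- c * of_real k) * complex_of_real x + (- c) * complex_of_real (k * h))"
          unfolding e_def by (simp add: algebra_simps)
        also have "\<dots> = e x * exp ((- c) * complex_of_real (k * h))"
          unfolding exp_add e_def ..
        also have "exp ((- c) * complex_of_real (k * h)) = - c"
          unfolding kh using c
          by (auto simp: complex_eq_iff Re_exp Im_exp)
        finally show ?thesis .
      qed
      have "e x * (- c) * ((v (x + h) + c * of_real P * u (x + h)) - c * (v x + c * of_real P * u x))
          = e x * (- c) * (v (x + h) + c * of_real P * u (x + h)) + e x * (c * c) * (v x + c * of_real P * u x)"
        by (simp add: algebra_simps)
      also have "\<dots> = Y (x + h) - Y x"
        unfolding Y_def eh cc by (simp add: algebra_simps)
      finally have "Y (x + h) - Y x = e x * (- c) * ((v (x + h) + c * of_real P * u (x + h)) - c * (v x + c * of_real P * u x))" ..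
      then show ?thesis by (simp add: norm_mult ne cc)
    qed
    show ?thesis
      by (rule tendsto_norm_zero_cancel) (unfold eq, rule tendsto_norm_zero[OF L])
  qed
  \<comment> \<open>The terms at x + h cancel, because the two combinations v + i P u and v - i P u
    differ by 2 i P u. What remains at x is -2 i (v - i P u).\<close>
  have "((\<lambda>x. ((v (x + h) + \<i> * of_real P * u (x + h)) - \<i> * (v x + \<i> * of_real P * u x))
     - 2 * \<i> * of_real P * (u (x + h) - \<i> * u x)
     - ((v (x + h) + (- \<i>) * of_real P * u (x + h)) - (- \<i>) * (v x + (- \<i>) * of_real P * u x))) \<longlongrightarrow> 0 - 2 * \<i> * of_real P * 0 - 0) at_top"
    by (intro tendsto_intros ysh ush) auto
  then have "((\<lambda>x. - 2 * \<i> * (v x - \<i> * of_real P * u x)) \<longlongrightarrow> 0) at_top" by (simp add: algebra_simps)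
  then have "((\<lambda>x. (\<i> / 2) * (- 2 * \<i> * (v x - \<i> * of_real P * u x))) \<longlongrightarrow> (\<i> / 2) * 0) at_top"
    by (intro tendsto_intros)
  then have "((\<lambda>x. v x - \<i> * complex_of_real (mom \<mu>) * u x) \<longlongrightarrow> 0) at_top" by (simp add: P_def)
  then show ?thesis by (intro that[OF s _ uK])
qed

text \<open>Up to a constant factor Im (cnj u v) is the Wronskian of u and its conjugate, two
  solutions at the same real energy; so it is constant and can be read off at infinity.\<close>

lemma Wronskian_limit:
  assumes mu: "\<mu> > 0" and s: "sol \<mu> u v"
    and l1: "((\<lambda>x. v x - \<i> * complex_of_real (mom \<mu>) * u x) \<longlongrightarrow> 0) at_top"
    and l2: "((\<lambda>x. cmod (u x)) \<longlongrightarrow> K) at_top" and x: "x \<ge> 0"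
  shows "Im (cnj (u x) * v x) = mom \<mu> * K^2"
proof -
  obtain B where B: "\<And>x. x \<ge> 0 \<Longrightarrow> cmod (u x) \<le> B" "\<And>x. x \<ge> 0 \<Longrightarrow> cmod (v x) \<le> B"
    by (rule sol_bounded[OF mu s]) (assumption | rule that)+
  define w where "w y = v y - \<i> * complex_of_real (mom \<mu>) * u y" for y
  have const: "Im (cnj (u y) * v y) = Im (cnj (u 0) * v 0)" if "y \<ge> 0" for y
  proof -
    define I where "I y = Im (cnj (u y) * v y)" for y
    have im: "cnj (v y) * u y - cnj (u y) * v y = - (2 * \<i> * complex_of_real (I y))" for y
      by (simp add: complex_eq_iff I_def)
    have "I y = I 0" using Wronskian_const[OF sol_cnj[OF s] s that] unfolding im by simp
    then show ?thesis by (simp only: I_def)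
  qed
  have "((\<lambda>y. Im (cnj (u y) * w y) + mom \<mu> * (cmod (u y))^2) \<longlongrightarrow> 0 + mom \<mu> * K^2) at_top"
  proof (intro tendsto_intros l2)
    show "((\<lambda>y. Im (cnj (u y) * w y)) \<longlongrightarrow> 0) at_top"
    proof (rule Lim_null_comparison)
      show "\<forall>\<^sub>F y in at_top. norm (Im (cnj (u y) * w y)) \<le> B * norm (w y)"
        using eventually_ge_at_top[of 0]
      proof eventually_elim
        case (elim y)
        have "norm (Im (cnj (u y) * w y)) \<le> cmod (cnj (u y) * w y)"
          unfolding real_norm_def by (rule abs_Im_le_cmod)
        also have "\<dots> \<le> B * norm (w y)" unfolding norm_mult complex_mod_cnj by (intro mult_right_mono B elim) simp
        finally show ?case .
      qed
      show "((\<lambda>y. B * norm (w y)) \<longlongrightarrow> 0) at_top"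
        using l1 unfolding w_def by (intro tendsto_mult_right_zero tendsto_norm_zero)
    qed
  qed
  moreover have "\<forall>\<^sub>F y in at_top. Im (cnj (u y) * w y) + mom \<mu> * (cmod (u y))^2 = Im (cnj (u x) * v x)"
    using eventually_ge_at_top[of 0]
  proof eventually_elim
    case (elim y)
    have "Im (cnj (u y) * w y) + mom \<mu> * (cmod (u y))^2 = Im (cnj (u y) * v y)"
      unfolding cmod_power2 by (simp add: w_def power2_eq_square algebra_simps)
    then show ?case using const[OF elim] const[OF x] by simp
  qed
  ultimately have "((\<lambda>y::real. Im (cnj (u x) * v x)) \<longlongrightarrow> 0 + mom \<mu> * K^2) at_top"
    by (rule Lim_transform_eventually)
  from tendsto_unique[OF trivial_limit_at_top_linorder tendsto_const this] show ?thesis by simp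
qed

text \<open>The flux does not vanish, which rules out \<theta>(0) = 0 and permits the division by w
  = p(0) \<theta>(0). The resulting normalisation \<psi>(0) = 1 / p(0) makes the Wronskian with the
  regular solution equal to 1.\<close>

lemma Weyl_solution:
  assumes mu: "\<mu> > 0" and J: "jost_sol p p' q q' x0 \<mu> \<theta>"
  defines "\<kappa> \<equiv> mom \<mu> * (Kfun p q \<mu>)^2 / (cmod (cp 0 * \<theta> 0))^2"
  shows "\<kappa> > 0"
    and "\<exists>\<psi> v. sol \<mu> \<psi> v \<and> \<psi> 0 = 1 / cp 0 \<and> (\<forall>x\<ge>0. Im (cnj (\<psi> x) * v x) = \<kappa>)
      \<and> ((\<lambda>x. v x - \<i> * complex_of_real (mom \<mu>) * \<psi> x) \<longlongrightarrow> 0) at_top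
      \<and> ((\<lambda>x. (cmod (\<psi> x))^2) \<longlongrightarrow> \<kappa> / mom \<mu>) at_top"
proof -
  obtain v where s: "sol \<mu> \<theta> v"
    and l1: "((\<lambda>x. v x - \<i> * complex_of_real (mom \<mu>) * \<theta> x) \<longlongrightarrow> 0) at_top"
    and l2: "((\<lambda>x. cmod (\<theta> x)) \<longlongrightarrow> Kfun p q \<mu>) at_top"
    by (rule jost_asymptotics[OF mu J])
  have P: "mom \<mu> > 0" by (rule mom_pos[OF mu])
  have K: "Kfun p q \<mu> > 0" by (simp add: Kfun_def)
  have W: "Im (cnj (\<theta> x) * v x) = mom \<mu> * (Kfun p q \<mu>)^2" if "x \<ge> 0" for x
    by (rule Wronskian_limit[OF mu s l1 l2 that])
  have t0: "\<theta> 0 \<noteq> 0"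
  proof
    assume "\<theta> 0 = 0"
    then show False using W[of 0] P K by simp
  qed
  define w where "w = cp 0 * \<theta> 0"
  have w: "w \<noteq> 0" using t0 p_pos[of 0] by (simp add: w_def)
  show "\<kappa> > 0" using P K w by (simp add: \<kappa>_def w_def)
  show "\<exists>\<psi> v. sol \<mu> \<psi> v \<and> \<psi> 0 = 1 / cp 0 \<and> (\<forall>x\<ge>0. Im (cnj (\<psi> x) * v x) = \<kappa>)
      \<and> ((\<lambda>x. v x - \<i> * complex_of_real (mom \<mu>) * \<psi> x) \<longlongrightarrow> 0) at_top
      \<and> ((\<lambda>x. (cmod (\<psi> x))^2) \<longlongrightarrow> \<kappa> / mom \<mu>) at_top"
  proof (rule exI[of _ "\<lambda>x. inverse w * \<theta> x"], rule exI[of _ "\<lambda>x. inverse w * v x"], intro conjI allI impI)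
    show "sol \<mu> (\<lambda>x. inverse w * \<theta> x) (\<lambda>x. inverse w * v x)" by (rule sol_scale[OF s])
    show "inverse w * \<theta> 0 = 1 / cp 0" using t0 p_pos[of 0] by (simp add: w_def field_simps)
    show "Im (cnj (inverse w * \<theta> x) * (inverse w * v x)) = \<kappa>" if "x \<ge> 0" for x
    proof -
      have "cnj (inverse w * \<theta> x) * (inverse w * v x) = (inverse w * cnj (inverse w)) * (cnj (\<theta> x) * v x)"
        by simp
      also have "inverse w * cnj (inverse w) = complex_of_real (1 / (cmod w)^2)"
        unfolding complex_norm_square[symmetric] by (simp add: norm_divide power_divide inverse_eq_divide)
      finally have "Im (cnj (inverse w * \<theta> x) * (inverse w * v x)) = 1 / (cmod w)^2 * Im (cnj (\<theta> x) * v x)"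
        by (simp only: Im_complex_of_real Re_complex_of_real times_complex.sel)
      then show ?thesis using W[OF that] by (simp add: \<kappa>_def w_def)
    qed
    have "((\<lambda>x. inverse w * (v x - \<i> * complex_of_real (mom \<mu>) * \<theta> x)) \<longlongrightarrow> inverse w * 0) at_top"
      by (intro tendsto_intros l1)
    then show "((\<lambda>x. inverse w * v x - \<i> * complex_of_real (mom \<mu>) * (inverse w * \<theta> x)) \<longlongrightarrow> 0) at_top"
      by (simp add: algebra_simps)
    have "((\<lambda>x. (cmod (inverse w) * cmod (\<theta> x))^2) \<longlongrightarrow> (cmod (inverse w) * Kfun p q \<mu>)^2) at_top"
      by (intro tendsto_intros l2)
    moreover have "(cmod (inverse w) * Kfun p q \<mu>)^2 = \<kappa> / mom \<mu>"
      using P by (simp add: \<kappa>_def w_def[symmetric] norm_inverse power_mult_distrib power_inverse divide_inverse)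
    ultimately show "((\<lambda>x. (cmod (inverse w * \<theta> x))^2) \<longlongrightarrow> \<kappa> / mom \<mu>) at_top" by (simp add: norm_mult)
  qed
qed

end

lemma continuous_on_Icc_bounded:
  fixes f :: "real \<Rightarrow> 'a::real_normed_vector"
  assumes "continuous_on {a..b} f"
  obtains B where "\<And>x. x \<in> {a..b} \<Longrightarrow> norm (f x) \<le> B"
proof -
  have "bounded (f ` {a..b})"
    by (intro compact_imp_bounded compact_continuous_image[OF assms]) simp
  then obtain B where "\<forall>y\<in>f ` {a..b}. norm y \<le> B" unfolding bounded_iff by (rule exE)
  then show ?thesis by (intro that[of B]) simp
qed

section \<open>The regular solution and the flux as functions of the energy\<close>

locale scattering = coefficients +
  fixes \<phi> :: "real \<Rightarrow> real \<Rightarrow> real" and \<theta> :: "real \<Rightarrow> real \<Rightarrow> complex"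
  assumes phi: "\<And>l. l > 0 \<Longrightarrow> regular_sol p q l (\<lambda>x. \<phi> x l)"
    and theta: "\<And>l. l > 0 \<Longrightarrow> jost_sol p p' q q' x0 l (\<lambda>x. \<theta> x l)"
begin

definition \<kappa> :: "real \<Rightarrow> real" where
  "\<kappa> \<mu> = mom \<mu> * (Kfun p q \<mu>)^2 / (cmod (cp 0 * \<theta> 0 \<mu>))^2"

abbreviation cphi where "cphi \<mu> \<equiv> \<lambda>x. complex_of_real (\<phi> x \<mu>)"

text \<open>\<open>regular_sol\<close> only asserts that a quasi-derivative exists; one is fixed
  here for each energy.\<close>

definition vphi :: "real \<Rightarrow> real \<Rightarrow> complex" where
  "vphi \<mu> = (SOME v. sol \<mu> (cphi \<mu>) v \<and> \<phi> 0 \<mu> = 0 \<and> v 0 = cp 0)"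

lemma vphi:
  assumes "\<mu> > 0"
  shows "sol \<mu> (cphi \<mu>) (vphi \<mu>)" "\<phi> 0 \<mu> = 0" "vphi \<mu> 0 = cp 0"
proof -
  have "\<exists>v. sol \<mu> (cphi \<mu>) v \<and> \<phi> 0 \<mu> = 0 \<and> v 0 = cp 0"
    using phi[OF assms] unfolding regular_sol_def .
  from someI_ex[OF this] show "sol \<mu> (cphi \<mu>) (vphi \<mu>)" "\<phi> 0 \<mu> = 0" "vphi \<mu> 0 = cp 0"
    unfolding vphi_def by blast+
qed

lemma Weyl_ex:
  assumes mu: "\<mu> > 0"
  obtains \<psi> v where "sol \<mu> \<psi> v" "\<psi> 0 = 1 / cp 0" "\<And>x. x \<ge> 0 \<Longrightarrow> Im (cnj (\<psi> x) * v x) = \<kappa> \<mu>"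
    "((\<lambda>x. v x - \<i> * complex_of_real (mom \<mu>) * \<psi> x) \<longlongrightarrow> 0) at_top"
    "((\<lambda>x. (cmod (\<psi> x))^2) \<longlongrightarrow> \<kappa> \<mu> / mom \<mu>) at_top"
proof -
  obtain \<psi> where "\<exists>v. sol \<mu> \<psi> v \<and> \<psi> 0 = 1 / cp 0 \<and> (\<forall>x\<ge>0. Im (cnj (\<psi> x) * v x) = \<kappa> \<mu>)
      \<and> ((\<lambda>x. v x - \<i> * complex_of_real (mom \<mu>) * \<psi> x) \<longlongrightarrow> 0) at_top
      \<and> ((\<lambda>x. (cmod (\<psi> x))^2) \<longlongrightarrow> \<kappa> \<mu> / mom \<mu>) at_top"
    using Weyl_solution(2)[OF mu theta[OF mu]] unfolding \<kappa>_def by (rule exE)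
  then obtain v where "sol \<mu> \<psi> v \<and> \<psi> 0 = 1 / cp 0 \<and> (\<forall>x\<ge>0. Im (cnj (\<psi> x) * v x) = \<kappa> \<mu>)
      \<and> ((\<lambda>x. v x - \<i> * complex_of_real (mom \<mu>) * \<psi> x) \<longlongrightarrow> 0) at_top
      \<and> ((\<lambda>x. (cmod (\<psi> x))^2) \<longlongrightarrow> \<kappa> \<mu> / mom \<mu>) at_top" by (rule exE)
  then show ?thesis by (intro that[of \<psi> v]) simp_all
qed

lemma kappa_pos: "\<mu> > 0 \<Longrightarrow> \<kappa> \<mu> > 0"
  unfolding \<kappa>_def by (rule Weyl_solution(1)[OF _ theta])

text \<open>\<psi> minus its conjugate vanishes at 0 with quasi-derivative 2 i \<kappa> p(0) there,
  so uniqueness for the initial value problem identifies it with 2 i \<kappa> \<phi>.\<close>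

lemma phi_Im_psi:
  assumes mu: "\<mu> > 0" and s: "sol \<mu> \<psi> v" and i: "\<psi> 0 = 1 / cp 0" "\<And>x. x \<ge> 0 \<Longrightarrow> Im (cnj (\<psi> x) * v x) = \<kappa> \<mu>"
    and x: "x \<ge> 0"
  shows "\<kappa> \<mu> * \<phi> x \<mu> = Im (\<psi> x)" "complex_of_real (\<kappa> \<mu>) * vphi \<mu> x = complex_of_real (Im (v x))"
proof -
  let ?c = "- (2 * \<i> * complex_of_real (\<kappa> \<mu>))"
  let ?U = "\<lambda>x. (\<psi> x + (-1) * cnj (\<psi> x)) + ?c * cphi \<mu> x"
  let ?V = "\<lambda>x. (v x + (-1) * cnj (v x)) + ?c * vphi \<mu> x"
  have d: "sol \<mu> ?U ?V" by (intro sol_lin s sol_cnj vphi(1)[OF mu])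
  have p0': "p 0 > 0" using p_pos[of 0] by simp
  \<comment> \<open>Since \<psi>(0) = 1 / p(0) is real, the flux at 0 is Im (v 0) / p(0).\<close>
  have "Im (v 0) = \<kappa> \<mu> * p 0" using i(2)[of 0] p0' by (simp add: i(1) field_simps)
  then have V0: "?V 0 = 0" using vphi(3)[OF mu] by (simp add: complex_eq_iff)
  have U0: "?U 0 = 0" using vphi(2)[OF mu] i(1) by simp
  have "?U x = 0" "?V x = 0" using sol_unique[OF d U0 V0 x] by auto
  then show "\<kappa> \<mu> * \<phi> x \<mu> = Im (\<psi> x)" "complex_of_real (\<kappa> \<mu>) * vphi \<mu> x = complex_of_real (Im (v x))"
    by (simp_all add: complex_eq_iff)
qed

lemma psi_bounded_seq:
  assumes mu: "\<mu> > 0" and s: "sol \<mu> \<psi> v"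
  obtains B where "B \<ge> 0" "\<And>x. x \<ge> 0 \<Longrightarrow> cmod (\<psi> x) \<le> B" "\<And>x. x \<ge> 0 \<Longrightarrow> cmod (v x) \<le> B"
proof -
  obtain B where B: "\<And>x. x \<ge> 0 \<Longrightarrow> cmod (\<psi> x) \<le> B" "\<And>x. x \<ge> 0 \<Longrightarrow> cmod (v x) \<le> B"
    by (rule sol_bounded[OF mu s]) (assumption | rule that)+
  have "B \<ge> 0" using order_trans[OF norm_ge_zero B(1)[OF order_refl]] .
  then show ?thesis using B by (intro that[of B])
qed

text \<open>Inserting \<phi> = Im \<psi> / \<kappa>, the outgoing condition and |\<psi>|^2 ->
  \<kappa> / mom gives mom^2 (\<kappa> / mom) / \<kappa>^2. The point is to express \<kappa> through
  \<phi>, whose dependence on the energy is governed by the equation, rather than through the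
  separately chosen Jost solutions.\<close>

lemma en_phi_lim:
  assumes mu: "\<mu> > 0"
  shows "(en \<mu> (cphi \<mu>) (vphi \<mu>) \<longlongrightarrow> mom \<mu> / \<kappa> \<mu>) at_top"
proof -
  obtain \<psi> v where W: "sol \<mu> \<psi> v" "\<psi> 0 = 1 / cp 0" "\<And>x. x \<ge> 0 \<Longrightarrow> Im (cnj (\<psi> x) * v x) = \<kappa> \<mu>"
    "((\<lambda>x. v x - \<i> * complex_of_real (mom \<mu>) * \<psi> x) \<longlongrightarrow> 0) at_top"
    "((\<lambda>x. (cmod (\<psi> x))^2) \<longlongrightarrow> \<kappa> \<mu> / mom \<mu>) at_top"
    by (rule Weyl_ex[OF mu]) (assumption | rule that)+
  obtain B where B: "B \<ge> 0" "\<And>x. x \<ge> 0 \<Longrightarrow> cmod (\<psi> x) \<le> B" "\<And>x. x \<ge> 0 \<Longrightarrow> cmod (v x) \<le> B"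
    by (rule psi_bounded_seq[OF mu W(1)]) (assumption | rule that)+
  define w where "w x = v x - \<i> * complex_of_real (mom \<mu>) * \<psi> x" for x
  have k: "\<kappa> \<mu> > 0" by (rule kappa_pos[OF mu])
  have P: "mom \<mu> > 0" by (rule mom_pos[OF mu])
  \<comment> \<open>\<open>R\<close> collects the errors: the deviation of (\<mu> - q) p from \<mu>
    p0, and the outgoing defect \<open>w\<close>.\<close>
  define R where "R x = ((\<mu> - q x) * p x - \<mu> * p0) * (Im (\<psi> x))^2 + 2 * mom \<mu> * (Re (\<psi> x) * Im (w x)) + (Im (w x))^2" for x
  have eq: "en \<mu> (cphi \<mu>) (vphi \<mu>) x = (mom \<mu> * mom \<mu> * (cmod (\<psi> x))^2 + R x) / (\<kappa> \<mu>)^2" if x: "x \<ge> 0" for x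
  proof -
    have "\<phi> x \<mu> = Im (\<psi> x) / \<kappa> \<mu>"
      using phi_Im_psi(1)[OF mu W(1,2,3) x] k by (simp add: eq_divide_eq mult.commute)
    then have 1: "(cmod (cphi \<mu> x))^2 = (Im (\<psi> x))^2 / (\<kappa> \<mu>)^2" by (simp only: norm_of_real power2_abs power_divide)
    have "vphi \<mu> x = complex_of_real (Im (v x) / \<kappa> \<mu>)"
      using phi_Im_psi(2)[OF mu W(1,2,3) x] k by (simp add: eq_divide_eq mult.commute)
    then have "cmod (vphi \<mu> x) = \<bar>Im (v x) / \<kappa> \<mu>\<bar>" by (simp only: norm_of_real)
    then have 2: "(cmod (vphi \<mu> x))^2 = (Im (v x))^2 / (\<kappa> \<mu>)^2" by (simp add: power_divide)
    have 3: "Im (v x) = mom \<mu> * Re (\<psi> x) + Im (w x)" by (simp add: w_def)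
    have 4: "mom \<mu> * mom \<mu> * (cmod (\<psi> x))^2 = p0 * \<mu> * (Im (\<psi> x))^2 + mom \<mu> * mom \<mu> * (Re (\<psi> x))^2"
      unfolding cmod_power2 by (simp add: mom_sq[OF mu] distrib_left)
    have "(\<mu> - q x) * p x * (Im (\<psi> x))^2 + (mom \<mu> * Re (\<psi> x) + Im (w x))^2 = mom \<mu> * mom \<mu> * (cmod (\<psi> x))^2 + R x"
      unfolding 4 R_def by (simp add: power2_eq_square algebra_simps)
    then show ?thesis unfolding en_def 1 2 3 times_divide_eq_right add_divide_distrib[symmetric] by (rule arg_cong)
  qed
  have wl: "((\<lambda>x. Im (w x)) \<longlongrightarrow> Im 0) at_top" by (intro tendsto_intros) (use W(4) in \<open>simp add: w_def\<close>)
  have bz: "((\<lambda>x. b x * c x) \<longlongrightarrow> 0) at_top" if "\<And>x. x \<ge> 0 \<Longrightarrow> \<bar>c x\<bar> \<le> D" "(b \<longlongrightarrow> 0) at_top" for b c :: "real \<Rightarrow> real" and D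
  proof (rule Lim_null_comparison)
    show "\<forall>\<^sub>F x in at_top. norm (b x * c x) \<le> norm (b x) * D"
      using eventually_ge_at_top[of 0] by eventually_elim (use that(1) in \<open>simp add: abs_mult mult_left_mono\<close>)
    show "((\<lambda>x. norm (b x) * D) \<longlongrightarrow> 0) at_top"
      using tendsto_mult_left_zero[OF tendsto_norm_zero[OF that(2)], of D] .
  qed
  have "(R \<longlongrightarrow> 0 + 2 * mom \<mu> * 0 + 0^2) at_top"
    unfolding R_def
  proof (intro tendsto_add tendsto_mult tendsto_const tendsto_power)
    show "((\<lambda>x. ((\<mu> - q x) * p x - \<mu> * p0) * (Im (\<psi> x))^2) \<longlongrightarrow> 0) at_top"
    proof (rule bz)
      show "\<bar>(Im (\<psi> x))^2\<bar> \<le> B^2" if "x \<ge> 0" for x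
        using power_mono[OF order_trans[OF abs_Im_le_cmod B(2)[OF that]] abs_ge_zero, of 2] by simp
      have "((\<lambda>x. (\<mu> - q x) * p x - \<mu> * p0) \<longlongrightarrow> (\<mu> - 0) * p0 - \<mu> * p0) at_top"
        by (intro tendsto_intros q_lim p_lim)
      then show "((\<lambda>x. (\<mu> - q x) * p x - \<mu> * p0) \<longlongrightarrow> 0) at_top" by simp
    qed
    have "((\<lambda>x. Im (w x) * Re (\<psi> x)) \<longlongrightarrow> 0) at_top"
    proof (rule bz)
      show "\<bar>Re (\<psi> x)\<bar> \<le> B" if "x \<ge> 0" for x using order_trans[OF abs_Re_le_cmod B(2)[OF that]] .
    qed (use wl in simp)
    then show "((\<lambda>x. Re (\<psi> x) * Im (w x)) \<longlongrightarrow> 0) at_top" by (simp add: mult.commute)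
    show "((\<lambda>x. Im (w x)) \<longlongrightarrow> 0) at_top" using wl by simp
  qed
  then have "((\<lambda>x. (mom \<mu> * mom \<mu> * (cmod (\<psi> x))^2 + R x) / (\<kappa> \<mu>)^2) \<longlongrightarrow> (mom \<mu> * mom \<mu> * (\<kappa> \<mu> / mom \<mu>) + 0) / (\<kappa> \<mu>)^2) at_top"
    by (intro tendsto_intros W(5)) (use k in simp_all)
  moreover have "(mom \<mu> * mom \<mu> * (\<kappa> \<mu> / mom \<mu>) + 0) / (\<kappa> \<mu>)^2 = mom \<mu> / \<kappa> \<mu>"
    using k P by (simp add: power2_eq_square)
  ultimately have "((\<lambda>x. (mom \<mu> * mom \<mu> * (cmod (\<psi> x))^2 + R x) / (\<kappa> \<mu>)^2) \<longlongrightarrow> mom \<mu> / \<kappa> \<mu>) at_top" by simp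
  then show ?thesis
    by (rule Lim_transform_eventually[OF _ eventually_mono[OF eventually_ge_at_top[of 0] eq[symmetric]]])
qed

lemma phi_bounded:
  assumes ab: "0 < \<alpha>" "\<alpha> \<le> \<beta>"
  obtains B where "B > 0" "\<And>\<mu> x. \<mu> \<in> {\<alpha>..\<beta>} \<Longrightarrow> x \<ge> 0 \<Longrightarrow> nsol (cphi \<mu>) (vphi \<mu>) x \<le> B"
proof -
  obtain C where C: "C > 0"
    "\<And>\<mu> u v s t. \<mu> \<in> {\<alpha>..\<beta>} \<Longrightarrow> sol \<mu> u v \<Longrightarrow> 0 \<le> s \<Longrightarrow> 0 \<le> t \<Longrightarrow> nsol u v t \<le> C * nsol u v s"
    by (rule nsol_global[OF ab]) (assumption | rule that)+
  show ?thesis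
  proof (rule that[of "C * p 0"])
    show "C * p 0 > 0" using C(1) p_pos[of 0] by simp
    fix \<mu> and x :: real assume mu: "\<mu> \<in> {\<alpha>..\<beta>}" and x: "x \<ge> 0"
    have m: "\<mu> > 0" using mu ab by simp
    have "nsol (cphi \<mu>) (vphi \<mu>) 0 = p 0" using vphi(2,3)[OF m] p_pos[of 0] by (simp add: nsol_def)
    then show "nsol (cphi \<mu>) (vphi \<mu>) x \<le> C * p 0" using C(2)[OF mu vphi(1)[OF m] order_refl x] by simp
  qed
qed

text \<open>The difference of the regular solutions at \<mu> and \<mu>' solves the equation at \<mu>
  with source (\<mu>' - \<mu>) times the solution at \<mu>' and with zero data at 0;
  \<open>nsol_Gronwall\<close> bounds it by its source.\<close>

lemma phi_Lipschitz:
  assumes ab: "0 < \<alpha>" "\<alpha> \<le> \<beta>" and X: "X \<ge> 0"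
  obtains L where "L \<ge> 0"
    "\<And>\<mu> \<mu>' x. \<mu> \<in> {\<alpha>..\<beta>} \<Longrightarrow> \<mu>' \<in> {\<alpha>..\<beta>} \<Longrightarrow> x \<in> {0..X} \<Longrightarrow>
       cmod (cphi \<mu> x - cphi \<mu>' x) + cmod (vphi \<mu> x - vphi \<mu>' x) \<le> L * \<bar>\<mu> - \<mu>'\<bar>"
proof -
  obtain B where B: "B > 0" "\<And>\<mu> x. \<mu> \<in> {\<alpha>..\<beta>} \<Longrightarrow> x \<ge> 0 \<Longrightarrow> nsol (cphi \<mu>) (vphi \<mu>) x \<le> B"
    by (rule phi_bounded[OF ab]) (assumption | rule that)+
  obtain C where C: "C \<ge> 0" "\<And>\<mu> u v g B s t. \<lbrakk>\<bar>\<mu>\<bar> \<le> \<beta>; prim 0 u (\<lambda>x. v x / cp x);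
     prim 0 v (\<lambda>x. (cq x - complex_of_real \<mu>) * u x + g x); 0 \<le> B;
     (LINT x:{0..X}|lborel. cmod (g x)) \<le> B; s \<in> {0..X}; t \<in> {0..X}\<rbrakk> \<Longrightarrow> nsol u v t \<le> C * (nsol u v s + B)"
    by (rule nsol_Gronwall[OF X, of \<beta>]) (use ab in simp, (assumption | rule that)+)
  show ?thesis
  proof (rule that[of "C * (B * X)"])
    show "0 \<le> C * (B * X)" using C(1) B(1) X by simp
    fix \<mu> \<mu>' x assume mu: "\<mu> \<in> {\<alpha>..\<beta>}" "\<mu>' \<in> {\<alpha>..\<beta>}" and x: "x \<in> {0..X}"
    have m: "\<mu> > 0" "\<mu>' > 0" using mu ab by auto
    note s1 = vphi(1)[OF m(1)] and s2 = vphi(1)[OF m(2)]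
    define u where "u = (\<lambda>x. cphi \<mu> x + (-1) * cphi \<mu>' x)"
    define v where "v = (\<lambda>x. vphi \<mu> x + (-1) * vphi \<mu>' x)"
    define g where "g x = complex_of_real (\<mu>' - \<mu>) * cphi \<mu>' x" for x
    have pu: "prim 0 u (\<lambda>x. v x / cp x)"
      using prim_lin[OF sol_prim(1)[OF s1] sol_prim(1)[OF s2], of "-1"] by (simp add: u_def v_def diff_divide_distrib)
    have pv: "prim 0 v (\<lambda>x. (cq x - complex_of_real \<mu>) * u x + g x)"
      using prim_lin[OF sol_prim(2)[OF s1] sol_prim(2)[OF s2], of "-1"] by (simp add: u_def v_def g_def algebra_simps)
    have phiB: "cmod (cphi \<mu>' x) \<le> B" if "x \<ge> 0" for x
    proof -
      have "cmod (cphi \<mu>' x) \<le> nsol (cphi \<mu>') (vphi \<mu>') x" unfolding nsol_def by simp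
      then show ?thesis using B(2)[OF mu(2) that] by linarith
    qed
    have cphi': "continuous_on {0..X} (cphi \<mu>')" by (rule continuous_on_subset[OF prim_cont[OF sol_prim(1)[OF s2]]]) auto
    have "(LINT x:{0..X}|lborel. cmod (g x)) \<le> (LINT x:{0..X}|lborel. \<bar>\<mu> - \<mu>'\<bar> * B)"
    proof (rule set_integral_mono)
      show "set_integrable lborel {0..X} (\<lambda>x. cmod (g x))"
        by (intro set_integrable_norm set_integrable_cont) (auto simp: g_def intro!: continuous_on_mult cphi')
      show "cmod (g x) \<le> \<bar>\<mu> - \<mu>'\<bar> * B" if "x \<in> {0..X}" for x
        unfolding g_def norm_mult norm_of_real abs_minus_commute[of \<mu>'] using phiB[of x] that by (intro mult_left_mono) auto
    qed simp
    also have "\<dots> = \<bar>\<mu> - \<mu>'\<bar> * B * X" using X by (simp add: set_integral_const)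
    finally have g: "(LINT x:{0..X}|lborel. cmod (g x)) \<le> \<bar>\<mu> - \<mu>'\<bar> * B * X" .
    have "nsol u v x \<le> C * (nsol u v 0 + \<bar>\<mu> - \<mu>'\<bar> * B * X)"
      by (rule C(2)[OF _ pu pv _ g]) (use mu ab x X B(1) in auto)
    moreover have "nsol u v 0 = 0" using vphi(2,3)[OF m(1)] vphi(2,3)[OF m(2)] by (simp add: nsol_def u_def v_def)
    ultimately show "cmod (cphi \<mu> x - cphi \<mu>' x) + cmod (vphi \<mu> x - vphi \<mu>' x) \<le> C * (B * X) * \<bar>\<mu> - \<mu>'\<bar>"
      by (simp add: nsol_def u_def v_def mult_ac)
  qed
qed

lemma Lipschitz_continuous_on:
  fixes f :: "real \<Rightarrow> 'z::metric_space"
  assumes "\<And>x y. x \<in> S \<Longrightarrow> y \<in> S \<Longrightarrow> dist (f x) (f y) \<le> L * \<bar>x - y\<bar>" "L \<ge> 0"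
  shows "continuous_on S f"
proof (rule Lipschitz.lipschitz_on_continuous_on[of L])
  show "L-lipschitz_on S f" by (rule lipschitz_onI) (use assms in \<open>auto simp: dist_real_def\<close>)
qed

lemma phi_cont_mu:
  assumes ab: "0 < \<alpha>" "\<alpha> \<le> \<beta>" and x: "x \<ge> 0"
  shows "continuous_on {\<alpha>..\<beta>} (\<lambda>\<mu>. cphi \<mu> x)" "continuous_on {\<alpha>..\<beta>} (\<lambda>\<mu>. vphi \<mu> x)"
proof -
  obtain L where L: "L \<ge> 0" "\<And>\<mu> \<mu>' y. \<mu> \<in> {\<alpha>..\<beta>} \<Longrightarrow> \<mu>' \<in> {\<alpha>..\<beta>} \<Longrightarrow> y \<in> {0..x} \<Longrightarrow>
       cmod (cphi \<mu> y - cphi \<mu>' y) + cmod (vphi \<mu> y - vphi \<mu>' y) \<le> L * \<bar>\<mu> - \<mu>'\<bar>"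
    by (rule phi_Lipschitz[OF ab x]) (assumption | rule that)+
  have 1: "cmod (cphi \<mu> x - cphi \<mu>' x) \<le> L * \<bar>\<mu> - \<mu>'\<bar>" "cmod (vphi \<mu> x - vphi \<mu>' x) \<le> L * \<bar>\<mu> - \<mu>'\<bar>"
    if "\<mu> \<in> {\<alpha>..\<beta>}" "\<mu>' \<in> {\<alpha>..\<beta>}" for \<mu> \<mu>'
  proof -
    have "cmod (cphi \<mu> x - cphi \<mu>' x) + cmod (vphi \<mu> x - vphi \<mu>' x) \<le> L * \<bar>\<mu> - \<mu>'\<bar>"
      by (rule L(2)[OF that]) (use x in simp)
    then show "cmod (cphi \<mu> x - cphi \<mu>' x) \<le> L * \<bar>\<mu> - \<mu>'\<bar>" "cmod (vphi \<mu> x - vphi \<mu>' x) \<le> L * \<bar>\<mu> - \<mu>'\<bar>"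
      using norm_ge_zero[of "cphi \<mu> x - cphi \<mu>' x"] norm_ge_zero[of "vphi \<mu> x - vphi \<mu>' x"] by linarith+
  qed
  show "continuous_on {\<alpha>..\<beta>} (\<lambda>\<mu>. cphi \<mu> x)" by (rule Lipschitz_continuous_on[OF _ L(1)]) (unfold dist_norm, rule 1(1))
  show "continuous_on {\<alpha>..\<beta>} (\<lambda>\<mu>. vphi \<mu> x)" by (rule Lipschitz_continuous_on[OF _ L(1)]) (unfold dist_norm, rule 1(2))
qed

text \<open>Lipschitz dependence on the energy, uniform over bounded positions, combined with
  continuity in the position at one energy.\<close>

lemma phi_joint: "continuous_on ({0..} \<times> {0<..}) (\<lambda>z. \<phi> (fst z) (snd z))"
  unfolding continuous_on_def
proof
  fix z :: "real \<times> real" assume z: "z \<in> {0..} \<times> {0<..}"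
  obtain x1 m1 where zz: "z = (x1, m1)" "x1 \<ge> 0" "m1 > 0" using z by (cases z) auto
  let ?F = "at z within {0..} \<times> {0<..}"
  obtain L where L: "L \<ge> 0" "\<And>\<mu> \<mu>' y. \<mu> \<in> {m1/2..2*m1} \<Longrightarrow> \<mu>' \<in> {m1/2..2*m1} \<Longrightarrow> y \<in> {0..x1+1} \<Longrightarrow>
       cmod (cphi \<mu> y - cphi \<mu>' y) + cmod (vphi \<mu> y - vphi \<mu>' y) \<le> L * \<bar>\<mu> - \<mu>'\<bar>"
    by (rule phi_Lipschitz[of "m1/2" "2*m1" "x1+1"]) (use zz in simp, use zz in simp, use zz in simp, (assumption | rule that)+)
  have f1: "((\<lambda>w. fst w) \<longlongrightarrow> x1) ?F" and f2: "((\<lambda>w. snd w) \<longlongrightarrow> m1) ?F"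
    using zz(1) tendsto_fst[OF tendsto_ident_at, of z] tendsto_snd[OF tendsto_ident_at, of z] by simp_all
  have c1: "continuous_on {0..} (\<lambda>x. \<phi> x m1)"
    using continuous_on_Re[OF prim_cont[OF sol_prim(1)[OF vphi(1)[OF zz(3)]]]] by simp
  have ev: "\<forall>\<^sub>F w in ?F. fst w \<in> {0..x1+1} \<and> snd w \<in> {m1/2..2*m1}"
  proof -
    have "\<forall>\<^sub>F w in ?F. fst w < x1 + 1" by (rule order_tendstoD(2)[OF f1]) simp
    moreover have "\<forall>\<^sub>F w in ?F. snd w < 2 * m1" by (rule order_tendstoD(2)[OF f2]) (use zz in simp)
    moreover have "\<forall>\<^sub>F w in ?F. m1 / 2 < snd w" by (rule order_tendstoD(1)[OF f2]) (use zz in simp)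
    moreover have "\<forall>\<^sub>F w in ?F. w \<in> {0..} \<times> {0<..}" by (simp add: eventually_at_filter)
    ultimately show ?thesis by eventually_elim auto
  qed
  have "((\<lambda>w. \<phi> (fst w) (snd w) - \<phi> (fst w) m1) \<longlongrightarrow> 0) ?F"
  proof (rule Lim_null_comparison)
    show "\<forall>\<^sub>F w in ?F. norm (\<phi> (fst w) (snd w) - \<phi> (fst w) m1) \<le> L * \<bar>snd w - m1\<bar>"
      using ev
    proof eventually_elim
      case (elim w)
      have "cmod (cphi (snd w) (fst w) - cphi m1 (fst w)) + cmod (vphi (snd w) (fst w) - vphi m1 (fst w)) \<le> L * \<bar>snd w - m1\<bar>"
        by (rule L(2)) (use elim zz in auto)
      then have "cmod (cphi (snd w) (fst w) - cphi m1 (fst w)) \<le> L * \<bar>snd w - m1\<bar>"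
        using norm_ge_zero[of "vphi (snd w) (fst w) - vphi m1 (fst w)"] by linarith
      then show ?case unfolding of_real_diff[symmetric] norm_of_real real_norm_def .
    qed
    have "((\<lambda>w. L * \<bar>snd w - m1\<bar>) \<longlongrightarrow> L * \<bar>m1 - m1\<bar>) ?F" by (intro tendsto_intros f2)
    then show "((\<lambda>w. L * \<bar>snd w - m1\<bar>) \<longlongrightarrow> 0) ?F" by simp
  qed
  moreover have "((\<lambda>w. \<phi> (fst w) m1) \<longlongrightarrow> \<phi> x1 m1) ?F"
  proof (rule continuous_on_tendsto_compose[OF c1 f1])
    show "\<forall>\<^sub>F w in ?F. fst w \<in> {0..}" using ev by eventually_elim auto
  qed (use zz in simp)
  ultimately have "((\<lambda>w. (\<phi> (fst w) (snd w) - \<phi> (fst w) m1) + \<phi> (fst w) m1) \<longlongrightarrow> 0 + \<phi> x1 m1) ?F" by (rule tendsto_add)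
  then show "((\<lambda>w. \<phi> (fst w) (snd w)) \<longlongrightarrow> \<phi> (fst z) (snd z)) ?F" by (simp add: zz(1))
qed

text \<open>On compact energy intervals mom / \<kappa> is the uniform limit of \<open>en\<close> of
  the regular solution at a fixed position, which is continuous in \<mu>. The tail bound in
  \<open>energy_estimates\<close> supplies the uniformity.\<close>

lemma kappa_cont: "continuous_on {0<..} \<kappa>"
proof -
  have main: "continuous_on {\<alpha>..\<beta>} \<kappa>" if ab: "0 < \<alpha>" "\<alpha> \<le> \<beta>" for \<alpha> \<beta>
  proof -
    obtain X m M C where E: "X \<ge> x0" "m > 0" "M > 0" "C > 0"
      "\<And>\<mu> u v x. \<mu> \<in> {\<alpha>..\<beta>} \<Longrightarrow> x \<ge> X \<Longrightarrow> m * (nsol u v x)^2 \<le> en \<mu> u v x"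
      "\<And>\<mu> u v x. \<mu> \<in> {\<alpha>..\<beta>} \<Longrightarrow> x \<ge> X \<Longrightarrow> en \<mu> u v x \<le> M * (nsol u v x)^2"
      "\<And>\<mu> u v s t. \<mu> \<in> {\<alpha>..\<beta>} \<Longrightarrow> sol \<mu> u v \<Longrightarrow> X \<le> s \<Longrightarrow> X \<le> t \<Longrightarrow> en \<mu> u v t \<le> 2 * en \<mu> u v s"
      "\<And>\<mu> u v s t. \<mu> \<in> {\<alpha>..\<beta>} \<Longrightarrow> sol \<mu> u v \<Longrightarrow> X \<le> s \<Longrightarrow> s \<le> t \<Longrightarrow>
         \<bar>en \<mu> u v t - en \<mu> u v s\<bar> \<le> C * en \<mu> u v X * (LINT x:{s..}|lborel. var x)"
      by (rule energy_estimates[OF ab]) (assumption | rule that)+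
    obtain B where B: "B > 0" "\<And>\<mu> x. \<mu> \<in> {\<alpha>..\<beta>} \<Longrightarrow> x \<ge> 0 \<Longrightarrow> nsol (cphi \<mu>) (vphi \<mu>) x \<le> B"
      by (rule phi_bounded[OF ab]) (assumption | rule that)+
    have X0: "X \<ge> 0" using E(1) x0_pos by simp
    let ?e = "\<lambda>x \<mu>. en \<mu> (cphi \<mu>) (vphi \<mu>) x"
    let ?T = "\<lambda>s. LINT x:{s..}|lborel. var x"
    have T0: "0 \<le> ?T s" for s
      unfolding set_lebesgue_integral_def using var_nonneg by (intro integral_nonneg_AE) auto
    have est: "\<bar>mom \<mu> / \<kappa> \<mu> - ?e s \<mu>\<bar> \<le> C * (M * B^2) * ?T s" if mu: "\<mu> \<in> {\<alpha>..\<beta>}" and s: "s \<ge> X" for \<mu> s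
    proof -
      have m: "\<mu> > 0" using mu ab by simp
      have "?e X \<mu> \<le> M * (nsol (cphi \<mu>) (vphi \<mu>) X)^2" by (rule E(6)[OF mu order_refl])
      also have "\<dots> \<le> M * B^2" using B(2)[OF mu X0] E(3) nsol_nonneg by (intro mult_left_mono power_mono) auto
      finally have eX: "?e X \<mu> \<le> M * B^2" .
      have "((\<lambda>t. \<bar>?e t \<mu> - ?e s \<mu>\<bar>) \<longlongrightarrow> \<bar>mom \<mu> / \<kappa> \<mu> - ?e s \<mu>\<bar>) at_top"
        by (intro tendsto_intros en_phi_lim[OF m])
      then show ?thesis
      proof (rule tendsto_upperbound)
        show "\<forall>\<^sub>F t in at_top. \<bar>?e t \<mu> - ?e s \<mu>\<bar> \<le> C * (M * B^2) * ?T s"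
          using eventually_ge_at_top[of s]
        proof eventually_elim
          case (elim t)
          have "\<bar>?e t \<mu> - ?e s \<mu>\<bar> \<le> C * ?e X \<mu> * ?T s" by (rule E(8)[OF mu vphi(1)[OF m] s elim])
          also have "\<dots> \<le> C * (M * B^2) * ?T s"
            using eX E(4) T0[of s] by (intro mult_right_mono mult_left_mono) auto
          finally show ?case .
        qed
      qed simp
    qed
    have ul: "uniform_limit {\<alpha>..\<beta>} ?e (\<lambda>\<mu>. mom \<mu> / \<kappa> \<mu>) at_top"
    proof (rule uniform_limitI)
      fix e :: real assume e: "e > 0"
      have "((\<lambda>s. C * (M * B^2) * ?T s) \<longlongrightarrow> 0) at_top"
        by (intro tendsto_mult_right_zero tail_tendsto_zero[OF var_int])
      then have "\<forall>\<^sub>F s in at_top. C * (M * B^2) * ?T s < e" by (rule order_tendstoD(2)) (rule e)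
      then show "\<forall>\<^sub>F s in at_top. \<forall>\<mu>\<in>{\<alpha>..\<beta>}. dist (?e s \<mu>) (mom \<mu> / \<kappa> \<mu>) < e"
        using eventually_ge_at_top[of X]
      proof eventually_elim
        case (elim s)
        show ?case
        proof
          fix \<mu> assume "\<mu> \<in> {\<alpha>..\<beta>}"
          from est[OF this elim(2)] elim(1) show "dist (?e s \<mu>) (mom \<mu> / \<kappa> \<mu>) < e"
            by (simp add: dist_real_def abs_minus_commute)
        qed
      qed
    qed
    have c: "continuous_on {\<alpha>..\<beta>} (?e s)" if "s \<ge> 0" for s
    proof -
      have "continuous_on {\<alpha>..\<beta>} (\<lambda>\<mu>. (\<mu> - q s) * p s * (cmod (cphi \<mu> s))^2 + (cmod (vphi \<mu> s))^2)"
        by (intro continuous_intros continuous_on_norm phi_cont_mu[OF ab that] continuous_on_power)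
      then show ?thesis by (simp add: en_def)
    qed
    have "continuous_on {\<alpha>..\<beta>} (\<lambda>\<mu>. mom \<mu> / \<kappa> \<mu>)"
      by (rule uniform_limit_theorem[OF eventually_mono[OF eventually_ge_at_top[of 0] c] ul])
        (simp_all add: trivial_limit_at_top_linorder)
    then have "continuous_on {\<alpha>..\<beta>} (\<lambda>\<mu>. mom \<mu> / (mom \<mu> / \<kappa> \<mu>))"
    proof (rule continuous_on_divide[rotated])
      show "continuous_on {\<alpha>..\<beta>} mom" unfolding mom_def by (intro continuous_intros)
      show "\<forall>x\<in>{\<alpha>..\<beta>}. mom x / \<kappa> x \<noteq> 0"
      proof
        fix x assume "x \<in> {\<alpha>..\<beta>}"
        then have "x > 0" using ab by simp
        then show "mom x / \<kappa> x \<noteq> 0" using mom_pos[of x] kappa_pos[of x] by simp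
      qed
    qed
    moreover have "mom \<mu> / (mom \<mu> / \<kappa> \<mu>) = \<kappa> \<mu>" if "\<mu> \<in> {\<alpha>..\<beta>}" for \<mu>
      using mom_pos[of \<mu>] that ab by simp
    ultimately show ?thesis using continuous_on_cong[of "{\<alpha>..\<beta>}" "{\<alpha>..\<beta>}" "\<lambda>\<mu>. mom \<mu> / (mom \<mu> / \<kappa> \<mu>)" \<kappa>] by blast
  qed
  have "isCont \<kappa> x" if "x > 0" for x
    by (rule continuous_on_interior[OF main[of "x/2" "2*x"]]) (use that in auto)
  then show ?thesis by (intro continuous_at_imp_continuous_on) auto
qed

text \<open>A bound at 0 is not at hand for the quasi-derivative of \<psi>, so the solution is
  controlled from infinity: there |\<psi>|^2 tends to \<kappa> / mom, a continuous function of the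
  energy, and \<open>nsol_global\<close> carries the bound back to every x.\<close>

lemma psi_bounded:
  assumes ab: "0 < \<alpha>" "\<alpha> \<le> \<beta>"
  obtains B where "B > 0" "\<And>\<mu> \<psi> v x. \<lbrakk>\<mu> \<in> {\<alpha>..\<beta>}; sol \<mu> \<psi> v;
    ((\<lambda>x. v x - \<i> * complex_of_real (mom \<mu>) * \<psi> x) \<longlongrightarrow> 0) at_top;
    ((\<lambda>x. (cmod (\<psi> x))^2) \<longlongrightarrow> \<kappa> \<mu> / mom \<mu>) at_top; x \<ge> 0\<rbrakk> \<Longrightarrow> nsol \<psi> v x \<le> B"
proof -
  obtain C where C: "C > 0"
    "\<And>\<mu> u v s t. \<mu> \<in> {\<alpha>..\<beta>} \<Longrightarrow> sol \<mu> u v \<Longrightarrow> 0 \<le> s \<Longrightarrow> 0 \<le> t \<Longrightarrow> nsol u v t \<le> C * nsol u v s"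
    by (rule nsol_global[OF ab]) (assumption | rule that)+
  have cf: "continuous_on {\<alpha>..\<beta>} (\<lambda>\<mu>. (1 + mom \<mu>) * sqrt (\<kappa> \<mu> / mom \<mu>))"
  proof (intro continuous_intros)
    show "continuous_on {\<alpha>..\<beta>} \<kappa>" by (rule continuous_on_subset[OF kappa_cont]) (use ab in auto)
    show "continuous_on {\<alpha>..\<beta>} mom" unfolding mom_def by (intro continuous_intros)
    then show "continuous_on {\<alpha>..\<beta>} mom" .
    show "\<forall>x\<in>{\<alpha>..\<beta>}. mom x \<noteq> 0"
    proof
      fix x assume "x \<in> {\<alpha>..\<beta>}"
      then show "mom x \<noteq> 0" using mom_pos[of x] ab by simp
    qed
  qed
  obtain D where D: "\<And>\<mu>. \<mu> \<in> {\<alpha>..\<beta>} \<Longrightarrow> norm ((1 + mom \<mu>) * sqrt (\<kappa> \<mu> / mom \<mu>)) \<le> D"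
    by (rule continuous_on_Icc_bounded[OF cf]) (assumption | rule that)+
  have D0: "D \<ge> 0" using order_trans[OF norm_ge_zero D[of \<alpha>]] ab by simp
  show ?thesis
  proof (rule that[of "C * D + 1"])
    show "C * D + 1 > 0" using C(1) D0 by (simp add: add_nonneg_pos)
    fix \<mu> \<psi> v and x :: real
    assume mu: "\<mu> \<in> {\<alpha>..\<beta>}" and s: "sol \<mu> \<psi> v"
      and l1: "((\<lambda>x. v x - \<i> * complex_of_real (mom \<mu>) * \<psi> x) \<longlongrightarrow> 0) at_top"
      and l2: "((\<lambda>x. (cmod (\<psi> x))^2) \<longlongrightarrow> \<kappa> \<mu> / mom \<mu>) at_top" and x: "x \<ge> 0"
    have P: "mom \<mu> > 0" using mu ab by (intro mom_pos) simp
    have l3: "((\<lambda>x. cmod (\<psi> x)) \<longlongrightarrow> sqrt (\<kappa> \<mu> / mom \<mu>)) at_top"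
      using tendsto_real_sqrt[OF l2] by simp
    have "((\<lambda>y. C * (cmod (\<psi> y) + (cmod (v y - \<i> * complex_of_real (mom \<mu>) * \<psi> y) + mom \<mu> * cmod (\<psi> y))))
       \<longlongrightarrow> C * (sqrt (\<kappa> \<mu> / mom \<mu>) + (0 + mom \<mu> * sqrt (\<kappa> \<mu> / mom \<mu>)))) at_top"
      by (intro tendsto_intros l3 tendsto_norm_zero[OF l1])
    then have "nsol \<psi> v x \<le> C * (sqrt (\<kappa> \<mu> / mom \<mu>) + (0 + mom \<mu> * sqrt (\<kappa> \<mu> / mom \<mu>)))"
    proof (rule tendsto_lowerbound)
      show "\<forall>\<^sub>F y in at_top. nsol \<psi> v x \<le> C * (cmod (\<psi> y) + (cmod (v y - \<i> * complex_of_real (mom \<mu>) * \<psi> y) + mom \<mu> * cmod (\<psi> y)))"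
        using eventually_ge_at_top[of 0]
      proof eventually_elim
        case (elim y)
        have "cmod (v y) \<le> cmod (v y - \<i> * complex_of_real (mom \<mu>) * \<psi> y) + cmod (\<i> * complex_of_real (mom \<mu>) * \<psi> y)"
          using norm_triangle_sub[of "v y" "\<i> * complex_of_real (mom \<mu>) * \<psi> y"] by linarith
        also have "cmod (\<i> * complex_of_real (mom \<mu>) * \<psi> y) = mom \<mu> * cmod (\<psi> y)" using P by (simp add: norm_mult)
        finally have "nsol \<psi> v y \<le> cmod (\<psi> y) + (cmod (v y - \<i> * complex_of_real (mom \<mu>) * \<psi> y) + mom \<mu> * cmod (\<psi> y))"
          unfolding nsol_def by simp
        then have "C * nsol \<psi> v y \<le> C * (cmod (\<psi> y) + (cmod (v y - \<i> * complex_of_real (mom \<mu>) * \<psi> y) + mom \<mu> * cmod (\<psi> y)))"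
          using C(1) by (intro mult_left_mono) auto
        then show ?case using C(2)[OF mu s elim x] by linarith
      qed
    qed simp
    also have "\<dots> = C * ((1 + mom \<mu>) * sqrt (\<kappa> \<mu> / mom \<mu>))" by (simp add: algebra_simps)
    also have "\<dots> \<le> C * D" using D[OF mu] C(1) by (intro mult_left_mono) auto
    finally show "nsol \<psi> v x \<le> C * D + 1" by simp
  qed
qed

end

section \<open>Compactly supported data and the outgoing solution\<close>

text \<open>The function is required to be Borel on the whole line and to vanish off (0, b];
  integrals over the line, over the half-line and over [0, b] then agree without case
  distinctions.\<close>

definition csupp :: "real \<Rightarrow> (real \<Rightarrow> complex) \<Rightarrow> bool" where
  "csupp b f \<longleftrightarrow> f \<in> borel_measurable borel \<and> integrable lborel (\<lambda>x. (cmod (f x))^2) \<and> (\<forall>x. x \<notin> {0<..b} \<longrightarrow> f x = 0)"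

lemma csupp_integrable:
  assumes "csupp b f" shows "integrable lborel f"
proof (rule Bochner_Integration.integrable_bound)
  show "integrable lborel (\<lambda>x. indicator {0..b} x + (cmod (f x))^2)"
    using assms unfolding csupp_def
    by (intro Bochner_Integration.integrable_add integrable_real_indicator) (auto simp: emeasure_lborel_Icc_eq)
  show "f \<in> borel_measurable lborel" using assms by (simp add: csupp_def)
  show "AE x in lborel. norm (f x) \<le> norm (indicator {0..b} x + (cmod (f x))^2 :: real)"
  proof (rule AE_I2)
    fix x
    have "0 \<le> (cmod (f x) - 1)^2" by simp
    then have "2 * cmod (f x) \<le> 1 + (cmod (f x))^2" by (simp add: power2_diff)
    then have "cmod (f x) \<le> 1 + (cmod (f x))^2" using zero_le_power2[of "cmod (f x)"] by linarith
    moreover have "f x = 0" if "x \<notin> {0..b}" using assms that by (auto simp: csupp_def)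
    ultimately show "norm (f x) \<le> norm (indicator {0..b} x + (cmod (f x))^2 :: real)"
      by (cases "x \<in> {0..b}") auto
  qed
qed

lemma integrable_lpos:
  fixes f :: "real \<Rightarrow> 'a::{banach, second_countable_topology}"
  shows "integrable lpos f \<longleftrightarrow> integrable lborel (\<lambda>x. indicator {0<..} x *\<^sub>R f x)"
  unfolding lpos_def by (subst integrable_restrict_space) auto

lemma integral_lpos:
  fixes f :: "real \<Rightarrow> 'a::{banach, second_countable_topology}"
  shows "(LINT x|lpos. f x) = (LINT x|lborel. indicator {0<..} x *\<^sub>R f x)"
  unfolding lpos_def by (subst integral_restrict_space) auto

lemma measurable_lpos:
  fixes f :: "real \<Rightarrow> 'a::real_normed_vector"
  shows "f \<in> borel_measurable lpos \<longleftrightarrow> (\<lambda>x. indicator {0<..} x *\<^sub>R f x) \<in> borel_measurable borel"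
  unfolding lpos_def by (subst borel_measurable_restrict_space_iff) auto

lemma measurable_lpos_borel: "f \<in> borel_measurable borel \<Longrightarrow> f \<in> borel_measurable lpos"
  unfolding lpos_def by (rule measurable_restrict_space1) simp

lemma measurable_lpos_cont:
  fixes f :: "real \<Rightarrow> 'a::real_normed_vector"
  assumes "continuous_on {0..} f" shows "f \<in> borel_measurable lpos"
  unfolding measurable_lpos
  by (rule borel_measurable_continuous_on_indicator) (auto intro: continuous_on_subset[OF assms])

lemma csupp_L2: "csupp b f \<Longrightarrow> L2 f"
proof -
  assume f: "csupp b f"
  have e: "(\<lambda>x. indicator {0<..} x *\<^sub>R (cmod (f x))^2) = (\<lambda>x. (cmod (f x))^2)"
  proof
    fix x show "indicator {0<..} x *\<^sub>R (cmod (f x))^2 = (cmod (f x))^2"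
      using f unfolding csupp_def by (cases "x \<in> {0<..b}") auto
  qed
  show ?thesis unfolding L2_iff integrable_lpos e using f measurable_lpos_borel[of f] unfolding csupp_def by blast
qed

lemma L2_bound:
  assumes "f \<in> borel_measurable lpos" "L2 g" "\<And>x. x > 0 \<Longrightarrow> cmod (f x) \<le> cmod (g x)"
  shows "L2 f"
  unfolding L2_iff
proof (rule conjI[OF assms(1)], rule Bochner_Integration.integrable_bound[of lpos "\<lambda>x. (cmod (g x))^2"])
  show "integrable lpos (\<lambda>x. (cmod (g x))^2)" using assms(2) by (simp add: L2_iff)
  show "(\<lambda>x. (cmod (f x))\<^sup>2) \<in> borel_measurable lpos" using assms(1) by measurable
  show "AE x in lpos. norm ((cmod (f x))\<^sup>2) \<le> norm ((cmod (g x))\<^sup>2)"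
    by (rule AE_I2) (use assms(3) in \<open>auto intro: power_mono\<close>)
qed

lemma exp_decay_tendsto:
  fixes c :: real
  assumes "c > 0" shows "((\<lambda>x. exp (- (c * x))) \<longlongrightarrow> 0) at_top"
  by (rule filterlim_compose[OF exp_at_bot])
    (use assms in \<open>simp add: filterlim_uminus_at_bot filterlim_tendsto_pos_mult_at_top[OF tendsto_const _ filterlim_ident]\<close>)

lemma exp_lpos:
  assumes c: "c > 0"
  shows "integrable lpos (\<lambda>x. exp (- (c * x)))" "(LINT x|lpos. exp (- (c * x))) = 1 / c"
proof -
  have nn: "(\<integral>\<^sup>+x. ennreal (exp (- (c * x))) * indicator {0..} x \<partial>lborel) = ennreal (0 - (- exp (- (c * 0)) / c))"
  proof (rule nn_integral_FTC_atLeast)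
    show "DERIV (\<lambda>x. - exp (- (c * x)) / c) x :> exp (- (c * x))" for x
      using c by (auto intro!: derivative_eq_intros)
    have "((\<lambda>x. - exp (- (c * x)) / c) \<longlongrightarrow> - 0 / c) at_top"
    proof (intro tendsto_divide tendsto_minus tendsto_const)
      show "((\<lambda>x. exp (- (c * x))) \<longlongrightarrow> 0) at_top" by (rule exp_decay_tendsto[OF c])
    qed (use c in simp)
    then show "((\<lambda>x. - exp (- (c * x)) / c) \<longlongrightarrow> 0) at_top" by simp
  qed auto
  have "has_bochner_integral lborel (\<lambda>x. indicator {0..} x *\<^sub>R exp (- (c * x))) (1 / c)"
  proof (rule has_bochner_integral_nn_integral)
    show "(\<integral>\<^sup>+x. ennreal (indicator {0..} x *\<^sub>R exp (- (c * x))) \<partial>lborel) = ennreal (1 / c)"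
    proof -
      have "(\<integral>\<^sup>+x. ennreal (indicator {0..} x *\<^sub>R exp (- (c * x))) \<partial>lborel) = (\<integral>\<^sup>+x. ennreal (exp (- (c * x))) * indicator {0..} x \<partial>lborel)"
        by (intro nn_integral_cong) (auto simp: indicator_def)
      then show ?thesis using nn by simp
    qed
  qed (use c in auto)
  moreover have ae: "AE x in lborel. indicator {0..} x *\<^sub>R exp (- (c * x)) = indicator {0<..} x *\<^sub>R exp (- (c * x))"
    using AE_lborel_singleton[of "0::real"] by eventually_elim (auto simp: indicator_def)
  ultimately have "has_bochner_integral lborel (\<lambda>x. indicator {0<..} x *\<^sub>R exp (- (c * x))) (1 / c)"
    by (subst has_bochner_integral_cong_AE[OF _ _ ae, symmetric]) auto
  then show "integrable lpos (\<lambda>x. exp (- (c * x)))" "(LINT x|lpos. exp (- (c * x))) = 1 / c"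
    unfolding integrable_lpos integral_lpos by (auto simp: has_bochner_integral_iff)
qed

lemma L2_exp_decay:
  assumes f: "continuous_on {0..} f" and c: "c > 0" and b: "\<And>x. x \<ge> 0 \<Longrightarrow> cmod (f x) \<le> B * exp (- (c * x))"
  shows "L2 f"
proof (rule L2_bound[OF measurable_lpos_cont[OF f]])
  have "(\<lambda>x. complex_of_real (B * exp (- (c * x)))) \<in> borel_measurable lpos"
    by (intro measurable_lpos_cont continuous_intros)
  moreover have "(cmod (complex_of_real (B * exp (- (c * x)))))^2 = B^2 * exp (- ((2 * c) * x))" for x
    by (simp add: norm_mult power_mult_distrib exp_double[symmetric] mult.assoc flip: exp_of_nat_mult)
  ultimately show "L2 (\<lambda>x. complex_of_real (B * exp (- (c * x))))"
    unfolding L2_iff using exp_lpos(1)[of "2 * c"] c by simp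
  show "cmod (f x) \<le> cmod (complex_of_real (B * exp (- (c * x))))" if "x > 0" for x
    using b[of x] that unfolding norm_of_real by linarith
qed

lemma LINT_Icc_lpos:
  fixes F :: "real \<Rightarrow> complex"
  assumes "F \<in> borel_measurable lpos"
  shows "(LINT t:{0..X}|lborel. F t) = (LINT t|lborel. indicator {..X} t *\<^sub>R (indicator {0<..} t *\<^sub>R F t))"
  unfolding set_lebesgue_integral_def
proof (rule integral_cong_AE)
  have [measurable]: "(\<lambda>t. indicator {0<..} t *\<^sub>R F t) \<in> borel_measurable borel" using assms by (simp add: measurable_lpos)
  show "(\<lambda>t. indicator {..X} t *\<^sub>R (indicator {0<..} t *\<^sub>R F t)) \<in> borel_measurable lborel" by measurable
  \<comment> \<open>The value at 0 is split off, since measurability on \<open>lpos\<close> says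
    nothing about that point.\<close>
  have e: "(\<lambda>t. indicator {0..X} t *\<^sub>R F t) = (\<lambda>t. indicator {..X} t *\<^sub>R (indicator {0<..} t *\<^sub>R F t) + indicator {0} t *\<^sub>R (indicator {..X} t *\<^sub>R F 0))"
    by (auto simp: fun_eq_iff indicator_def)
  show "(\<lambda>t. indicator {0..X} t *\<^sub>R F t) \<in> borel_measurable lborel" unfolding e by measurable
  show "AE t in lborel. indicator {0..X} t *\<^sub>R F t = indicator {..X} t *\<^sub>R (indicator {0<..} t *\<^sub>R F t)"
    using AE_lborel_singleton[of "0::real"] by eventually_elim (auto simp: indicator_def)
qed

text \<open>Once integrability is known, the improper integral determines the Lebesgue integral;
  this is how a boundary term at infinity is evaluated.\<close>

lemma integral_lpos_limit:
  fixes F :: "real \<Rightarrow> complex"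
  assumes F: "integrable lpos F" and L: "((\<lambda>X. LINT t:{0..X}|lborel. F t) \<longlongrightarrow> L) at_top"
  shows "(LINT x|lpos. F x) = L"
proof -
  have i: "integrable lborel (\<lambda>x. indicator {0<..} x *\<^sub>R F x)" using F by (simp add: integrable_lpos)
  have "((\<lambda>X. LINT t|lborel. indicator {..X} t *\<^sub>R (indicator {0<..} t *\<^sub>R F t)) \<longlongrightarrow> (LINT t|lborel. indicator {0<..} t *\<^sub>R F t)) at_top"
  proof (rule integral_dominated_convergence_at_top[where M=lborel and f="\<lambda>t. indicator {0<..} t *\<^sub>R F t"
      and s="\<lambda>X t. indicator {..X} t *\<^sub>R (indicator {0<..} t *\<^sub>R F t)" and w="\<lambda>t. norm (indicator {0<..} t *\<^sub>R F t)"])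
    show "AE t in lborel. ((\<lambda>X. indicator {..X} t *\<^sub>R (indicator {0<..} t *\<^sub>R F t)) \<longlongrightarrow> indicator {0<..} t *\<^sub>R F t) at_top"
    proof (rule AE_I2)
      fix t
      show "((\<lambda>X. indicator {..X} t *\<^sub>R (indicator {0<..} t *\<^sub>R F t)) \<longlongrightarrow> indicator {0<..} t *\<^sub>R F t) at_top"
        by (rule tendsto_eventually, rule eventually_mono[OF eventually_ge_at_top[of t]]) (auto simp: indicator_def)
    qed
    show "\<forall>\<^sub>F X in at_top. AE t in lborel. norm (indicator {..X} t *\<^sub>R (indicator {0<..} t *\<^sub>R F t)) \<le> norm (indicator {0<..} t *\<^sub>R F t)"
      by (auto intro!: always_eventually simp: indicator_def)
    show "(\<lambda>t. indicator {0<..} t *\<^sub>R F t) \<in> borel_measurable lborel" using borel_measurable_integrable[OF i] .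
    then show "(\<lambda>t. indicator {..X} t *\<^sub>R (indicator {0<..} t *\<^sub>R F t)) \<in> borel_measurable lborel" for X by measurable
    show "integrable lborel (\<lambda>t. norm (indicator {0<..} t *\<^sub>R F t))" by (rule integrable_norm[OF i])
  qed
  then have "((\<lambda>X. LINT t:{0..X}|lborel. F t) \<longlongrightarrow> (LINT x|lpos. F x)) at_top"
    unfolding LINT_Icc_lpos[OF borel_measurable_integrable[OF F]] integral_lpos .
  then show ?thesis using L by (rule tendsto_unique[OF trivial_limit_at_top_linorder])
qed

lemma LINT_Icc_same [simp]: "(LINT t:{a..a::real}|lborel. g t) = (0 :: complex)"
  unfolding set_lebesgue_integral_def
proof (rule integral_eq_zero_AE)
  show "AE t in lborel. indicator {a..a} t *\<^sub>R g t = 0"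
    using AE_lborel_singleton[of a] by eventually_elim (auto simp: indicator_def)
qed

lemma csupp_integral:
  assumes f: "csupp b f" and g: "\<And>x. g x 0 = (0::complex)" and x: "b \<le> x"
  shows "(LINT t:{0..x}|lborel. g t (f t)) = (LINT t|lborel. g t (f t))"
  unfolding set_lebesgue_integral_def
proof (intro Bochner_Integration.integral_cong refl)
  fix t
  show "indicator {0..x} t *\<^sub>R g t (f t) = g t (f t)"
  proof (cases "t \<in> {0<..b}")
    case True
    then show ?thesis using x by (auto simp: indicator_def)
  next
    case False
    then have "f t = 0" using f by (auto simp: csupp_def)
    then show ?thesis by (simp add: g)
  qed
qed

context scattering
begin

text \<open>The generalised Fourier transform attached to the eigenfunctions \<phi>; there is no
  conjugation because \<phi> is real.\<close>

definition ftr :: "(real \<Rightarrow> complex) \<Rightarrow> real \<Rightarrow> complex" where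
  "ftr f \<mu> = (LINT x|lborel. cphi \<mu> x * f x)"

lemma prim_mult_csupp:
  assumes f: "csupp b f" and g: "continuous_on {0..} g"
  shows "prim 0 (\<lambda>x. LINT t:{0..x}|lborel. g t * f t) (\<lambda>x. g x * f x)"
proof (rule primI)
  fix x :: real
  have "set_integrable lborel {0..x} f"
    using csupp_integrable[OF f] by (auto simp: set_integrable_def intro!: integrable_mult_indicator)
  from set_integrable_mult_continuous[OF this continuous_on_subset[OF g]]
  show "set_integrable lborel {0..x} (\<lambda>t. g t * f t)" by (simp add: mult.commute)
  show "(LINT t:{0..x}|lborel. g t * f t) - (LINT t:{0..0}|lborel. g t * f t) = (LINT t:{0..x}|lborel. g t * f t)"
    unfolding LINT_Icc_same by simp
qed

lemma norm_LINT_csupp_le: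
  assumes f: "csupp b f" and i: "set_integrable lborel {s..t} (\<lambda>x. g x * f x)"
    and g: "\<And>x. x \<ge> 0 \<Longrightarrow> cmod (g x) \<le> B"
  shows "cmod (LINT x:{s..t}|lborel. g x * f x) \<le> B * (LINT x|lborel. cmod (f x))"
proof -
  have B: "B \<ge> 0" using order_trans[OF norm_ge_zero g[OF order_refl]] .
  have "cmod (LINT x:{s..t}|lborel. g x * f x) \<le> (LINT x|lborel. B * cmod (f x))"
    unfolding set_lebesgue_integral_def
  proof (rule order_trans[OF integral_norm_bound integral_mono])
    show "integrable lborel (\<lambda>x. norm (indicator {s..t} x *\<^sub>R (g x * f x)))"
      using i unfolding set_integrable_def by (rule integrable_norm)
    show "integrable lborel (\<lambda>x. B * cmod (f x))" using csupp_integrable[OF f] by simp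
    show "norm (indicator {s..t} x *\<^sub>R (g x * f x)) \<le> B * cmod (f x)" for x
    proof (cases "x > 0")
      case True
      then have "cmod (g x) * cmod (f x) \<le> B * cmod (f x)" using g[of x] by (intro mult_right_mono) auto
      then show ?thesis using B by (auto simp: indicator_def norm_mult)
    next
      case False
      then have "f x = 0" using f by (simp add: csupp_def)
      then show ?thesis by simp
    qed
  qed
  then show ?thesis by simp
qed

text \<open>The limit of the resolvent applied to \<open>f\<close> as the spectral parameter approaches \<open>\<mu> + i0\<close>,
  by variation of parameters; its energy flux at infinity gives the imaginary part of \<open>(u, f)\<close>.\<close>

lemma outgoing_solution:
  assumes f: "csupp b f" and b: "b > 0" and ab: "0 < \<alpha>" "\<alpha> \<le> \<beta>"
  obtains B where "B > 0" and "\<And>\<mu>. \<mu> \<in> {\<alpha>..\<beta>} \<Longrightarrow> \<exists>u v. prim 0 u (\<lambda>x. v x / cp x) \<and>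
      prim 0 v (\<lambda>x. (cq x - complex_of_real \<mu>) * u x - f x) \<and> u 0 = 0 \<and>
      (\<forall>x\<ge>0. cmod (u x) \<le> B \<and> cmod (v x) \<le> B) \<and>
      ((\<lambda>x. v x - \<i> * complex_of_real (mom \<mu>) * u x) \<longlongrightarrow> 0) at_top \<and>
      Im (ip u f) = \<kappa> \<mu> * (cmod (ftr f \<mu>))^2"
proof -
  obtain B1 where B1: "B1 > 0" "\<And>\<mu> x. \<mu> \<in> {\<alpha>..\<beta>} \<Longrightarrow> x \<ge> 0 \<Longrightarrow> nsol (cphi \<mu>) (vphi \<mu>) x \<le> B1"
    by (rule phi_bounded[OF ab]) (assumption | rule that)+
  obtain B2 where B2: "B2 > 0" "\<And>\<mu> \<psi> v x. \<lbrakk>\<mu> \<in> {\<alpha>..\<beta>}; sol \<mu> \<psi> v;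
    ((\<lambda>x. v x - \<i> * complex_of_real (mom \<mu>) * \<psi> x) \<longlongrightarrow> 0) at_top;
    ((\<lambda>x. (cmod (\<psi> x))^2) \<longlongrightarrow> \<kappa> \<mu> / mom \<mu>) at_top; x \<ge> 0\<rbrakk> \<Longrightarrow> nsol \<psi> v x \<le> B2"
    by (rule psi_bounded[OF ab]) (assumption | rule that)+
  define I where "I = (LINT x|lborel. cmod (f x))"
  have I: "I \<ge> 0" unfolding I_def by (intro integral_nonneg_AE) auto
  \<comment> \<open>Each of the two summands below is a product of two bounded factors and the L1
    norm of \<open>f\<close>; the 1 keeps \<open>B\<close> positive when \<open>f\<close>
    vanishes.\<close>
  define B where "B = 2 * (B1 * B2 * I) + 1"
  show ?thesis
  proof (rule that[of B])
    show "B > 0" using B1(1) B2(1) I by (simp add: B_def add_nonneg_pos)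
    fix \<mu> assume mu: "\<mu> \<in> {\<alpha>..\<beta>}"
    then have m: "\<mu> > 0" using ab by simp
    obtain \<psi> w where W: "sol \<mu> \<psi> w" "\<psi> 0 = 1 / cp 0" "\<And>x. x \<ge> 0 \<Longrightarrow> Im (cnj (\<psi> x) * w x) = \<kappa> \<mu>"
      "((\<lambda>x. w x - \<i> * complex_of_real (mom \<mu>) * \<psi> x) \<longlongrightarrow> 0) at_top"
      "((\<lambda>x. (cmod (\<psi> x))^2) \<longlongrightarrow> \<kappa> \<mu> / mom \<mu>) at_top"
      by (rule Weyl_ex[OF m]) (assumption | rule that)+
    note s1 = sol_prim[OF vphi(1)[OF m]] and s2 = sol_prim[OF W(1)]
    define f1 where "f1 = (\<lambda>x. LINT t:{0..x}|lborel. cphi \<mu> t * f t)"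
    define f2 where "f2 = (\<lambda>x. LINT t:{0..x}|lborel. \<psi> t * f t)"
    have p1: "prim 0 f1 (\<lambda>x. cphi \<mu> x * f x)" unfolding f1_def by (rule prim_mult_csupp[OF f prim_cont[OF s1(1)]])
    have p2: "prim 0 f2 (\<lambda>x. \<psi> x * f x)" unfolding f2_def by (rule prim_mult_csupp[OF f prim_cont[OF s2(1)]])
    have p3: "prim 0 (\<lambda>x. f2 b + (-1) * f2 x) (\<lambda>x. 0 + (-1) * (\<psi> x * f x))"
      by (intro prim_lin prim_const p2)
    \<comment> \<open>Green's formula: \<psi>(x) times the integral of \<phi> f up to x, plus
      \<phi>(x) times the integral of \<psi> f from x to b. The Wronskian \<open>wr\<close> equals
      1, so no denominator appears.\<close>
    define u where "u x = \<psi> x * f1 x + 1 * (cphi \<mu> x * (f2 b + (-1) * f2 x))" for x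
    define v where "v x = w x * f1 x + 1 * (vphi \<mu> x * (f2 b + (-1) * f2 x))" for x
    have wr: "vphi \<mu> x * \<psi> x - cphi \<mu> x * w x = 1" if "x \<ge> 0" for x
      using Wronskian_const[OF vphi(1)[OF m] W(1) that] vphi(2,3)[OF m] W(2) p_pos[of 0] by simp
    have pu: "prim 0 u (\<lambda>x. v x / cp x)"
      by (rule prim_cong[OF prim_lin[OF prim_mult[OF s2(1) p1] prim_mult[OF s1(1) p3], of 1]])
        (simp_all add: u_def v_def add_divide_distrib algebra_simps diff_divide_distrib)
    have pv: "prim 0 v (\<lambda>x. (cq x - complex_of_real \<mu>) * u x - f x)"
    proof (rule prim_cong[OF prim_lin[OF prim_mult[OF s2(2) p1] prim_mult[OF s1(2) p3], of 1]])
      fix x :: real assume x: "0 \<le> x"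
      have "(cq x - complex_of_real \<mu>) * \<psi> x * f1 x + w x * (cphi \<mu> x * f x) +
         1 * ((cq x - complex_of_real \<mu>) * cphi \<mu> x * (f2 b + - 1 * f2 x) + vphi \<mu> x * (0 + - 1 * (\<psi> x * f x)))
        = (cq x - complex_of_real \<mu>) * u x - (vphi \<mu> x * \<psi> x - cphi \<mu> x * w x) * f x"
        by (simp add: u_def algebra_simps)
      then show "(cq x - complex_of_real \<mu>) * \<psi> x * f1 x + w x * (cphi \<mu> x * f x) +
         1 * ((cq x - complex_of_real \<mu>) * cphi \<mu> x * (f2 b + - 1 * f2 x) + vphi \<mu> x * (0 + - 1 * (\<psi> x * f x)))
        = (cq x - complex_of_real \<mu>) * u x - f x" unfolding wr[OF x] by simp
    qed (simp add: v_def)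
    have phiB: "cmod (cphi \<mu> x) \<le> B1" "cmod (vphi \<mu> x) \<le> B1" if "x \<ge> 0" for x
      using B1(2)[OF mu that] norm_ge_zero[of "cphi \<mu> x"] norm_ge_zero[of "vphi \<mu> x"] unfolding nsol_def by linarith+
    have psiB: "cmod (\<psi> x) \<le> B2" "cmod (w x) \<le> B2" if "x \<ge> 0" for x
      using B2(2)[OF mu W(1,4,5) that] norm_ge_zero[of "\<psi> x"] norm_ge_zero[of "w x"] unfolding nsol_def by linarith+
    have f1B: "cmod (f1 x) \<le> B1 * I" if "x \<ge> 0" for x
      unfolding f1_def I_def by (rule norm_LINT_csupp_le[OF f prim_integrable[OF p1 order_refl] phiB(1)])
    have f2b: "f2 x = f2 b" if "x \<ge> b" for x
      using csupp_integral[OF f, of "\<lambda>t z. \<psi> t * z" x] csupp_integral[OF f, of "\<lambda>t z. \<psi> t * z" b] that by (simp add: f2_def)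
    have f1b: "f1 x = ftr f \<mu>" if "x \<ge> b" for x
      using csupp_integral[OF f, of "\<lambda>t z. cphi \<mu> t * z" x] that by (simp add: f1_def ftr_def)
    have f2B: "cmod (f2 b + (-1) * f2 x) \<le> B2 * I" if "x \<ge> 0" for x
    proof (cases "x \<le> b")
      case True
      then have "f2 b + (-1) * f2 x = (LINT t:{x..b}|lborel. \<psi> t * f t)" using prim_diff[OF p2 that True] by simp
      then show ?thesis unfolding I_def
        using norm_LINT_csupp_le[OF f prim_integrable[OF p2 that, of b] psiB(1)] by simp
    next
      case False
      then show ?thesis using f2b[of x] B2(1) I by simp
    qed
    have uB: "cmod (u x) \<le> B \<and> cmod (v x) \<le> B" if x: "x \<ge> 0" for x
    proof -
      have "cmod (u x) \<le> cmod (\<psi> x) * cmod (f1 x) + cmod (cphi \<mu> x) * cmod (f2 b + (-1) * f2 x)"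
        unfolding u_def using norm_triangle_ineq[of "\<psi> x * f1 x" "1 * (cphi \<mu> x * (f2 b + (-1) * f2 x))"] by (simp add: norm_mult)
      also have "\<dots> \<le> B2 * (B1 * I) + B1 * (B2 * I)"
        using psiB(1)[OF x] phiB(1)[OF x] f1B[OF x] f2B[OF x] B1(1) B2(1) by (intro add_mono mult_mono) auto
      also have "\<dots> \<le> B" by (simp add: B_def)
      finally have 1: "cmod (u x) \<le> B" .
      have "cmod (v x) \<le> cmod (w x) * cmod (f1 x) + cmod (vphi \<mu> x) * cmod (f2 b + (-1) * f2 x)"
        unfolding v_def using norm_triangle_ineq[of "w x * f1 x" "1 * (vphi \<mu> x * (f2 b + (-1) * f2 x))"] by (simp add: norm_mult)
      also have "\<dots> \<le> B2 * (B1 * I) + B1 * (B2 * I)"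
        using psiB(2)[OF x] phiB(2)[OF x] f1B[OF x] f2B[OF x] B1(1) B2(1) by (intro add_mono mult_mono) auto
      also have "\<dots> \<le> B" by (simp add: B_def)
      finally show ?thesis using 1 by simp
    qed
    have f10: "f1 0 = 0" unfolding f1_def by (rule LINT_Icc_same)
    have u0: "u 0 = 0" using f10 vphi(2)[OF m] by (simp add: u_def)
    \<comment> \<open>Beyond the support of \<open>f\<close> only the first summand survives, so
      \<open>u\<close> is a multiple of \<psi>: it inherits the outgoing condition, and its flux is
      \<kappa> times the squared modulus of the transform.\<close>
    have ub: "u x = \<psi> x * ftr f \<mu>" "v x = w x * ftr f \<mu>" if "x \<ge> b" for x
      using f1b[OF that] f2b[OF that] by (simp_all add: u_def v_def)
    have lim: "((\<lambda>x. v x - \<i> * complex_of_real (mom \<mu>) * u x) \<longlongrightarrow> 0) at_top"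
    proof (rule Lim_transform_eventually)
      show "((\<lambda>x. (w x - \<i> * complex_of_real (mom \<mu>) * \<psi> x) * ftr f \<mu>) \<longlongrightarrow> 0) at_top"
        by (rule tendsto_mult_left_zero[OF W(4)])
      show "\<forall>\<^sub>F x in at_top. (w x - \<i> * complex_of_real (mom \<mu>) * \<psi> x) * ftr f \<mu> = v x - \<i> * complex_of_real (mom \<mu>) * u x"
        using eventually_ge_at_top[of b] by eventually_elim (simp add: ub algebra_simps)
    qed
    have "Im (ip u f) = \<kappa> \<mu> * (cmod (ftr f \<mu>))^2"
    proof -
      \<comment> \<open>In the derivative of cnj u v every term is real except - cnj u f. Hence the
        flux of \<open>u\<close> at b, where it starts from 0 at the origin, is the imaginary part
        of the pairing with \<open>f\<close>.\<close>
      let ?d = "\<lambda>x. cnj (v x / cp x) * v x + cnj (u x) * ((cq x - complex_of_real \<mu>) * u x - f x)"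
      have pr: "prim 0 (\<lambda>x. cnj (u x) * v x) ?d" by (rule prim_mult[OF prim_cnj[OF pu] pv])
      have "Im (cnj (u b) * v b) = Im (LINT x:{0..b}|lborel. ?d x)"
        using prim_diff[OF pr order_refl, of b] b u0 by simp
      also have "\<dots> = (LINT x|lborel. Im (indicator {0..b} x *\<^sub>R ?d x))"
        unfolding set_lebesgue_integral_def
        by (rule integral_Im[symmetric]) (use prim_integrable[OF pr order_refl, of b] in \<open>simp add: set_integrable_def\<close>)
      also have "\<dots> = (LINT x|lborel. Im (indicator {0<..} x *\<^sub>R (u x * cnj (f x))))"
      proof (intro Bochner_Integration.integral_cong refl)
        fix x
        show "Im (indicator {0..b} x *\<^sub>R ?d x) = Im (indicator {0<..} x *\<^sub>R (u x * cnj (f x)))"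
        proof (cases "x \<in> {0..b}")
          case True
          have "cnj (v x / cp x) * v x = complex_of_real ((cmod (v x))^2 / p x)"
            unfolding of_real_divide complex_norm_square by (simp add: mult.commute)
          moreover have "cnj (u x) * ((cq x - complex_of_real \<mu>) * u x - f x)
            = complex_of_real ((q x - \<mu>) * (cmod (u x))^2) - cnj (u x) * f x"
            unfolding of_real_mult of_real_diff complex_norm_square by (simp add: algebra_simps)
          ultimately have "Im (?d x) = - Im (cnj (u x) * f x)" by (simp only: plus_complex.sel minus_complex.sel Im_complex_of_real)
          also have "\<dots> = Im (u x * cnj (f x))" by simp
          finally show ?thesis using True f by (auto simp: indicator_def csupp_def)
        next
          case False
          then have "f x = 0" using f by (auto simp: csupp_def)
          then show ?thesis using False by simp
        qed
      qed
      also have "\<dots> = Im (ip u f)"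
        unfolding ip_eq integral_lpos
      proof (rule integral_Im)
        have "integrable lpos (\<lambda>x. u x * cnj (f x))"
        proof (rule Bochner_Integration.integrable_bound)
          show "integrable lpos (\<lambda>x. B * cmod (f x))"
            unfolding integrable_lpos using csupp_integrable[OF f] by (intro integrable_mult_indicator) auto
          show "(\<lambda>x. u x * cnj (f x)) \<in> borel_measurable lpos"
            using f by (intro borel_measurable_times measurable_cnj measurable_lpos_cont[OF prim_cont[OF pu]] measurable_lpos_borel[of f])
              (simp add: csupp_def)
          show "AE x in lpos. norm (u x * cnj (f x)) \<le> norm (B * cmod (f x))"
          proof (rule AE_I2)
            fix x assume "x \<in> space lpos"
            then have "cmod (u x) * cmod (f x) \<le> B * cmod (f x)" using uB[of x] by (intro mult_right_mono) auto
            then show "norm (u x * cnj (f x)) \<le> norm (B * cmod (f x))" by (simp add: norm_mult)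
          qed
        qed
        then show "integrable lborel (\<lambda>x. indicator {0<..} x *\<^sub>R (u x * cnj (f x)))" by (simp add: integrable_lpos)
      qed
      finally have "Im (ip u f) = Im (cnj (u b) * v b)" ..
      also have "cnj (u b) * v b = complex_of_real ((cmod (ftr f \<mu>))^2) * (cnj (\<psi> b) * w b)"
        unfolding ub[OF order_refl] complex_norm_square by (simp add: mult_ac)
      also have "Im \<dots> = (cmod (ftr f \<mu>))^2 * \<kappa> \<mu>"
        using W(3)[of b] b by (simp only: times_complex.sel Im_complex_of_real Re_complex_of_real)
      finally show ?thesis by (simp add: mult.commute)
    qed
    then show "\<exists>u v. prim 0 u (\<lambda>x. v x / cp x) \<and>
      prim 0 v (\<lambda>x. (cq x - complex_of_real \<mu>) * u x - f x) \<and> u 0 = 0 \<and>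
      (\<forall>x\<ge>0. cmod (u x) \<le> B \<and> cmod (v x) \<le> B) \<and>
      ((\<lambda>x. v x - \<i> * complex_of_real (mom \<mu>) * u x) \<longlongrightarrow> 0) at_top \<and>
      Im (ip u f) = \<kappa> \<mu> * (cmod (ftr f \<mu>))^2"
      by (rule_tac exI[of _ u], rule_tac exI[of _ v], intro conjI pu pv u0 lim) (use uB in auto)
  qed
qed

end

section \<open>The form domain and the damped outgoing solution\<close>

lemma H10_prim: "H10 h dh \<Longrightarrow> prim 0 h dh"
proof (rule primI)
  assume H: "H10 h dh"
  have h: "h x = (LINT t:{0..x}|lborel. dh t)" and i: "set_integrable lborel {0..x} dh" if "x \<ge> 0" for x
    using H that unfolding H10_def by blast+
  have "h 0 = 0" using h[OF order_refl] by (simp only: LINT_Icc_same)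
  then show "h x - h 0 = (LINT t:{0..x}|lborel. dh t)" if "0 \<le> x" for x using h[OF that] by (simp only: diff_zero)
  show "set_integrable lborel {0..x} dh" if "0 \<le> x" for x by (rule i[OF that])
qed

lemma H10_L2: "H10 h dh \<Longrightarrow> L2 h" "H10 h dh \<Longrightarrow> L2 dh"
  unfolding H10_def by blast+

lemma prim_H10:
  assumes "L2 f" "L2 df" "prim 0 f df" "f 0 = 0"
  shows "H10 f df"
  unfolding H10_def
proof (intro conjI allI impI assms(1,2))
  fix x :: real assume "0 \<le> x"
  show "set_integrable lborel {0..x} df" by (rule prim_integrable[OF assms(3) order_refl])
  show "f x = (LINT t:{0..x}|lborel. df t)" using prim_diff[OF assms(3) order_refl \<open>0 \<le> x\<close>] assms(4) by simp
qed

text \<open>Crude, from |z| \<le> 1 + |z|^2 under the integral, but sufficient twice: linear growth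
  loses against exponential decay at infinity, and local boundedness compensates for
  \<open>q\<close> being only integrable near 0.\<close>

lemma H10_growth:
  assumes H: "H10 h dh" and x: "x \<ge> 0"
  shows "cmod (h x) \<le> x + (nrm dh)^2"
proof -
  have L: "L2 dh" using H10_L2(2)[OF H] .
  have m: "dh \<in> borel_measurable lpos" and i: "integrable lpos (\<lambda>x. (cmod (dh x))^2)" using L by (auto simp: L2_iff)
  have i2: "integrable lborel (\<lambda>t. indicator {0<..} t *\<^sub>R (cmod (dh t))^2)" using i by (simp add: integrable_lpos)
  have i1: "integrable lborel (\<lambda>t. indicator {0..x} t :: real)"
    by (intro integrable_real_indicator) (auto simp: emeasure_lborel_Icc_eq)
  have "h x = (LINT t:{0..x}|lborel. dh t)" using H x unfolding H10_def by blast
  also have "\<dots> = (LINT t|lborel. indicator {..x} t *\<^sub>R (indicator {0<..} t *\<^sub>R dh t))" by (rule LINT_Icc_lpos[OF m])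
  also have "cmod \<dots> \<le> (LINT t|lborel. indicator {0..x} t + indicator {0<..} t *\<^sub>R (cmod (dh t))^2)"
  proof (rule Bochner_Integration.integral_norm_bound_integral)
    show "integrable lborel (\<lambda>t. indicator {0..x} t + indicator {0<..} t *\<^sub>R (cmod (dh t))^2)" using i1 i2 by simp
    have le: "cmod (indicator {..x} t *\<^sub>R (indicator {0<..} t *\<^sub>R dh t)) \<le> indicator {0..x} t + indicator {0<..} t *\<^sub>R (cmod (dh t))^2" for t
    proof -
      have "0 \<le> (cmod (dh t) - 1)^2" by simp
      then have "2 * cmod (dh t) \<le> 1 + (cmod (dh t))^2" by (simp add: power2_diff)
      then have "cmod (dh t) \<le> 1 + (cmod (dh t))^2" using zero_le_power2[of "cmod (dh t)"] by linarith
      then show ?thesis by (auto simp: indicator_def)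
    qed
    show "cmod (indicator {..x} t *\<^sub>R (indicator {0<..} t *\<^sub>R dh t)) \<le> indicator {0..x} t + indicator {0<..} t *\<^sub>R (cmod (dh t))^2" for t
      by (rule le)
    show "integrable lborel (\<lambda>t. indicator {..x} t *\<^sub>R (indicator {0<..} t *\<^sub>R dh t))"
    proof (rule Bochner_Integration.integrable_bound)
      show "integrable lborel (\<lambda>t. indicator {0..x} t + indicator {0<..} t *\<^sub>R (cmod (dh t))^2)" using i1 i2 by simp
      have [measurable]: "(\<lambda>t. indicator {0<..} t *\<^sub>R dh t) \<in> borel_measurable borel" using m by (simp add: measurable_lpos)
      show "(\<lambda>t. indicator {..x} t *\<^sub>R (indicator {0<..} t *\<^sub>R dh t)) \<in> borel_measurable lborel" by measurable
      show "AE t in lborel. norm (indicator {..x} t *\<^sub>R (indicator {0<..} t *\<^sub>R dh t)) \<le> norm (indicator {0..x} t + indicator {0<..} t *\<^sub>R (cmod (dh t))^2)"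
        by (rule AE_I2) (use le in \<open>simp add: order_trans[OF _ abs_ge_self]\<close>)
    qed
  qed
  also have "\<dots> = x + (nrm dh)^2"
    using i1 i2 x by (simp add: nrm_power2 integral_lpos)
  finally show ?thesis .
qed

context coefficients
begin

lemma q_measurable: "q \<in> borel_measurable lpos"
proof -
  have 1: "(\<lambda>y. indicator {0..x0} y *\<^sub>R q y) \<in> borel_measurable borel"
    using borel_measurable_integrable[OF q_int[of x0, unfolded set_integrable_def]] by simp
  have 2: "(\<lambda>y. indicator {x0<..} y *\<^sub>R q y) \<in> borel_measurable borel"
    by (rule borel_measurable_continuous_on_indicator) (auto intro: continuous_on_subset[OF q_cont])
  have e: "(\<lambda>y. indicator {0<..} y *\<^sub>R q y) = (\<lambda>y. indicator {0<..} y * (indicator {0..x0} y *\<^sub>R q y) + indicator {x0<..} y *\<^sub>R q y)"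
    using x0_pos by (auto simp: fun_eq_iff indicator_def)
  show ?thesis unfolding measurable_lpos e using 1 2 by measurable
qed

lemma p_measurable: "p \<in> borel_measurable lpos" by (rule measurable_lpos_cont[OF p_cont])

lemma q_exp_integrable:
  assumes c: "c > 0" shows "integrable lpos (\<lambda>x. \<bar>q x\<bar> * exp (- (c * x)))"
proof -
  obtain qb where qb: "\<forall>x\<ge>x0. \<bar>q x\<bar> \<le> qb" using q_bound by (rule exE)
  have qb0: "qb \<ge> 0" using qb by (metis abs_ge_zero order_refl order_trans)
  show ?thesis
  proof (rule Bochner_Integration.integrable_bound)
  have "integrable lborel (\<lambda>x. indicator {0<..} x *\<^sub>R \<bar>indicator {0..x0} x *\<^sub>R q x\<bar>)"
    using q_int[of x0, unfolded set_integrable_def] by (intro integrable_mult_indicator) auto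
  then have "integrable lpos (\<lambda>x. \<bar>indicator {0..x0} x *\<^sub>R q x\<bar>)" by (simp only: integrable_lpos)
  then show "integrable lpos (\<lambda>x. \<bar>indicator {0..x0} x *\<^sub>R q x\<bar> + qb * exp (- (c * x)))"
    by (intro Bochner_Integration.integrable_add integrable_mult_right exp_lpos(1)[OF c])
  show "(\<lambda>x. \<bar>q x\<bar> * exp (- (c * x))) \<in> borel_measurable lpos"
    by (intro borel_measurable_times borel_measurable_abs q_measurable measurable_lpos_cont continuous_intros)
  show "AE x in lpos. norm (\<bar>q x\<bar> * exp (- (c * x))) \<le> norm (\<bar>indicator {0..x0} x *\<^sub>R q x\<bar> + qb * exp (- (c * x)))"
  proof (rule AE_I2)
    fix x assume "x \<in> space lpos"
    then have x: "x > 0" by simp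
    have e1: "exp (- (c * x)) \<le> 1" using c x by simp
    show "norm (\<bar>q x\<bar> * exp (- (c * x))) \<le> norm (\<bar>indicator {0..x0} x *\<^sub>R q x\<bar> + qb * exp (- (c * x)))"
    proof (cases "x \<le> x0")
      case True
      have "\<bar>q x\<bar> * exp (- (c * x)) \<le> \<bar>q x\<bar>" using e1 by (simp add: mult_left_le)
      also have "\<dots> \<le> \<bar>q x\<bar> + qb * exp (- (c * x))" using qb0 by simp
      finally show ?thesis using True x qb0 by simp
    next
      case False
      then have "\<bar>q x\<bar> * exp (- (c * x)) \<le> qb * exp (- (c * x))" using qb by (intro mult_right_mono) auto
      then show ?thesis using False x qb0 by simp
    qed
  qed
  qed
qed

lemma hform_eq: "hform p q f df h dh = (LINT x|lpos. cp x * df x * cnj (dh x) + cq x * f x * cnj (h x))"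
  unfolding hform_def lpos_def set_lebesgue_integral_def by (subst integral_restrict_space) auto

text \<open>The Liouville variable. A damping exp (- \<epsilon> tau) satisfies p chi' = - \<epsilon>
  chi, so it brings no derivative of \<open>p\<close> into the equation.\<close>

definition tau :: "real \<Rightarrow> real" where "tau x = integral {0..x} (\<lambda>t. 1 / p t)"
definition chi :: "real \<Rightarrow> real \<Rightarrow> real" where "chi \<epsilon> x = exp (- (\<epsilon> * tau x))"

lemma tau_bounds:
  assumes x: "x \<ge> 0" shows "x / ph \<le> tau x" "tau x \<le> x / pl"
proof -
  have i: "(\<lambda>t. 1 / p t) integrable_on {0..x}"
    by (rule integrable_continuous_interval) (rule continuous_on_subset[OF inv_p_cont], auto)
  have "integral {0..x} (\<lambda>t. 1 / ph) \<le> integral {0..x} (\<lambda>t. 1 / p t)"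
    by (rule integral_le[OF integrable_const_ivl i]) (use p_pos le_ph in \<open>auto intro!: frac_le\<close>)
  then show "x / ph \<le> tau x" using x by (simp add: tau_def)
  have "integral {0..x} (\<lambda>t. 1 / p t) \<le> integral {0..x} (\<lambda>t. 1 / pl)"
    by (rule integral_le[OF i integrable_const_ivl]) (use pl_pos pl_le in \<open>auto intro!: frac_le\<close>)
  then show "tau x \<le> x / pl" using x by (simp add: tau_def)
qed

lemma chi_pos: "chi \<epsilon> x > 0" by (simp add: chi_def)

lemma chi_le:
  assumes "x \<ge> 0" "\<epsilon> > 0" shows "chi \<epsilon> x \<le> exp (- (\<epsilon> / ph * x))" "1 - chi \<epsilon> x \<le> \<epsilon> * x / pl" "chi \<epsilon> x \<le> 1"
proof -
  have "\<epsilon> / ph * x \<le> \<epsilon> * tau x" using mult_left_mono[OF tau_bounds(1)[OF assms(1)], of \<epsilon>] assms(2) by simp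
  then show 1: "chi \<epsilon> x \<le> exp (- (\<epsilon> / ph * x))" by (simp add: chi_def)
  have "1 + (- (\<epsilon> * tau x)) \<le> chi \<epsilon> x" unfolding chi_def by (rule exp_ge_add_one_self)
  moreover have "\<epsilon> * tau x \<le> \<epsilon> * x / pl" using mult_left_mono[OF tau_bounds(2)[OF assms(1)], of \<epsilon>] assms(2) by simp
  ultimately show "1 - chi \<epsilon> x \<le> \<epsilon> * x / pl" by linarith
  have "exp (- (\<epsilon> / ph * x)) \<le> 1" using assms ph_pos by simp
  then show "chi \<epsilon> x \<le> 1" using 1 by linarith
qed

lemma prim_chi: "prim 0 (\<lambda>x. complex_of_real (chi \<epsilon> x)) (\<lambda>x. complex_of_real (- \<epsilon> / p x * chi \<epsilon> x))"
proof -
  have dt: "(tau has_real_derivative 1 / p x) (at x within {0..})" if x: "x \<ge> 0" for x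
  proof -
    have "(tau has_real_derivative 1 / p x) (at x within {0..x+1})"
      unfolding tau_def by (rule integral_has_real_derivative) (use x in \<open>auto intro: continuous_on_subset[OF inv_p_cont]\<close>)
    moreover have "at x within {0..x+1} = at x within {0..}" by (rule at_within_nhd[where S="{..<x+1}"]) auto
    ultimately show ?thesis by simp
  qed
  have dc: "(chi \<epsilon> has_real_derivative (- \<epsilon> / p x * chi \<epsilon> x)) (at x within {0..})" if x: "x \<ge> 0" for x
  proof -
    have "((\<lambda>x. exp (- (\<epsilon> * tau x))) has_real_derivative exp (- (\<epsilon> * tau x)) * (- (\<epsilon> * (1 / p x)))) (at x within {0..})"
      by (rule derivative_eq_intros refl dt[OF x])+ simp
    then show ?thesis unfolding chi_def[abs_def] by (simp add: mult.commute)
  qed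
  have cc: "continuous_on {0..} (chi \<epsilon>)"
    by (rule DERIV_continuous_on[OF dc]) auto
  show ?thesis
  proof (rule prim_C1)
    have "continuous_on {0..} (\<lambda>x. - \<epsilon> * (1 / p x) * chi \<epsilon> x)"
      by (intro continuous_on_mult continuous_on_const inv_p_cont cc)
    then show "continuous_on {0..} (\<lambda>x. complex_of_real (- \<epsilon> / p x * chi \<epsilon> x))"
      by (intro continuous_on_of_real) simp
    show "((\<lambda>x. complex_of_real (chi \<epsilon> x)) has_vector_derivative complex_of_real (- \<epsilon> / p x * chi \<epsilon> x)) (at x within {0..})" if "0 \<le> x" for x
      by (rule has_vector_derivative_of_real) (use dc[OF that] in \<open>simp add: has_real_derivative_iff_has_vector_derivative\<close>)
  qed
qed

text \<open>Half of the decay rate is spent on absorbing the linear factor.\<close>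

lemma decay_mult:
  fixes x c D :: real
  assumes "c > 0" "x \<ge> 0" "D \<ge> 0"
  shows "exp (- (c * x)) * (x + D) \<le> (2 / c + D) * exp (- (c / 2 * x))"
proof -
  have e: "exp (- (c * x)) * exp (c / 2 * x) = exp (- (c / 2 * x))" by (simp add: exp_add[symmetric])
  have "c / 2 * x \<le> exp (c / 2 * x)" using exp_ge_add_one_self[of "c / 2 * x"] by linarith
  then have "x \<le> 2 / c * exp (c / 2 * x)" using assms by (simp add: field_simps)
  moreover have "D * 1 \<le> D * exp (c / 2 * x)" using assms by (intro mult_left_mono) auto
  ultimately have "x + D \<le> (2 / c + D) * exp (c / 2 * x)" by (simp add: distrib_right)
  then have "exp (- (c * x)) * (x + D) \<le> exp (- (c * x)) * ((2 / c + D) * exp (c / 2 * x))" by (intro mult_left_mono) auto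
  also have "\<dots> = (2 / c + D) * exp (- (c / 2 * x))" unfolding e[symmetric] by (simp add: mult_ac)
  finally show ?thesis .
qed

text \<open>Membership in the graph by integrating w cnj h by parts. The boundary term vanishes at 0
  because h(0) = 0, and at infinity because exponential decay of \<open>w\<close> beats the linear
  growth of form-domain functions.\<close>

lemma Hop_intro:
  assumes U: "prim 0 U (\<lambda>x. w x / cp x)" and w: "prim 0 w w'" and U0: "U 0 = 0"
    and g: "L2 g" and eq: "\<And>x. x > 0 \<Longrightarrow> cq x * U x - w' x = g x"
    and c: "c > 0" and Ub: "\<And>x. x \<ge> 0 \<Longrightarrow> cmod (U x) \<le> B * exp (- (c * x))"
    and wb: "\<And>x. x \<ge> 0 \<Longrightarrow> cmod (w x) \<le> B * exp (- (c * x))"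
  shows "Hop p q U g"
proof -
  have B: "B \<ge> 0" using order_trans[OF norm_ge_zero Ub[OF order_refl]] by simp
  have LU: "L2 U" by (rule L2_exp_decay[OF prim_cont[OF U] c Ub])
  have Lw: "L2 w" by (rule L2_exp_decay[OF prim_cont[OF w] c wb])
  have LdU: "L2 (\<lambda>x. w x / cp x)"
  proof (rule L2_exp_decay[OF _ c])
    show "continuous_on {0..} (\<lambda>x. w x / cp x)"
      using continuous_on_mult[OF prim_cont[OF w] inv_cp_cont] by simp
    show "cmod (w x / cp x) \<le> (B / pl) * exp (- (c * x))" if "x \<ge> 0" for x
    proof -
      have "cmod (w x / cp x) = cmod (w x) / p x" using p_pos[OF that] by (simp add: norm_divide)
      also have "\<dots> \<le> (B * exp (- (c * x))) / pl" using wb[OF that] pl_le[OF that] pl_pos B by (intro frac_le) auto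
      finally show ?thesis by simp
    qed
  qed
  have "hform p q U (\<lambda>x. w x / cp x) h dh = ip g h" if H: "H10 h dh" for h dh
  proof -
    note Lh = H10_L2[OF H] and ph' = H10_prim[OF H]
    have h0: "h 0 = 0" using H10_growth[OF H order_refl] H unfolding H10_def by (metis LINT_Icc_same order_refl)
    define G where "G x = w' x * cnj (h x) + w x * cnj (dh x)" for x
    have pG: "prim 0 (\<lambda>x. w x * cnj (h x)) G" unfolding G_def by (rule prim_mult[OF w prim_cnj[OF ph']])
    have i1: "integrable lpos (\<lambda>x. w x * cnj (dh x))" by (rule L2_integrable[OF Lw Lh(2)])
    have i2: "integrable lpos (\<lambda>x. g x * cnj (h x))" by (rule L2_integrable[OF g Lh(1)])
    define D where "D = (nrm dh)^2"
    have D: "D \<ge> 0" by (simp add: D_def)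
    \<comment> \<open>Near 0 the function q U need not be square integrable, so the L2 pairing does
      not apply; the growth bound on \<open>h\<close> replaces it.\<close>
    have i3: "integrable lpos (\<lambda>x. cq x * U x * cnj (h x))"
    proof (rule Bochner_Integration.integrable_bound)
      show "integrable lpos (\<lambda>x. B * (2 / c + D) * (\<bar>q x\<bar> * exp (- (c / 2 * x))))"
        by (intro integrable_mult_right q_exp_integrable) (use c in simp)
      show "(\<lambda>x. cq x * U x * cnj (h x)) \<in> borel_measurable lpos"
        by (intro borel_measurable_times measurable_compose[OF q_measurable borel_measurable_of_real] measurable_cnj
            measurable_lpos_cont[OF prim_cont[OF U]] measurable_lpos_cont[OF prim_cont[OF ph']])
      show "AE x in lpos. norm (cq x * U x * cnj (h x)) \<le> norm (B * (2 / c + D) * (\<bar>q x\<bar> * exp (- (c / 2 * x))))"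
      proof (rule AE_I2)
        fix x assume "x \<in> space lpos"
        then have x: "x \<ge> 0" by simp
        have "cmod (U x) * cmod (h x) \<le> (B * exp (- (c * x))) * (x + D)"
          using Ub[OF x] H10_growth[OF H x] B D_def by (intro mult_mono) auto
        also have "\<dots> \<le> B * ((2 / c + D) * exp (- (c / 2 * x)))"
          unfolding mult.assoc using decay_mult[OF c x D] B by (intro mult_left_mono) auto
        finally have "\<bar>q x\<bar> * (cmod (U x) * cmod (h x)) \<le> \<bar>q x\<bar> * (B * ((2 / c + D) * exp (- (c / 2 * x))))"
          by (intro mult_left_mono) auto
        also have "\<dots> = B * (2 / c + D) * (\<bar>q x\<bar> * exp (- (c / 2 * x)))" by (simp add: mult_ac)
        finally show "norm (cq x * U x * cnj (h x)) \<le> norm (B * (2 / c + D) * (\<bar>q x\<bar> * exp (- (c / 2 * x))))"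
          using B D c by (simp add: norm_mult mult.assoc abs_mult)
      qed
    qed
    have Geq: "G x = w x * cnj (dh x) + cq x * U x * cnj (h x) - g x * cnj (h x)" if "x > 0" for x
      using eq[OF that] by (simp add: G_def algebra_simps flip: eq[OF that])
    have iG': "integrable lpos (\<lambda>x. w x * cnj (dh x) + cq x * U x * cnj (h x) - g x * cnj (h x))"
      by (intro Bochner_Integration.integrable_diff Bochner_Integration.integrable_add i1 i2 i3)
    have iG: "integrable lpos G"
      using iG' by (rule Bochner_Integration.integrable_cong[THEN iffD1, rotated 2]) (auto simp: Geq)
    have "(LINT x|lpos. G x) = 0"
    proof (rule integral_lpos_limit[OF iG])
      show "((\<lambda>X. LINT t:{0..X}|lborel. G t) \<longlongrightarrow> 0) at_top"
      proof (rule Lim_null_comparison)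
        show "\<forall>\<^sub>F X in at_top. norm (LINT t:{0..X}|lborel. G t) \<le> B * ((2 / c + D) * exp (- (c / 2 * X)))"
          using eventually_ge_at_top[of 0]
        proof eventually_elim
          case (elim X)
          have "(LINT t:{0..X}|lborel. G t) = w X * cnj (h X)" using prim_diff[OF pG order_refl elim] h0 by simp
          then have "norm (LINT t:{0..X}|lborel. G t) = cmod (w X) * cmod (h X)" by (simp add: norm_mult)
          also have "\<dots> \<le> (B * exp (- (c * X))) * (X + D)"
            using wb[OF elim] H10_growth[OF H elim] B D_def by (intro mult_mono) auto
          also have "\<dots> \<le> B * ((2 / c + D) * exp (- (c / 2 * X)))"
            unfolding mult.assoc using decay_mult[OF c elim D] B by (intro mult_left_mono) auto
          finally show ?case .
        qed
        have "((\<lambda>X. exp (- (c / 2 * X))) \<longlongrightarrow> 0) at_top" using c by (intro exp_decay_tendsto) simp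
        then show "((\<lambda>X. B * ((2 / c + D) * exp (- (c / 2 * X)))) \<longlongrightarrow> 0) at_top"
          by (intro tendsto_mult_right_zero)
      qed
    qed
    moreover have "(LINT x|lpos. G x) = (LINT x|lpos. w x * cnj (dh x) + cq x * U x * cnj (h x) - g x * cnj (h x))"
      by (rule Bochner_Integration.integral_cong) (auto simp: Geq)
    moreover have "\<dots> = (LINT x|lpos. w x * cnj (dh x) + cq x * U x * cnj (h x)) - ip g h"
      unfolding ip_eq by (rule Bochner_Integration.integral_diff) (intro Bochner_Integration.integrable_add i1 i2 i3)+
    moreover have "hform p q U (\<lambda>x. w x / cp x) h dh = (LINT x|lpos. w x * cnj (dh x) + cq x * U x * cnj (h x))"
      unfolding hform_eq
    proof (rule Bochner_Integration.integral_cong[OF refl])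
      fix x assume "x \<in> space lpos"
      then have "cp x \<noteq> 0" using p_pos[of x] by simp
      then show "cp x * (w x / cp x) * cnj (dh x) + cq x * U x * cnj (h x) = w x * cnj (dh x) + cq x * U x * cnj (h x)" by simp
    qed
    ultimately show ?thesis by simp
  qed
  then show ?thesis
    unfolding Hop_def using LU g prim_H10[OF LU LdU U U0] aeq_refl by blast
qed

text \<open>By p chi' = - \<epsilon> chi the residual at energy \<mu> + 2 i \<epsilon> k is (chi -
  1) f + 2 \<epsilon> chi (v/p - i k u) - \<epsilon>^2 chi u / p. The imaginary part 2 \<epsilon> k
  is dictated by the middle term, whose bracket is small beyond \<open>Y\<close> for an outgoing
  solution. The squared norm of chi is at most \<open>ph / (2 * \<epsilon>)\<close>, so this term
  costs only a multiple of \<epsilon> s^2 there.\<close>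

lemma damped_resolvent:
  fixes b B \<mu> \<epsilon> :: real
  assumes f: "csupp b f" and b: "b > 0" and mu: "\<mu> > 0" and eps: "\<epsilon> > 0"
    and u: "prim 0 u (\<lambda>x. v x / cp x)" and v: "prim 0 v (\<lambda>x. (cq x - complex_of_real \<mu>) * u x - f x)"
    and u0: "u 0 = 0" and B: "\<And>x. x \<ge> 0 \<Longrightarrow> cmod (u x) \<le> B" "\<And>x. x \<ge> 0 \<Longrightarrow> cmod (v x) \<le> B"
    and s: "\<And>x. x \<ge> Y \<Longrightarrow> cmod (v x / cp x - \<i> * complex_of_real k * u x) \<le> s" and Y: "Y \<ge> 0" and k: "k \<ge> 0"
  defines "U \<equiv> \<lambda>x. complex_of_real (chi \<epsilon> x) * u x"
  defines "g \<equiv> \<lambda>x. complex_of_real (chi \<epsilon> x) * f x + (complex_of_real \<mu> * U x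
      + 2 * complex_of_real \<epsilon> * (complex_of_real (chi \<epsilon> x) * v x / cp x) - (complex_of_real \<epsilon>)^2 * U x / cp x)"
  shows "Hop p q U g"
    and "(nrm (\<lambda>x. g x - Complex \<mu> (2 * \<epsilon> * k) * U x - f x))^2 \<le>
       3 * (\<epsilon> * b / pl)^2 * (nrm f)^2 + 12 * \<epsilon>^2 * ((B / pl + k * B)^2 * Y + s^2 * (ph / (2 * \<epsilon>)))
         + 3 * \<epsilon>^4 * (B / pl)^2 * (ph / (2 * \<epsilon>))"
    and "cmod (ip U f - ip u f) \<le> \<epsilon> * b / pl * B * (LINT x|lborel. cmod (f x))"
proof -
  \<comment> \<open>Since \<open>tau x\<close> is at least \<open>x / ph\<close>, the damping factor
    is at most exp (- c x).\<close>
  define c where "c = \<epsilon> / ph"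
  have c: "c > 0" using eps ph_pos by (simp add: c_def)
  define X where "X x = complex_of_real (chi \<epsilon> x)" for x
  have nX: "cmod (X x) = chi \<epsilon> x" for x using chi_pos[of \<epsilon> x] by (simp add: X_def)
  have Xe: "cmod (X x) \<le> exp (- (c * x))" if "x \<ge> 0" for x unfolding nX c_def by (rule chi_le(1)[OF that eps])
  have B0: "B \<ge> 0" using order_trans[OF norm_ge_zero B(1)[OF order_refl]] .
  note pX = prim_chi[of \<epsilon>, folded X_def]
  have cX: "continuous_on {0..} X" using prim_cont[OF pX] .
  have cu: "continuous_on {0..} u" and cv: "continuous_on {0..} v" using prim_cont[OF u] prim_cont[OF v] .
  have cU: "continuous_on {0..} U" unfolding U_def X_def[symmetric] by (intro continuous_on_mult cX cu)
  define w where "w = (\<lambda>x. X x * (v x + (- complex_of_real \<epsilon>) * u x))"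
  define w' where "w' = (\<lambda>x. complex_of_real (- \<epsilon> / p x * chi \<epsilon> x) * (v x + (- complex_of_real \<epsilon>) * u x)
     + X x * (((cq x - complex_of_real \<mu>) * u x - f x) + (- complex_of_real \<epsilon>) * (v x / cp x)))"
  have pw: "prim 0 w w'" unfolding w_def w'_def by (rule prim_mult[OF pX prim_lin[OF v u]])
  have pU: "prim 0 U (\<lambda>x. w x / cp x)"
    by (rule prim_cong[OF prim_mult[OF pX u]]) (simp_all add: U_def w_def X_def diff_divide_distrib algebra_simps)
  have Ub: "cmod (U x) \<le> ((1 + \<epsilon>) * B) * exp (- (c * x))" if "x \<ge> 0" for x
  proof -
    have "cmod (U x) \<le> exp (- (c * x)) * B"
      unfolding U_def X_def[symmetric] norm_mult by (intro mult_mono Xe[OF that] B(1)[OF that]) auto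
    also have "\<dots> \<le> exp (- (c * x)) * ((1 + \<epsilon>) * B)" using B0 eps by (intro mult_left_mono) (auto simp: algebra_simps)
    finally show ?thesis by (simp add: mult.commute)
  qed
  have wb: "cmod (w x) \<le> ((1 + \<epsilon>) * B) * exp (- (c * x))" if "x \<ge> 0" for x
  proof -
    have "cmod (v x + (- complex_of_real \<epsilon>) * u x) \<le> cmod (v x) + cmod ((- complex_of_real \<epsilon>) * u x)" by (rule norm_triangle_ineq)
    also have "cmod ((- complex_of_real \<epsilon>) * u x) = \<epsilon> * cmod (u x)" using eps by (simp add: norm_mult)
    also have "cmod (v x) + \<epsilon> * cmod (u x) \<le> B + \<epsilon> * B" using B(1)[OF that] B(2)[OF that] eps by (intro add_mono mult_left_mono) auto
    finally have 1: "cmod (v x + (- complex_of_real \<epsilon>) * u x) \<le> (1 + \<epsilon>) * B" by (simp add: algebra_simps)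
    have "cmod (w x) \<le> exp (- (c * x)) * ((1 + \<epsilon>) * B)"
      unfolding w_def norm_mult by (intro mult_mono Xe[OF that] 1) auto
    then show ?thesis by (simp add: mult.commute)
  qed
  define g2 where "g2 x = complex_of_real \<mu> * U x + 2 * complex_of_real \<epsilon> * (X x * v x / cp x) - (complex_of_real \<epsilon>)^2 * U x / cp x" for x
  have geq: "g = (\<lambda>x. X x * f x + g2 x)" by (simp add: g_def g2_def X_def fun_eq_iff)
  have fm: "f \<in> borel_measurable lpos" using csupp_L2[OF f] by (simp add: L2_iff)
  have L1: "L2 (\<lambda>x. X x * f x)"
  proof (rule L2_bound[OF _ csupp_L2[OF f]])
    show "(\<lambda>x. X x * f x) \<in> borel_measurable lpos" by (intro borel_measurable_times measurable_lpos_cont[OF cX] fm)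
    show "cmod (X x * f x) \<le> cmod (f x)" if "x > 0" for x
      unfolding norm_mult nX using chi_le(3)[of x \<epsilon>] chi_pos[of \<epsilon> x] that eps by (intro mult_left_le_one_le) auto
  qed
  have ip1: "cmod (z / cp x) \<le> cmod z / pl" if "x \<ge> 0" for x z
    unfolding norm_divide norm_of_real using p_pos[OF that] pl_le[OF that] pl_pos by (intro divide_left_mono) auto
  have L2': "L2 g2"
  proof -
    have a: "L2 U" by (rule L2_exp_decay[OF cU c Ub])
    have b': "L2 (\<lambda>x. X x * v x / cp x)"
    proof (rule L2_exp_decay[OF _ c])
      show "continuous_on {0..} (\<lambda>x. X x * v x / cp x)"
        using continuous_on_mult[OF continuous_on_mult[OF cX cv] inv_cp_cont] by simp
      show "cmod (X x * v x / cp x) \<le> (B / pl) * exp (- (c * x))" if "x \<ge> 0" for x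
      proof -
        have "cmod (X x * v x) \<le> exp (- (c * x)) * B" unfolding norm_mult by (intro mult_mono Xe[OF that] B(2)[OF that]) auto
        then have "cmod (X x * v x) / pl \<le> (exp (- (c * x)) * B) / pl" using pl_pos by (intro divide_right_mono) auto
        then show ?thesis using ip1[OF that, of "X x * v x"] by (simp add: mult.commute)
      qed
    qed
    have c': "L2 (\<lambda>x. U x / cp x)"
    proof (rule L2_exp_decay[OF _ c])
      show "continuous_on {0..} (\<lambda>x. U x / cp x)" using continuous_on_mult[OF cU inv_cp_cont] by simp
      show "cmod (U x / cp x) \<le> (((1 + \<epsilon>) * B) / pl) * exp (- (c * x))" if "x \<ge> 0" for x
        using order_trans[OF ip1[OF that, of "U x"] divide_right_mono[OF Ub[OF that], of pl]] pl_pos by simp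
    qed
    have "L2 (\<lambda>x. (complex_of_real \<mu> * U x + (2 * complex_of_real \<epsilon>) * (X x * v x / cp x)) + (- ((complex_of_real \<epsilon>)^2)) * (U x / cp x))"
      by (intro L2_lin L2_scale a b' c')
    then show ?thesis by (simp add: g2_def[abs_def])
  qed
  have Lg: "L2 g" unfolding geq by (rule L2_add[OF L1 L2'])
  have U0: "U 0 = 0" using u0 by (simp add: U_def)
  show "Hop p q U g"
  proof (rule Hop_intro[OF pU pw U0 Lg _ c Ub wb])
    fix x :: real assume "x > 0"
    then have cpx: "cp x \<noteq> 0" using p_pos[of x] by simp
    show "cq x * U x - w' x = g x"
      unfolding geq g2_def w'_def U_def X_def using cpx by (simp add: field_simps power2_eq_square)
  qed assumption+
  define r where "r x = g x - Complex \<mu> (2 * \<epsilon> * k) * U x - f x" for x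
  define E where "E x = exp (- (2 * c * x))" for x
  \<comment> \<open>The 3 comes from squaring a sum of three terms; 12 is that 3 times the square of
    the factor 2 in 2 \<epsilon>.\<close>
  define bd where "bd x = 3 * (\<epsilon> * b / pl)^2 * (cmod (f x))^2 + 12 * \<epsilon>^2 * ((B / pl + k * B)^2 * indicator {0..Y} x + s^2 * E x)
         + 3 * \<epsilon>^4 * (B / pl)^2 * E x" for x
  have XE: "(cmod (X x))^2 \<le> E x" if "x \<ge> 0" for x
  proof -
    have "(cmod (X x))^2 \<le> (exp (- (c * x)))^2" by (intro power_mono Xe[OF that]) auto
    also have "\<dots> = E x" by (simp add: E_def exp_double[symmetric] power2_eq_square exp_add[symmetric])
    finally show ?thesis .
  qed
  have s0: "s \<ge> 0" using order_trans[OF norm_ge_zero s[OF order_refl]] .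
  have rb: "(cmod (r x))^2 \<le> bd x" if x: "x > 0" for x
  proof -
    have x0: "x \<ge> 0" using x by simp
    define g0 where "g0 = v x / cp x - \<i> * complex_of_real k * u x"
    define A1 where "A1 = (X x - 1) * f x"
    define A2 where "A2 = 2 * complex_of_real \<epsilon> * (X x * g0)"
    define A3 where "A3 = (complex_of_real \<epsilon>)^2 * (X x * (u x / cp x))"
    have z: "Complex \<mu> (2 * \<epsilon> * k) = complex_of_real \<mu> + 2 * complex_of_real \<epsilon> * (\<i> * complex_of_real k)"
      by (simp add: complex_eq_iff)
    have req: "r x = A1 + A2 - A3"
      unfolding r_def geq g2_def z A1_def A2_def A3_def g0_def U_def X_def by (simp add: algebra_simps)
    have "cmod (r x) \<le> cmod A1 + cmod A2 + cmod A3"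
      unfolding req using norm_triangle_ineq4[of "A1 + A2" A3] norm_triangle_ineq[of A1 A2] by linarith
    then have "(cmod (r x))^2 \<le> (cmod A1 + cmod A2 + cmod A3)^2" by (intro power_mono) auto
    also have "\<dots> \<le> 3 * (cmod A1)^2 + 3 * (cmod A2)^2 + 3 * (cmod A3)^2"
      using sum_squares_bound[of "cmod A1" "cmod A2"] sum_squares_bound[of "cmod A1" "cmod A3"] sum_squares_bound[of "cmod A2" "cmod A3"]
      by (simp add: power2_eq_square algebra_simps)
    finally have 0: "(cmod (r x))^2 \<le> 3 * (cmod A1)^2 + 3 * (cmod A2)^2 + 3 * (cmod A3)^2" .
    have 1: "(cmod A1)^2 \<le> (\<epsilon> * b / pl)^2 * (cmod (f x))^2"
    proof (cases "x \<le> b")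
      case True
      have "cmod (X x - 1) = 1 - chi \<epsilon> x"
      proof -
        have "X x - 1 = complex_of_real (chi \<epsilon> x - 1)" by (simp add: X_def)
        then have "cmod (X x - 1) = \<bar>chi \<epsilon> x - 1\<bar>" by (simp only: norm_of_real)
        then show ?thesis using chi_le(3)[OF x0 eps] by simp
      qed
      also have "\<dots> \<le> \<epsilon> * x / pl" by (rule chi_le(2)[OF x0 eps])
      also have "\<dots> \<le> \<epsilon> * b / pl" using True eps pl_pos by (simp add: divide_right_mono)
      finally have "(cmod (X x - 1))^2 \<le> (\<epsilon> * b / pl)^2" by (intro power_mono) auto
      then show ?thesis unfolding A1_def norm_mult power_mult_distrib by (intro mult_right_mono) auto
    next
      case False
      then have "f x = 0" using f by (auto simp: csupp_def)
      then show ?thesis by (simp add: A1_def)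
    qed
    \<comment> \<open>Up to \<open>Y\<close> only the crude bound on the bracket is available, on an
      interval of finite length; beyond \<open>Y\<close> the bracket is at most \<open>s\<close> and
      the damping provides integrability.\<close>
    have g0: "(cmod g0)^2 * (cmod (X x))^2 \<le> (B / pl + k * B)^2 * indicator {0..Y} x + s^2 * E x"
    proof (cases "x \<le> Y")
      case True
      have "cmod g0 \<le> cmod (v x / cp x) + cmod (\<i> * complex_of_real k * u x)" unfolding g0_def by (rule norm_triangle_ineq4)
      also have "\<dots> \<le> B / pl + k * B"
      proof (rule add_mono)
        show "cmod (v x / cp x) \<le> B / pl"
          using order_trans[OF ip1[OF x0, of "v x"] divide_right_mono[OF B(2)[OF x0], of pl]] pl_pos by simp
        show "cmod (\<i> * complex_of_real k * u x) \<le> k * B" using B(1)[OF x0] k by (simp add: norm_mult mult_left_mono)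
      qed
      finally have "(cmod g0)^2 \<le> (B / pl + k * B)^2" by (intro power_mono) auto
      moreover have "(cmod (X x))^2 \<le> 1" unfolding nX using chi_le(3)[OF x0 eps] chi_pos[of \<epsilon> x] by (simp add: power_le_one)
      ultimately have "(cmod g0)^2 * (cmod (X x))^2 \<le> (B / pl + k * B)^2 * 1" by (intro mult_mono) auto
      moreover have "0 \<le> s^2 * E x" by (simp add: E_def)
      ultimately show ?thesis using True x by simp
    next
      case False
      then have "(cmod g0)^2 \<le> s^2" using s[of x] unfolding g0_def by (intro power_mono) auto
      then have "(cmod g0)^2 * (cmod (X x))^2 \<le> s^2 * E x" using XE[OF x0] by (intro mult_mono) auto
      then show ?thesis using False by simp
    qed
    have 2: "(cmod A2)^2 = 4 * \<epsilon>^2 * ((cmod g0)^2 * (cmod (X x))^2)"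
      unfolding A2_def using eps by (simp add: norm_mult power_mult_distrib)
    have 3: "(cmod A3)^2 \<le> \<epsilon>^4 * ((B / pl)^2 * E x)"
    proof -
      have "cmod (u x / cp x) \<le> B / pl"
        using order_trans[OF ip1[OF x0, of "u x"] divide_right_mono[OF B(1)[OF x0], of pl]] pl_pos by simp
      then have "(cmod (u x / cp x))^2 \<le> (B / pl)^2" by (intro power_mono) auto
      then have "(cmod (u x / cp x))^2 * (cmod (X x))^2 \<le> (B / pl)^2 * E x" using XE[OF x0] by (intro mult_mono) auto
      then have "\<epsilon>^4 * ((cmod (u x / cp x))^2 * (cmod (X x))^2) \<le> \<epsilon>^4 * ((B / pl)^2 * E x)" by (intro mult_left_mono) auto
      moreover have "(cmod A3)^2 = \<epsilon>^4 * ((cmod (u x / cp x))^2 * (cmod (X x))^2)"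
        unfolding A3_def norm_mult power_mult_distrib norm_power norm_of_real power_mult[symmetric] using eps by (simp add: mult_ac)
      ultimately show ?thesis by simp
    qed
    have "3 * (cmod A2)^2 \<le> 12 * \<epsilon>^2 * ((B / pl + k * B)^2 * indicator {0..Y} x + s^2 * E x)"
      unfolding 2 using mult_left_mono[OF g0, of "12 * \<epsilon>^2"] by (simp add: mult.assoc)
    then show ?thesis using 0 1 3 unfolding bd_def by (simp add: mult.assoc)
  qed
  have iE: "integrable lpos E" "(LINT x|lpos. E x) = ph / (2 * \<epsilon>)"
    unfolding E_def using exp_lpos[of "2 * c"] c by (simp_all add: c_def)
  have iI: "integrable lpos (indicator {0..Y} :: real \<Rightarrow> real)" "(LINT x|lpos. indicator {0..Y} x :: real) = Y"
  proof -
    have e: "(\<lambda>x. indicator {0<..} x *\<^sub>R indicator {0..Y} x) = (indicator {0<..Y} :: real \<Rightarrow> real)"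
      by (auto simp: fun_eq_iff indicator_def)
    show "integrable lpos (indicator {0..Y} :: real \<Rightarrow> real)" unfolding integrable_lpos e
      by (rule integrable_real_indicator) (use Y in auto)
    show "(LINT x|lpos. indicator {0..Y} x :: real) = Y" unfolding integral_lpos e using Y by simp
  qed
  have ifsq: "integrable lpos (\<lambda>x. (cmod (f x))^2)" using csupp_L2[OF f] by (simp add: L2_iff)
  have ibd: "integrable lpos bd"
    unfolding bd_def[abs_def] using ifsq iE(1) iI(1) by simp
  have LU: "L2 U" by (rule L2_exp_decay[OF cU c Ub])
  have "L2 r" unfolding r_def[abs_def] by (intro L2_diff L2_scale Lg LU csupp_L2[OF f])
  then have "integrable lpos (\<lambda>x. (cmod (r x))^2)" by (simp add: L2_iff)
  then have "(nrm r)^2 \<le> (LINT x|lpos. bd x)"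
    unfolding nrm_power2 by (rule integral_mono[OF _ ibd]) (use rb in simp)
  also have "\<dots> = 3 * (\<epsilon> * b / pl)^2 * (nrm f)^2 + 12 * \<epsilon>^2 * ((B / pl + k * B)^2 * Y + s^2 * (ph / (2 * \<epsilon>)))
         + 3 * \<epsilon>^4 * (B / pl)^2 * (ph / (2 * \<epsilon>))"
    unfolding bd_def[abs_def] nrm_power2 iE(2)[symmetric] using ifsq iE(1) iI by simp
  finally show "(nrm (\<lambda>x. g x - Complex \<mu> (2 * \<epsilon> * k) * U x - f x))^2 \<le>
       3 * (\<epsilon> * b / pl)^2 * (nrm f)^2 + 12 * \<epsilon>^2 * ((B / pl + k * B)^2 * Y + s^2 * (ph / (2 * \<epsilon>)))
         + 3 * \<epsilon>^4 * (B / pl)^2 * (ph / (2 * \<epsilon>))" by (simp add: r_def[abs_def])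
  have fi: "integrable lpos (\<lambda>x. cmod (f x))"
    unfolding integrable_lpos using csupp_integrable[OF f] by (intro integrable_mult_indicator) auto
  have ufi: "integrable lpos (\<lambda>x. y x * cnj (f x))" if "continuous_on {0..} y" "\<And>x. x \<ge> 0 \<Longrightarrow> cmod (y x) \<le> B'" for y B'
  proof (rule Bochner_Integration.integrable_bound)
    show "integrable lpos (\<lambda>x. B' * cmod (f x))" using fi by simp
    show "(\<lambda>x. y x * cnj (f x)) \<in> borel_measurable lpos"
      by (intro borel_measurable_times measurable_cnj measurable_lpos_cont[OF that(1)] fm)
    show "AE x in lpos. norm (y x * cnj (f x)) \<le> norm (B' * cmod (f x))"
    proof (rule AE_I2)
      fix x assume "x \<in> space lpos"
      then have "cmod (y x) * cmod (f x) \<le> B' * cmod (f x)" using that(2)[of x] by (intro mult_right_mono) auto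
      then show "norm (y x * cnj (f x)) \<le> norm (B' * cmod (f x))"
        unfolding norm_mult complex_mod_cnj real_norm_def by (meson abs_ge_self order_trans abs_mult norm_ge_zero abs_of_nonneg)
    qed
  qed
  have "ip U f - ip u f = (LINT x|lpos. U x * cnj (f x) - u x * cnj (f x))"
    unfolding ip_eq
  proof (rule Bochner_Integration.integral_diff[symmetric])
    show "integrable lpos (\<lambda>x. u x * cnj (f x))" by (rule ufi[OF cu B(1)])
    show "integrable lpos (\<lambda>x. U x * cnj (f x))" by (rule L2_integrable[OF LU csupp_L2[OF f]])
  qed
  also have "cmod \<dots> \<le> (LINT x|lpos. \<epsilon> * b / pl * B * cmod (f x))"
  proof (rule Bochner_Integration.integral_norm_bound_integral)
    show "integrable lpos (\<lambda>x. U x * cnj (f x) - u x * cnj (f x))"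
      by (intro Bochner_Integration.integrable_diff ufi[OF cu B(1)] L2_integrable[OF LU csupp_L2[OF f]])
    show "integrable lpos (\<lambda>x. \<epsilon> * b / pl * B * cmod (f x))" using fi by simp
    fix x assume "x \<in> space lpos"
    then have x: "x \<ge> 0" by simp
    show "cmod (U x * cnj (f x) - u x * cnj (f x)) \<le> \<epsilon> * b / pl * B * cmod (f x)"
    proof (cases "x \<le> b")
      case True
      have e: "U x * cnj (f x) - u x * cnj (f x) = complex_of_real (chi \<epsilon> x - 1) * u x * cnj (f x)" by (simp add: U_def algebra_simps)
      have "cmod (complex_of_real (chi \<epsilon> x - 1)) = 1 - chi \<epsilon> x" unfolding norm_of_real using chi_le(3)[OF x eps] by simp
      also have "\<dots> \<le> \<epsilon> * x / pl" by (rule chi_le(2)[OF x eps])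
      also have "\<dots> \<le> \<epsilon> * b / pl" using True eps pl_pos by (simp add: divide_right_mono)
      finally have d: "cmod (complex_of_real (chi \<epsilon> x - 1)) \<le> \<epsilon> * b / pl" .
      show ?thesis unfolding e norm_mult complex_mod_cnj
        using eps b pl_pos B0 by (intro mult_right_mono mult_mono d B(1)[OF x]) auto
    next
      case False
      then have "f x = 0" using f by (auto simp: csupp_def)
      then show ?thesis by simp
    qed
  qed
  also have "\<dots> = \<epsilon> * b / pl * B * (LINT x|lpos. cmod (f x))" by simp
  also have "(LINT x|lpos. cmod (f x)) = (LINT x|lborel. cmod (f x))"
    unfolding integral_lpos
  proof (rule Bochner_Integration.integral_cong[OF refl])
    fix x show "indicator {0<..} x *\<^sub>R cmod (f x) = cmod (f x)"
      using f unfolding csupp_def by (cases "x \<in> {0<..b}") auto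
  qed
  finally show "cmod (ip U f - ip u f) \<le> \<epsilon> * b / pl * B * (LINT x|lborel. cmod (f x))" .
qed

end

context coefficients
begin

text \<open>Below \<open>x0\<close> form-domain functions are bounded and \<open>q\<close> is
  integrable; beyond \<open>x0\<close> the roles change: \<open>q\<close> is bounded and the
  functions are square integrable.\<close>

lemma hform_integrable:
  assumes F: "H10 f df" and H: "H10 h dh"
  shows "integrable lpos (\<lambda>x. cp x * df x * cnj (dh x) + cq x * f x * cnj (h x))"
proof (rule Bochner_Integration.integrable_add)
  note LF = H10_L2[OF F] and LH = H10_L2[OF H]
  have mF: "f \<in> borel_measurable lpos" "df \<in> borel_measurable lpos" and mH: "h \<in> borel_measurable lpos" "dh \<in> borel_measurable lpos"
    using LF LH by (simp_all add: L2_iff)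
  show "integrable lpos (\<lambda>x. cp x * df x * cnj (dh x))"
  proof (rule Bochner_Integration.integrable_bound)
    show "integrable lpos (\<lambda>x. ph * (cmod (df x) * cmod (dh x)))"
      by (intro integrable_mult_right L2_integrable_norm LF LH)
    show "(\<lambda>x. cp x * df x * cnj (dh x)) \<in> borel_measurable lpos"
      by (intro borel_measurable_times measurable_cnj mF mH measurable_compose[OF p_measurable borel_measurable_of_real])
    show "AE x in lpos. norm (cp x * df x * cnj (dh x)) \<le> norm (ph * (cmod (df x) * cmod (dh x)))"
    proof (rule AE_I2)
      fix x assume "x \<in> space lpos"
      then have "\<bar>p x\<bar> * (cmod (df x) * cmod (dh x)) \<le> ph * (cmod (df x) * cmod (dh x))"
        using p_pos[of x] le_ph[of x] by (intro mult_right_mono) auto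
      then show "norm (cp x * df x * cnj (dh x)) \<le> norm (ph * (cmod (df x) * cmod (dh x)))"
        using ph_pos by (simp add: norm_mult mult.assoc abs_mult)
    qed
  qed
  obtain qb where qb: "\<forall>x\<ge>x0. \<bar>q x\<bar> \<le> qb" using q_bound by (rule exE)
  have qb0: "qb \<ge> 0" using qb by (metis abs_ge_zero order_refl order_trans)
  define b where "b = (x0 + (nrm df)^2) * (x0 + (nrm dh)^2)"
  have b0: "b \<ge> 0" using x0_pos by (simp add: b_def)
  show "integrable lpos (\<lambda>x. cq x * f x * cnj (h x))"
  proof (rule Bochner_Integration.integrable_bound)
    have "integrable lborel (\<lambda>x. indicator {0<..} x *\<^sub>R \<bar>indicator {0..x0} x *\<^sub>R q x\<bar>)"
      using q_int[of x0, unfolded set_integrable_def] by (intro integrable_mult_indicator) auto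
    then have "integrable lpos (\<lambda>x. \<bar>indicator {0..x0} x *\<^sub>R q x\<bar>)" by (simp only: integrable_lpos)
    then show "integrable lpos (\<lambda>x. b * \<bar>indicator {0..x0} x *\<^sub>R q x\<bar> + qb * (cmod (f x) * cmod (h x)))"
      by (intro Bochner_Integration.integrable_add integrable_mult_right L2_integrable_norm LF LH)
    show "(\<lambda>x. cq x * f x * cnj (h x)) \<in> borel_measurable lpos"
      by (intro borel_measurable_times measurable_cnj mF mH measurable_compose[OF q_measurable borel_measurable_of_real])
    show "AE x in lpos. norm (cq x * f x * cnj (h x)) \<le> norm (b * \<bar>indicator {0..x0} x *\<^sub>R q x\<bar> + qb * (cmod (f x) * cmod (h x)))"
    proof (rule AE_I2)
      fix x assume "x \<in> space lpos"
      then have x: "x > 0" "x \<ge> 0" by auto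
      have "\<bar>q x\<bar> * (cmod (f x) * cmod (h x)) \<le> b * \<bar>indicator {0..x0} x *\<^sub>R q x\<bar> + qb * (cmod (f x) * cmod (h x))"
      proof (cases "x \<le> x0")
        case True
        have "cmod (f x) \<le> x0 + (nrm df)^2" "cmod (h x) \<le> x0 + (nrm dh)^2"
          using H10_growth[OF F x(2)] H10_growth[OF H x(2)] True by linarith+
        then have "cmod (f x) * cmod (h x) \<le> b" unfolding b_def using x0_pos by (intro mult_mono) auto
        then have "\<bar>q x\<bar> * (cmod (f x) * cmod (h x)) \<le> \<bar>q x\<bar> * b" by (rule mult_left_mono) simp
        moreover have "0 \<le> qb * (cmod (f x) * cmod (h x))" using qb0 by simp
        ultimately show ?thesis using True x by (simp add: mult.commute[of b])
      next
        case False
        then have "\<bar>q x\<bar> * (cmod (f x) * cmod (h x)) \<le> qb * (cmod (f x) * cmod (h x))"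
          using qb by (intro mult_right_mono) auto
        then show ?thesis using False by simp
      qed
      also have "\<dots> \<le> \<bar>b * \<bar>indicator {0..x0} x *\<^sub>R q x\<bar> + qb * (cmod (f x) * cmod (h x))\<bar>" by (rule abs_ge_self)
      finally show "norm (cq x * f x * cnj (h x)) \<le> norm (b * \<bar>indicator {0..x0} x *\<^sub>R q x\<bar> + qb * (cmod (f x) * cmod (h x)))"
        unfolding norm_mult norm_of_real complex_mod_cnj real_norm_def mult.assoc .
    qed
  qed
qed

text \<open>The form is a Bochner integral, so splitting it over a sum rests on
  \<open>hform_integrable\<close>. The representatives in the form domain are combined, since the
  functions themselves agree with them only almost everywhere.\<close>

lemma Hop_lin:
  assumes 1: "Hop p q f g" and 2: "Hop p q f' g'"
  shows "Hop p q (\<lambda>x. f x + c * f' x) (\<lambda>x. g x + c * g' x)"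
proof -
  obtain f0 df0 where a: "L2 f" "L2 g" "aeq f f0" "H10 f0 df0" "\<And>h dh. H10 h dh \<Longrightarrow> hform p q f0 df0 h dh = ip g h"
    using 1 unfolding Hop_def by blast
  obtain f1 df1 where b: "L2 f'" "L2 g'" "aeq f' f1" "H10 f1 df1" "\<And>h dh. H10 h dh \<Longrightarrow> hform p q f1 df1 h dh = ip g' h"
    using 2 unfolding Hop_def by blast
  have h0: "h 0 = 0" if "H10 h dh" for h dh
    using that unfolding H10_def by (metis LINT_Icc_same order_refl)
  have H: "H10 (\<lambda>x. f0 x + c * f1 x) (\<lambda>x. df0 x + c * df1 x)"
    by (rule prim_H10[OF L2_lin[OF H10_L2(1)[OF a(4)] H10_L2(1)[OF b(4)]] L2_lin[OF H10_L2(2)[OF a(4)] H10_L2(2)[OF b(4)]]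
          prim_lin[OF H10_prim[OF a(4)] H10_prim[OF b(4)]]]) (simp add: h0[OF a(4)] h0[OF b(4)])
  have "hform p q (\<lambda>x. f0 x + c * f1 x) (\<lambda>x. df0 x + c * df1 x) h dh = ip (\<lambda>x. g x + c * g' x) h" if h: "H10 h dh" for h dh
  proof -
    have "hform p q (\<lambda>x. f0 x + c * f1 x) (\<lambda>x. df0 x + c * df1 x) h dh
      = (LINT x|lpos. (cp x * df0 x * cnj (dh x) + cq x * f0 x * cnj (h x)) + c * (cp x * df1 x * cnj (dh x) + cq x * f1 x * cnj (h x)))"
      unfolding hform_eq by (simp add: algebra_simps)
    also have "\<dots> = hform p q f0 df0 h dh + c * hform p q f1 df1 h dh"
      unfolding hform_eq using hform_integrable[OF a(4) h] hform_integrable[OF b(4) h]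
      by (subst Bochner_Integration.integral_add) (auto simp del: integrable_add)
    also have "\<dots> = ip (\<lambda>x. g x + c * g' x) h"
      using a(5)[OF h] b(5)[OF h] ip_lin_left[OF a(2) b(2) H10_L2(1)[OF h]] by simp
    finally show ?thesis .
  qed
  then show ?thesis
    unfolding Hop_def using L2_lin[OF a(1) b(1)] L2_lin[OF a(2) b(2)] aeq_lin[OF a(3) b(3)] H by blast
qed

end

section \<open>Boundary values of the Poisson integral and the spectral density\<close>

lemma csupp_mono: "csupp b f \<Longrightarrow> b \<le> b' \<Longrightarrow> csupp b' f"
  unfolding csupp_def by auto

lemma csupp_lin:
  assumes "csupp b f" "csupp b g" shows "csupp b (\<lambda>x. f x + c * g x)"
proof -
  have m: "f \<in> borel_measurable borel" "g \<in> borel_measurable borel" using assms by (auto simp: csupp_def)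
  have z: "f x + c * g x = 0" if "x \<notin> {0<..b}" for x using assms that by (auto simp: csupp_def)
  have "L2 (\<lambda>x. f x + c * g x)" by (intro L2_lin csupp_L2[OF assms(1)] csupp_L2[OF assms(2)])
  then have "integrable lborel (\<lambda>x. indicator {0<..} x *\<^sub>R (cmod (f x + c * g x))^2)" by (simp add: L2_iff integrable_lpos)
  moreover have e: "indicator {0<..} x *\<^sub>R (cmod (f x + c * g x))^2 = (cmod (f x + c * g x))^2" for x
    using z[of x] by (cases "x \<in> {0<..b}") auto
  ultimately have "integrable lborel (\<lambda>x. (cmod (f x + c * g x))^2)" by (simp only: e)
  then show ?thesis using m z unfolding csupp_def by (intro conjI) (auto intro!: borel_measurable_add borel_measurable_times)
qed

locale spectral_problem = scattering +
  fixes E :: "real \<Rightarrow> (real \<Rightarrow> complex) \<Rightarrow> (real \<Rightarrow> complex)"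
  assumes spec: "spectral_family (Hop p q) E"

sublocale spectral_problem \<subseteq> resolution "Hop p q" E
  by unfold_locales (fact spec, fact Hop_L2, fact Hop_lin, fact Hop_cong)

context spectral_problem
begin

lemma ip_csupp_bound:
  assumes f: "csupp b f" and u: "continuous_on {0..} u" and B: "\<And>x. x \<ge> 0 \<Longrightarrow> cmod (u x) \<le> B"
  shows "cmod (ip u f) \<le> B * (LINT x|lborel. cmod (f x))"
proof -
  have B0: "B \<ge> 0" using order_trans[OF norm_ge_zero B[OF order_refl]] .
  have fi: "integrable lborel (\<lambda>x. cmod (f x))" using csupp_integrable[OF f] by simp
  have le: "cmod (indicator {0<..} x *\<^sub>R (u x * cnj (f x))) \<le> B * cmod (f x)" for x
  proof (cases "x > 0")
    case True
    then show ?thesis using B[of x] by (simp add: norm_mult mult_right_mono)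
  next
    case False
    then show ?thesis using B0 by simp
  qed
  have "cmod (ip u f) \<le> (LINT x|lborel. B * cmod (f x))"
    unfolding ip_eq integral_lpos
  proof (rule Bochner_Integration.integral_norm_bound_integral[OF _ _ le])
    show "integrable lborel (\<lambda>x. B * cmod (f x))" using fi by simp
    show "integrable lborel (\<lambda>x. indicator {0<..} x *\<^sub>R (u x * cnj (f x)))"
    proof (rule Bochner_Integration.integrable_bound[OF \<open>integrable lborel (\<lambda>x. B * cmod (f x))\<close>])
      have "(\<lambda>x. u x * cnj (f x)) \<in> borel_measurable lpos"
        using csupp_L2[OF f] by (intro borel_measurable_times measurable_cnj measurable_lpos_cont[OF u]) (simp add: L2_iff)
      then show "(\<lambda>x. indicator {0<..} x *\<^sub>R (u x * cnj (f x))) \<in> borel_measurable lborel" by (simp add: measurable_lpos)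
      show "AE x in lborel. norm (indicator {0<..} x *\<^sub>R (u x * cnj (f x))) \<le> norm (B * cmod (f x))"
        by (rule AE_I2, rule order_trans[OF le]) simp
    qed
  qed
  then show ?thesis by simp
qed

lemma poisson_nonneg: "\<eta> > 0 \<Longrightarrow> 0 \<le> poisson f \<eta> \<mu>"
  unfolding poisson_def by (intro integral_nonneg_AE) auto

text \<open>The quadratic inequality \<open>|P - A| \<le> \<delta> \<surd>P\<close> bounds \<open>P\<close>, and forces \<open>P \<rightarrow> A\<close> as \<open>\<delta> \<rightarrow> 0\<close>.\<close>

lemma poisson_boundary_values:
  assumes f: "csupp b f" and b: "b > 0" and ab: "0 < \<alpha>" "\<alpha> \<le> \<beta>"
  obtains C where "\<And>\<mu> n. \<mu> \<in> {\<alpha>..\<beta>} \<Longrightarrow> poisson f (inverse (real (Suc n))) \<mu> \<le> C"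
    and "\<And>\<mu>. \<mu> \<in> {\<alpha>..\<beta>} \<Longrightarrow> (\<lambda>n. poisson f (inverse (real (Suc n))) \<mu>) \<longlonglongrightarrow> \<kappa> \<mu> * (cmod (ftr f \<mu>))^2"
proof -
  obtain B where B: "B > 0" and O: "\<And>\<mu>. \<mu> \<in> {\<alpha>..\<beta>} \<Longrightarrow> \<exists>u v. prim 0 u (\<lambda>x. v x / cp x) \<and>
      prim 0 v (\<lambda>x. (cq x - complex_of_real \<mu>) * u x - f x) \<and> u 0 = 0 \<and>
      (\<forall>x\<ge>0. cmod (u x) \<le> B \<and> cmod (v x) \<le> B) \<and>
      ((\<lambda>x. v x - \<i> * complex_of_real (mom \<mu>) * u x) \<longlongrightarrow> 0) at_top \<and>
      Im (ip u f) = \<kappa> \<mu> * (cmod (ftr f \<mu>))^2"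
    by (rule outgoing_solution[OF f b ab]) (assumption | rule that)+
  define I where "I = (LINT x|lborel. cmod (f x))"
  have I: "I \<ge> 0" unfolding I_def by (intro integral_nonneg_AE) auto
  define \<eta> where "\<eta> n = inverse (real (Suc n))" for n
  have eta: "\<eta> n > 0" "\<eta> n \<le> 1" for n by (simp_all add: \<eta>_def inverse_le_1_iff del: of_nat_Suc) 
  have eta_lim: "\<eta> \<longlonglongrightarrow> 0" unfolding \<eta>_def[abs_def] by (rule LIMSEQ_inverse_real_of_nat)
  \<comment> \<open>\<open>kl\<close> and \<open>kh\<close> are the wave numbers at the ends of the
    energy interval; they enclose k = mom / p0 for every energy in between.\<close>
  define kl where "kl = mom \<alpha> / p0"
  define kh where "kh = mom \<beta> / p0"
  have kl: "kl > 0" using mom_pos[of \<alpha>] ab p0_pos by (simp add: kl_def)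
  define B0 where "B0 = B / pl + kh * B"
  have kh0: "kh \<ge> 0" using mom_pos[of \<beta>] ab p0_pos by (simp add: kh_def)
  have B0: "B0 \<ge> 0" using B pl_pos kh0 by (simp add: B0_def)
  \<comment> \<open>The coefficients of the residual bound in \<open>damped_resolvent\<close>, after
    inserting \<epsilon> \<le> \<eta> / (2 kl) and dividing by \<eta>. Likewise \<open>c3\<close>
    bounds the change of the pairing caused by the damping.\<close>
  define c1 where "c1 = 3 * (b / pl)^2 * (nrm f)^2 / (4 * kl^2) + 3 * B0^2 / kl^2 + 3 / 16 * (B / pl)^2 * ph / kl^3"
  define c2 where "c2 = 3 * ph / kl"
  define c3 where "c3 = 1 / (2 * kl) * b / pl * B * I"
  have c1: "c1 \<ge> 0" using ph_pos kl by (simp add: c1_def)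
  have c2: "c2 \<ge> 0" using ph_pos kl by (simp add: c2_def)
  have c3: "c3 \<ge> 0" using kl b pl_pos B I by (simp add: c3_def)
  \<comment> \<open>\<open>Y\<close> and \<open>s\<close> remain free: beyond \<open>Y\<close> the
    outgoing defect is at most \<open>s\<close>. With \<open>Y = 0\<close> the estimate gives a
    bound uniform in the energy; with small \<open>s\<close>, and \<open>Y\<close> depending on the
    energy, it gives the limit.\<close>
  have main: "\<bar>poisson f (\<eta> n) \<mu> - Im (ip u f)\<bar> \<le> sqrt (c1 * \<eta> n * (1 + Y) + c2 * s^2) * sqrt (poisson f (\<eta> n) \<mu>) + c3 * \<eta> n"
    if mu: "\<mu> \<in> {\<alpha>..\<beta>}" and u: "prim 0 u (\<lambda>x. v x / cp x)" and v: "prim 0 v (\<lambda>x. (cq x - complex_of_real \<mu>) * u x - f x)"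
      and u0: "u 0 = 0" and uB: "\<And>x. x \<ge> 0 \<Longrightarrow> cmod (u x) \<le> B" and vB: "\<And>x. x \<ge> 0 \<Longrightarrow> cmod (v x) \<le> B"
      and s: "\<And>x. x \<ge> Y \<Longrightarrow> cmod (v x / cp x - \<i> * complex_of_real (mom \<mu> / p0) * u x) \<le> s" and Y: "Y \<ge> 0"
    for \<mu> u v s Y n
  proof -
    have m: "\<mu> > 0" using mu ab by simp
    define k where "k = mom \<mu> / p0"
    have k: "kl \<le> k" "k \<le> kh"
      using mu ab p0_pos unfolding kl_def k_def kh_def mom_def by (auto intro!: divide_right_mono mult_left_mono)
    have k0: "k > 0" using k(1) kl by simp
    \<comment> \<open>This makes the imaginary part 2 \<epsilon> k of the damped problem equal to
      \<eta>.\<close>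
    define \<epsilon> where "\<epsilon> = \<eta> n / (2 * k)"
    have e: "\<epsilon> > 0" using eta k0 by (simp add: \<epsilon>_def)
    have ek: "2 * \<epsilon> * k = \<eta> n" using k0 by (simp add: \<epsilon>_def)
    have el: "\<epsilon> \<le> \<eta> n / (2 * kl)" unfolding \<epsilon>_def using eta[of n] kl k(1) by (intro divide_left_mono) auto
    define U where "U = (\<lambda>x. complex_of_real (chi \<epsilon> x) * u x)"
    define g where "g = (\<lambda>x. complex_of_real (chi \<epsilon> x) * f x + (complex_of_real \<mu> * U x
      + 2 * complex_of_real \<epsilon> * (complex_of_real (chi \<epsilon> x) * v x / cp x) - (complex_of_real \<epsilon>)^2 * U x / cp x))"
    have DR1: "Hop p q U g"
      unfolding g_def U_def
      by (rule damped_resolvent(1)[OF f b m e u v u0 uB vB s[folded k_def] Y less_imp_le[OF k0]])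
    have DR2: "(nrm (\<lambda>x. g x - Complex \<mu> (2 * \<epsilon> * k) * U x - f x))^2 \<le>
       3 * (\<epsilon> * b / pl)^2 * (nrm f)^2 + 12 * \<epsilon>^2 * ((B / pl + k * B)^2 * Y + s^2 * (ph / (2 * \<epsilon>)))
         + 3 * \<epsilon>^4 * (B / pl)^2 * (ph / (2 * \<epsilon>))"
      unfolding g_def U_def
      by (rule damped_resolvent(2)[OF f b m e u v u0 uB vB s[folded k_def] Y less_imp_le[OF k0]])
    have DR3: "cmod (ip U f - ip u f) \<le> \<epsilon> * b / pl * B * (LINT x|lborel. cmod (f x))"
      unfolding U_def
      by (rule damped_resolvent(3)[OF f b m e u v u0 uB vB s[folded k_def] Y less_imp_le[OF k0]])
    define R where "R = nrm (\<lambda>x. g x - Complex \<mu> (\<eta> n) * U x - f x)"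
    have s0: "s \<ge> 0" using order_trans[OF norm_ge_zero s[OF order_refl]] .
    have R2: "R^2 / \<eta> n \<le> c1 * \<eta> n * (1 + Y) + c2 * s^2"
    proof -
      have "R^2 \<le> 3 * (\<epsilon> * b / pl)^2 * (nrm f)^2 + 12 * \<epsilon>^2 * ((B / pl + k * B)^2 * Y + s^2 * (ph / (2 * \<epsilon>)))
         + 3 * \<epsilon>^4 * (B / pl)^2 * (ph / (2 * \<epsilon>))"
        using DR2 unfolding ek R_def .
      also have "\<dots> = \<epsilon>^2 * (3 * (b / pl)^2 * (nrm f)^2 + 12 * (B / pl + k * B)^2 * Y) + 6 * ph * s^2 * \<epsilon> + 3 / 2 * (B / pl)^2 * ph * \<epsilon>^3"
        using e by (simp add: field_simps power2_eq_square power3_eq_cube power4_eq_xxxx)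
      also have "\<dots> \<le> (\<eta> n / (2 * kl))^2 * (3 * (b / pl)^2 * (nrm f)^2 + 12 * B0^2 * Y) + 6 * ph * s^2 * (\<eta> n / (2 * kl)) + 3 / 2 * (B / pl)^2 * ph * (\<eta> n / (2 * kl))^3"
      proof (intro add_mono mult_mono mult_left_mono power_mono el)
        show "B / pl + k * B \<le> B0" unfolding B0_def using k(2) B by (simp add: mult_right_mono)
      qed (use e ph_pos Y eta[of n] kl B pl_pos k0 b s0 in auto)
      also have "\<dots> = (3 * (b / pl)^2 * (nrm f)^2 / (4 * kl^2) + 3 * B0^2 / kl^2 * Y + 3 / 16 * (B / pl)^2 * ph / kl^3 * \<eta> n) * \<eta> n * \<eta> n + c2 * s^2 * \<eta> n"
        using kl by (simp add: c2_def field_simps power2_eq_square power3_eq_cube)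
      also have "\<dots> \<le> (c1 * (1 + Y)) * \<eta> n * \<eta> n + c2 * s^2 * \<eta> n"
      proof -
        have a1: "0 \<le> 3 * (b / pl)^2 * (nrm f)^2 / (4 * kl^2)" "0 \<le> 3 * B0^2 / kl^2" "0 \<le> 3 / 16 * (B / pl)^2 * ph / kl^3"
          using kl ph_pos by simp_all
        have "3 / 16 * (B / pl)^2 * ph / kl^3 * \<eta> n \<le> 3 / 16 * (B / pl)^2 * ph / kl^3 * 1"
          using a1(3) eta[of n] by (intro mult_left_mono) auto
        moreover have "0 \<le> 3 * (b / pl)^2 * (nrm f)^2 / (4 * kl^2) * Y" by (rule mult_nonneg_nonneg[OF a1(1) Y])
        moreover have "0 \<le> 3 / 16 * (B / pl)^2 * ph / kl^3 * Y" by (rule mult_nonneg_nonneg[OF a1(3) Y])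
        ultimately have "3 * (b / pl)^2 * (nrm f)^2 / (4 * kl^2) + 3 * B0^2 / kl^2 * Y + 3 / 16 * (B / pl)^2 * ph / kl^3 * \<eta> n \<le> c1 * (1 + Y)"
          using a1 unfolding c1_def distrib_left distrib_right mult_1_right by linarith
        then show ?thesis using eta[of n] by (intro add_mono mult_right_mono) auto
      qed
      finally show ?thesis using eta[of n] by (simp add: pos_divide_le_eq algebra_simps)
    qed
    have "\<bar>poisson f (\<eta> n) \<mu> - Im (ip U f)\<bar> \<le> R * sqrt (poisson f (\<eta> n) \<mu> / \<eta> n)"
      unfolding R_def by (rule poisson_estimate[OF DR1 csupp_L2[OF f] eta(1)])
    also have "\<dots> = sqrt (R^2 / \<eta> n) * sqrt (poisson f (\<eta> n) \<mu>)"
      using nrm_nonneg by (simp add: R_def real_sqrt_divide)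
    also have "\<dots> \<le> sqrt (c1 * \<eta> n * (1 + Y) + c2 * s^2) * sqrt (poisson f (\<eta> n) \<mu>)"
      using R2 poisson_nonneg[OF eta(1)] by (intro mult_right_mono real_sqrt_le_mono) auto
    finally have 1: "\<bar>poisson f (\<eta> n) \<mu> - Im (ip U f)\<bar> \<le> sqrt (c1 * \<eta> n * (1 + Y) + c2 * s^2) * sqrt (poisson f (\<eta> n) \<mu>)" .
    have "\<bar>Im (ip U f) - Im (ip u f)\<bar> \<le> cmod (ip U f - ip u f)" using abs_Im_le_cmod[of "ip U f - ip u f"] by simp
    also have "\<dots> \<le> \<epsilon> * b / pl * B * I" using DR3 by (simp add: I_def)
    also have "\<dots> = \<epsilon> * (b / pl * B * I)" by simp
    also have "\<dots> \<le> \<eta> n / (2 * kl) * (b / pl * B * I)" using b pl_pos B I by (intro mult_right_mono el) auto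
    also have "\<dots> = c3 * \<eta> n" by (simp add: c3_def)
    finally show ?thesis using 1 by linarith
  qed
  \<comment> \<open>Comes from \<open>main\<close> with \<open>Y = 0\<close> and
    \<open>s = B0\<close>: for the Poisson integral P it gives P \<le> B I + c3 + (c1 + c2 B0^2 + P)
    / 2, which is solved for P.\<close>
  define C where "C = 2 * (B * I + c3) + (c1 + c2 * B0^2)"
  have bound: "poisson f (\<eta> n) \<mu> \<le> C" if mu: "\<mu> \<in> {\<alpha>..\<beta>}" for \<mu> n
  proof -
    obtain u where "\<exists>v. prim 0 u (\<lambda>x. v x / cp x) \<and>
      prim 0 v (\<lambda>x. (cq x - complex_of_real \<mu>) * u x - f x) \<and> u 0 = 0 \<and>
      (\<forall>x\<ge>0. cmod (u x) \<le> B \<and> cmod (v x) \<le> B) \<and>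
      ((\<lambda>x. v x - \<i> * complex_of_real (mom \<mu>) * u x) \<longlongrightarrow> 0) at_top \<and>
      Im (ip u f) = \<kappa> \<mu> * (cmod (ftr f \<mu>))^2" using O[OF mu] by (rule exE)
    then obtain v where uv: "prim 0 u (\<lambda>x. v x / cp x) \<and>
      prim 0 v (\<lambda>x. (cq x - complex_of_real \<mu>) * u x - f x) \<and> u 0 = 0 \<and>
      (\<forall>x\<ge>0. cmod (u x) \<le> B \<and> cmod (v x) \<le> B) \<and>
      ((\<lambda>x. v x - \<i> * complex_of_real (mom \<mu>) * u x) \<longlongrightarrow> 0) at_top \<and>
      Im (ip u f) = \<kappa> \<mu> * (cmod (ftr f \<mu>))^2" by (rule exE)
    then have uB: "\<And>x. x \<ge> 0 \<Longrightarrow> cmod (u x) \<le> B" and vB: "\<And>x. x \<ge> 0 \<Longrightarrow> cmod (v x) \<le> B" by simp_all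
    define P where "P = poisson f (\<eta> n) \<mu>"
    have P0: "P \<ge> 0" unfolding P_def by (rule poisson_nonneg[OF eta(1)])
    have "\<bar>P - Im (ip u f)\<bar> \<le> sqrt (c1 * \<eta> n * (1 + 0) + c2 * B0^2) * sqrt P + c3 * \<eta> n"
      unfolding P_def
    proof (rule main[OF mu _ _ _ uB vB])
      fix x :: real assume x: "0 \<le> x"
      have "cmod (v x / cp x - \<i> * complex_of_real (mom \<mu> / p0) * u x) \<le> cmod (v x / cp x) + cmod (\<i> * complex_of_real (mom \<mu> / p0) * u x)"
        by (rule norm_triangle_ineq4)
      also have "\<dots> \<le> B / pl + kh * B"
      proof (rule add_mono)
        have "cmod (v x / cp x) = cmod (v x) / p x" using p_pos[OF x] by (simp add: norm_divide)
        also have "\<dots> \<le> B / pl" using vB[OF x] pl_le[OF x] pl_pos B by (intro frac_le) auto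
        finally show "cmod (v x / cp x) \<le> B / pl" .
        have mk: "0 \<le> mom \<mu> / p0" "mom \<mu> / p0 \<le> kh"
          using mu ab p0_pos unfolding kh_def mom_def by (auto intro!: divide_right_mono mult_left_mono)
        have "cmod (\<i> * complex_of_real (mom \<mu> / p0) * u x) = (mom \<mu> / p0) * cmod (u x)"
          unfolding norm_mult norm_of_real abs_of_nonneg[OF mk(1)] by simp
        also have "\<dots> \<le> kh * B" using mk uB[OF x] kh0 by (intro mult_mono) auto
        finally show "cmod (\<i> * complex_of_real (mom \<mu> / p0) * u x) \<le> kh * B" .
      qed
      finally show "cmod (v x / cp x - \<i> * complex_of_real (mom \<mu> / p0) * u x) \<le> B0" by (simp add: B0_def)
    qed (use uv in auto)
    moreover have "Im (ip u f) \<le> B * I"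
    proof -
      have "Im (ip u f) \<le> cmod (ip u f)" using abs_Im_le_cmod[of "ip u f"] by linarith
      also have "\<dots> \<le> B * I" unfolding I_def by (rule ip_csupp_bound[OF f prim_cont uB]) (use uv in blast)+
      finally show ?thesis .
    qed
    moreover have "sqrt (c1 * \<eta> n * (1 + 0) + c2 * B0^2) * sqrt P \<le> (c1 + c2 * B0^2 + P) / 2"
    proof -
      define T where "T = c1 * \<eta> n * (1 + 0) + c2 * B0^2"
      have T: "0 \<le> T" "T \<le> c1 + c2 * B0^2" using c1 c2 eta[of n] by (simp_all add: T_def mult_left_le)
      have "2 * (sqrt T * sqrt P) \<le> (sqrt T)^2 + (sqrt P)^2" using sum_squares_bound[of "sqrt T" "sqrt P"] by (simp add: mult.assoc)
      then show ?thesis unfolding T_def[symmetric] using T P0 by simp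
    qed
    moreover have "c3 * \<eta> n \<le> c3" using c3 eta[of n] by (simp add: mult_left_le)
    ultimately have "P \<le> C" unfolding C_def by (simp add: abs_le_iff field_simps)
    then show ?thesis by (simp add: P_def)
  qed
  have C0: "C \<ge> 0" using B I c1 c2 c3 by (simp add: C_def)
  show ?thesis
  proof (rule that[of C])
    show "poisson f (inverse (real (Suc n))) \<mu> \<le> C" if "\<mu> \<in> {\<alpha>..\<beta>}" for \<mu> n using bound[OF that] by (simp add: \<eta>_def)
    fix \<mu> assume mu: "\<mu> \<in> {\<alpha>..\<beta>}"
    obtain u where "\<exists>v. prim 0 u (\<lambda>x. v x / cp x) \<and>
      prim 0 v (\<lambda>x. (cq x - complex_of_real \<mu>) * u x - f x) \<and> u 0 = 0 \<and>
      (\<forall>x\<ge>0. cmod (u x) \<le> B \<and> cmod (v x) \<le> B) \<and>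
      ((\<lambda>x. v x - \<i> * complex_of_real (mom \<mu>) * u x) \<longlongrightarrow> 0) at_top \<and>
      Im (ip u f) = \<kappa> \<mu> * (cmod (ftr f \<mu>))^2" using O[OF mu] by (rule exE)
    then obtain v where uv: "prim 0 u (\<lambda>x. v x / cp x) \<and>
      prim 0 v (\<lambda>x. (cq x - complex_of_real \<mu>) * u x - f x) \<and> u 0 = 0 \<and>
      (\<forall>x\<ge>0. cmod (u x) \<le> B \<and> cmod (v x) \<le> B) \<and>
      ((\<lambda>x. v x - \<i> * complex_of_real (mom \<mu>) * u x) \<longlongrightarrow> 0) at_top \<and>
      Im (ip u f) = \<kappa> \<mu> * (cmod (ftr f \<mu>))^2" by (rule exE)
    then have uB: "\<And>x. x \<ge> 0 \<Longrightarrow> cmod (u x) \<le> B" and vB: "\<And>x. x \<ge> 0 \<Longrightarrow> cmod (v x) \<le> B" by simp_all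
    \<comment> \<open>The outgoing condition compares \<open>v / p0\<close> with i k u. Replacing
      \<open>p0\<close> by \<open>p\<close> is harmless because \<open>v\<close> is bounded and
      \<open>p\<close> tends to \<open>p0\<close>.\<close>
    have g0: "((\<lambda>x. v x / cp x - \<i> * complex_of_real (mom \<mu> / p0) * u x) \<longlongrightarrow> 0) at_top"
    proof -
      have l1: "((\<lambda>x. (v x - \<i> * complex_of_real (mom \<mu>) * u x) / complex_of_real p0) \<longlongrightarrow> 0 / complex_of_real p0) at_top"
        by (intro tendsto_divide tendsto_const) (use uv p0_pos in auto)
      have l2: "((\<lambda>x. (1 / cp x - 1 / complex_of_real p0) * v x) \<longlongrightarrow> 0) at_top"
      proof (rule Lim_null_comparison)
        show "\<forall>\<^sub>F x in at_top. norm ((1 / cp x - 1 / complex_of_real p0) * v x) \<le> norm (1 / cp x - 1 / complex_of_real p0) * B"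
          using eventually_ge_at_top[of 0]
          by eventually_elim (unfold norm_mult, intro mult_left_mono vB norm_ge_zero)
        have "((\<lambda>x. norm (1 / cp x - 1 / complex_of_real p0) * B) \<longlongrightarrow> norm (1 / complex_of_real p0 - 1 / complex_of_real p0) * B) at_top"
          by (intro tendsto_intros p_lim) (use p0_pos in simp)
        then show "((\<lambda>x. norm (1 / cp x - 1 / complex_of_real p0) * B) \<longlongrightarrow> 0) at_top" by simp
      qed
      have "((\<lambda>x. (v x - \<i> * complex_of_real (mom \<mu>) * u x) / complex_of_real p0 + (1 / cp x - 1 / complex_of_real p0) * v x) \<longlongrightarrow> 0 / complex_of_real p0 + 0) at_top"
        by (rule tendsto_add[OF l1 l2])
      then show ?thesis by (simp add: diff_divide_distrib algebra_simps)
    qed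
    have "(\<lambda>n. poisson f (\<eta> n) \<mu>) \<longlonglongrightarrow> Im (ip u f)"
    proof (rule LIMSEQ_I)
      fix e :: real assume e: "e > 0"
      \<comment> \<open>Order of choices: \<open>s = e / (2 * D)\<close> turns the square-root term
        into at most e / 2; \<open>Y\<close> is determined by \<open>s\<close>; \<open>n\<close>
        comes last, large in terms of \<open>Y\<close>, so that c1 \<eta> (1 + Y) is absorbed into
        c2 s^2. The latter is the origin of the 2 under the root.\<close>
      define D where "D = sqrt (2 * c2 * C) + 1"
      have D: "D > 0" using c2 C0 by (simp add: D_def add_nonneg_pos)
      define s where "s = e / (2 * D)"
      have s: "s > 0" using e D by (simp add: s_def)
      have "\<forall>\<^sub>F x in at_top. dist (v x / cp x - \<i> * complex_of_real (mom \<mu> / p0) * u x) 0 < s" by (rule tendstoD[OF g0 s])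
      then obtain Y0 where Y0: "\<And>x. x \<ge> Y0 \<Longrightarrow> dist (v x / cp x - \<i> * complex_of_real (mom \<mu> / p0) * u x) 0 < s"
        unfolding eventually_at_top_linorder by (rule exE) blast
      define Y where "Y = max Y0 0"
      have ph0: "c2 > 0" using ph_pos kl by (simp add: c2_def)
      have "(\<lambda>n. c1 * \<eta> n * (1 + Y)) \<longlonglongrightarrow> c1 * 0 * (1 + Y)" by (intro tendsto_intros eta_lim)
      then have ev1: "\<forall>\<^sub>F n in sequentially. c1 * \<eta> n * (1 + Y) < c2 * s^2"
        by (rule order_tendstoD(2)) (use ph0 s in simp)
      have "(\<lambda>n. c3 * \<eta> n) \<longlonglongrightarrow> c3 * 0" by (intro tendsto_intros eta_lim)
      then have ev2: "\<forall>\<^sub>F n in sequentially. c3 * \<eta> n < e / 2" by (rule order_tendstoD(2)) (use e in simp)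
      have "\<forall>\<^sub>F n in sequentially. norm (poisson f (\<eta> n) \<mu> - Im (ip u f)) < e"
        using ev1 ev2
      proof eventually_elim
        case (elim n)
        have "\<bar>poisson f (\<eta> n) \<mu> - Im (ip u f)\<bar> \<le> sqrt (c1 * \<eta> n * (1 + Y) + c2 * s^2) * sqrt (poisson f (\<eta> n) \<mu>) + c3 * \<eta> n"
        proof (rule main[OF mu _ _ _ uB vB])
          fix x assume "Y \<le> x"
          then have "dist (v x / cp x - \<i> * complex_of_real (mom \<mu> / p0) * u x) 0 < s" by (intro Y0) (simp add: Y_def)
          then show "cmod (v x / cp x - \<i> * complex_of_real (mom \<mu> / p0) * u x) \<le> s" by simp
        qed (use uv in \<open>auto simp: Y_def\<close>)
        also have "sqrt (c1 * \<eta> n * (1 + Y) + c2 * s^2) * sqrt (poisson f (\<eta> n) \<mu>) \<le> sqrt (2 * c2 * s^2) * sqrt C"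
          using elim(1) bound[OF mu, of n] poisson_nonneg[OF eta(1), of f n \<mu>] c2 by (intro mult_mono real_sqrt_le_mono) auto
        also have "\<dots> = s * sqrt (2 * c2 * C)" using s by (simp add: real_sqrt_mult)
        also have "\<dots> \<le> s * D" using s by (intro mult_left_mono) (auto simp: D_def)
        also have "\<dots> = e / 2" using D by (simp add: s_def)
        finally show ?case using elim(2) by simp
      qed
      then show "\<exists>no. \<forall>n\<ge>no. norm (poisson f (\<eta> n) \<mu> - Im (ip u f)) < e"
        unfolding eventually_sequentially .
    qed
    moreover have "Im (ip u f) = \<kappa> \<mu> * (cmod (ftr f \<mu>))^2" using uv by blast
    ultimately show "(\<lambda>n. poisson f (inverse (real (Suc n))) \<mu>) \<longlonglongrightarrow> \<kappa> \<mu> * (cmod (ftr f \<mu>))^2"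
      by (simp add: \<eta>_def)
  qed
qed

lemma spectral_density:
  assumes f: "csupp b f" and b: "b > 0" and lm: "0 < l" "l < m"
  shows "pi * (Ecdf f m - Ecdf f l) = (LINT \<mu>:{l..m}|lborel. \<kappa> \<mu> * (cmod (ftr f \<mu>))^2)"
proof -
  obtain C where C: "\<And>\<mu> n. \<mu> \<in> {l..m} \<Longrightarrow> poisson f (inverse (real (Suc n))) \<mu> \<le> C"
    "\<And>\<mu>. \<mu> \<in> {l..m} \<Longrightarrow> (\<lambda>n. poisson f (inverse (real (Suc n))) \<mu>) \<longlonglongrightarrow> \<kappa> \<mu> * (cmod (ftr f \<mu>))^2"
    by (rule poisson_boundary_values[OF f b lm(1) less_imp_le[OF lm(2)]]) (assumption | rule that)+
  show ?thesis by (rule Stone_formula[OF csupp_L2[OF f] lm(2) C(2) C(1)])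
qed

lemma ftr_cont:
  assumes f: "csupp b f" and b: "b > 0" and lm: "0 < l" "l \<le> m"
  shows "continuous_on {l..m} (ftr f)"
proof -
  obtain L where L: "L \<ge> 0" "\<And>\<mu> \<mu>' x. \<mu> \<in> {l..m} \<Longrightarrow> \<mu>' \<in> {l..m} \<Longrightarrow> x \<in> {0..b} \<Longrightarrow>
       cmod (cphi \<mu> x - cphi \<mu>' x) + cmod (vphi \<mu> x - vphi \<mu>' x) \<le> L * \<bar>\<mu> - \<mu>'\<bar>"
    by (rule phi_Lipschitz[OF lm less_imp_le[OF b]]) (assumption | rule that)+
  define I where "I = (LINT x|lborel. cmod (f x))"
  have I: "I \<ge> 0" unfolding I_def by (intro integral_nonneg_AE) auto
  have int: "integrable lborel (\<lambda>x. cphi \<mu> x * f x)" if "\<mu> > 0" for \<mu>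
  proof -
    have c: "continuous_on {0..} (cphi \<mu>)" using prim_cont[OF sol_prim(1)[OF vphi(1)[OF that]]] .
    have "set_integrable lborel {0..b} (\<lambda>x. cphi \<mu> x * f x)" by (rule prim_integrable[OF prim_mult_csupp[OF f c] order_refl])
    moreover have "indicator {0..b} x *\<^sub>R (cphi \<mu> x * f x) = cphi \<mu> x * f x" for x
    proof (cases "x \<in> {0<..b}")
      case True
      then show ?thesis by (auto simp: indicator_def)
    next
      case False
      then have "f x = 0" using f by (simp add: csupp_def)
      then show ?thesis by simp
    qed
    ultimately show ?thesis unfolding set_integrable_def by simp
  qed
  show ?thesis
  proof (rule Lipschitz_continuous_on[of _ _ "L * I"])
    fix \<mu> \<mu>' assume mu: "\<mu> \<in> {l..m}" "\<mu>' \<in> {l..m}"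
    then have p: "\<mu> > 0" "\<mu>' > 0" using lm by auto
    have "ftr f \<mu> - ftr f \<mu>' = (LINT x|lborel. cphi \<mu> x * f x - cphi \<mu>' x * f x)"
      unfolding ftr_def by (rule Bochner_Integration.integral_diff[symmetric, OF int[OF p(1)] int[OF p(2)]])
    also have "cmod \<dots> \<le> (LINT x|lborel. (L * \<bar>\<mu> - \<mu>'\<bar>) * cmod (f x))"
    proof (rule Bochner_Integration.integral_norm_bound_integral)
      show "integrable lborel (\<lambda>x. cphi \<mu> x * f x - cphi \<mu>' x * f x)" by (intro Bochner_Integration.integrable_diff int p)
      show "integrable lborel (\<lambda>x. (L * \<bar>\<mu> - \<mu>'\<bar>) * cmod (f x))" by (intro integrable_mult_right integrable_norm csupp_integrable[OF f])
      fix x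
      show "cmod (cphi \<mu> x * f x - cphi \<mu>' x * f x) \<le> L * \<bar>\<mu> - \<mu>'\<bar> * cmod (f x)"
      proof (cases "x \<in> {0<..b}")
        case True
        have "cmod (cphi \<mu> x - cphi \<mu>' x) + cmod (vphi \<mu> x - vphi \<mu>' x) \<le> L * \<bar>\<mu> - \<mu>'\<bar>"
          by (rule L(2)[OF mu]) (use True in auto)
        then have "cmod (cphi \<mu> x - cphi \<mu>' x) \<le> L * \<bar>\<mu> - \<mu>'\<bar>" using norm_ge_zero[of "vphi \<mu> x - vphi \<mu>' x"] by linarith
        then show ?thesis unfolding left_diff_distrib[symmetric] norm_mult by (rule mult_right_mono) simp
      next
        case False
        then have "f x = 0" using f by (simp add: csupp_def)
        then show ?thesis by simp
      qed
    qed
    also have "\<dots> = L * I * \<bar>\<mu> - \<mu>'\<bar>" by (simp add: I_def)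
    finally show "dist (ftr f \<mu>) (ftr f \<mu>') \<le> L * I * \<bar>\<mu> - \<mu>'\<bar>" by (simp add: dist_norm)
  qed (use L(1) I in simp)
qed

lemma ftr_lin:
  assumes f: "csupp b f" and g: "csupp b g" and mu: "\<mu> > 0"
  shows "ftr (\<lambda>x. f x + c * g x) \<mu> = ftr f \<mu> + c * ftr g \<mu>"
proof -
  have cc: "continuous_on {0..} (cphi \<mu>)" using prim_cont[OF sol_prim(1)[OF vphi(1)[OF mu]]] .
  have e: "ftr w \<mu> = (LINT x:{0..b}|lborel. cphi \<mu> x * w x)" and i: "set_integrable lborel {0..b} (\<lambda>x. cphi \<mu> x * w x)" if w: "csupp b w" for w
  proof -
    show "ftr w \<mu> = (LINT x:{0..b}|lborel. cphi \<mu> x * w x)"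
      unfolding ftr_def using csupp_integral[OF w, of "\<lambda>t z. cphi \<mu> t * z" b] by simp
    show "set_integrable lborel {0..b} (\<lambda>x. cphi \<mu> x * w x)" by (rule prim_integrable[OF prim_mult_csupp[OF w cc] order_refl])
  qed
  have "ftr (\<lambda>x. f x + c * g x) \<mu> = (LINT x:{0..b}|lborel. cphi \<mu> x * f x + c * (cphi \<mu> x * g x))"
    unfolding e[OF csupp_lin[OF f g]] by (simp add: algebra_simps)
  also have "\<dots> = ftr f \<mu> + c * ftr g \<mu>"
    unfolding e[OF f] e[OF g] using i[OF f] i[OF g] by (simp add: set_integral_add)
  finally show ?thesis .
qed

text \<open>\<open>spectral_density\<close> is the diagonal case f = g; polarisation over the fourth
  roots of unity gives the rest, because the transform is linear.\<close>

lemma PE_ftr: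
  assumes f: "csupp b f" and g: "csupp b g" and b: "b > 0" and lm: "0 < l" "l < m"
  shows "ip (PE l m f) g = (LINT \<mu>:{l..m}|lborel. complex_of_real (\<kappa> \<mu> / pi) * ftr f \<mu> * cnj (ftr g \<mu>))"
proof -
  note Lf = csupp_L2[OF f] and Lg = csupp_L2[OF g]
  have lm': "l \<le> m" using lm by simp
  have kc: "continuous_on {l..m} \<kappa>" by (rule continuous_on_subset[OF kappa_cont]) (use lm in auto)
  define Q where "Q c = ip (PE l m (\<lambda>x. f x + c * g x)) (\<lambda>x. f x + c * g x)" for c
  define q2 where "q2 c \<mu> = complex_of_real (\<kappa> \<mu> / pi) * ((ftr f \<mu> + c * ftr g \<mu>) * cnj (ftr f \<mu> + c * ftr g \<mu>))" for c \<mu>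
  have q2i: "set_integrable lborel {l..m} (q2 c)" for c
    unfolding q2_def
    by (intro set_integrable_cont continuous_intros kc ftr_cont[OF f b lm(1) lm'] ftr_cont[OF g b lm(1) lm']) simp
  have Q: "Q c = (LINT \<mu>:{l..m}|lborel. q2 c \<mu>)" for c
  proof -
    have h: "csupp b (\<lambda>x. f x + c * g x)" by (rule csupp_lin[OF f g])
    note Lh = csupp_L2[OF h]
    have "Q c = complex_of_real (Ecdf (\<lambda>x. f x + c * g x) m - Ecdf (\<lambda>x. f x + c * g x) l)"
      unfolding Q_def PE_def by (simp add: ip_diff_left Lh ip_E_self)
    also have "Ecdf (\<lambda>x. f x + c * g x) m - Ecdf (\<lambda>x. f x + c * g x) l
       = (LINT \<mu>:{l..m}|lborel. \<kappa> \<mu> * (cmod (ftr (\<lambda>x. f x + c * g x) \<mu>))^2) / pi"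
      using spectral_density[OF h b lm] by (simp add: field_simps)
    also have "complex_of_real \<dots> = (LINT \<mu>:{l..m}|lborel. complex_of_real (\<kappa> \<mu> * (cmod (ftr (\<lambda>x. f x + c * g x) \<mu>))^2 / pi))"
      unfolding set_integral_of_real by simp
    also have "\<dots> = (LINT \<mu>:{l..m}|lborel. q2 c \<mu>)"
    proof (rule set_lebesgue_integral_cong)
      show "\<forall>\<mu>. \<mu> \<in> {l..m} \<longrightarrow> complex_of_real (\<kappa> \<mu> * (cmod (ftr (\<lambda>x. f x + c * g x) \<mu>))^2 / pi) = q2 c \<mu>"
      proof (intro allI impI)
        fix \<mu> assume "\<mu> \<in> {l..m}"
        then have "\<mu> > 0" using lm by simp
        then show "complex_of_real (\<kappa> \<mu> * (cmod (ftr (\<lambda>x. f x + c * g x) \<mu>))^2 / pi) = q2 c \<mu>"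
          unfolding q2_def ftr_lin[OF f g \<open>\<mu> > 0\<close>] complex_norm_square[symmetric] by simp
      qed
    qed simp
    finally show ?thesis .
  qed
  have exp: "Q c = ip (PE l m f) f + cnj c * ip (PE l m f) g + c * ip (PE l m g) f + (c * cnj c) * ip (PE l m g) g" for c
  proof -
    have "Q c = ip (\<lambda>x. PE l m f x + c * PE l m g x) (\<lambda>x. f x + c * g x)"
      unfolding Q_def by (rule ip_cong) (use PE_lin[OF Lf Lg] Lf Lg in \<open>auto intro!: L2_lin\<close>)
    then show ?thesis using Lf Lg by (simp add: ip_lin_left ip_lin_right L2_lin PE_L2 algebra_simps)
  qed
  have "4 * ip (PE l m f) g = Q 1 - Q (-1) + \<i> * Q \<i> - \<i> * Q (-\<i>)"
    unfolding exp by (simp add: algebra_simps)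
  also have "\<dots> = (LINT \<mu>:{l..m}|lborel. q2 1 \<mu> - q2 (-1) \<mu> + \<i> * q2 \<i> \<mu> - \<i> * q2 (-\<i>) \<mu>)"
    unfolding Q using q2i by (simp add: set_integral_diff set_integral_add set_integrable_mult_right)
  also have "\<dots> = (LINT \<mu>:{l..m}|lborel. 4 * (complex_of_real (\<kappa> \<mu> / pi) * ftr f \<mu> * cnj (ftr g \<mu>)))"
    unfolding q2_def by (intro set_lebesgue_integral_cong) (auto simp: algebra_simps)
  also have "\<dots> = 4 * (LINT \<mu>:{l..m}|lborel. complex_of_real (\<kappa> \<mu> / pi) * ftr f \<mu> * cnj (ftr g \<mu>))" by simp
  finally show ?thesis by (rule mult_left_cancel[THEN iffD1, rotated]) simp
qed

end

section \<open>The integral kernel of the spectral projections\<close>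

text \<open>The bounded factor is dominated by its bound, and the product of integrable functions of
  separate variables is integrable on the plane.\<close>

lemma Fubini_bounded:
  fixes a :: "real \<Rightarrow> real \<Rightarrow> complex" and r s :: "real \<Rightarrow> complex"
  assumes a: "(\<lambda>z. a (fst z) (snd z)) \<in> borel_measurable borel" and b: "\<And>x y. cmod (a x y) \<le> C"
    and r: "integrable lborel r" and s: "integrable lborel s"
  shows "(LINT x|lborel. LINT y|lborel. a x y * (r x * s y)) = (LINT y|lborel. LINT x|lborel. a x y * (r x * s y))"
    and "(\<lambda>y. LINT x|lborel. a x y * (r x * s y)) \<in> borel_measurable borel"
proof -
  have [measurable]: "r \<in> borel_measurable borel" "s \<in> borel_measurable borel"
    using borel_measurable_integrable[OF r] borel_measurable_integrable[OF s] by simp_all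
  have [measurable]: "(\<lambda>z. a (fst z) (snd z)) \<in> borel_measurable (borel \<Otimes>\<^sub>M borel)" using a by (simp add: borel_prod)
  have C: "C \<ge> 0" using order_trans[OF norm_ge_zero b[of 0 0]] .
  have m: "(\<lambda>(x, y). a x y * (r x * s y)) \<in> borel_measurable (lborel \<Otimes>\<^sub>M lborel)"
    by (simp add: case_prod_beta') measurable
  have rs: "integrable (lborel \<Otimes>\<^sub>M lborel) (\<lambda>(x, y). C * (r x * s y))"
  proof (rule lborel_pair.Fubini_integrable)
    show "(\<lambda>(x, y). C * (r x * s y)) \<in> borel_measurable (lborel \<Otimes>\<^sub>M lborel)" by measurable
    show "integrable lborel (\<lambda>x. LINT y|lborel. norm (case (x, y) of (x, y) \<Rightarrow> C * (r x * s y)))"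
      using r by (simp add: norm_mult)
    show "AE x in lborel. integrable lborel (\<lambda>y. case (x, y) of (x, y) \<Rightarrow> C * (r x * s y))" using s by simp
  qed
  have i: "integrable (lborel \<Otimes>\<^sub>M lborel) (\<lambda>(x, y). a x y * (r x * s y))"
  proof (rule Bochner_Integration.integrable_bound[OF rs m])
    show "AE z in lborel \<Otimes>\<^sub>M lborel. norm (case z of (x, y) \<Rightarrow> a x y * (r x * s y)) \<le> norm (case z of (x, y) \<Rightarrow> C * (r x * s y))"
      by (rule AE_I2) (use b C in \<open>auto simp: norm_mult intro!: mult_right_mono\<close>)
  qed
  show "(LINT x|lborel. LINT y|lborel. a x y * (r x * s y)) = (LINT y|lborel. LINT x|lborel. a x y * (r x * s y))"
    using lborel_pair.Fubini_integral[OF i] by simp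
  have "(\<lambda>y. LINT x|lborel. a x y * (r x * s y)) \<in> borel_measurable lborel"
  proof (rule lborel.borel_measurable_lebesgue_integral)
    have "(\<lambda>z :: real \<times> real. (snd z, fst z)) \<in> borel \<Otimes>\<^sub>M lborel \<rightarrow>\<^sub>M borel \<Otimes>\<^sub>M borel" by measurable
    from measurable_compose[OF this a[folded borel_prod]]
    have [measurable]: "(\<lambda>z. a (snd z) (fst z)) \<in> borel_measurable (borel \<Otimes>\<^sub>M lborel)" by simp
    have "(\<lambda>z. a (snd z) (fst z) * (r (snd z) * s (fst z))) \<in> borel_measurable (borel \<Otimes>\<^sub>M lborel)" by measurable
    then show "(\<lambda>(y, x). a x y * (r x * s y)) \<in> borel_measurable (lborel \<Otimes>\<^sub>M lborel)"
      by (simp add: case_prod_beta' measurable_cong_sets[OF sets_pair_measure_cong[OF sets_lborel refl] refl])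
  qed
  then show "(\<lambda>y. LINT x|lborel. a x y * (r x * s y)) \<in> borel_measurable borel" by simp
qed

lemma csupp_truncate:
  assumes m: "w \<in> borel_measurable lpos" and i: "integrable lpos (\<lambda>x. indicator {0<..n} x *\<^sub>R (cmod (w x))^2)"
  shows "csupp n (\<lambda>x. indicator {0<..n} x *\<^sub>R w x)"
  unfolding csupp_def
proof (intro conjI allI impI)
  have [measurable]: "(\<lambda>x. indicator {0<..} x *\<^sub>R w x) \<in> borel_measurable borel" using m by (simp add: measurable_lpos)
  have "(\<lambda>x. indicator {0<..n} x *\<^sub>R w x) = (\<lambda>x. indicator {..n} x *\<^sub>R (indicator {0<..} x *\<^sub>R w x))"
    by (auto simp: fun_eq_iff indicator_def)
  then show "(\<lambda>x. indicator {0<..n} x *\<^sub>R w x) \<in> borel_measurable borel"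
    by (simp only:) measurable
  have "(\<lambda>x. indicator {0<..} x *\<^sub>R (indicator {0<..n} x *\<^sub>R (cmod (w x))^2)) = (\<lambda>x. (cmod (indicator {0<..n} x *\<^sub>R w x))^2)"
    by (auto simp: fun_eq_iff indicator_def)
  then show "integrable lborel (\<lambda>x. (cmod (indicator {0<..n} x *\<^sub>R w x))^2)" using i unfolding integrable_lpos by simp
qed (simp add: indicator_def)

lemma csupp_truncate_L2:
  assumes "L2 w" shows "csupp n (\<lambda>x. indicator {0<..n} x *\<^sub>R w x)"
proof (rule csupp_truncate)
  show "w \<in> borel_measurable lpos" using assms by (simp add: L2_iff)
  show "integrable lpos (\<lambda>x. indicator {0<..n} x *\<^sub>R (cmod (w x))^2)"
  proof (rule Bochner_Integration.integrable_bound)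
    show "integrable lpos (\<lambda>x. (cmod (w x))^2)" using assms by (simp add: L2_iff)
    show "(\<lambda>x. indicator {0<..n} x *\<^sub>R (cmod (w x))^2) \<in> borel_measurable lpos"
      using assms by (intro borel_measurable_scaleR measurable_lpos_borel[of "indicator {0<..n}"] borel_measurable_power borel_measurable_norm)
        (auto simp: L2_iff)
  qed (auto simp: indicator_def)
qed

text \<open>Truncations of \<open>A\<close> itself serve as test functions; local square
  integrability is what makes them admissible.\<close>

lemma aeq_by_testing:
  assumes A: "A \<in> borel_measurable lpos" and loc: "\<And>n. integrable lpos (\<lambda>x. indicator {0<..real n} x *\<^sub>R (cmod (A x))^2)"
    and t: "\<And>h b. csupp b h \<Longrightarrow> b > 0 \<Longrightarrow> ip A h = 0"
  shows "aeq A (\<lambda>x. 0)"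
proof -
  have "AE x in lpos. indicator {0<..real (Suc n)} x *\<^sub>R (cmod (A x))^2 = 0" for n
  proof -
    define h where "h x = indicator {0<..real (Suc n)} x *\<^sub>R A x" for x
    have "csupp (real (Suc n)) h" unfolding h_def by (rule csupp_truncate[OF A loc])
    then have "ip A h = 0" by (rule t) simp
    moreover have "A x * cnj (h x) = complex_of_real (indicator {0<..real (Suc n)} x *\<^sub>R (cmod (A x))^2)" for x
      unfolding h_def by (simp add: indicator_def complex_norm_square del: of_real_power)
    ultimately have "complex_of_real (LINT x|lpos. indicator {0<..real (Suc n)} x *\<^sub>R (cmod (A x))^2) = 0"
      unfolding ip_eq by (simp only: integral_complex_of_real)
    then have "(LINT x|lpos. indicator {0<..real (Suc n)} x *\<^sub>R (cmod (A x))^2) = 0" by (simp only: of_real_eq_0_iff)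
    then show ?thesis by (subst (asm) integral_nonneg_eq_0_iff_AE[OF loc]) auto
  qed
  then have "AE x in lpos. \<forall>n. indicator {0<..real (Suc n)} x *\<^sub>R (cmod (A x))^2 = 0"
    by (intro AE_all_countable[THEN iffD2] allI)
  then show ?thesis
    unfolding aeq_iff
  proof (rule AE_mp[OF _ AE_I2], intro impI)
    fix x assume x: "x \<in> space lpos" and z: "\<forall>n. indicator {0<..real (Suc n)} x *\<^sub>R (cmod (A x))^2 = 0"
    obtain n :: nat where "x < real n" using reals_Archimedean2 by blast
    then have "x \<in> {0<..real (Suc n)}" using x by simp
    then show "A x = 0" using z[rule_format, of n] by simp
  qed
qed

context spectral_problem
begin

definition dens :: "real \<Rightarrow> real \<Rightarrow> real \<Rightarrow> real" where
  "dens x y \<mu> = \<kappa> \<mu> / pi * \<phi> x \<mu> * \<phi> y \<mu>"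

definition kern :: "real \<Rightarrow> real \<Rightarrow> real \<Rightarrow> real \<Rightarrow> real" where
  "kern l m x y = (LINT \<mu>:{l..m}|lborel. dens x y \<mu>)"

lemma phi_cont_mu': "x \<ge> 0 \<Longrightarrow> continuous_on {0<..} (\<lambda>\<mu>. \<phi> x \<mu>)"
proof -
  assume x: "x \<ge> 0"
  have "continuous_on {0<..} ((\<lambda>z. \<phi> (fst z) (snd z)) \<circ> (\<lambda>\<mu>. (x, \<mu>)))"
    by (rule continuous_on_compose) (auto intro!: continuous_intros continuous_on_subset[OF phi_joint] simp: x)
  then show ?thesis by (simp add: o_def)
qed

lemma dens_cont: "x \<ge> 0 \<Longrightarrow> y \<ge> 0 \<Longrightarrow> continuous_on {0<..} (dens x y)"
  unfolding dens_def by (intro continuous_intros kappa_cont phi_cont_mu') auto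

lemma dens_bounds:
  assumes lm: "0 < l" "l \<le> m"
  obtains K B where "K > 0" "B > 0" "\<And>\<mu>. \<mu> \<in> {l..m} \<Longrightarrow> \<bar>\<kappa> \<mu> / pi\<bar> \<le> K"
    "\<And>\<mu> x. \<mu> \<in> {l..m} \<Longrightarrow> x \<ge> 0 \<Longrightarrow> \<bar>\<phi> x \<mu>\<bar> \<le> B"
proof -
  have kc: "continuous_on {l..m} (\<lambda>\<mu>. \<kappa> \<mu> / pi)"
    by (intro continuous_on_divide continuous_on_const continuous_on_subset[OF kappa_cont]) (use lm in auto)
  obtain K where K: "\<And>\<mu>. \<mu> \<in> {l..m} \<Longrightarrow> norm (\<kappa> \<mu> / pi) \<le> K"
    by (rule continuous_on_Icc_bounded[OF kc]) (assumption | rule that)+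
  obtain B where B: "B > 0" "\<And>\<mu> x. \<mu> \<in> {l..m} \<Longrightarrow> x \<ge> 0 \<Longrightarrow> nsol (cphi \<mu>) (vphi \<mu>) x \<le> B"
    by (rule phi_bounded[OF lm]) (assumption | rule that)+
  show ?thesis
  proof (rule that[of "\<bar>K\<bar> + 1" B])
    show "\<bar>\<kappa> \<mu> / pi\<bar> \<le> \<bar>K\<bar> + 1" if "\<mu> \<in> {l..m}" for \<mu> using K[OF that] unfolding real_norm_def by linarith
    show "\<bar>\<phi> x \<mu>\<bar> \<le> B" if "\<mu> \<in> {l..m}" "x \<ge> 0" for \<mu> x
      using B(2)[OF that] norm_ge_zero[of "vphi \<mu> x"] unfolding nsol_def norm_of_real by linarith
  qed (use B(1) in auto)
qed

lemma dens_bounded: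
  assumes lm: "0 < l" "l \<le> m"
  obtains C where "C > 0" "\<And>\<mu> x y. \<mu> \<in> {l..m} \<Longrightarrow> x \<ge> 0 \<Longrightarrow> y \<ge> 0 \<Longrightarrow> \<bar>dens x y \<mu>\<bar> \<le> C"
proof -
  obtain K B where KB: "K > 0" "B > 0" "\<And>\<mu>. \<mu> \<in> {l..m} \<Longrightarrow> \<bar>\<kappa> \<mu> / pi\<bar> \<le> K"
    "\<And>\<mu> x. \<mu> \<in> {l..m} \<Longrightarrow> x \<ge> 0 \<Longrightarrow> \<bar>\<phi> x \<mu>\<bar> \<le> B"
    by (rule dens_bounds[OF lm]) (assumption | rule that)+
  show ?thesis
  proof (rule that[of "K * B * B"])
    show "K * B * B > 0" using KB by simp
    show "\<bar>dens x y \<mu>\<bar> \<le> K * B * B" if "\<mu> \<in> {l..m}" "x \<ge> 0" "y \<ge> 0" for \<mu> x y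
      unfolding dens_def abs_mult[of "\<kappa> \<mu> / pi * \<phi> x \<mu>"] abs_mult[of "\<kappa> \<mu> / pi"]
      using KB that by (intro mult_mono) auto
  qed
qed

text \<open>Joint measurability is obtained from joint continuity, which holds at positive energies
  and on the half-line; the indicator cuts the function off to that region.\<close>

lemma phi_cut_measurable:
  assumes lm: "0 < l"
  shows "(\<lambda>z. indicator ({l..m} \<times> {0<..}) z *\<^sub>R complex_of_real (\<kappa> (fst z) / pi * \<phi> (snd z) (fst z))) \<in> borel_measurable borel"
proof (rule borel_measurable_continuous_on_indicator)
  show "{l..m} \<times> {0<..} \<in> sets (borel :: (real \<times> real) measure)"
    unfolding borel_prod[symmetric] by (intro pair_measureI) auto
  have "continuous_on ({l..m} \<times> {0<..}) ((\<lambda>z. \<phi> (fst z) (snd z)) \<circ> (\<lambda>z. (snd z, fst z)))"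
    by (rule continuous_on_compose) (use lm in \<open>auto intro!: continuous_intros continuous_on_subset[OF phi_joint]\<close>)
  then have 1: "continuous_on ({l..m} \<times> {0<..}) (\<lambda>z. \<phi> (snd z) (fst z))" by (simp add: o_def)
  have "continuous_on ({l..m} \<times> ({0<..} :: real set)) (\<kappa> \<circ> fst)"
    by (rule continuous_on_compose) (use lm in \<open>auto intro!: continuous_intros continuous_on_subset[OF kappa_cont]\<close>)
  then have 2: "continuous_on ({l..m} \<times> ({0<..} :: real set)) (\<lambda>z. \<kappa> (fst z))" by (simp add: o_def)
  show "continuous_on ({l..m} \<times> {0<..}) (\<lambda>z. complex_of_real (\<kappa> (fst z) / pi * \<phi> (snd z) (fst z)))"
    by (intro continuous_on_of_real continuous_on_mult continuous_on_divide 1 2 continuous_on_const) auto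
qed

lemma kern_measurable:
  assumes lm: "0 < l"
  shows "(\<lambda>z. indicator ({0<..} \<times> {0<..}) z *\<^sub>R complex_of_real (kern l m (fst z) (snd z))) \<in> borel_measurable borel"
    (is "?k \<in> _")
proof -
  define a where "a \<mu> x = indicator ({l..m} \<times> {0<..}) (\<mu>, x) *\<^sub>R complex_of_real (\<kappa> \<mu> / pi * \<phi> x \<mu>)" for \<mu> x
  have am: "(\<lambda>z. a (fst z) (snd z)) \<in> borel_measurable borel"
    unfolding a_def using phi_cut_measurable[OF lm, of m] by simp
  \<comment> \<open>The density split into two factors, each cut off to the region of joint
    continuity, so that the integrand is Borel in the position pair and the energy together.\<close>
  define A where "A \<mu> z = indicator {0<..} (fst z) *\<^sub>R (a \<mu> (fst z) * (indicator ({l..m} \<times> {0<..}) (\<mu>, snd z) *\<^sub>R complex_of_real (\<phi> (snd z) \<mu>)))" for \<mu> and z :: "real \<times> real"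
  have "?k = (\<lambda>z. LINT \<mu>|lborel. A \<mu> z)"
  proof
    fix z :: "real \<times> real"
    obtain x y where z: "z = (x, y)" by (cases z)
    show "?k z = (LINT \<mu>|lborel. A \<mu> z)"
    proof (cases "x > 0 \<and> y > 0")
      case True
      have "(LINT \<mu>|lborel. A \<mu> z) = (LINT \<mu>:{l..m}|lborel. complex_of_real (dens x y \<mu>))"
        unfolding set_lebesgue_integral_def z A_def
        by (rule Bochner_Integration.integral_cong[OF refl]) (use True in \<open>auto simp: a_def dens_def indicator_def\<close>)
      then show ?thesis using True by (simp add: z set_integral_of_real kern_def)
    next
      case False
      then have "A \<mu> z = 0" for \<mu> by (auto simp: A_def z indicator_def)
      then show ?thesis using False by (auto simp: z indicator_def)
    qed
  qed
  moreover have "(\<lambda>z. LINT \<mu>|lborel. A \<mu> z) \<in> borel_measurable (borel \<Otimes>\<^sub>M borel)"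
  proof (rule lborel.borel_measurable_lebesgue_integral)
    have am2: "(\<lambda>v :: (real \<times> real) \<times> real. a (snd v) (fst (fst v))) \<in> borel_measurable ((borel \<Otimes>\<^sub>M borel) \<Otimes>\<^sub>M lborel)"
    proof -
      have "(\<lambda>v :: (real \<times> real) \<times> real. (snd v, fst (fst v))) \<in> (borel \<Otimes>\<^sub>M borel) \<Otimes>\<^sub>M lborel \<rightarrow>\<^sub>M borel \<Otimes>\<^sub>M borel" by measurable
      from measurable_compose[OF this am[folded borel_prod]] show ?thesis by simp
    qed
    have bm2: "(\<lambda>v :: (real \<times> real) \<times> real. indicator ({l..m} \<times> {0<..}) (snd v, snd (fst v)) *\<^sub>R complex_of_real (\<phi> (snd (fst v)) (snd v))) \<in> borel_measurable ((borel \<Otimes>\<^sub>M borel) \<Otimes>\<^sub>M lborel)"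
    proof -
      have c: "(\<lambda>z. indicator ({l..m} \<times> {0<..}) z *\<^sub>R complex_of_real (\<phi> (snd z) (fst z))) \<in> borel_measurable borel"
      proof (rule borel_measurable_continuous_on_indicator)
        show "{l..m} \<times> {0<..} \<in> sets (borel :: (real \<times> real) measure)"
          unfolding borel_prod[symmetric] by (intro pair_measureI) auto
        have "continuous_on ({l..m} \<times> {0<..}) ((\<lambda>z. \<phi> (fst z) (snd z)) \<circ> (\<lambda>z. (snd z, fst z)))"
          by (rule continuous_on_compose) (use lm in \<open>auto intro!: continuous_intros continuous_on_subset[OF phi_joint]\<close>)
        then show "continuous_on ({l..m} \<times> {0<..}) (\<lambda>z. complex_of_real (\<phi> (snd z) (fst z)))"
          by (intro continuous_on_of_real) (simp add: o_def)
      qed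
      have "(\<lambda>v :: (real \<times> real) \<times> real. (snd v, snd (fst v))) \<in> (borel \<Otimes>\<^sub>M borel) \<Otimes>\<^sub>M lborel \<rightarrow>\<^sub>M borel \<Otimes>\<^sub>M borel" by measurable
      from measurable_compose[OF this c[folded borel_prod]] show ?thesis by simp
    qed
    have "(\<lambda>v :: (real \<times> real) \<times> real. indicator {0<..} (fst (fst v)) *\<^sub>R (a (snd v) (fst (fst v)) * (indicator ({l..m} \<times> {0<..}) (snd v, snd (fst v)) *\<^sub>R complex_of_real (\<phi> (snd (fst v)) (snd v)))))
      \<in> borel_measurable ((borel \<Otimes>\<^sub>M borel) \<Otimes>\<^sub>M lborel)"
      by (intro borel_measurable_scaleR borel_measurable_times am2 bm2) measurable
    then show "(\<lambda>(z, \<mu>). A \<mu> z) \<in> borel_measurable ((borel \<Otimes>\<^sub>M borel) \<Otimes>\<^sub>M lborel)"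
      by (simp add: A_def case_prod_beta')
  qed
  ultimately show ?thesis by (simp add: borel_prod)
qed

text \<open>With \<open>d = 0\<close> this is a size bound; with \<open>d\<close> the density at an
  endpoint of the interval it is the fundamental theorem of calculus for the kernel.\<close>

lemma kern_close:
  assumes lm: "0 < l" "l \<le> m" and xy: "x \<ge> 0" "y \<ge> 0" and e: "\<And>\<mu>. \<mu> \<in> {l..m} \<Longrightarrow> \<bar>dens x y \<mu> - d\<bar> \<le> e"
  shows "\<bar>kern l m x y - d * (m - l)\<bar> \<le> e * (m - l)"
proof -
  have "continuous_on {l..m} (dens x y)" by (rule continuous_on_subset[OF dens_cont]) (use xy lm in auto)
  then have i1: "set_integrable lborel {l..m} (\<lambda>\<mu>. complex_of_real (dens x y \<mu>))"
    by (intro set_integrable_cont continuous_on_of_real)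
  have i2: "set_integrable lborel {l..m} (\<lambda>\<mu>. complex_of_real d)" by (rule set_integrable_const)
  have "cmod (LINT \<mu>:{l..m}|lborel. complex_of_real (dens x y \<mu>) - complex_of_real d) \<le> (LINT \<mu>:{l..m}|lborel. e)"
  proof (rule norm_set_integral_le)
    show "set_integrable lborel {l..m} (\<lambda>\<mu>. complex_of_real (dens x y \<mu>) - complex_of_real d)"
      by (rule set_integral_diff(1)[OF i1 i2])
    show "cmod (complex_of_real (dens x y \<mu>) - complex_of_real d) \<le> e" if "l \<le> \<mu>" "\<mu> \<le> m" for \<mu>
      using e[of \<mu>] that unfolding of_real_diff[symmetric] norm_of_real by simp
  qed (rule set_integrable_const)
  also have "\<dots> = e * (m - l)" using lm by (simp add: set_integral_const)
  also have "(LINT \<mu>:{l..m}|lborel. complex_of_real (dens x y \<mu>) - complex_of_real d)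
      = complex_of_real (kern l m x y) - (LINT \<mu>:{l..m}|lborel. complex_of_real d)"
    unfolding set_integral_diff(2)[OF i1 i2] set_integral_of_real kern_def ..
  also have "(LINT \<mu>:{l..m}|lborel. complex_of_real d) = complex_of_real (d * (m - l))"
    using lm by (simp add: set_integral_of_real set_integral_const)
  finally show ?thesis unfolding of_real_diff[symmetric] norm_of_real .
qed

lemma kern_bounded:
  assumes lm: "0 < l" "l \<le> m" and xy: "x \<ge> 0" "y \<ge> 0" and C: "\<And>\<mu>. \<mu> \<in> {l..m} \<Longrightarrow> \<bar>dens x y \<mu>\<bar> \<le> C"
  shows "\<bar>kern l m x y\<bar> \<le> C * (m - l)"
  using kern_close[OF lm xy, of 0 C] C by simp

text \<open>For truncations of \<open>w\<close> the pairing with a test function is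
  \<open>PE_ftr\<close>. The truncations converge, and since \<phi> is bounded and \<open>w\<close>
  integrable their transforms converge boundedly on [l, m]. Fubini, used twice, rewrites the energy
  integral as a pairing with the kernel operator, and \<open>aeq_by_testing\<close> removes the test
  function. Integrability of \<open>w\<close> is available later because \<sigma> f is a product of
  two L2 functions.\<close>

lemma spectral_kernel:
  assumes lm: "0 < l" "l < m" and w: "L2 w" and w1: "integrable lpos w"
  shows "aeq (PE l m w) (\<lambda>x. LINT y|lpos. complex_of_real (kern l m x y) * w y)"
proof -
  have lm': "l \<le> m" using lm by simp
  obtain K B where KB: "K > 0" "B > 0" "\<And>\<mu>. \<mu> \<in> {l..m} \<Longrightarrow> \<bar>\<kappa> \<mu> / pi\<bar> \<le> K"
    "\<And>\<mu> x. \<mu> \<in> {l..m} \<Longrightarrow> x \<ge> 0 \<Longrightarrow> \<bar>\<phi> x \<mu>\<bar> \<le> B"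
    by (rule dens_bounds[OF lm(1) lm']) (assumption | rule that)+
  define T where "T x = (LINT y|lpos. complex_of_real (kern l m x y) * w y)" for x
  define W where "W y = indicator {0<..} y *\<^sub>R w y" for y
  have Wi: "integrable lborel W" using w1 by (simp add: integrable_lpos W_def[abs_def])
  have Wm [measurable]: "W \<in> borel_measurable borel" using borel_measurable_integrable[OF Wi] by simp
  define a where "a \<mu> x = indicator ({l..m} \<times> {0<..}) (\<mu>, x) *\<^sub>R complex_of_real (\<kappa> \<mu> / pi * \<phi> x \<mu>)" for \<mu> x
  have am: "(\<lambda>z. a (fst z) (snd z)) \<in> borel_measurable borel"
    unfolding a_def using phi_cut_measurable[OF lm(1), of m] by simp
  have ab: "cmod (a \<mu> x) \<le> K * B" for \<mu> x
  proof (cases "\<mu> \<in> {l..m} \<and> x \<in> {0<..}")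
    case True
    then have "\<bar>\<kappa> \<mu> / pi\<bar> * \<bar>\<phi> x \<mu>\<bar> \<le> K * B" using KB by (intro mult_mono) auto
    then show ?thesis using True unfolding a_def norm_scaleR norm_of_real abs_mult by (simp add: indicator_def)
  next
    case False
    then show ?thesis using KB by (auto simp: a_def indicator_def)
  qed
  \<comment> \<open>The transform of \<open>w\<close>, which has no compact support: it converges
    because \<phi> is bounded and \<open>w\<close> is integrable.\<close>
  define Fw where "Fw \<mu> = (LINT y|lpos. cphi \<mu> y * w y)" for \<mu>
  have cphi_lpos: "cphi \<mu> \<in> borel_measurable lpos" if "\<mu> > 0" for \<mu>
    by (rule measurable_lpos_cont[OF prim_cont[OF sol_prim(1)[OF vphi(1)[OF that]]]])
  have wm: "w \<in> borel_measurable lpos" using w by (simp add: L2_iff)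
  have Fwi: "integrable lpos (\<lambda>y. cphi \<mu> y * w y)" if mu: "\<mu> \<in> {l..m}" for \<mu>
  proof (rule Bochner_Integration.integrable_bound[OF integrable_mult_right[OF integrable_norm[OF w1], of B]])
    show "(\<lambda>y. cphi \<mu> y * w y) \<in> borel_measurable lpos"
      using mu lm by (intro borel_measurable_times cphi_lpos wm) auto
    show "AE y in lpos. norm (cphi \<mu> y * w y) \<le> norm (B * norm (w y))"
    proof (rule AE_I2)
      fix y assume "y \<in> space lpos"
      then have "\<bar>\<phi> y \<mu>\<bar> * cmod (w y) \<le> B * cmod (w y)" using KB(4)[OF mu, of y] by (intro mult_right_mono) auto
      then show "norm (cphi \<mu> y * w y) \<le> norm (B * norm (w y))" using KB(2) by (simp add: norm_mult)
    qed
  qed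
  define wn where "wn n x = indicator {0<..real (Suc n)} x *\<^sub>R w x" for n x
  have wn: "csupp (real (Suc n)) (wn n)" for n unfolding wn_def by (rule csupp_truncate_L2[OF w])
  have wnle: "cmod (wn n x) \<le> cmod (w x)" for n x by (simp add: wn_def indicator_def)
  have wnlim: "(\<lambda>n. wn n x) \<longlonglongrightarrow> w x" if "x > 0" for x
  proof (rule tendsto_eventually)
    obtain n0 :: nat where "x < real n0" using reals_Archimedean2 by blast
    then show "\<forall>\<^sub>F n in sequentially. wn n x = w x"
      using that by (intro eventually_sequentiallyI[of n0]) (auto simp: wn_def)
  qed
  have main: "ip (PE l m w) h = ip T h" and Tm: "T \<in> borel_measurable lpos" and Tb: "\<And>x. x > 0 \<Longrightarrow> cmod (T x) \<le> K * B * B * (m - l) * (LINT y|lborel. cmod (W y))"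
    if h: "csupp b h" and b: "b > 0" for h b
  proof -
    note Lh = csupp_L2[OF h]
    have hi: "integrable lborel h" by (rule csupp_integrable[OF h])
    have fh: "continuous_on {l..m} (ftr h)" by (rule ftr_cont[OF h b lm(1) lm'])
    have kc: "continuous_on {l..m} \<kappa>" by (rule continuous_on_subset[OF kappa_cont]) (use lm in auto)
    have lim1: "(\<lambda>n. ip (PE l m (wn n)) h) \<longlonglongrightarrow> ip (PE l m w) h"
    proof -
      have "(\<lambda>n. LINT x|lpos. wn n x * cnj (PE l m h x)) \<longlonglongrightarrow> (LINT x|lpos. w x * cnj (PE l m h x))"
      proof (rule integral_dominated_convergence[where w="\<lambda>x. cmod (w x) * cmod (PE l m h x)"])
        show "integrable lpos (\<lambda>x. cmod (w x) * cmod (PE l m h x))" by (rule L2_integrable_norm[OF w PE_L2[OF Lh]])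
        show "(\<lambda>x. w x * cnj (PE l m h x)) \<in> borel_measurable lpos"
          by (rule borel_measurable_integrable[OF L2_integrable[OF w PE_L2[OF Lh]]])
        show "(\<lambda>x. wn n x * cnj (PE l m h x)) \<in> borel_measurable lpos" for n
          by (rule borel_measurable_integrable[OF L2_integrable[OF csupp_L2[OF wn] PE_L2[OF Lh]]])
        show "AE x in lpos. (\<lambda>n. wn n x * cnj (PE l m h x)) \<longlonglongrightarrow> w x * cnj (PE l m h x)"
          by (rule AE_I2) (intro tendsto_mult tendsto_const wnlim, simp)
        show "AE x in lpos. norm (wn n x * cnj (PE l m h x)) \<le> cmod (w x) * cmod (PE l m h x)" for n
          by (rule AE_I2) (simp add: norm_mult mult_right_mono wnle)
      qed
      then have "(\<lambda>n. ip (wn n) (PE l m h)) \<longlonglongrightarrow> ip w (PE l m h)" unfolding ip_eq .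
      then show ?thesis using ip_PE[OF csupp_L2[OF wn] Lh, of l m] ip_PE[OF w Lh, of l m] by simp
    qed
    have fwn: "ftr (wn n) \<mu> = (LINT y|lpos. cphi \<mu> y * wn n y)" for n \<mu>
      unfolding ftr_def integral_lpos
    proof (rule Bochner_Integration.integral_cong[OF refl])
      fix y show "cphi \<mu> y * wn n y = indicator {0<..} y *\<^sub>R (cphi \<mu> y * wn n y)" by (auto simp: wn_def indicator_def)
    qed
    have flim: "(\<lambda>n. ftr (wn n) \<mu>) \<longlonglongrightarrow> Fw \<mu>" if mu: "\<mu> \<in> {l..m}" for \<mu>
      unfolding fwn Fw_def
    proof (rule integral_dominated_convergence[where w="\<lambda>y. cmod (cphi \<mu> y * w y)"])
      show "integrable lpos (\<lambda>y. cmod (cphi \<mu> y * w y))" by (rule integrable_norm[OF Fwi[OF mu]])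
      show "(\<lambda>y. cphi \<mu> y * w y) \<in> borel_measurable lpos" by (rule borel_measurable_integrable[OF Fwi[OF mu]])
      show "(\<lambda>y. cphi \<mu> y * wn n y) \<in> borel_measurable lpos" for n
        using mu lm csupp_L2[OF wn, of n] by (intro borel_measurable_times cphi_lpos) (auto simp: L2_iff)
      show "AE y in lpos. (\<lambda>n. cphi \<mu> y * wn n y) \<longlonglongrightarrow> cphi \<mu> y * w y"
        by (rule AE_I2) (intro tendsto_mult tendsto_const wnlim, simp)
      show "AE y in lpos. norm (cphi \<mu> y * wn n y) \<le> cmod (cphi \<mu> y * w y)" for n
        by (rule AE_I2) (unfold norm_mult, intro mult_left_mono wnle norm_ge_zero)
    qed
    define I where "I = (LINT y|lborel. cmod (W y))"
    have fb: "cmod (ftr (wn n) \<mu>) \<le> B * I" if mu: "\<mu> \<in> {l..m}" for n \<mu>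
    proof -
      have "cmod (ftr (wn n) \<mu>) \<le> (LINT y|lpos. B * cmod (w y))"
        unfolding fwn
      proof (rule Bochner_Integration.integral_norm_bound_integral)
        show "integrable lpos (\<lambda>y. B * cmod (w y))" by (intro integrable_mult_right integrable_norm w1)
        show le: "cmod (cphi \<mu> y * wn n y) \<le> B * cmod (w y)" if "y \<in> space lpos" for y
          unfolding norm_mult norm_of_real using KB(2) KB(4)[OF mu, of y] that wnle by (intro mult_mono) auto
        show "integrable lpos (\<lambda>y. cphi \<mu> y * wn n y)"
        proof (rule Bochner_Integration.integrable_bound[OF \<open>integrable lpos (\<lambda>y. B * cmod (w y))\<close>])
          show "(\<lambda>y. cphi \<mu> y * wn n y) \<in> borel_measurable lpos"
            using mu lm csupp_L2[OF wn, of n] by (intro borel_measurable_times cphi_lpos) (auto simp: L2_iff)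
          show "AE y in lpos. norm (cphi \<mu> y * wn n y) \<le> norm (B * cmod (w y))"
            by (rule AE_I2, rule order_trans[OF le]) auto
        qed
      qed
      also have "\<dots> = B * (LINT y|lborel. cmod (W y))"
        unfolding integral_lpos W_def by (simp flip: integral_mult_right_zero) (rule Bochner_Integration.integral_cong, auto simp: indicator_def)
      finally show ?thesis by (simp add: I_def)
    qed
    \<comment> \<open>The part of the pairing that is independent of the truncation; its modulus
      times a constant is the dominating function.\<close>
    define G where "G \<mu> = indicator {l..m} \<mu> *\<^sub>R (complex_of_real (\<kappa> \<mu> / pi) * cnj (ftr h \<mu>))" for \<mu>
    have Gi: "integrable lborel G"
    proof -
      have "set_integrable lborel {l..m} (\<lambda>\<mu>. complex_of_real (\<kappa> \<mu> / pi) * cnj (ftr h \<mu>))"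
        by (intro set_integrable_cont continuous_intros kc fh) simp
      then show ?thesis by (simp add: set_integrable_def G_def[abs_def])
    qed
    have fwnc: "continuous_on {l..m} (ftr (wn n))" for n by (rule ftr_cont[OF wn _ lm(1) lm']) simp
    have lim2: "(\<lambda>n. LINT \<mu>|lborel. indicator {l..m} \<mu> *\<^sub>R (complex_of_real (\<kappa> \<mu> / pi) * ftr (wn n) \<mu> * cnj (ftr h \<mu>)))
       \<longlonglongrightarrow> (LINT \<mu>|lborel. Fw \<mu> * G \<mu>)"
    proof (rule integral_dominated_convergence[where w="\<lambda>\<mu>. B * I * cmod (G \<mu>)"])
      show "integrable lborel (\<lambda>\<mu>. B * I * cmod (G \<mu>))" by (intro integrable_mult_right integrable_norm Gi)
      show m1: "(\<lambda>\<mu>. indicator {l..m} \<mu> *\<^sub>R (complex_of_real (\<kappa> \<mu> / pi) * ftr (wn n) \<mu> * cnj (ftr h \<mu>))) \<in> borel_measurable lborel" for n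
      proof -
        have "set_integrable lborel {l..m} (\<lambda>\<mu>. complex_of_real (\<kappa> \<mu> / pi) * ftr (wn n) \<mu> * cnj (ftr h \<mu>))"
          by (intro set_integrable_cont continuous_intros kc fh fwnc) simp
        then show ?thesis unfolding set_integrable_def by (rule borel_measurable_integrable)
      qed
      have l: "(\<lambda>n. indicator {l..m} \<mu> *\<^sub>R (complex_of_real (\<kappa> \<mu> / pi) * ftr (wn n) \<mu> * cnj (ftr h \<mu>))) \<longlonglongrightarrow> Fw \<mu> * G \<mu>" for \<mu>
      proof (cases "\<mu> \<in> {l..m}")
        case True
        have "(\<lambda>n. complex_of_real (\<kappa> \<mu> / pi) * ftr (wn n) \<mu> * cnj (ftr h \<mu>)) \<longlonglongrightarrow> complex_of_real (\<kappa> \<mu> / pi) * Fw \<mu> * cnj (ftr h \<mu>)"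
          by (intro tendsto_intros flim[OF True])
        then show ?thesis using True by (simp add: G_def mult_ac)
      next
        case False
        then show ?thesis by (simp add: G_def)
      qed
      then show "AE \<mu> in lborel. (\<lambda>n. indicator {l..m} \<mu> *\<^sub>R (complex_of_real (\<kappa> \<mu> / pi) * ftr (wn n) \<mu> * cnj (ftr h \<mu>))) \<longlonglongrightarrow> Fw \<mu> * G \<mu>"
        by simp
      show "(\<lambda>\<mu>. Fw \<mu> * G \<mu>) \<in> borel_measurable lborel" by (rule borel_measurable_LIMSEQ_metric[OF m1 l])
      show "AE \<mu> in lborel. norm (indicator {l..m} \<mu> *\<^sub>R (complex_of_real (\<kappa> \<mu> / pi) * ftr (wn n) \<mu> * cnj (ftr h \<mu>))) \<le> B * I * cmod (G \<mu>)" for n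
      proof (rule AE_I2)
        fix \<mu>
        show "norm (indicator {l..m} \<mu> *\<^sub>R (complex_of_real (\<kappa> \<mu> / pi) * ftr (wn n) \<mu> * cnj (ftr h \<mu>))) \<le> B * I * cmod (G \<mu>)"
        proof (cases "\<mu> \<in> {l..m}")
          case True
          have "norm (indicator {l..m} \<mu> *\<^sub>R (complex_of_real (\<kappa> \<mu> / pi) * ftr (wn n) \<mu> * cnj (ftr h \<mu>))) = cmod (ftr (wn n) \<mu>) * cmod (G \<mu>)"
            using True by (simp add: norm_mult norm_divide G_def norm_mult mult_ac)
          also have "\<dots> \<le> B * I * cmod (G \<mu>)" by (intro mult_right_mono fb[OF True]) simp
          finally show ?thesis .
        next
          case False
          then show ?thesis by (simp add: G_def)
        qed
      qed
    qed
    have "ip (PE l m (wn n)) h = (LINT \<mu>|lborel. indicator {l..m} \<mu> *\<^sub>R (complex_of_real (\<kappa> \<mu> / pi) * ftr (wn n) \<mu> * cnj (ftr h \<mu>)))" for n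
    proof -
      define b' where "b' = max b (real (Suc n))"
      have cs: "csupp b' (wn n)" "csupp b' h" by (rule csupp_mono[OF wn], simp add: b'_def) (rule csupp_mono[OF h], simp add: b'_def)
      have "b' > 0" using b by (simp add: b'_def)
      then show ?thesis using PE_ftr[OF cs _ lm] unfolding set_lebesgue_integral_def by blast
    qed
    then have e1: "ip (PE l m w) h = (LINT \<mu>|lborel. Fw \<mu> * G \<mu>)"
      using lim1 lim2 LIMSEQ_unique by simp
    define R where "R \<mu> = indicator {l..m} \<mu> *\<^sub>R Fw \<mu>" for \<mu>
    have one: "integrable lborel (\<lambda>\<mu>. indicator {l..m} \<mu> *\<^sub>R (1::complex))"
      using set_integrable_const[of l m "1::complex"] by (simp add: set_integrable_def)
    have Req: "R \<mu> = (LINT y|lborel. (indicator ({l..m} \<times> {0<..}) (\<mu>, y) *\<^sub>R complex_of_real (\<phi> y \<mu>)) * W y)" for \<mu>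
    proof (cases "\<mu> \<in> {l..m}")
      case True
      then show ?thesis unfolding R_def Fw_def integral_lpos W_def
        by (auto simp: indicator_def intro!: Bochner_Integration.integral_cong)
    next
      case False
      then have "indicator ({l..m} \<times> {0<..}) (\<mu>, y) = (0::real)" for y :: real by (auto simp: indicator_def)
      then show ?thesis using False by (simp add: R_def)
    qed
    have Fwb: "cmod (Fw \<mu>) \<le> B * I" if "\<mu> \<in> {l..m}" for \<mu>
      by (rule LIMSEQ_le_const2[OF tendsto_norm[OF flim[OF that]]]) (use fb[OF that] in auto)
    have Rm: "R \<in> borel_measurable borel"
    proof (rule borel_measurable_LIMSEQ_metric)
      show "(\<lambda>\<mu>. indicator {l..m} \<mu> *\<^sub>R ftr (wn n) \<mu>) \<in> borel_measurable borel" for n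
        by (rule borel_measurable_continuous_on_indicator[OF _ fwnc]) simp
      show "(\<lambda>n. indicator {l..m} \<mu> *\<^sub>R ftr (wn n) \<mu>) \<longlonglongrightarrow> R \<mu>" for \<mu>
        using flim[of \<mu>] by (cases "\<mu> \<in> {l..m}") (simp_all add: R_def)
    qed
    have Ri: "integrable lborel R"
    proof (rule Bochner_Integration.integrable_bound[OF integrable_mult_right[OF one, of "complex_of_real (B * I)"]])
      show "R \<in> borel_measurable lborel" using Rm by simp
      show "AE \<mu> in lborel. norm (R \<mu>) \<le> norm (complex_of_real (B * I) * (indicator {l..m} \<mu> *\<^sub>R 1))"
      proof (rule AE_I2)
        fix \<mu>
        have "\<mu> \<in> {l..m} \<Longrightarrow> cmod (Fw \<mu>) \<le> \<bar>B * I\<bar>" by (rule order_trans[OF Fwb abs_ge_self])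
        then show "norm (R \<mu>) \<le> norm (complex_of_real (B * I) * (indicator {l..m} \<mu> *\<^sub>R 1))"
          unfolding R_def norm_mult norm_of_real norm_scaleR by (cases "\<mu> \<in> {l..m}") simp_all
      qed
    qed
    have hci: "integrable lborel (\<lambda>x. cnj (h x))" by (rule integrable_cnj[OF hi])
    have "(LINT \<mu>|lborel. Fw \<mu> * G \<mu>) = (LINT \<mu>|lborel. LINT x|lborel. a \<mu> x * (R \<mu> * cnj (h x)))"
    proof (rule Bochner_Integration.integral_cong[OF refl])
      fix \<mu>
      show "Fw \<mu> * G \<mu> = (LINT x|lborel. a \<mu> x * (R \<mu> * cnj (h x)))"
      proof (cases "\<mu> \<in> {l..m}")
        case True
        have "cnj (ftr h \<mu>) = (LINT x|lborel. cphi \<mu> x * cnj (h x))"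
          unfolding ftr_def by (subst Bochner_Integration.integral_cnj[symmetric]) simp
        moreover have "G \<mu> = complex_of_real (\<kappa> \<mu> / pi) * cnj (ftr h \<mu>)" using True unfolding G_def by simp
        ultimately have "Fw \<mu> * G \<mu> = Fw \<mu> * complex_of_real (\<kappa> \<mu> / pi) * (LINT x|lborel. cphi \<mu> x * cnj (h x))"
          by (simp only: mult.assoc)
        also have "\<dots> = (LINT x|lborel. Fw \<mu> * complex_of_real (\<kappa> \<mu> / pi) * (cphi \<mu> x * cnj (h x)))"
          by (rule integral_mult_right_zero[symmetric])
        also have "\<dots> = (LINT x|lborel. a \<mu> x * (R \<mu> * cnj (h x)))"
        proof (rule Bochner_Integration.integral_cong[OF refl])
          fix x
          show "Fw \<mu> * complex_of_real (\<kappa> \<mu> / pi) * (cphi \<mu> x * cnj (h x)) = a \<mu> x * (R \<mu> * cnj (h x))"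
          proof (cases "x > 0")
            case True
            then show ?thesis using \<open>\<mu> \<in> {l..m}\<close> by (simp add: a_def R_def indicator_def)
          next
            case False
            then have "h x = 0" using h by (simp add: csupp_def)
            then show ?thesis by simp
          qed
        qed
        finally show ?thesis .
      next
        case False
        then show ?thesis by (simp add: G_def R_def)
      qed
    qed
    \<comment> \<open>The first exchange, of the energy with the variable of the test function. The
      second, inside, exchanges the energy with the variable of \<open>w\<close> and produces the
      kernel.\<close>
    also have "\<dots> = (LINT x|lborel. LINT \<mu>|lborel. a \<mu> x * (R \<mu> * cnj (h x)))"
      by (rule Fubini_bounded(1)[OF am ab Ri hci])
    also have "\<dots> = (LINT x|lborel. indicator {0<..} x *\<^sub>R (T x * cnj (h x)))"
    proof (rule Bochner_Integration.integral_cong[OF refl])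
      fix x
      show "(LINT \<mu>|lborel. a \<mu> x * (R \<mu> * cnj (h x))) = indicator {0<..} x *\<^sub>R (T x * cnj (h x))"
      proof (cases "x > 0")
        case True
        have ax: "(\<lambda>z. a (fst z) x) \<in> borel_measurable (borel :: (real \<times> real) measure)"
        proof -
          have "(\<lambda>\<mu>. a (fst (\<mu>, x)) (snd (\<mu>, x))) \<in> borel_measurable borel"
            by (rule measurable_compose[OF _ am]) (simp add: borel_prod[symmetric])
          then have am': "(\<lambda>\<mu>. a \<mu> x) \<in> borel_measurable borel" by simp
          have fm: "fst \<in> (borel :: (real \<times> real) measure) \<rightarrow>\<^sub>M borel"
            by (intro borel_measurable_continuous_onI continuous_on_fst continuous_on_id)
          show ?thesis by (rule measurable_compose[OF fm am'])
        qed
        define b where "b \<mu> y = indicator ({l..m} \<times> {0<..}) (\<mu>, y) *\<^sub>R complex_of_real (\<phi> y \<mu>)" for \<mu> y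
        have bm: "(\<lambda>z. b (fst z) (snd z)) \<in> borel_measurable borel"
        proof -
          have "(\<lambda>z. indicator ({l..m} \<times> {0<..}) z *\<^sub>R complex_of_real (\<phi> (snd z) (fst z))) \<in> borel_measurable borel"
          proof (rule borel_measurable_continuous_on_indicator)
            show "{l..m} \<times> {0<..} \<in> sets (borel :: (real \<times> real) measure)"
              unfolding borel_prod[symmetric] by (intro pair_measureI) auto
            have "continuous_on ({l..m} \<times> {0<..}) ((\<lambda>z. \<phi> (fst z) (snd z)) \<circ> (\<lambda>z. (snd z, fst z)))"
              by (rule continuous_on_compose) (use lm in \<open>auto intro!: continuous_intros continuous_on_subset[OF phi_joint]\<close>)
            then show "continuous_on ({l..m} \<times> {0<..}) (\<lambda>z. complex_of_real (\<phi> (snd z) (fst z)))"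
              by (intro continuous_on_of_real) (simp add: o_def)
          qed
          then show ?thesis unfolding b_def by simp
        qed
        have bb: "cmod (a \<mu> x * b \<mu> y) \<le> K * B * B" for \<mu> y
        proof -
          have "cmod (b \<mu> y) \<le> B" using KB(2) KB(4)[of \<mu> y] by (auto simp: b_def indicator_def)
          then show ?thesis unfolding norm_mult using ab[of \<mu> x] KB by (intro mult_mono) auto
        qed
        have "(LINT \<mu>|lborel. a \<mu> x * R \<mu>) = (LINT \<mu>|lborel. LINT y|lborel. (a \<mu> x * b \<mu> y) * ((indicator {l..m} \<mu> *\<^sub>R 1) * W y))"
        proof (rule Bochner_Integration.integral_cong[OF refl])
          fix \<mu>
          have "a \<mu> x * R \<mu> = (LINT y|lborel. a \<mu> x * (b \<mu> y * W y))" unfolding Req b_def[symmetric] by simp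
          also have "\<dots> = (LINT y|lborel. (a \<mu> x * b \<mu> y) * ((indicator {l..m} \<mu> *\<^sub>R 1) * W y))"
            by (rule Bochner_Integration.integral_cong[OF refl]) (auto simp: a_def indicator_def)
          finally show "a \<mu> x * R \<mu> = (LINT y|lborel. (a \<mu> x * b \<mu> y) * ((indicator {l..m} \<mu> *\<^sub>R 1) * W y))" .
        qed
        also have "\<dots> = (LINT y|lborel. LINT \<mu>|lborel. (a \<mu> x * b \<mu> y) * ((indicator {l..m} \<mu> *\<^sub>R 1) * W y))"
          by (rule Fubini_bounded(1)[where a="\<lambda>\<mu> y. a \<mu> x * b \<mu> y" and C="K * B * B" and s=W
                and r="\<lambda>\<mu>. indicator {l..m} \<mu> *\<^sub>R 1", OF _ bb one Wi]) (intro borel_measurable_times ax bm)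
        also have "\<dots> = T x"
          unfolding T_def integral_lpos
        proof (rule Bochner_Integration.integral_cong[OF refl])
          fix y
          have "(LINT \<mu>|lborel. (a \<mu> x * b \<mu> y) * ((indicator {l..m} \<mu> *\<^sub>R 1) * W y)) = (LINT \<mu>|lborel. (a \<mu> x * b \<mu> y) * (indicator {l..m} \<mu> *\<^sub>R 1)) * W y"
            by (simp only: mult.assoc[symmetric] integral_mult_left_zero)
          also have "\<dots> = indicator {0<..} y *\<^sub>R (complex_of_real (kern l m x y) * w y)"
          proof (cases "y > 0")
            case y: True
            have "(LINT \<mu>|lborel. (a \<mu> x * b \<mu> y) * (indicator {l..m} \<mu> *\<^sub>R 1)) = (LINT \<mu>:{l..m}|lborel. complex_of_real (dens x y \<mu>))"
              unfolding set_lebesgue_integral_def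
              by (rule Bochner_Integration.integral_cong[OF refl]) (use True y in \<open>auto simp: a_def b_def dens_def indicator_def\<close>)
            also have "\<dots> = complex_of_real (kern l m x y)" unfolding set_integral_of_real kern_def ..
            finally have e: "(LINT \<mu>|lborel. (a \<mu> x * b \<mu> y) * (indicator {l..m} \<mu> *\<^sub>R 1)) = complex_of_real (kern l m x y)" .
            show ?thesis unfolding e using y by (simp add: W_def)
          next
            case False
            then show ?thesis by (simp add: W_def)
          qed
          finally show "(LINT \<mu>|lborel. (a \<mu> x * b \<mu> y) * ((indicator {l..m} \<mu> *\<^sub>R 1) * W y)) = indicator {0<..} y *\<^sub>R (complex_of_real (kern l m x y) * w y)" .
        qed
        finally have "(LINT \<mu>|lborel. a \<mu> x * R \<mu>) = T x" .
        moreover have "(LINT \<mu>|lborel. a \<mu> x * (R \<mu> * cnj (h x))) = (LINT \<mu>|lborel. a \<mu> x * R \<mu>) * cnj (h x)"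
          by (simp only: mult.assoc[symmetric] integral_mult_left_zero)
        ultimately show ?thesis using True by simp
      next
        case False
        then have "h x = 0" using h by (simp add: csupp_def)
        then show ?thesis by simp
      qed
    qed
    also have "\<dots> = ip T h" unfolding ip_eq integral_lpos ..
    finally show "ip (PE l m w) h = ip T h" using e1 by simp
    have kb: "\<bar>kern l m x y\<bar> \<le> K * B * B * (m - l)" if xy: "x > 0" "y > 0" for x y
    proof (rule kern_bounded[OF lm(1) lm'])
      fix \<mu> assume "\<mu> \<in> {l..m}"
      then have "\<bar>\<kappa> \<mu> / pi\<bar> * \<bar>\<phi> x \<mu>\<bar> * \<bar>\<phi> y \<mu>\<bar> \<le> K * B * B" using KB xy by (intro mult_mono) auto
      then show "\<bar>dens x y \<mu>\<bar> \<le> K * B * B" unfolding dens_def abs_mult .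
    qed (use xy in auto)
    show "cmod (T x) \<le> K * B * B * (m - l) * (LINT y|lborel. cmod (W y))" if x: "x > 0" for x
    proof -
      have "cmod (T x) \<le> (LINT y|lborel. cmod (indicator {0<..} y *\<^sub>R (complex_of_real (kern l m x y) * w y)))"
        unfolding T_def integral_lpos by (rule integral_norm_bound)
      also have "\<dots> \<le> (LINT y|lborel. K * B * B * (m - l) * cmod (W y))"
      proof (rule integral_mono')
        show "integrable lborel (\<lambda>y. K * B * B * (m - l) * cmod (W y))" by (intro integrable_mult_right integrable_norm Wi)
        show "cmod (indicator {0<..} y *\<^sub>R (complex_of_real (kern l m x y) * w y)) \<le> K * B * B * (m - l) * cmod (W y)" for y
          using kb[OF x, of y] by (cases "y > 0") (simp_all add: W_def norm_mult mult_right_mono)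
      qed (use KB lm in simp)
      finally show ?thesis by simp
    qed
    have "(\<lambda>x. indicator {0<..} x *\<^sub>R T x) \<in> borel_measurable borel"
    proof -
      note mk = kern_measurable[OF lm(1), of m]
      let ?k = "\<lambda>z. indicator ({0<..} \<times> {0<..}) z *\<^sub>R complex_of_real (kern l m (fst z) (snd z))"
      have "(\<lambda>x. LINT y|lborel. ?k (x, y) * W y) \<in> borel_measurable borel"
      proof (rule lborel.borel_measurable_lebesgue_integral)
        have "(\<lambda>z. ?k z * W (snd z)) \<in> borel_measurable (borel \<Otimes>\<^sub>M lborel)"
        proof (intro borel_measurable_times)
          show "?k \<in> borel_measurable (borel \<Otimes>\<^sub>M lborel)" using mk[folded borel_prod]
            by (simp add: measurable_cong_sets[OF sets_pair_measure_cong[OF refl sets_lborel] refl])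
        qed measurable
        then show "(\<lambda>(x, y). ?k (x, y) * W y) \<in> borel_measurable (borel \<Otimes>\<^sub>M lborel)" by (simp add: case_prod_beta')
      qed
      moreover have "indicator {0<..} x *\<^sub>R T x = (LINT y|lborel. ?k (x, y) * W y)" for x
      proof (cases "x > 0")
        case True
        then have "indicator {0<..} x *\<^sub>R T x = (LINT y|lborel. indicator {0<..} y *\<^sub>R (complex_of_real (kern l m x y) * w y))"
          unfolding T_def integral_lpos by simp
        also have "\<dots> = (LINT y|lborel. ?k (x, y) * W y)"
          by (rule Bochner_Integration.integral_cong[OF refl]) (use True in \<open>auto simp: W_def indicator_def\<close>)
        finally show ?thesis .
      next
        case False
        then show ?thesis by (simp add: indicator_def)
      qed
      ultimately show ?thesis by simp
    qed
    then show "T \<in> borel_measurable lpos" by (simp add: measurable_lpos)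
  qed
  \<comment> \<open>Measurability and boundedness of \<open>T\<close> were proved in a block that
    fixes a test function, although they speak of \<open>T\<close> alone; the zero function releases
    them.\<close>
  have c0: "csupp 1 (\<lambda>x. 0)" by (simp add: csupp_def)
  have Tm: "T \<in> borel_measurable lpos" and Tb: "\<And>x. x > 0 \<Longrightarrow> cmod (T x) \<le> K * B * B * (m - l) * (LINT y|lborel. cmod (W y))"
    using Tm[OF c0] Tb[OF c0] by simp_all
  define M where "M = K * B * B * (m - l) * (LINT y|lborel. cmod (W y))"
  note LP = PE_L2[OF w, of l m]
  have LPm: "PE l m w \<in> borel_measurable lpos" using LP by (simp add: L2_iff)
  have "aeq (\<lambda>x. PE l m w x - T x) (\<lambda>x. 0)"
  proof (rule aeq_by_testing)
    show Dm: "(\<lambda>x. PE l m w x - T x) \<in> borel_measurable lpos" by (intro borel_measurable_diff LPm Tm)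
    \<comment> \<open>At this stage \<open>T\<close> is known to be bounded but not to be square
      integrable, hence the truncation.\<close>
    show "integrable lpos (\<lambda>x. indicator {0<..real n} x *\<^sub>R (cmod (PE l m w x - T x))^2)" for n
    proof (rule Bochner_Integration.integrable_bound)
      have "integrable lborel (\<lambda>x. indicator {0<..} x *\<^sub>R indicator {0..real n} x :: real)"
        by (intro integrable_mult_indicator integrable_real_indicator) (auto simp: emeasure_lborel_Icc_eq)
      then have "integrable lpos (indicator {0..real n} :: real \<Rightarrow> real)" by (simp only: integrable_lpos)
      then show "integrable lpos (\<lambda>x. 2 * (cmod (PE l m w x))^2 + 2 * M^2 * indicator {0..real n} x)"
        using LP by (intro Bochner_Integration.integrable_add integrable_mult_right) (auto simp: L2_iff)
      show "(\<lambda>x. indicator {0<..real n} x *\<^sub>R (cmod (PE l m w x - T x))^2) \<in> borel_measurable lpos"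
        by (intro borel_measurable_scaleR measurable_lpos_borel[of "indicator {0<..real n}"] borel_measurable_power measurable_compose[OF Dm borel_measurable_norm]) auto
      show "AE x in lpos. norm (indicator {0<..real n} x *\<^sub>R (cmod (PE l m w x - T x))^2)
          \<le> norm (2 * (cmod (PE l m w x))^2 + 2 * M^2 * indicator {0..real n} x)"
      proof (rule AE_I2)
        fix x assume "x \<in> space lpos"
        then have Tx: "cmod (T x) \<le> M" using Tb[of x] by (simp add: M_def)
        have "(cmod (PE l m w x - T x))^2 \<le> (cmod (PE l m w x) + M)^2"
          by (intro power_mono order_trans[OF norm_triangle_ineq4] add_left_mono Tx) simp
        also have "\<dots> \<le> 2 * (cmod (PE l m w x))^2 + 2 * M^2"
          using sum_squares_bound[of "cmod (PE l m w x)" M] by (simp add: power2_sum)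
        finally show "norm (indicator {0<..real n} x *\<^sub>R (cmod (PE l m w x - T x))^2)
          \<le> norm (2 * (cmod (PE l m w x))^2 + 2 * M^2 * indicator {0..real n} x)"
          by (auto simp: indicator_def)
      qed
    qed
    fix h b assume h: "csupp b h" and b: "b > 0"
    have "ip (\<lambda>x. PE l m w x - T x) h = ip (PE l m w) h - ip T h"
    proof -
      have Th: "integrable lpos (\<lambda>x. T x * cnj (h x))"
      proof (rule Bochner_Integration.integrable_bound)
        show "integrable lpos (\<lambda>x. M * cmod (h x))"
          unfolding integrable_lpos using csupp_integrable[OF h] by (intro integrable_mult_indicator) auto
        show "(\<lambda>x. T x * cnj (h x)) \<in> borel_measurable lpos"
          using csupp_L2[OF h] by (intro borel_measurable_times measurable_cnj Tm) (simp add: L2_iff)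
        show "AE x in lpos. norm (T x * cnj (h x)) \<le> norm (M * cmod (h x))"
        proof (rule AE_I2)
          fix x assume "x \<in> space lpos"
          then have "cmod (T x) * cmod (h x) \<le> M * cmod (h x)" using Tb[of x] unfolding M_def by (intro mult_right_mono) auto
          also have "\<dots> \<le> norm (M * cmod (h x))" by simp
          finally show "norm (T x * cnj (h x)) \<le> norm (M * cmod (h x))" by (simp only: norm_mult complex_mod_cnj)
        qed
      qed
      show ?thesis unfolding ip_eq left_diff_distrib
        by (rule Bochner_Integration.integral_diff[OF L2_integrable[OF LP csupp_L2[OF h]] Th])
    qed
    then show "ip (\<lambda>x. PE l m w x - T x) h = 0" using main[OF h b] by simp
  qed
  then show ?thesis unfolding aeq_iff T_def[symmetric] by (auto elim: eventually_mono)
qed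

end

section \<open>Hilbert-Schmidt convergence\<close>

text \<open>Extension by zero from the open quadrant to the plane, so that measurability of a kernel
  can be stated for Borel functions of the whole plane.\<close>

definition cutk :: "(real \<Rightarrow> real \<Rightarrow> real) \<Rightarrow> real \<times> real \<Rightarrow> complex" where
  "cutk G z = indicator ({0<..} \<times> {0<..}) z *\<^sub>R complex_of_real (G (fst z) (snd z))"

text \<open>The weight |\<sigma>(x)|^2 |\<sigma>(y)|^2 on the quadrant. It is integrable because
  \<sigma> is in L2, and up to a constant it dominates all integrands of Hilbert-Schmidt norms
  below.\<close>

definition hsw :: "(real \<Rightarrow> complex) \<Rightarrow> real \<times> real \<Rightarrow> real" where
  "hsw \<sigma> z = (cmod (indicator {0<..} (fst z) *\<^sub>R \<sigma> (fst z)))^2 * (cmod (indicator {0<..} (snd z) *\<^sub>R \<sigma> (snd z)))^2"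

lemma hsw_integrable:
  assumes s: "L2 \<sigma>" shows "integrable lborel (hsw \<sigma>)"
proof -
  define s where "s x = (cmod (indicator {0<..} x *\<^sub>R \<sigma> x))^2" for x
  have si: "integrable lborel s"
  proof -
    have "integrable lborel (\<lambda>x. indicator {0<..} x *\<^sub>R (cmod (\<sigma> x))^2)" using assms by (simp add: L2_iff integrable_lpos)
    moreover have "(\<lambda>x. indicator {0<..} x *\<^sub>R (cmod (\<sigma> x))^2) = s" by (auto simp: fun_eq_iff s_def indicator_def)
    ultimately show ?thesis by simp
  qed
  have [measurable]: "s \<in> borel_measurable borel" using borel_measurable_integrable[OF si] by simp
  have "integrable (lborel \<Otimes>\<^sub>M lborel) (\<lambda>(x, y). s x * s y)"
  proof (rule lborel_pair.Fubini_integrable)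
    show "(\<lambda>(x, y). s x * s y) \<in> borel_measurable (lborel \<Otimes>\<^sub>M lborel)" by measurable
    show "integrable lborel (\<lambda>x. LINT y|lborel. norm (case (x, y) of (x, y) \<Rightarrow> s x * s y))"
      using si by (simp add: abs_mult)
    show "AE x in lborel. integrable lborel (\<lambda>y. case (x, y) of (x, y) \<Rightarrow> s x * s y)" using si by simp
  qed
  then show ?thesis unfolding lborel_prod s_def hsw_def[abs_def] by (simp add: case_prod_beta')
qed

lemma weighted_kernel_norm:
  "indicator ({0<..} \<times> {0<..}) z *\<^sub>R (cmod (\<sigma> (fst z) * complex_of_real (G (fst z) (snd z)) * \<sigma> (snd z)))^2
    = hsw \<sigma> z * (cmod (cutk G z))^2"
  by (cases z) (auto simp: hsw_def cutk_def indicator_def norm_mult power_mult_distrib)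

lemma weighted_kernel_integrable:
  assumes s: "L2 \<sigma>" and G: "cutk G \<in> borel_measurable borel" and C: "\<And>x y. x > 0 \<Longrightarrow> y > 0 \<Longrightarrow> \<bar>G x y\<bar> \<le> C"
  shows "integrable lborel (\<lambda>z. hsw \<sigma> z * (cmod (cutk G z))^2)"
    and "norm (hsw \<sigma> z * (cmod (cutk G z))^2) \<le> C^2 * hsw \<sigma> z"
proof -
  have *: "norm (hsw \<sigma> z * (cmod (cutk G z))^2) \<le> C^2 * hsw \<sigma> z" for z
  proof -
    have h0: "hsw \<sigma> z \<ge> 0" by (simp add: hsw_def)
    have C0: "0 \<le> C" using C[of 1 1] by simp
    have "cmod (cutk G z) \<le> C" using C[of "fst z" "snd z"] C0 by (cases z) (auto simp: cutk_def indicator_def)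
    then have "(cmod (cutk G z))^2 \<le> C^2" by (intro power_mono) auto
    then have "hsw \<sigma> z * (cmod (cutk G z))^2 \<le> hsw \<sigma> z * C^2" by (rule mult_left_mono) (rule h0)
    moreover have "norm (hsw \<sigma> z * (cmod (cutk G z))^2) = hsw \<sigma> z * (cmod (cutk G z))^2"
      using h0 by simp
    ultimately show ?thesis by (simp only: mult.commute[of "C^2" "hsw \<sigma> z"])
  qed
  then show "norm (hsw \<sigma> z * (cmod (cutk G z))^2) \<le> C^2 * hsw \<sigma> z" .
  show "integrable lborel (\<lambda>z. hsw \<sigma> z * (cmod (cutk G z))^2)"
  proof (rule Bochner_Integration.integrable_bound[OF integrable_mult_right[OF hsw_integrable[OF s], of "C^2"]])
    show "(\<lambda>z. hsw \<sigma> z * (cmod (cutk G z))^2) \<in> borel_measurable lborel"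
    proof (intro borel_measurable_times borel_measurable_power borel_measurable_integrable[OF hsw_integrable[OF s]])
      show "(\<lambda>z. cmod (cutk G z)) \<in> borel_measurable lborel"
        using measurable_compose[OF G borel_measurable_norm] by simp
    qed
  qed (rule AE_I2, rule order_trans[OF * order_trans[OF abs_ge_self]], simp)
qed

lemma weighted_L2k:
  assumes s: "L2 \<sigma>" and G: "cutk G \<in> borel_measurable borel" and C: "\<And>x y. x > 0 \<Longrightarrow> y > 0 \<Longrightarrow> \<bar>G x y\<bar> \<le> C"
  shows "L2k (\<lambda>x y. \<sigma> x * complex_of_real (G x y) * \<sigma> y)"
  unfolding L2k_def set_integrable_def weighted_kernel_norm
proof (intro conjI weighted_kernel_integrable[OF s G C])
  have sm: "(\<lambda>x. indicator {0<..} x *\<^sub>R \<sigma> x) \<in> borel_measurable borel" using s by (simp add: L2_iff measurable_lpos)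
  have f: "fst \<in> (borel :: (real \<times> real) measure) \<rightarrow>\<^sub>M borel" "snd \<in> (borel :: (real \<times> real) measure) \<rightarrow>\<^sub>M borel"
    by (intro borel_measurable_continuous_onI continuous_intros)+
  have "(\<lambda>z. (indicator {0<..} (fst z) *\<^sub>R \<sigma> (fst z)) * cutk G z * (indicator {0<..} (snd z) *\<^sub>R \<sigma> (snd z))) \<in> borel_measurable borel"
    by (intro borel_measurable_times G measurable_compose[OF f(1) sm] measurable_compose[OF f(2) sm])
  also have "(\<lambda>z. (indicator {0<..} (fst z) *\<^sub>R \<sigma> (fst z)) * cutk G z * (indicator {0<..} (snd z) *\<^sub>R \<sigma> (snd z)))
      = (\<lambda>z. indicator ({0<..} \<times> {0<..}) z *\<^sub>R (\<sigma> (fst z) * complex_of_real (G (fst z) (snd z)) * \<sigma> (snd z)))"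
    by (auto simp: fun_eq_iff cutk_def indicator_def)
  finally show "set_borel_measurable lborel ({0<..} \<times> {0<..}) (\<lambda>z. \<sigma> (fst z) * complex_of_real (G (fst z) (snd z)) * \<sigma> (snd z))"
    unfolding set_borel_measurable_def by simp
qed

text \<open>Pointwise convergence of uniformly bounded kernels suffices: \<sigma> supplies the
  integrable majorant C^2 times \<open>hsw\<close>.\<close>

lemma weighted_hsn_tendsto:
  fixes H :: "real \<Rightarrow> real \<Rightarrow> real \<Rightarrow> real"
  assumes s: "L2 \<sigma>" and d: "d > 0"
    and H: "\<And>m. m \<noteq> l \<Longrightarrow> \<bar>m - l\<bar> < d \<Longrightarrow> cutk (H m) \<in> borel_measurable borel"
    and C: "\<And>m x y. m \<noteq> l \<Longrightarrow> \<bar>m - l\<bar> < d \<Longrightarrow> x > 0 \<Longrightarrow> y > 0 \<Longrightarrow> \<bar>H m x y\<bar> \<le> C"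
    and lim: "\<And>x y. x > 0 \<Longrightarrow> y > 0 \<Longrightarrow> ((\<lambda>m. H m x y) \<longlongrightarrow> 0) (at l)"
  shows "((\<lambda>m. hsn (\<lambda>x y. \<sigma> x * complex_of_real (H m x y) * \<sigma> y)) \<longlongrightarrow> 0) (at l)"
proof -
  let ?S = "{l - d<..<l + d}"
  have at: "at l within ?S = at l" by (rule at_within_open) (use d in auto)
  have "((\<lambda>m. hsn (\<lambda>x y. \<sigma> x * complex_of_real (H m x y) * \<sigma> y)) \<longlongrightarrow> 0) (at l within ?S)"
  \<comment> \<open>Dominated convergence is applied along sequences; restricting to the
    neighbourhood \<open>?S\<close> guarantees the hypotheses for every member of the
    sequence.\<close>
  proof (rule tendsto_at_iff_sequentially[THEN iffD2], intro allI impI)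
    fix X :: "nat \<Rightarrow> real" assume X: "\<forall>i. X i \<in> ?S - {l}" and Xl: "X \<longlonglongrightarrow> l"
    have Xn: "X n \<noteq> l" "\<bar>X n - l\<bar> < d" for n using X[rule_format, of n] by auto
    have fl: "filterlim X (at l) sequentially" using Xl Xn(1) by (simp add: filterlim_at)
    have "(\<lambda>n. LINT z|lborel. hsw \<sigma> z * (cmod (cutk (H (X n)) z))^2) \<longlonglongrightarrow> (LINT z|(lborel :: (real \<times> real) measure). 0)"
    proof (rule integral_dominated_convergence[where w="\<lambda>z. C^2 * hsw \<sigma> z"])
      show "integrable lborel (\<lambda>z. C^2 * hsw \<sigma> z)" by (intro integrable_mult_right hsw_integrable[OF s])
      show "(\<lambda>z. hsw \<sigma> z * (cmod (cutk (H (X n)) z))^2) \<in> borel_measurable lborel" for n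
        by (rule borel_measurable_integrable[OF weighted_kernel_integrable(1)[OF s H[OF Xn] C[OF Xn]]])
      show "AE z in lborel. norm (hsw \<sigma> z * (cmod (cutk (H (X n)) z))^2) \<le> C^2 * hsw \<sigma> z" for n
        by (rule AE_I2, rule weighted_kernel_integrable(2)[OF s H[OF Xn] C[OF Xn]])
      show "AE z in lborel. (\<lambda>n. hsw \<sigma> z * (cmod (cutk (H (X n)) z))^2) \<longlonglongrightarrow> 0"
      proof (rule AE_I2)
        fix z :: "real \<times> real"
        have "(\<lambda>n. cutk (H (X n)) z) \<longlonglongrightarrow> 0"
        proof (cases "z \<in> {0<..} \<times> {0<..}")
          case True
          have "(\<lambda>n. H (X n) (fst z) (snd z)) \<longlonglongrightarrow> 0"
            by (rule filterlim_compose[OF lim fl]) (use True in auto)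
          from tendsto_of_real[OF this] show ?thesis using True by (simp add: cutk_def)
        next
          case False
          then show ?thesis by (simp add: cutk_def)
        qed
        from tendsto_mult[OF tendsto_const[of "hsw \<sigma> z"] tendsto_power[OF tendsto_norm[OF this], of 2]]
        show "(\<lambda>n. hsw \<sigma> z * (cmod (cutk (H (X n)) z))^2) \<longlonglongrightarrow> 0" by simp
      qed
    qed simp
    from tendsto_real_sqrt[OF this]
    show "((\<lambda>m. hsn (\<lambda>x y. \<sigma> x * complex_of_real (H m x y) * \<sigma> y)) \<circ> X) \<longlonglongrightarrow> 0"
      unfolding hsn_def set_lebesgue_integral_def weighted_kernel_norm o_def by simp
  qed
  then show ?thesis unfolding at .
qed

context spectral_problem
begin

lemma dens_cut_measurable:
  assumes m: "\<mu> > 0" shows "cutk (\<lambda>x y. dens x y \<mu>) \<in> borel_measurable borel"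
  unfolding cutk_def[abs_def]
proof (rule borel_measurable_continuous_on_indicator)
  show "{0<..} \<times> {0<..} \<in> sets (borel :: (real \<times> real) measure)"
    unfolding borel_prod[symmetric] by (intro pair_measureI) auto
  have "continuous_on {0<..} ((\<lambda>z. \<phi> (fst z) (snd z)) \<circ> (\<lambda>x. (x, \<mu>)))"
    by (rule continuous_on_compose) (use m in \<open>auto intro!: continuous_intros continuous_on_subset[OF phi_joint]\<close>)
  then have c: "continuous_on {0<..} (\<lambda>x. \<phi> x \<mu>)" by (simp add: o_def)
  have c1: "continuous_on ({0<..} \<times> ({0<..} :: real set)) (\<lambda>z. \<phi> (fst z) \<mu>)"
    by (rule continuous_on_compose2[OF c]) (auto intro!: continuous_intros)
  have c2: "continuous_on (({0<..} :: real set) \<times> {0<..}) (\<lambda>z. \<phi> (snd z) \<mu>)"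
    by (rule continuous_on_compose2[OF c]) (auto intro!: continuous_intros)
  show "continuous_on ({0<..} \<times> {0<..}) (\<lambda>z. complex_of_real (dens (fst z) (snd z) \<mu>))"
    unfolding dens_def by (intro continuous_on_of_real continuous_on_mult c1 c2 continuous_on_const)
qed

lemma dens_tendsto:
  assumes "l > 0" "x \<ge> 0" "y \<ge> 0" shows "(dens x y \<longlongrightarrow> dens x y l) (at l)"
proof -
  have "continuous (at l) (dens x y)"
    using continuous_on_eq_continuous_at[OF open_greaterThan, of 0 "dens x y"] dens_cont[OF assms(2,3)] assms(1) by auto
  then show ?thesis by (simp add: isCont_def)
qed

text \<open>The kernel of the difference quotient, in one formula for both sides of
  \<open>l\<close>: exchanging the endpoints changes the sign of E(m) - E(l) and of m - l
  alike.\<close>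

definition avg :: "real \<Rightarrow> real \<Rightarrow> real \<Rightarrow> real \<Rightarrow> real" where
  "avg l m x y = kern (min l m) (max l m) x y / \<bar>m - l\<bar>"

lemma max_min_dist: "max l m - min l m = \<bar>m - l\<bar>" for l m :: real by (simp add: max_def min_def)

lemma avg_measurable:
  assumes "l > 0" "m > 0" shows "cutk (avg l m) \<in> borel_measurable borel"
proof -
  have "(\<lambda>z. indicator ({0<..} \<times> {0<..}) z *\<^sub>R complex_of_real (kern (min l m) (max l m) (fst z) (snd z)) / complex_of_real \<bar>m - l\<bar>) \<in> borel_measurable borel"
    using assms by (intro borel_measurable_divide kern_measurable borel_measurable_const) auto
  then show ?thesis by (simp only: cutk_def[abs_def] avg_def of_real_divide times_divide_eq_right scaleR_conv_of_real)
qed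

lemma avg_tendsto:
  assumes l: "l > 0" and xy: "x \<ge> 0" "y \<ge> 0"
  shows "((\<lambda>m. avg l m x y) \<longlongrightarrow> dens x y l) (at l)"
  unfolding LIM_def
proof (intro allI impI)
  fix e :: real assume e: "e > 0"
  have "\<exists>s>0. \<forall>\<mu>. \<mu> \<noteq> l \<and> dist \<mu> l < s \<longrightarrow> dist (dens x y \<mu>) (dens x y l) < e / 2"
    using dens_tendsto[OF l xy, unfolded LIM_def, rule_format, OF half_gt_zero[OF e]] .
  then obtain s where s: "s > 0" "\<And>\<mu>. \<mu> \<noteq> l \<Longrightarrow> dist \<mu> l < s \<Longrightarrow> dist (dens x y \<mu>) (dens x y l) < e / 2" by blast
  show "\<exists>s>0. \<forall>m. m \<noteq> l \<and> dist m l < s \<longrightarrow> dist (avg l m x y) (dens x y l) < e"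
  \<comment> \<open>The second entry keeps \<open>m\<close> positive, so that the whole interval
    between \<open>l\<close> and \<open>m\<close> consists of positive energies.\<close>
  proof (intro exI[of _ "min s l"] conjI allI impI)
    show "min s l > 0" using s l by simp
    fix m assume m: "m \<noteq> l \<and> dist m l < min s l"
    have "\<bar>kern (min l m) (max l m) x y - dens x y l * (max l m - min l m)\<bar> \<le> e / 2 * (max l m - min l m)"
    proof (rule kern_close[OF _ _ xy])
      show "0 < min l m" using m l by (auto simp: dist_real_def)
      fix \<mu> assume mu: "\<mu> \<in> {min l m..max l m}"
      show "\<bar>dens x y \<mu> - dens x y l\<bar> \<le> e / 2"
      proof (cases "\<mu> = l")
        case False
        have "dist \<mu> l < s" using mu m unfolding dist_real_def by (auto simp: min_def max_def split: if_splits)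
        from s(2)[OF False this] show ?thesis by (simp add: dist_real_def)
      qed (use e in simp)
    qed simp
    then have *: "\<bar>kern (min l m) (max l m) x y - dens x y l * \<bar>m - l\<bar>\<bar> \<le> e / 2 * \<bar>m - l\<bar>" unfolding max_min_dist .
    have ml: "\<bar>m - l\<bar> > 0" using m by simp
    have "avg l m x y - dens x y l = (kern (min l m) (max l m) x y - dens x y l * \<bar>m - l\<bar>) / \<bar>m - l\<bar>"
      using ml unfolding avg_def by (simp add: diff_divide_distrib)
    then have "dist (avg l m x y) (dens x y l) = \<bar>kern (min l m) (max l m) x y - dens x y l * \<bar>m - l\<bar>\<bar> / \<bar>m - l\<bar>"
      unfolding dist_real_def by (simp only: abs_divide abs_abs)
    also have "\<dots> \<le> e / 2" using * ml by (simp only: pos_divide_le_eq)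
    finally show "dist (avg l m x y) (dens x y l) < e" using e by simp
  qed
qed

lemma avg_bounded:
  assumes l: "0 < a" "a \<le> l" "l \<le> b" and m: "a \<le> m" "m \<le> b" "m \<noteq> l" and xy: "x \<ge> 0" "y \<ge> 0"
    and C: "\<And>\<mu>. \<mu> \<in> {a..b} \<Longrightarrow> \<bar>dens x y \<mu>\<bar> \<le> C"
  shows "\<bar>avg l m x y\<bar> \<le> C"
proof -
  have "\<bar>kern (min l m) (max l m) x y\<bar> \<le> C * (max l m - min l m)"
    by (rule kern_bounded[OF _ _ xy C]) (use l m in auto)
  then show ?thesis unfolding max_min_dist avg_def abs_divide abs_abs using m(3) by (simp add: pos_divide_le_eq)
qed

text \<open>\<sigma> f is integrable as a product of two L2 functions and square integrable by
  assumption, which is what \<open>spectral_kernel\<close> asks for; the outer factor \<sigma> is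
  then multiplied in pointwise.\<close>

lemma kop_avg:
  assumes l: "l > 0" and m: "m > 0" "m \<noteq> l" and s: "L2 \<sigma>" and f: "L2 f" and w: "L2 (\<lambda>x. \<sigma> x * f x)"
  shows "aeq (\<lambda>x. \<sigma> x * (E m (\<lambda>y. \<sigma> y * f y) x - E l (\<lambda>y. \<sigma> y * f y) x) / complex_of_real (m - l))
    (kop (\<lambda>x y. \<sigma> x * complex_of_real (avg l m x y) * \<sigma> y) f)"
proof -
  define w where "w = (\<lambda>x. \<sigma> x * f x)"
  have w1: "integrable lpos w"
  proof (rule Bochner_Integration.integrable_bound[OF L2_integrable_norm[OF s f]])
    show "w \<in> borel_measurable lpos" using w by (simp add: L2_iff w_def)
  qed (simp add: w_def norm_mult)
  have "aeq (PE (min l m) (max l m) w) (\<lambda>x. LINT y|lpos. complex_of_real (kern (min l m) (max l m) x y) * w y)"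
    by (rule spectral_kernel[OF _ _ w[folded w_def] w1]) (use l m in auto)
  then show ?thesis
    unfolding aeq_iff
  proof (rule AE_mp[OF _ AE_I2], intro impI)
    fix x assume e: "PE (min l m) (max l m) w x = (LINT y|lpos. complex_of_real (kern (min l m) (max l m) x y) * w y)"
    have "kop (\<lambda>x y. \<sigma> x * complex_of_real (avg l m x y) * \<sigma> y) f x
        = (LINT y|lpos. \<sigma> x / complex_of_real \<bar>m - l\<bar> * (complex_of_real (kern (min l m) (max l m) x y) * w y))"
      unfolding kop_def set_lebesgue_integral_def integral_lpos
      by (rule Bochner_Integration.integral_cong[OF refl]) (simp add: avg_def w_def)
    also have "\<dots> = \<sigma> x / complex_of_real \<bar>m - l\<bar> * PE (min l m) (max l m) w x" by (simp only: integral_mult_right_zero e)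
    also have "\<dots> = \<sigma> x * (E m w x - E l w x) / complex_of_real (m - l)"
    proof (cases "l < m")
      case True
      then show ?thesis by (simp add: PE_def max_def min_def)
    next
      case False
      then have "l - m \<noteq> 0" "m < l" using m(2) by auto
      then show ?thesis by (simp add: PE_def max_def min_def divide_simps) (simp add: algebra_simps)
    qed
    finally show "\<sigma> x * (E m (\<lambda>y. \<sigma> y * f y) x - E l (\<lambda>y. \<sigma> y * f y) x) / complex_of_real (m - l)
        = kop (\<lambda>x y. \<sigma> x * complex_of_real (avg l m x y) * \<sigma> y) f x" unfolding w_def by simp
  qed
qed

text \<open>The averages \<open>avg\<close> converge pointwise to the density and obey the same
  bound as the density, so \<open>weighted_hsn_tendsto\<close> applies to the difference.\<close>

lemma HS_difference_quotient:
  assumes l: "l > 0" and s: "L2 \<sigma>" and e: "e > 0"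
  shows "\<exists>\<delta>>0. \<forall>m. m > 0 \<and> m \<noteq> l \<and> \<bar>m - l\<bar> < \<delta> \<longrightarrow>
        (\<exists>k. L2k k \<and>
           (\<forall>f. L2 f \<and> L2 (\<lambda>x. \<sigma> x * f x) \<longrightarrow>
              aeq (\<lambda>x. \<sigma> x * (E m (\<lambda>y. \<sigma> y * f y) x - E l (\<lambda>y. \<sigma> y * f y) x) / complex_of_real (m - l))
                  (kop k f)) \<and>
           hsn (\<lambda>x y. k x y - \<sigma> x * complex_of_real (dens x y l) * \<sigma> y) < e)"
proof -
  \<comment> \<open>On this neighbourhood of \<open>l\<close> one constant bounds all densities, and
    |m - l| < l / 2 keeps \<open>m\<close> inside it.\<close>
  have ll: "0 < l / 2" "l / 2 \<le> 2 * l" using l by auto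
  obtain C where C: "C > 0" "\<And>\<mu> x y. \<mu> \<in> {l / 2..2 * l} \<Longrightarrow> x \<ge> 0 \<Longrightarrow> y \<ge> 0 \<Longrightarrow> \<bar>dens x y \<mu>\<bar> \<le> C"
    by (rule dens_bounded[OF ll]) (assumption | rule that)+
  have ab: "\<bar>avg l m x y\<bar> \<le> C" if "m \<noteq> l" "\<bar>m - l\<bar> < l / 2" "x > 0" "y > 0" for m x y
  proof (rule avg_bounded[OF ll(1), of l "2 * l"])
    show "l / 2 \<le> m" "m \<le> 2 * l" using that by linarith+
    show "\<bar>dens x y \<mu>\<bar> \<le> C" if "\<mu> \<in> {l / 2..2 * l}" for \<mu> by (rule C(2)) (use that \<open>x > 0\<close> \<open>y > 0\<close> in auto)
  qed (use that l in auto)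
  have mp: "m > 0" if "\<bar>m - l\<bar> < l / 2" for m using that by linarith
  have "((\<lambda>m. hsn (\<lambda>x y. \<sigma> x * complex_of_real (avg l m x y - dens x y l) * \<sigma> y)) \<longlongrightarrow> 0) (at l)"
  proof (rule weighted_hsn_tendsto[OF s ll(1), where C="2 * C"])
    fix m assume m: "m \<noteq> l" "\<bar>m - l\<bar> < l / 2"
    have "cutk (\<lambda>x y. avg l m x y - dens x y l) = (\<lambda>z. cutk (avg l m) z - cutk (\<lambda>x y. dens x y l) z)"
      by (simp add: fun_eq_iff cutk_def scaleR_diff_right)
    then show "cutk (\<lambda>x y. avg l m x y - dens x y l) \<in> borel_measurable borel"
      using avg_measurable[OF l mp[OF m(2)]] dens_cut_measurable[OF l] by simp
    fix x y :: real assume xy: "x > 0" "y > 0"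
    have "\<bar>dens x y l\<bar> \<le> C" by (rule C(2)) (use xy l in auto)
    then show "\<bar>avg l m x y - dens x y l\<bar> \<le> 2 * C" using ab[OF m xy] by linarith
  next
    fix x y :: real assume "x > 0" "y > 0"
    then show "((\<lambda>m. avg l m x y - dens x y l) \<longlongrightarrow> 0) (at l)"
      using avg_tendsto[OF l, of x y] by (simp add: LIM_zero_iff)
  qed
  then have "\<exists>d>0. \<forall>m. m \<noteq> l \<and> dist m l < d \<longrightarrow> dist (hsn (\<lambda>x y. \<sigma> x * complex_of_real (avg l m x y - dens x y l) * \<sigma> y)) 0 < e"
    using e unfolding LIM_def by blast
  then obtain d where d: "d > 0" "\<And>m. m \<noteq> l \<Longrightarrow> dist m l < d \<Longrightarrow> dist (hsn (\<lambda>x y. \<sigma> x * complex_of_real (avg l m x y - dens x y l) * \<sigma> y)) 0 < e"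
    by blast
  show ?thesis
  proof (intro exI[of _ "min d (l / 2)"] conjI allI impI)
    show "min d (l / 2) > 0" using d l by simp
    fix m assume m: "m > 0 \<and> m \<noteq> l \<and> \<bar>m - l\<bar> < min d (l / 2)"
    let ?k = "\<lambda>x y. \<sigma> x * complex_of_real (avg l m x y) * \<sigma> y"
    have "L2k ?k" by (rule weighted_L2k[OF s avg_measurable[OF l]]) (use m ab[of m] in auto)
    moreover have "\<forall>f. L2 f \<and> L2 (\<lambda>x. \<sigma> x * f x) \<longrightarrow>
        aeq (\<lambda>x. \<sigma> x * (E m (\<lambda>y. \<sigma> y * f y) x - E l (\<lambda>y. \<sigma> y * f y) x) / complex_of_real (m - l)) (kop ?k f)"
      using kop_avg[OF l _ _ s] m by blast
    moreover have "hsn (\<lambda>x y. ?k x y - \<sigma> x * complex_of_real (dens x y l) * \<sigma> y) < e"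
    proof -
      have "hsn (\<lambda>x y. \<sigma> x * complex_of_real (avg l m x y - dens x y l) * \<sigma> y) < e"
        using d(2)[of m] m by (simp add: dist_real_def)
      then show ?thesis by (simp only: of_real_diff left_diff_distrib right_diff_distrib)
    qed
    ultimately show "\<exists>k. L2k k \<and> (\<forall>f. L2 f \<and> L2 (\<lambda>x. \<sigma> x * f x) \<longrightarrow>
        aeq (\<lambda>x. \<sigma> x * (E m (\<lambda>y. \<sigma> y * f y) x - E l (\<lambda>y. \<sigma> y * f y) x) / complex_of_real (m - l)) (kop k f)) \<and>
        hsn (\<lambda>x y. k x y - \<sigma> x * complex_of_real (dens x y l) * \<sigma> y) < e"
      by (intro exI[of _ ?k] conjI)
  qed
qed

text \<open>The scheme of \<open>HS_difference_quotient\<close> with the density at \<open>m\<close>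
  in place of the average; pointwise convergence is continuity of \<kappa> and \<phi> in the
  energy.\<close>

lemma HS_density:
  assumes l: "l > 0" and s: "L2 \<sigma>"
  shows "L2k (\<lambda>x y. \<sigma> x * complex_of_real (dens x y l) * \<sigma> y)"
    and "((\<lambda>m. hsn (\<lambda>x y. \<sigma> x * complex_of_real (dens x y m) * \<sigma> y - \<sigma> x * complex_of_real (dens x y l) * \<sigma> y)) \<longlongrightarrow> 0) (at l)"
proof -
  have ll: "0 < l / 2" "l / 2 \<le> 2 * l" using l by auto
  obtain C where C: "C > 0" "\<And>\<mu> x y. \<mu> \<in> {l / 2..2 * l} \<Longrightarrow> x \<ge> 0 \<Longrightarrow> y \<ge> 0 \<Longrightarrow> \<bar>dens x y \<mu>\<bar> \<le> C"
    by (rule dens_bounded[OF ll]) (assumption | rule that)+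
  show "L2k (\<lambda>x y. \<sigma> x * complex_of_real (dens x y l) * \<sigma> y)"
    by (rule weighted_L2k[OF s dens_cut_measurable[OF l]], rule C(2)) (use l in auto)
  have "((\<lambda>m. hsn (\<lambda>x y. \<sigma> x * complex_of_real (dens x y m - dens x y l) * \<sigma> y)) \<longlongrightarrow> 0) (at l)"
  proof (rule weighted_hsn_tendsto[OF s ll(1), where C="2 * C"])
    fix m assume m: "m \<noteq> l" "\<bar>m - l\<bar> < l / 2"
    have mi: "m \<in> {l / 2..2 * l}" "m > 0" using m(2) unfolding atLeastAtMost_iff by linarith+
    have "cutk (\<lambda>x y. dens x y m - dens x y l) = (\<lambda>z. cutk (\<lambda>x y. dens x y m) z - cutk (\<lambda>x y. dens x y l) z)"
      by (simp add: fun_eq_iff cutk_def scaleR_diff_right)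
    then show "cutk (\<lambda>x y. dens x y m - dens x y l) \<in> borel_measurable borel"
      using dens_cut_measurable[OF l] dens_cut_measurable[OF mi(2)] by simp
    fix x y :: real assume xy: "x > 0" "y > 0"
    have "\<bar>dens x y l\<bar> \<le> C" by (rule C(2)) (use xy l in auto)
    moreover have "\<bar>dens x y m\<bar> \<le> C" by (rule C(2)[OF mi(1)]) (use xy in auto)
    ultimately show "\<bar>dens x y m - dens x y l\<bar> \<le> 2 * C" by linarith
  next
    fix x y :: real assume "x > 0" "y > 0"
    then show "((\<lambda>m. dens x y m - dens x y l) \<longlongrightarrow> 0) (at l)"
      using dens_tendsto[OF l, of x y] by (simp add: LIM_zero_iff)
  qed
  then show "((\<lambda>m. hsn (\<lambda>x y. \<sigma> x * complex_of_real (dens x y m) * \<sigma> y - \<sigma> x * complex_of_real (dens x y l) * \<sigma> y)) \<longlongrightarrow> 0) (at l)"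
    by (simp only: of_real_diff left_diff_distrib right_diff_distrib)
qed

end

text \<open>Multiplication by \<sigma> may be unbounded, so the difference quotient is evaluated on
  its domain only; there it coincides with the Hilbert-Schmidt operator of a square integrable
  kernel, and it is these kernels that converge in norm.\<close>

theorem theorem4p4:
  fixes p p' q q' :: "real \<Rightarrow> real" and p0 x0 :: real
    and \<sigma> :: "real \<Rightarrow> complex"
    and E :: "real \<Rightarrow> (real \<Rightarrow> complex) \<Rightarrow> (real \<Rightarrow> complex)"
    and \<phi> :: "real \<Rightarrow> real \<Rightarrow> real"
    and \<theta> :: "real \<Rightarrow> real \<Rightarrow> complex"
  assumes A: "assumptionA p p' p0 q q' x0"
    and E: "spectral_family (Hop p q) E"
    and sigma: "L2 \<sigma>"
    and phi: "\<forall>l>0. regular_sol p q l (\<lambda>x. \<phi> x l)"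
    and theta: "\<forall>l>0. jost_sol p p' q q' x0 l (\<lambda>x. \<theta> x l)"
  defines "D \<equiv> \<lambda>l x y. \<sigma> x * complex_of_real
                 (sqrt (p0 * l) * (Kfun p q l)^2
                   / (pi * (cmod (complex_of_real (p 0) * \<theta> 0 l))^2) * \<phi> x l * \<phi> y l)
                 * \<sigma> y"
  shows "\<forall>l>0.
     L2k (D l) \<and>
     (\<forall>e>0. \<exists>\<delta>>0. \<forall>m. m > 0 \<and> m \<noteq> l \<and> \<bar>m - l\<bar> < \<delta> \<longrightarrow>
        (\<exists>k. L2k k \<and>
           (\<forall>f. L2 f \<and> L2 (\<lambda>x. \<sigma> x * f x) \<longrightarrow>
              aeq (\<lambda>x. \<sigma> x * (E m (\<lambda>y. \<sigma> y * f y) x - E l (\<lambda>y. \<sigma> y * f y) x)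
                        / complex_of_real (m - l))
                  (kop k f)) \<and>
           hsn (\<lambda>x y. k x y - D l x y) < e)) \<and>
     ((\<lambda>m. hsn (\<lambda>x y. D m x y - D l x y)) \<longlongrightarrow> 0) (at l)"
proof -
  interpret spectral_problem p p' p0 q q' x0 \<phi> \<theta> E
  proof unfold_locales
    show "assumptionA p p' p0 q q' x0" by (rule A)
    show "regular_sol p q l (\<lambda>x. \<phi> x l)" if "l > 0" for l by (rule phi[rule_format, OF that])
    show "jost_sol p p' q q' x0 l (\<lambda>x. \<theta> x l)" if "l > 0" for l by (rule theta[rule_format, OF that])
    show "spectral_family (Hop p q) E" by (rule E)
  qed
  \<comment> \<open>The constant of the statement is \<kappa> / \<pi> with \<kappa> written out, up
    to the grouping of the denominator.\<close>
  have "sqrt (p0 * l) * (Kfun p q l)^2 / (pi * (cmod (complex_of_real (p 0) * \<theta> 0 l))^2) * \<phi> x l * \<phi> y l = dens x y l"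
    for l x y
    unfolding dens_def \<kappa>_def mom_def divide_divide_eq_left mult.commute[of pi] ..
  then have D: "D = (\<lambda>l x y. \<sigma> x * complex_of_real (dens x y l) * \<sigma> y)"
    unfolding D_def by (simp only:)
  show ?thesis
    unfolding D
  proof (rule allI, rule impI)
    fix l :: real assume l: "l > 0"
    note HS = HS_density[OF l sigma] HS_difference_quotient[OF l sigma]
    show "L2k (\<lambda>x y. \<sigma> x * complex_of_real (dens x y l) * \<sigma> y) \<and>
      (\<forall>e>0. \<exists>\<delta>>0. \<forall>m. m > 0 \<and> m \<noteq> l \<and> \<bar>m - l\<bar> < \<delta> \<longrightarrow>
        (\<exists>k. L2k k \<and>
           (\<forall>f. L2 f \<and> L2 (\<lambda>x. \<sigma> x * f x) \<longrightarrow>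
              aeq (\<lambda>x. \<sigma> x * (E m (\<lambda>y. \<sigma> y * f y) x - E l (\<lambda>y. \<sigma> y * f y) x)
                        / complex_of_real (m - l))
                  (kop k f)) \<and>
           hsn (\<lambda>x y. k x y - \<sigma> x * complex_of_real (dens x y l) * \<sigma> y) < e)) \<and>
      ((\<lambda>m. hsn (\<lambda>x y. \<sigma> x * complex_of_real (dens x y m) * \<sigma> y - \<sigma> x * complex_of_real (dens x y l) * \<sigma> y)) \<longlongrightarrow> 0) (at l)"
      by (rule conjI[OF HS(1) conjI[OF _ HS(2)]], rule allI, rule impI, rule HS(3))
  qed
qed

end
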